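(* Let $\mathcal{C}$ be an extensive locally cartesian closed category with dependent $\mathcal{W}$-types and $\mathcal{M}$-types, and let $P, Q$ be containers in $\mathrm{Cont}(\mathcal{C})$. Then $Q \star P^\diamond$ is the carrier of an initial algebra of the endofunctor $X \mapsto Q + X \star P$ of $\mathrm{Cont}(\mathcal{C})$.
   Context: $\mathrm{Cont}(\mathcal{C})$: objects are morphisms $P : A \to I$, viewed as internal families $(A_i)_{i:I}$; a morphism $(P:A\to I)\to(Q : B \to J)$ is $(\varphi,\psi)$ with $\varphi : I \to J$ and $\psi : I\times_J B \to A$ over $I$. $P + Q = (A+B \to I+J)$. $\mathbf{1}$ denotes the container $\mathrm{id} : 1 \to 1$. For $P = (A_i)_{i:I}$ and $Q = (B_j)_{j:J}$, the sequential product $Q \star P$ is the family (in the internal language) with shape $\sum_{i:I}(A_i \to J)$ and directions over $(i,f)$ equal to $\sum_{a : A_i} B_{f(a)}$. $P^\diamond$ denotes the carrier of the initial algebra of the (fibred polynomial) endofunctor $X \mapsto \mathbf{1} + X \star P$ of $\mathrm{Cont}(\mathcal{C})$. *)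

theory Defs
  imports Main
begin

section \<open>Categories, functors, universal constructions\<close>

text \<open>The operations of a category are only meaningful on its sets of objects and arrows. The hypotheses
  on categories below are existence statements; where an operation (pullback, coproduct, right
  adjoint) is needed as a function, a representative is selected by \<^const>\<open>Eps\<close>, and the induced arrows
  by \<^const>\<open>The\<close>.\<close>

record ('o, 'm) cat =
  Obj :: "'o set"
  Arr :: "'m set"
  Dom :: "'m \<Rightarrow> 'o"
  Cod :: "'m \<Rightarrow> 'o"
  Idt :: "'o \<Rightarrow> 'm"
  Cmp :: "'m \<Rightarrow> 'm \<Rightarrow> 'm"  (infixl "\<cdot>\<index>" 70)

definition hom :: "('o, 'm) cat \<Rightarrow> 'o \<Rightarrow> 'o \<Rightarrow> 'm set" where
  "hom C X Y = {f \<in> Arr C. Dom C f = X \<and> Cod C f = Y}"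

locale category =
  fixes C :: "('o, 'm) cat" (structure)
  assumes dom_obj: "f \<in> Arr C \<Longrightarrow> Dom C f \<in> Obj C"
    and cod_obj: "f \<in> Arr C \<Longrightarrow> Cod C f \<in> Obj C"
    and idt_hom: "X \<in> Obj C \<Longrightarrow> Idt C X \<in> hom C X X"
    and cmp_hom: "f \<in> hom C X Y \<Longrightarrow> g \<in> hom C Y Z \<Longrightarrow> g \<cdot> f \<in> hom C X Z"
    and idt_left: "f \<in> hom C X Y \<Longrightarrow> Idt C Y \<cdot> f = f"
    and idt_right: "f \<in> hom C X Y \<Longrightarrow> f \<cdot> Idt C X = f"
    and cmp_assoc: "f \<in> hom C W X \<Longrightarrow> g \<in> hom C X Y \<Longrightarrow> h \<in> hom C Y Z \<Longrightarrow> (h \<cdot> g) \<cdot> f = h \<cdot> (g \<cdot> f)"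

record ('o, 'm, 'p, 'n) fctr =
  FObj :: "'o \<Rightarrow> 'p"
  FArr :: "'m \<Rightarrow> 'n"

definition fcomp :: "('p, 'n, 'q, 'l) fctr \<Rightarrow> ('o, 'm, 'p, 'n) fctr \<Rightarrow> ('o, 'm, 'q, 'l) fctr" where
  "fcomp G F = \<lparr>FObj = FObj G \<circ> FObj F, FArr = FArr G \<circ> FArr F\<rparr>"

definition inverse_arrow :: "('o, 'm) cat \<Rightarrow> 'm \<Rightarrow> 'm" where
  "inverse_arrow C f = (THE g. g \<in> hom C (Cod C f) (Dom C f) \<and>
     g \<cdot>\<^bsub>C\<^esub> f = Idt C (Dom C f) \<and> f \<cdot>\<^bsub>C\<^esub> g = Idt C (Cod C f))"

definition is_terminal :: "('o, 'm) cat \<Rightarrow> 'o \<Rightarrow> bool" where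
  "is_terminal C T \<longleftrightarrow> T \<in> Obj C \<and> (\<forall>X\<in>Obj C. \<exists>!f. f \<in> hom C X T)"

definition is_initial :: "('o, 'm) cat \<Rightarrow> 'o \<Rightarrow> bool" where
  "is_initial C Z \<longleftrightarrow> Z \<in> Obj C \<and> (\<forall>X\<in>Obj C. \<exists>!f. f \<in> hom C Z X)"

definition is_pullback :: "('o, 'm) cat \<Rightarrow> 'm \<Rightarrow> 'm \<Rightarrow> 'm \<Rightarrow> 'm \<Rightarrow> bool" where
  "is_pullback C f g p q \<longleftrightarrow>
     f \<in> Arr C \<and> g \<in> Arr C \<and> Cod C f = Cod C g \<and>
     p \<in> Arr C \<and> q \<in> Arr C \<and> Dom C p = Dom C q \<and> Cod C p = Dom C f \<and> Cod C q = Dom C g \<and>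
     f \<cdot>\<^bsub>C\<^esub> p = g \<cdot>\<^bsub>C\<^esub> q \<and>
     (\<forall>T\<in>Obj C. \<forall>u\<in>hom C T (Dom C f). \<forall>v\<in>hom C T (Dom C g). f \<cdot>\<^bsub>C\<^esub> u = g \<cdot>\<^bsub>C\<^esub> v \<longrightarrow>
        (\<exists>!h. h \<in> hom C T (Dom C p) \<and> p \<cdot>\<^bsub>C\<^esub> h = u \<and> q \<cdot>\<^bsub>C\<^esub> h = v))"

definition is_coproduct :: "('o, 'm) cat \<Rightarrow> 'm \<Rightarrow> 'm \<Rightarrow> bool" where
  "is_coproduct C i j \<longleftrightarrow>
     i \<in> Arr C \<and> j \<in> Arr C \<and> Cod C i = Cod C j \<and>
     (\<forall>T\<in>Obj C. \<forall>u\<in>hom C (Dom C i) T. \<forall>v\<in>hom C (Dom C j) T.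
        \<exists>!h. h \<in> hom C (Cod C i) T \<and> h \<cdot>\<^bsub>C\<^esub> i = u \<and> h \<cdot>\<^bsub>C\<^esub> j = v)"

definition has_pullbacks :: "('o, 'm) cat \<Rightarrow> bool" where
  "has_pullbacks C \<longleftrightarrow>
     (\<forall>f\<in>Arr C. \<forall>g\<in>Arr C. Cod C f = Cod C g \<longrightarrow> (\<exists>p q. is_pullback C f g p q))"

definition has_finite_coproducts :: "('o, 'm) cat \<Rightarrow> bool" where
  "has_finite_coproducts C \<longleftrightarrow> (\<exists>Z. is_initial C Z) \<and>
     (\<forall>A\<in>Obj C. \<forall>B\<in>Obj C. \<exists>i j. is_coproduct C i j \<and> Dom C i = A \<and> Dom C j = B)"

definition terminal_obj :: "('o, 'm) cat \<Rightarrow> 'o" where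
  "terminal_obj C = (SOME T. is_terminal C T)"

definition bang :: "('o, 'm) cat \<Rightarrow> 'o \<Rightarrow> 'm" where
  "bang C X = (THE f. f \<in> hom C X (terminal_obj C))"

text \<open>\<open>pr1 C f g\<close> and \<open>pr2 C f g\<close> are the projections of the chosen pullback \<open>pb C f g\<close> of \<open>f : I \<rightarrow> K\<close>
  and \<open>g : J \<rightarrow> K\<close> to \<open>I\<close> and \<open>J\<close>; \<open>pair C f g u v\<close> is the arrow into it with components \<open>u\<close>, \<open>v\<close>.\<close>

definition pr :: "('o, 'm) cat \<Rightarrow> 'm \<Rightarrow> 'm \<Rightarrow> 'm \<times> 'm" where
  "pr C f g = (SOME (p, q). is_pullback C f g p q)"

definition pr1 :: "('o, 'm) cat \<Rightarrow> 'm \<Rightarrow> 'm \<Rightarrow> 'm" where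
  "pr1 C f g = fst (pr C f g)"

definition pr2 :: "('o, 'm) cat \<Rightarrow> 'm \<Rightarrow> 'm \<Rightarrow> 'm" where
  "pr2 C f g = snd (pr C f g)"

definition pb :: "('o, 'm) cat \<Rightarrow> 'm \<Rightarrow> 'm \<Rightarrow> 'o" where
  "pb C f g = Dom C (pr1 C f g)"

definition pair :: "('o, 'm) cat \<Rightarrow> 'm \<Rightarrow> 'm \<Rightarrow> 'm \<Rightarrow> 'm \<Rightarrow> 'm" where
  "pair C f g u v = (THE h. h \<in> hom C (Dom C u) (pb C f g) \<and>
     pr1 C f g \<cdot>\<^bsub>C\<^esub> h = u \<and> pr2 C f g \<cdot>\<^bsub>C\<^esub> h = v)"

definition injections :: "('o, 'm) cat \<Rightarrow> 'o \<Rightarrow> 'o \<Rightarrow> 'm \<times> 'm" where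
  "injections C A B = (SOME (i, j). is_coproduct C i j \<and> Dom C i = A \<and> Dom C j = B)"

definition inl :: "('o, 'm) cat \<Rightarrow> 'o \<Rightarrow> 'o \<Rightarrow> 'm" where
  "inl C A B = fst (injections C A B)"

definition inr :: "('o, 'm) cat \<Rightarrow> 'o \<Rightarrow> 'o \<Rightarrow> 'm" where
  "inr C A B = snd (injections C A B)"

definition coprod :: "('o, 'm) cat \<Rightarrow> 'o \<Rightarrow> 'o \<Rightarrow> 'o" where
  "coprod C A B = Cod C (inl C A B)"

definition copair :: "('o, 'm) cat \<Rightarrow> 'm \<Rightarrow> 'm \<Rightarrow> 'm" where
  "copair C u v = (THE h. h \<in> hom C (coprod C (Dom C u) (Dom C v)) (Cod C u) \<and>
     h \<cdot>\<^bsub>C\<^esub> inl C (Dom C u) (Dom C v) = u \<and> h \<cdot>\<^bsub>C\<^esub> inr C (Dom C u) (Dom C v) = v)"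

definition coprod_arr :: "('o, 'm) cat \<Rightarrow> 'm \<Rightarrow> 'm \<Rightarrow> 'm" where
  "coprod_arr C f g = copair C (inl C (Cod C f) (Cod C g) \<cdot>\<^bsub>C\<^esub> f) (inr C (Cod C f) (Cod C g) \<cdot>\<^bsub>C\<^esub> g)"

text \<open>Extensivity in the sense of Carboni, Lack and Walters: in a commutative diagram
  \<open>X \<rightarrow> Z \<leftarrow> Y\<close> over a coproduct \<open>A \<rightarrow> A + B \<leftarrow> B\<close>, the two squares are pullbacks if and only if the
  upper row is a coproduct.\<close>

definition extensive :: "('o, 'm) cat \<Rightarrow> bool" where
  "extensive C \<longleftrightarrow> has_finite_coproducts C \<and>
     (\<forall>i j. is_coproduct C i j \<longrightarrow>
        (\<forall>z\<in>Arr C. Cod C z = Cod C i \<longrightarrow>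
           (\<exists>x u. is_pullback C i z x u) \<and> (\<exists>y v. is_pullback C j z y v)) \<and>
        (\<forall>X Y Z x y z u v.
           x \<in> hom C X (Dom C i) \<and> y \<in> hom C Y (Dom C j) \<and> z \<in> hom C Z (Cod C i) \<and>
           u \<in> hom C X Z \<and> v \<in> hom C Y Z \<and> i \<cdot>\<^bsub>C\<^esub> x = z \<cdot>\<^bsub>C\<^esub> u \<and> j \<cdot>\<^bsub>C\<^esub> y = z \<cdot>\<^bsub>C\<^esub> v \<longrightarrow>
           (is_pullback C i z x u \<and> is_pullback C j z y v \<longleftrightarrow> is_coproduct C u v)))"

section \<open>Initial algebras and terminal coalgebras\<close>

definition initial_algebra :: "('o, 'm) cat \<Rightarrow> ('o, 'm, 'o, 'm) fctr \<Rightarrow> 'o \<Rightarrow> 'm \<Rightarrow> bool" where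
  "initial_algebra D F X a \<longleftrightarrow> X \<in> Obj D \<and> a \<in> hom D (FObj F X) X \<and>
     (\<forall>Y\<in>Obj D. \<forall>b\<in>hom D (FObj F Y) Y.
        \<exists>!h. h \<in> hom D X Y \<and> h \<cdot>\<^bsub>D\<^esub> a = b \<cdot>\<^bsub>D\<^esub> FArr F h)"

definition terminal_coalgebra :: "('o, 'm) cat \<Rightarrow> ('o, 'm, 'o, 'm) fctr \<Rightarrow> 'o \<Rightarrow> 'm \<Rightarrow> bool" where
  "terminal_coalgebra D F X a \<longleftrightarrow> X \<in> Obj D \<and> a \<in> hom D X (FObj F X) \<and>
     (\<forall>Y\<in>Obj D. \<forall>b\<in>hom D Y (FObj F Y).
        \<exists>!h. h \<in> hom D Y X \<and> a \<cdot>\<^bsub>D\<^esub> h = FArr F h \<cdot>\<^bsub>D\<^esub> b)"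

section \<open>Right adjoints\<close>

text \<open>\<open>cofree D E F Y R e\<close>: \<open>e : F R \<rightarrow> Y\<close> is a universal arrow from \<open>F : D \<rightarrow> E\<close> to \<open>Y\<close>. A right adjoint of \<open>F\<close>
  amounts to a choice of such arrows, which are then its counit.\<close>

definition cofree ::
    "('o, 'm) cat \<Rightarrow> ('p, 'n) cat \<Rightarrow> ('o, 'm, 'p, 'n) fctr \<Rightarrow> 'p \<Rightarrow> 'o \<Rightarrow> 'n \<Rightarrow> bool" where
  "cofree D E F Y R e \<longleftrightarrow> R \<in> Obj D \<and> e \<in> hom E (FObj F R) Y \<and>
     (\<forall>X\<in>Obj D. \<forall>k\<in>hom E (FObj F X) Y. \<exists>!h. h \<in> hom D X R \<and> e \<cdot>\<^bsub>E\<^esub> FArr F h = k)"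

definition has_right_adjoint ::
    "('o, 'm) cat \<Rightarrow> ('p, 'n) cat \<Rightarrow> ('o, 'm, 'p, 'n) fctr \<Rightarrow> bool" where
  "has_right_adjoint D E F \<longleftrightarrow> (\<forall>Y\<in>Obj E. \<exists>R e. cofree D E F Y R e)"

definition radj_data ::
    "('o, 'm) cat \<Rightarrow> ('p, 'n) cat \<Rightarrow> ('o, 'm, 'p, 'n) fctr \<Rightarrow> 'p \<Rightarrow> 'o \<times> 'n" where
  "radj_data D E F Y = (SOME (R, e). cofree D E F Y R e)"

definition counit ::
    "('o, 'm) cat \<Rightarrow> ('p, 'n) cat \<Rightarrow> ('o, 'm, 'p, 'n) fctr \<Rightarrow> 'p \<Rightarrow> 'n" where
  "counit D E F Y = snd (radj_data D E F Y)"

definition right_adjoint ::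
    "('o, 'm) cat \<Rightarrow> ('p, 'n) cat \<Rightarrow> ('o, 'm, 'p, 'n) fctr \<Rightarrow> ('p, 'n, 'o, 'm) fctr" where
  "right_adjoint D E F = \<lparr>
     FObj = (\<lambda>Y. fst (radj_data D E F Y)),
     FArr = (\<lambda>k. THE h. h \<in> hom D (fst (radj_data D E F (Dom E k))) (fst (radj_data D E F (Cod E k))) \<and>
        counit D E F (Cod E k) \<cdot>\<^bsub>E\<^esub> FArr F h = k \<cdot>\<^bsub>E\<^esub> counit D E F (Dom E k))\<rparr>"

section \<open>Slices, local cartesian closure, dependent polynomial functors\<close>

text \<open>An arrow \<open>h : f \<rightarrow> g\<close> of the slice over \<open>I\<close> is the triple \<open>(f, h, g)\<close>.\<close>

definition slice :: "('o, 'm) cat \<Rightarrow> 'o \<Rightarrow> ('m, 'm \<times> 'm \<times> 'm) cat" where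
  "slice C I = \<lparr>
     Obj = {f \<in> Arr C. Cod C f = I},
     Arr = {(f, h, g). f \<in> Arr C \<and> Cod C f = I \<and> g \<in> Arr C \<and> Cod C g = I \<and>
              h \<in> hom C (Dom C f) (Dom C g) \<and> g \<cdot>\<^bsub>C\<^esub> h = f},
     Dom = (\<lambda>(f, h, g). f),
     Cod = (\<lambda>(f, h, g). g),
     Idt = (\<lambda>f. (f, Idt C (Dom C f), f)),
     Cmp = (\<lambda>(g, k, g') (f, h, f'). (f, k \<cdot>\<^bsub>C\<^esub> h, g'))\<rparr>"

definition underlying :: "'m \<times> 'm \<times> 'm \<Rightarrow> 'm" where
  "underlying = (\<lambda>(f, h, g). h)"

text \<open>For \<open>f : I \<rightarrow> J\<close>: base change \<open>f\<^sup>* : C/J \<rightarrow> C/I\<close>, dependent sum \<open>\<Sigma>\<^sub>f\<close> and dependent product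
  \<open>\<Pi>\<^sub>f : C/I \<rightarrow> C/J\<close>.\<close>

definition base_change :: "('o, 'm) cat \<Rightarrow> 'm \<Rightarrow> ('m, 'm \<times> 'm \<times> 'm, 'm, 'm \<times> 'm \<times> 'm) fctr" where
  "base_change C f = \<lparr>
     FObj = (\<lambda>g. pr1 C f g),
     FArr = (\<lambda>(g, h, g'). (pr1 C f g, pair C f g' (pr1 C f g) (h \<cdot>\<^bsub>C\<^esub> pr2 C f g), pr1 C f g'))\<rparr>"

definition dep_sum :: "('o, 'm) cat \<Rightarrow> 'm \<Rightarrow> ('m, 'm \<times> 'm \<times> 'm, 'm, 'm \<times> 'm \<times> 'm) fctr" where
  "dep_sum C f = \<lparr>
     FObj = (\<lambda>g. f \<cdot>\<^bsub>C\<^esub> g),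
     FArr = (\<lambda>(g, h, g'). (f \<cdot>\<^bsub>C\<^esub> g, h, f \<cdot>\<^bsub>C\<^esub> g'))\<rparr>"

definition dep_prod :: "('o, 'm) cat \<Rightarrow> 'm \<Rightarrow> ('m, 'm \<times> 'm \<times> 'm, 'm, 'm \<times> 'm \<times> 'm) fctr" where
  "dep_prod C f = right_adjoint (slice C (Cod C f)) (slice C (Dom C f)) (base_change C f)"

definition dep_prod_counit :: "('o, 'm) cat \<Rightarrow> 'm \<Rightarrow> 'm \<Rightarrow> 'm \<times> 'm \<times> 'm" where
  "dep_prod_counit C f = counit (slice C (Cod C f)) (slice C (Dom C f)) (base_change C f)"

definition locally_cartesian_closed :: "('o, 'm) cat \<Rightarrow> bool" where
  "locally_cartesian_closed C \<longleftrightarrow> (\<exists>T. is_terminal C T) \<and> has_pullbacks C \<and>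
     (\<forall>f\<in>Arr C. has_right_adjoint (slice C (Cod C f)) (slice C (Dom C f)) (base_change C f))"

text \<open>The dependent polynomial functor \<open>\<Sigma>\<^sub>t \<Pi>\<^sub>f s\<^sup>* : C/I \<rightarrow> C/J\<close> of a diagram
  \<open>I \<leftarrow> B \<rightarrow> A \<rightarrow> J\<close> with arrows \<open>s\<close>, \<open>f\<close>, \<open>t\<close>.\<close>

definition poly_functor ::
    "('o, 'm) cat \<Rightarrow> 'm \<Rightarrow> 'm \<Rightarrow> 'm \<Rightarrow> ('m, 'm \<times> 'm \<times> 'm, 'm, 'm \<times> 'm \<times> 'm) fctr" where
  "poly_functor C s f t = fcomp (dep_sum C t) (fcomp (dep_prod C f) (base_change C s))"

definition has_dependent_W_types :: "('o, 'm) cat \<Rightarrow> bool" where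
  "has_dependent_W_types C \<longleftrightarrow>
     (\<forall>I\<in>Obj C. \<forall>A\<in>Obj C. \<forall>B\<in>Obj C. \<forall>s\<in>hom C B I. \<forall>f\<in>hom C B A. \<forall>t\<in>hom C A I.
        \<exists>X a. initial_algebra (slice C I) (poly_functor C s f t) X a)"

definition has_dependent_M_types :: "('o, 'm) cat \<Rightarrow> bool" where
  "has_dependent_M_types C \<longleftrightarrow>
     (\<forall>I\<in>Obj C. \<forall>A\<in>Obj C. \<forall>B\<in>Obj C. \<forall>s\<in>hom C B I. \<forall>f\<in>hom C B A. \<forall>t\<in>hom C A I.
        \<exists>X a. terminal_coalgebra (slice C I) (poly_functor C s f t) X a)"

section \<open>Containers\<close>

text \<open>A container morphism \<open>(\<phi>, \<psi>) : P \<rightarrow> Q\<close> is the tuple \<open>(P, \<phi>, \<psi>, Q)\<close>; for \<open>P : A \<rightarrow> I\<close> and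
  \<open>Q : B \<rightarrow> J\<close> the domain of \<open>\<psi>\<close> is the pullback of \<open>\<phi> : I \<rightarrow> J\<close> and \<open>Q\<close>. In the internal
  language the second component of a composite is \<open>(i, c) \<mapsto> \<psi> (i, \<psi>' (\<phi> i, c))\<close>.\<close>

definition Cont :: "('o, 'm) cat \<Rightarrow> ('m, 'm \<times> 'm \<times> 'm \<times> 'm) cat" where
  "Cont C = \<lparr>
     Obj = Arr C,
     Arr = {(P, \<phi>, \<psi>, Q). P \<in> Arr C \<and> Q \<in> Arr C \<and> \<phi> \<in> hom C (Cod C P) (Cod C Q) \<and>
              \<psi> \<in> hom C (pb C \<phi> Q) (Dom C P) \<and> P \<cdot>\<^bsub>C\<^esub> \<psi> = pr1 C \<phi> Q},
     Dom = (\<lambda>(P, \<phi>, \<psi>, Q). P),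
     Cod = (\<lambda>(P, \<phi>, \<psi>, Q). Q),
     Idt = (\<lambda>P. (P, Idt C (Cod C P), pr2 C (Idt C (Cod C P)) P, P)),
     Cmp = (\<lambda>(Q, \<phi>', \<psi>', R) (P, \<phi>, \<psi>, Q').
       (P, \<phi>' \<cdot>\<^bsub>C\<^esub> \<phi>,
        \<psi> \<cdot>\<^bsub>C\<^esub> pair C \<phi> Q (pr1 C (\<phi>' \<cdot>\<^bsub>C\<^esub> \<phi>) R)
              (\<psi>' \<cdot>\<^bsub>C\<^esub> pair C \<phi>' R (\<phi> \<cdot>\<^bsub>C\<^esub> pr1 C (\<phi>' \<cdot>\<^bsub>C\<^esub> \<phi>) R) (pr2 C (\<phi>' \<cdot>\<^bsub>C\<^esub> \<phi>) R)),
        R))\<rparr>"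

definition one_cont :: "('o, 'm) cat \<Rightarrow> 'm" where
  "one_cont C = Idt C (terminal_obj C)"

abbreviation sum_cont :: "('o, 'm) cat \<Rightarrow> 'm \<Rightarrow> 'm \<Rightarrow> 'm" where
  "sum_cont C P Q \<equiv> coprod_arr C P Q"

text \<open>For \<open>(\<phi>, \<psi>) : P \<rightarrow> P'\<close> and \<open>(\<phi>', \<psi>') : Q \<rightarrow> Q'\<close>, the morphism \<open>P + Q \<rightarrow> P' + Q'\<close> is \<open>\<phi> + \<phi>'\<close> on
  shapes, and \<open>\<psi> + \<psi>'\<close> on directions, preceded by the inverse of the canonical comparison
  (invertible by extensivity) from the coproduct of the pullbacks of \<open>\<phi>, P'\<close> and of \<open>\<phi>', Q'\<close> to the
  pullback of \<open>\<phi> + \<phi>'\<close> and \<open>P' + Q'\<close>.\<close>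

definition sum_compare :: "('o, 'm) cat \<Rightarrow> 'm \<Rightarrow> 'm \<Rightarrow> 'm \<Rightarrow> 'm \<Rightarrow> 'm" where
  "sum_compare C \<phi> P' \<phi>' Q' = copair C
     (pair C (coprod_arr C \<phi> \<phi>') (coprod_arr C P' Q')
        (inl C (Dom C \<phi>) (Dom C \<phi>') \<cdot>\<^bsub>C\<^esub> pr1 C \<phi> P') (inl C (Dom C P') (Dom C Q') \<cdot>\<^bsub>C\<^esub> pr2 C \<phi> P'))
     (pair C (coprod_arr C \<phi> \<phi>') (coprod_arr C P' Q')
        (inr C (Dom C \<phi>) (Dom C \<phi>') \<cdot>\<^bsub>C\<^esub> pr1 C \<phi>' Q') (inr C (Dom C P') (Dom C Q') \<cdot>\<^bsub>C\<^esub> pr2 C \<phi>' Q'))"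

definition sum_cont_arr ::
    "('o, 'm) cat \<Rightarrow> 'm \<times> 'm \<times> 'm \<times> 'm \<Rightarrow> 'm \<times> 'm \<times> 'm \<times> 'm \<Rightarrow> 'm \<times> 'm \<times> 'm \<times> 'm" where
  "sum_cont_arr C = (\<lambda>(P, \<phi>, \<psi>, P') (Q, \<phi>', \<psi>', Q').
     (sum_cont C P Q, coprod_arr C \<phi> \<phi>',
      coprod_arr C \<psi> \<psi>' \<cdot>\<^bsub>C\<^esub> inverse_arrow C (sum_compare C \<phi> P' \<phi>' Q'),
      sum_cont C P' Q'))"

text \<open>For \<open>P : A \<rightarrow> I\<close>: \<open>seq_shape C P J\<close> is the display arrow \<open>(\<Sigma>i:I. A\<^sub>i \<rightarrow> J) \<rightarrow> I\<close>, i.e. the dependent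
  product along \<open>P\<close> of the projection \<open>A \<times> J \<rightarrow> A\<close>. \<open>seq_ev C P J\<close> is the arrow \<open>(a, (i, f)) \<mapsto> f a\<close>
  defined on the pullback of \<open>P\<close> and \<open>seq_shape C P J\<close>, and \<open>seq_shape_arr C P \<phi>\<close> is
  \<open>(i, f) \<mapsto> (i, \<phi> \<circ> f)\<close>.\<close>

definition seq_shape :: "('o, 'm) cat \<Rightarrow> 'm \<Rightarrow> 'o \<Rightarrow> 'm" where
  "seq_shape C P J = FObj (dep_prod C P) (FObj (base_change C (bang C (Dom C P))) (bang C J))"

definition seq_ev :: "('o, 'm) cat \<Rightarrow> 'm \<Rightarrow> 'o \<Rightarrow> 'm" where
  "seq_ev C P J = pr2 C (bang C (Dom C P)) (bang C J) \<cdot>\<^bsub>C\<^esub>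
     underlying (dep_prod_counit C P (FObj (base_change C (bang C (Dom C P))) (bang C J)))"

definition seq_shape_arr :: "('o, 'm) cat \<Rightarrow> 'm \<Rightarrow> 'm \<Rightarrow> 'm" where
  "seq_shape_arr C P \<phi> = underlying (FArr (dep_prod C P)
     (FArr (base_change C (bang C (Dom C P))) (bang C (Dom C \<phi>), \<phi>, bang C (Cod C \<phi>))))"

text \<open>The total object of directions of \<open>Q \<star> P\<close> consists of pairs \<open>((a, (i, f)), b)\<close> with \<open>b\<close> in the
  fibre of \<open>Q\<close> over \<open>f a\<close>.\<close>

definition seq :: "('o, 'm) cat \<Rightarrow> 'm \<Rightarrow> 'm \<Rightarrow> 'm"  (infixl "\<star>\<index>" 70) where
  "Q \<star>\<^bsub>C\<^esub> P = pr2 C P (seq_shape C P (Cod C Q)) \<cdot>\<^bsub>C\<^esub> pr1 C (seq_ev C P (Cod C Q)) Q"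

text \<open>The action of \<open>X \<mapsto> X \<star> P\<close> on \<open>(\<phi>, \<psi>) : X \<rightarrow> X'\<close>. With \<open>\<sigma> = (i, f)\<close> and \<open>\<sigma>' = (i, \<phi> \<circ> f)\<close> the
  directions component sends \<open>(\<sigma>, ((a, \<sigma>'), b'))\<close> to \<open>((a, \<sigma>), \<psi> (f a, b'))\<close>; below, \<open>d\<close>, \<open>b\<close> and \<open>as\<close>
  are the arrows with values \<open>((a, \<sigma>'), b')\<close>, \<open>b'\<close> and \<open>(a, \<sigma>)\<close>.\<close>

definition seq_arr :: "('o, 'm) cat \<Rightarrow> 'm \<Rightarrow> 'm \<times> 'm \<times> 'm \<times> 'm \<Rightarrow> 'm \<times> 'm \<times> 'm \<times> 'm" where
  "seq_arr C P = (\<lambda>(X, \<phi>, \<psi>, X').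
     let s = seq_shape C P (Cod C X); s' = seq_shape C P (Cod C X');
         ev = seq_ev C P (Cod C X); ev' = seq_ev C P (Cod C X');
         \<phi>P = seq_shape_arr C P \<phi>;
         d = pr2 C \<phi>P (X' \<star>\<^bsub>C\<^esub> P);
         b = pr2 C ev' X' \<cdot>\<^bsub>C\<^esub> d;
         as = pair C P s (pr1 C P s' \<cdot>\<^bsub>C\<^esub> (pr1 C ev' X' \<cdot>\<^bsub>C\<^esub> d)) (pr1 C \<phi>P (X' \<star>\<^bsub>C\<^esub> P))
     in (X \<star>\<^bsub>C\<^esub> P, \<phi>P, pair C ev X as (\<psi> \<cdot>\<^bsub>C\<^esub> pair C \<phi> X' (ev \<cdot>\<^bsub>C\<^esub> as) b), X' \<star>\<^bsub>C\<^esub> P))"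

text \<open>\<open>step C Q P\<close> is the endofunctor \<open>X \<mapsto> Q + X \<star> P\<close> of \<open>Cont C\<close>. The carrier \<open>P\<^sup>\<diamond>\<close> is selected among the
  (isomorphic) carriers of initial algebras of \<open>X \<mapsto> \<one> + X \<star> P\<close>.\<close>

definition step ::
    "('o, 'm) cat \<Rightarrow> 'm \<Rightarrow> 'm \<Rightarrow> ('m, 'm \<times> 'm \<times> 'm \<times> 'm, 'm, 'm \<times> 'm \<times> 'm \<times> 'm) fctr" where
  "step C Q P = \<lparr>
     FObj = (\<lambda>X. sum_cont C Q (X \<star>\<^bsub>C\<^esub> P)),
     FArr = (\<lambda>m. sum_cont_arr C (Idt (Cont C) Q) (seq_arr C P m))\<rparr>"

definition diamond :: "('o, 'm) cat \<Rightarrow> 'm \<Rightarrow> 'm"  ("_\<^sup>\<diamond>\<index>" [1000] 999) where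
  "P\<^sup>\<diamond>\<^bsub>C\<^esub> = (SOME D. \<exists>d. initial_algebra (Cont C) (step C (one_cont C) P) D d)"

end

theory Submission
  imports Defs
begin

text \<open>Let \<open>W\<close> be the initial algebra of \<open>J \<mapsto> 1 + (\<Sigma>i:I. A\<^sub>i \<rightarrow> J)\<close>, with constructors \<open>e\<close> (leaf) and \<open>m\<close> (node);
  its elements are trees, and the directions of \<open>P\<^sup>\<diamond>\<close> over a tree are its paths to a leaf, a dependent \<open>W\<close>-type over \<open>W\<close>.
  A sequential product \<open>X \<star> P\<close> is a power of \<open>X\<close> by \<open>P\<close>: morphisms into it are families of morphisms into \<open>X\<close> indexed by the
  fibres of \<open>P\<close>. Since a leaf has one path, and a path to a leaf of \<open>m (i, f)\<close> is some \<open>a : A\<^sub>i\<close> followed by a path in \<open>f a\<close>,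
  the container \<open>G = Q \<star> P\<^sup>\<diamond>\<close>, mapped to \<open>W\<close> on shapes, restricts along \<open>e\<close> to \<open>Q\<close> and along \<open>m\<close> to \<open>G \<star> P\<close>.
  The pairs of a tree \<open>w\<close> and a container morphism from the fibre of \<open>G\<close> over \<open>w\<close> to \<open>X\<close> form an object \<open>H\<close> over \<open>W\<close>. An algebra
  structure \<open>Q + X \<star> P \<rightarrow> X\<close> makes \<open>H\<close> an algebra for the functor defining \<open>W\<close>, so initiality of \<open>W\<close> yields a unique compatible
  section of \<open>H \<rightarrow> W\<close>, that is, a unique algebra morphism \<open>G \<rightarrow> X\<close>.\<close>

text \<open>A container morphism runs forwards on shapes and backwards on directions, so recursion
  on \<open>W\<close> does not directly produce one. Sections of \<open>H\<close> move the problem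
  into the base category, where ordinary initiality applies. Pullbacks and powers are formulated for
  a category with a functor to a base: the same lemmas then serve \<open>C\<close> over itself, for
  shapes, and \<open>Cont C\<close> over \<open>C\<close>, and the functor preserves both notions.
  Universal properties quantify over all pullbacks; chosen pullbacks occur where the definitions of
  the containers bring them in. \<open>P\<^sup>\<diamond>\<close> is only a selected carrier. The
  recursion is therefore used twice. With the identity of \<open>W\<close> on shapes it shows that
  the explicit container of paths is initial for \<open>1 + X \<star> P\<close>, so it is isomorphic
  to \<open>P\<^sup>\<diamond>\<close>. Transporting \<open>Q \<star> P\<^sup>\<diamond>\<close>
  along this isomorphism makes it a power by the container of paths, hence an object over trees, and
  the recursion applies again. The fibres over leaf and node come from Lambek's decompositions of
  trees and of paths, compared by extensivity.\<close>

context category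
begin

lemma hom_iff: "f \<in> hom C X Y \<longleftrightarrow> f \<in> Arr C \<and> Dom C f = X \<and> Cod C f = Y"
  by (auto simp: hom_def)

lemma dom_in[simp]: "f \<in> Arr C \<Longrightarrow> Dom C f \<in> Obj C"
  by (rule dom_obj)

lemma cod_in[simp]: "f \<in> Arr C \<Longrightarrow> Cod C f \<in> Obj C"
  by (rule cod_obj)

lemma idt_arr[simp]: "X \<in> Obj C \<Longrightarrow> Idt C X \<in> Arr C"
  and dom_idt[simp]: "X \<in> Obj C \<Longrightarrow> Dom C (Idt C X) = X"
  and cod_idt[simp]: "X \<in> Obj C \<Longrightarrow> Cod C (Idt C X) = X"
  using idt_hom[of X] by (auto simp: hom_def)

lemma cmp_arr[simp]: "f \<in> Arr C \<Longrightarrow> g \<in> Arr C \<Longrightarrow> Cod C f = Dom C g \<Longrightarrow> g \<cdot> f \<in> Arr C"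
  and dom_cmp[simp]: "f \<in> Arr C \<Longrightarrow> g \<in> Arr C \<Longrightarrow> Cod C f = Dom C g \<Longrightarrow> Dom C (g \<cdot> f) = Dom C f"
  and cod_cmp[simp]: "f \<in> Arr C \<Longrightarrow> g \<in> Arr C \<Longrightarrow> Cod C f = Dom C g \<Longrightarrow> Cod C (g \<cdot> f) = Cod C g"
  using cmp_hom[of f "Dom C f" "Cod C f" g "Cod C g"] by (auto simp: hom_def)

lemma cmp_idt_left[simp]: "f \<in> Arr C \<Longrightarrow> Cod C f = Y \<Longrightarrow> Idt C Y \<cdot> f = f"
  by (rule idt_left) (simp add: hom_def)

lemma cmp_idt_right[simp]: "f \<in> Arr C \<Longrightarrow> Dom C f = X \<Longrightarrow> f \<cdot> Idt C X = f"
  by (rule idt_right) (simp add: hom_def)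

lemma assoc[simp]:
  "f \<in> Arr C \<Longrightarrow> g \<in> Arr C \<Longrightarrow> h \<in> Arr C \<Longrightarrow> Cod C f = Dom C g \<Longrightarrow> Cod C g = Dom C h \<Longrightarrow>
    (h \<cdot> g) \<cdot> f = h \<cdot> (g \<cdot> f)"
  by (rule cmp_assoc) (auto simp: hom_def)

text \<open>\<open>assoc\<close> nests composites to the right, so an equation
  \<open>f \<cdot> g = k\<close> no longer matches once a further arrow follows. This is its form
  under precomposition.\<close>

lemma precomp:
  "f \<cdot> g = k \<Longrightarrow> f \<in> Arr C \<Longrightarrow> g \<in> Arr C \<Longrightarrow> Cod C g = Dom C f \<Longrightarrow> x \<in> Arr C \<Longrightarrow> Cod C x = Dom C g \<Longrightarrow>
    f \<cdot> (g \<cdot> x) = k \<cdot> x"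
  using assoc[of x g f] by simp

end

section \<open>Pullbacks and powers relative to a base category\<close>

text \<open>A functor from \<open>E\<close> to \<open>B\<close>, written as its two actions. It is
  used for containers over their shapes and, with both actions the identity, for a category over
  itself.\<close>

locale category_over = E: category E + B: category B
  for E :: "('e, 'f) cat" and B :: "('b, 'g) cat" +
  fixes so :: "'e \<Rightarrow> 'b" and sa :: "'f \<Rightarrow> 'g"
  assumes so_obj: "X \<in> Obj E \<Longrightarrow> so X \<in> Obj B"
    and sa_arr: "f \<in> Arr E \<Longrightarrow> sa f \<in> Arr B"
    and dom_sa: "f \<in> Arr E \<Longrightarrow> Dom B (sa f) = so (Dom E f)"
    and cod_sa: "f \<in> Arr E \<Longrightarrow> Cod B (sa f) = so (Cod E f)"
    and sa_idt: "X \<in> Obj E \<Longrightarrow> sa (Idt E X) = Idt B (so X)"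
    and sa_cmp: "f \<in> Arr E \<Longrightarrow> g \<in> Arr E \<Longrightarrow> Cod E f = Dom E g \<Longrightarrow>
      sa (g \<cdot>\<^bsub>E\<^esub> f) = sa g \<cdot>\<^bsub>B\<^esub> sa f"
begin

lemmas sa_simps = so_obj sa_arr dom_sa cod_sa sa_idt sa_cmp

context notes [simp] = sa_simps
begin

text \<open>A pullback of \<open>v\<close> and \<open>u\<close> in which \<open>u\<close> starts at the image of an object of \<open>E\<close>, and whose vertex is again such an image:
  \<open>c\<close> is the projection in \<open>E\<close> and \<open>t\<close> the projection in \<open>B\<close>. For \<open>E = B\<close> this is an ordinary pullback.\<close>

definition mpb :: "'g \<Rightarrow> 'g \<Rightarrow> 'g \<Rightarrow> 'f \<Rightarrow> bool" where
  "mpb v u t c \<longleftrightarrow>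
     v \<in> Arr B \<and> u \<in> Arr B \<and> t \<in> Arr B \<and> c \<in> Arr E \<and>
     Cod B u = Cod B v \<and> Dom B u = so (Cod E c) \<and> Cod B t = Dom B v \<and> Dom B t = so (Dom E c) \<and>
     v \<cdot>\<^bsub>B\<^esub> t = u \<cdot>\<^bsub>B\<^esub> sa c \<and>
     (\<forall>y s. y \<in> Arr E \<longrightarrow> s \<in> Arr B \<longrightarrow> Cod E y = Cod E c \<longrightarrow> Dom B s = so (Dom E y) \<longrightarrow>
        Cod B s = Dom B v \<longrightarrow> v \<cdot>\<^bsub>B\<^esub> s = u \<cdot>\<^bsub>B\<^esub> sa y \<longrightarrow>
        (\<exists>!z. z \<in> hom E (Dom E y) (Dom E c) \<and> c \<cdot>\<^bsub>E\<^esub> z = y \<and> t \<cdot>\<^bsub>B\<^esub> sa z = s))"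

lemma mpbD:
  assumes "mpb v u t c"
  shows "v \<in> Arr B" "u \<in> Arr B" "t \<in> Arr B" "c \<in> Arr E"
    "Cod B u = Cod B v" "Dom B u = so (Cod E c)" "Cod B t = Dom B v" "Dom B t = so (Dom E c)"
    "v \<cdot>\<^bsub>B\<^esub> t = u \<cdot>\<^bsub>B\<^esub> sa c"
  using assms by (auto simp: mpb_def)

lemma mpb_lift:
  assumes "mpb v u t c" "y \<in> Arr E" "s \<in> Arr B" "Cod E y = Cod E c" "Dom B s = so (Dom E y)"
    "Cod B s = Dom B v" "v \<cdot>\<^bsub>B\<^esub> s = u \<cdot>\<^bsub>B\<^esub> sa y"
  obtains z where "z \<in> Arr E" "Dom E z = Dom E y" "Cod E z = Dom E c" "c \<cdot>\<^bsub>E\<^esub> z = y" "t \<cdot>\<^bsub>B\<^esub> sa z = s"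
proof -
  have "\<exists>!z. z \<in> hom E (Dom E y) (Dom E c) \<and> c \<cdot>\<^bsub>E\<^esub> z = y \<and> t \<cdot>\<^bsub>B\<^esub> sa z = s"
    using assms(1) unfolding mpb_def by (elim conjE allE[where x = y] allE[where x = s]) (simp add: assms(2-7))
  then show thesis
    using that unfolding E.hom_iff by blast
qed

lemma mpb_unique:
  assumes "mpb v u t c" "z \<in> Arr E" "z' \<in> Arr E" "Dom E z = Dom E z'" "Cod E z = Dom E c" "Cod E z' = Dom E c"
    "c \<cdot>\<^bsub>E\<^esub> z = c \<cdot>\<^bsub>E\<^esub> z'" "t \<cdot>\<^bsub>B\<^esub> sa z = t \<cdot>\<^bsub>B\<^esub> sa z'"
  shows "z = z'"
proof -
  note d[simp] = mpbD[OF assms(1)] assms(2-6)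
  have "v \<cdot>\<^bsub>B\<^esub> (t \<cdot>\<^bsub>B\<^esub> sa z) = u \<cdot>\<^bsub>B\<^esub> sa (c \<cdot>\<^bsub>E\<^esub> z)"
    using B.precomp[OF d(9), of "sa z"] by simp
  then have 1: "\<exists>!x. x \<in> hom E (Dom E (c \<cdot>\<^bsub>E\<^esub> z)) (Dom E c) \<and> c \<cdot>\<^bsub>E\<^esub> x = c \<cdot>\<^bsub>E\<^esub> z \<and> t \<cdot>\<^bsub>B\<^esub> sa x = t \<cdot>\<^bsub>B\<^esub> sa z"
    using assms(1) unfolding mpb_def
    by (elim conjE allE[where x = "c \<cdot>\<^bsub>E\<^esub> z"]) (erule allE[where x = "t \<cdot>\<^bsub>B\<^esub> sa z"], simp)
  have 2: "z \<in> hom E (Dom E (c \<cdot>\<^bsub>E\<^esub> z)) (Dom E c)" "z' \<in> hom E (Dom E (c \<cdot>\<^bsub>E\<^esub> z)) (Dom E c)"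
    by (simp_all add: E.hom_iff)
  show ?thesis
    using ex1E[OF 1, of "z = z'"] 2 assms(7,8) by metis
qed

lemma mpbI:
  assumes "v \<in> Arr B" "u \<in> Arr B" "t \<in> Arr B" "c \<in> Arr E"
    "Cod B u = Cod B v" "Dom B u = so (Cod E c)" "Cod B t = Dom B v" "Dom B t = so (Dom E c)"
    "v \<cdot>\<^bsub>B\<^esub> t = u \<cdot>\<^bsub>B\<^esub> sa c"
    and "\<And>y s. y \<in> Arr E \<Longrightarrow> s \<in> Arr B \<Longrightarrow> Cod E y = Cod E c \<Longrightarrow> Dom B s = so (Dom E y) \<Longrightarrow>
        Cod B s = Dom B v \<Longrightarrow> v \<cdot>\<^bsub>B\<^esub> s = u \<cdot>\<^bsub>B\<^esub> sa y \<Longrightarrow>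
        \<exists>z. z \<in> Arr E \<and> Dom E z = Dom E y \<and> Cod E z = Dom E c \<and> c \<cdot>\<^bsub>E\<^esub> z = y \<and> t \<cdot>\<^bsub>B\<^esub> sa z = s"
    and "\<And>z z'. z \<in> Arr E \<Longrightarrow> z' \<in> Arr E \<Longrightarrow> Dom E z = Dom E z' \<Longrightarrow> Cod E z = Dom E c \<Longrightarrow>
        Cod E z' = Dom E c \<Longrightarrow> c \<cdot>\<^bsub>E\<^esub> z = c \<cdot>\<^bsub>E\<^esub> z' \<Longrightarrow> t \<cdot>\<^bsub>B\<^esub> sa z = t \<cdot>\<^bsub>B\<^esub> sa z' \<Longrightarrow> z = z'"
  shows "mpb v u t c"
  unfolding mpb_def E.hom_iff
proof (intro conjI allI impI assms(1-9))
  fix y s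
  assume a: "y \<in> Arr E" "s \<in> Arr B" "Cod E y = Cod E c" "Dom B s = so (Dom E y)"
    "Cod B s = Dom B v" "v \<cdot>\<^bsub>B\<^esub> s = u \<cdot>\<^bsub>B\<^esub> sa y"
  show "\<exists>!z. (z \<in> Arr E \<and> Dom E z = Dom E y \<and> Cod E z = Dom E c) \<and> c \<cdot>\<^bsub>E\<^esub> z = y \<and> t \<cdot>\<^bsub>B\<^esub> sa z = s"
    using assms(10)[OF a] assms(11) by (auto intro!: ex_ex1I)
qed

lemma mpb_idt:
  assumes "v \<in> Arr B" "G \<in> Obj E" "Dom B v = so G"
  shows "mpb (Idt B (Cod B v)) v v (Idt E G)"
  using assms by (intro mpbI) auto

text \<open>The half of the pasting lemma in which the base changes: a lift through \<open>v\<close>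
  is lifted once more through \<open>v'\<close>. In \<open>mpb_paste\<close> it is \<open>u\<close>
  that changes.\<close>

lemma mpb_comp:
  assumes 1: "mpb v u t c" and 2: "mpb v' t t' c'" and e: "Cod E c' = Dom E c"
  shows "mpb (v \<cdot>\<^bsub>B\<^esub> v') u t' (c \<cdot>\<^bsub>E\<^esub> c')"
proof -
  note d[simp] = mpbD[OF 1] mpbD[OF 2] e
  have [simp]: "Dom B v = Cod B v'"
    using d(7,14) by simp
  note p[simp] = B.precomp[OF d(9)]
  show ?thesis
  proof (intro mpbI)
    fix y s
    assume a[simp]: "y \<in> Arr E" "s \<in> Arr B" "Cod E y = Cod E (c \<cdot>\<^bsub>E\<^esub> c')" "Dom B s = so (Dom E y)"
      "Cod B s = Dom B (v \<cdot>\<^bsub>B\<^esub> v')" and eq: "v \<cdot>\<^bsub>B\<^esub> v' \<cdot>\<^bsub>B\<^esub> s = u \<cdot>\<^bsub>B\<^esub> sa y"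
    obtain z where z[simp]: "z \<in> Arr E" "Dom E z = Dom E y" "Cod E z = Dom E c" "c \<cdot>\<^bsub>E\<^esub> z = y"
      "t \<cdot>\<^bsub>B\<^esub> sa z = v' \<cdot>\<^bsub>B\<^esub> s"
      by (rule mpb_lift[OF 1, of y "v' \<cdot>\<^bsub>B\<^esub> s"]) (use eq d in simp_all)
    obtain z' where z'[simp]: "z' \<in> Arr E" "Dom E z' = Dom E z" "Cod E z' = Dom E c'" "c' \<cdot>\<^bsub>E\<^esub> z' = z"
      "t' \<cdot>\<^bsub>B\<^esub> sa z' = s"
      by (rule mpb_lift[OF 2, of z s]) (use e d in simp_all)
    show "\<exists>z. z \<in> Arr E \<and> Dom E z = Dom E y \<and> Cod E z = Dom E (c \<cdot>\<^bsub>E\<^esub> c') \<and> c \<cdot>\<^bsub>E\<^esub> c' \<cdot>\<^bsub>E\<^esub> z = y \<and> t' \<cdot>\<^bsub>B\<^esub> sa z = s"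
      by (rule exI[of _ z']) simp
  next
    fix z z'
    assume a[simp]: "z \<in> Arr E" "z' \<in> Arr E" "Dom E z = Dom E z'" "Cod E z = Dom E (c \<cdot>\<^bsub>E\<^esub> c')"
      "Cod E z' = Dom E (c \<cdot>\<^bsub>E\<^esub> c')" and c: "c \<cdot>\<^bsub>E\<^esub> c' \<cdot>\<^bsub>E\<^esub> z = c \<cdot>\<^bsub>E\<^esub> c' \<cdot>\<^bsub>E\<^esub> z'" and t: "t' \<cdot>\<^bsub>B\<^esub> sa z = t' \<cdot>\<^bsub>B\<^esub> sa z'"
    have "t \<cdot>\<^bsub>B\<^esub> sa (c' \<cdot>\<^bsub>E\<^esub> z) = t \<cdot>\<^bsub>B\<^esub> sa (c' \<cdot>\<^bsub>E\<^esub> z')"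
      using t B.precomp[OF d(18), of "sa z"] B.precomp[OF d(18), of "sa z'"] by simp
    then have c': "c' \<cdot>\<^bsub>E\<^esub> z = c' \<cdot>\<^bsub>E\<^esub> z'"
      by - (rule mpb_unique[OF 1], use c in simp_all)
    show "z = z'"
      by (rule mpb_unique[OF 2]) (use t c' in simp_all)
  qed simp_all
qed


lemma mpb_iso:
  assumes 1: "mpb v u t c" and 2: "mpb v u t' c'" and 3: "Cod E c = Cod E c'"
  obtains i where "i \<in> Arr E" "Dom E i = Dom E c" "Cod E i = Dom E c'" "c' \<cdot>\<^bsub>E\<^esub> i = c" "t' \<cdot>\<^bsub>B\<^esub> sa i = t"
  using mpb_lift[OF 2 mpbD(4,3)[OF 1], of thesis] mpbD[OF 1] mpbD[OF 2] 3 by simp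

lemma mpb_iso2:
  assumes 1: "mpb v u t c" and 2: "mpb v u t' c'" and 3: "Cod E c = Cod E c'"
  obtains i j where "i \<in> Arr E" "Dom E i = Dom E c" "Cod E i = Dom E c'" "c' \<cdot>\<^bsub>E\<^esub> i = c" "t' \<cdot>\<^bsub>B\<^esub> sa i = t"
     "j \<in> Arr E" "Dom E j = Dom E c'" "Cod E j = Dom E c" "c \<cdot>\<^bsub>E\<^esub> j = c'" "t \<cdot>\<^bsub>B\<^esub> sa j = t'"
     "j \<cdot>\<^bsub>E\<^esub> i = Idt E (Dom E c)" "i \<cdot>\<^bsub>E\<^esub> j = Idt E (Dom E c')"
proof -
  note d[simp] = mpbD[OF 1] mpbD[OF 2] 3
  obtain i where i[simp]: "i \<in> Arr E" "Dom E i = Dom E c" "Cod E i = Dom E c'" "c' \<cdot>\<^bsub>E\<^esub> i = c" "t' \<cdot>\<^bsub>B\<^esub> sa i = t"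
    by (rule mpb_iso[OF 1 2 3])
  obtain j where j[simp]: "j \<in> Arr E" "Dom E j = Dom E c'" "Cod E j = Dom E c" "c \<cdot>\<^bsub>E\<^esub> j = c'" "t \<cdot>\<^bsub>B\<^esub> sa j = t'"
    by (rule mpb_iso[OF 2 1 3[symmetric]])
  note p[simp] = E.precomp[OF i(4)] E.precomp[OF j(4)] B.precomp[OF i(5)] B.precomp[OF j(5)]
  have "j \<cdot>\<^bsub>E\<^esub> i = Idt E (Dom E c)"
    by (rule mpb_unique[OF 1]) simp_all
  moreover have "i \<cdot>\<^bsub>E\<^esub> j = Idt E (Dom E c')"
    by (rule mpb_unique[OF 2]) simp_all
  ultimately show ?thesis
    using that i j by blast
qed

text \<open>With evaluation \<open>e\<close> on the pullback \<open>(a, n)\<close> of \<open>P\<close> and \<open>r\<close>, the arrow \<open>m\<close> over \<open>\<phi>\<close> is the transpose of \<open>g\<close>, which is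
  defined on the pullback \<open>(\<alpha>, c)\<close> of \<open>P\<close> and \<open>\<phi>\<close>.\<close>

definition transposes :: "'g \<Rightarrow> 'g \<Rightarrow> 'f \<Rightarrow> 'f \<Rightarrow> 'g \<Rightarrow> 'g \<Rightarrow> 'f \<Rightarrow> 'f \<Rightarrow> 'f \<Rightarrow> bool" where
  "transposes r a n e \<phi> \<alpha> c m g \<longleftrightarrow> m \<in> Arr E \<and> Dom E m = Cod E c \<and> Cod E m = Cod E n \<and> r \<cdot>\<^bsub>B\<^esub> sa m = \<phi> \<and>
     (\<exists>m'. m' \<in> Arr E \<and> Dom E m' = Dom E c \<and> Cod E m' = Dom E n \<and>
        n \<cdot>\<^bsub>E\<^esub> m' = m \<cdot>\<^bsub>E\<^esub> c \<and> a \<cdot>\<^bsub>B\<^esub> sa m' = \<alpha> \<and> e \<cdot>\<^bsub>E\<^esub> m' = g)"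

text \<open>Arrows from \<open>Y\<close> to \<open>Cod E n\<close> amount to a base arrow \<phi> to
  \<open>Cod B P\<close> together with an arrow to \<open>X\<close> from the pullback of
  \<open>Y\<close> along \<open>P\<close>; in the internal language the power consists of pairs of
  an \<open>i\<close> and a map from the fibre of \<open>P\<close> over \<open>i\<close> to
  \<open>X\<close>. Testing against every pullback keeps comparison isomorphisms out of later
  diagrams.\<close>

definition is_power :: "'g \<Rightarrow> 'e \<Rightarrow> 'g \<Rightarrow> 'g \<Rightarrow> 'f \<Rightarrow> 'f \<Rightarrow> bool" where
  "is_power P X r a n e \<longleftrightarrow> mpb P r a n \<and> e \<in> Arr E \<and> Dom E e = Dom E n \<and> Cod E e = X \<and>
     (\<forall>\<phi> \<alpha> c g. mpb P \<phi> \<alpha> c \<longrightarrow> g \<in> Arr E \<longrightarrow> Dom E g = Dom E c \<longrightarrow> Cod E g = X \<longrightarrow>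
       (\<exists>!m. transposes r a n e \<phi> \<alpha> c m g))"

lemma powerD:
  assumes "is_power P X r a n e"
  shows "mpb P r a n" "e \<in> Arr E" "Dom E e = Dom E n" "Cod E e = X"
  using assms by (auto simp: is_power_def)

lemma power_ex1:
  assumes "is_power P X r a n e" and c: "mpb P \<phi> \<alpha> c" "g \<in> Arr E" "Dom E g = Dom E c" "Cod E g = X"
  shows "\<exists>!m. transposes r a n e \<phi> \<alpha> c m g"
proof -
  have "mpb P \<phi> \<alpha> c \<longrightarrow> g \<in> Arr E \<longrightarrow> Dom E g = Dom E c \<longrightarrow> Cod E g = X \<longrightarrow> (\<exists>!m. transposes r a n e \<phi> \<alpha> c m g)"
    using assms(1) unfolding is_power_def by (elim conjE allE)
  then show ?thesis
    using c by simp
qed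

lemma power_ex:
  assumes "is_power P X r a n e" "mpb P \<phi> \<alpha> c" "g \<in> Arr E" "Dom E g = Dom E c" "Cod E g = X"
  obtains m m' where "m \<in> Arr E" "Dom E m = Cod E c" "Cod E m = Cod E n" "r \<cdot>\<^bsub>B\<^esub> sa m = \<phi>"
    "m' \<in> Arr E" "Dom E m' = Dom E c" "Cod E m' = Dom E n" "n \<cdot>\<^bsub>E\<^esub> m' = m \<cdot>\<^bsub>E\<^esub> c" "a \<cdot>\<^bsub>B\<^esub> sa m' = \<alpha>" "e \<cdot>\<^bsub>E\<^esub> m' = g"
proof -
  obtain m where "transposes r a n e \<phi> \<alpha> c m g"
    using ex1_implies_ex[OF power_ex1[OF assms(1-5)]] by (rule exE)
  then show thesis
    using that unfolding transposes_def by blast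
qed

lemma transposesI:
  assumes "m \<in> Arr E" "Dom E m = Cod E c" "Cod E m = Cod E n" "r \<cdot>\<^bsub>B\<^esub> sa m = \<phi>"
    "m' \<in> Arr E" "Dom E m' = Dom E c" "Cod E m' = Dom E n" "n \<cdot>\<^bsub>E\<^esub> m' = m \<cdot>\<^bsub>E\<^esub> c" "a \<cdot>\<^bsub>B\<^esub> sa m' = \<alpha>" "e \<cdot>\<^bsub>E\<^esub> m' = g"
  shows "transposes r a n e \<phi> \<alpha> c m g"
  unfolding transposes_def using assms by blast

lemma transposesE:
  assumes "transposes r a n e \<phi> \<alpha> c m g"
  obtains m' where "m \<in> Arr E" "Dom E m = Cod E c" "Cod E m = Cod E n" "r \<cdot>\<^bsub>B\<^esub> sa m = \<phi>"
    "m' \<in> Arr E" "Dom E m' = Dom E c" "Cod E m' = Dom E n" "n \<cdot>\<^bsub>E\<^esub> m' = m \<cdot>\<^bsub>E\<^esub> c" "a \<cdot>\<^bsub>B\<^esub> sa m' = \<alpha>" "e \<cdot>\<^bsub>E\<^esub> m' = g"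
  using assms unfolding transposes_def by blast

lemma power_unique':
  assumes "is_power P X r a n e" "mpb P \<phi> \<alpha> c" "g \<in> Arr E" "Dom E g = Dom E c" "Cod E g = X"
    and 4: "transposes r a n e \<phi> \<alpha> c m1 g" and 5: "transposes r a n e \<phi> \<alpha> c m2 g"
  shows "m1 = m2"
proof -
  note 3 = power_ex1[OF assms(1-5)]
  show ?thesis
    by (rule trans[OF the1_equality[OF 3 4, symmetric] the1_equality[OF 3 5]])
qed

lemma power_unique:
  assumes "is_power P X r a n e" "mpb P \<phi> \<alpha> c"
    and 1: "m1 \<in> Arr E" "Dom E m1 = Cod E c" "Cod E m1 = Cod E n" "r \<cdot>\<^bsub>B\<^esub> sa m1 = \<phi>"
    "m1' \<in> Arr E" "Dom E m1' = Dom E c" "Cod E m1' = Dom E n" "n \<cdot>\<^bsub>E\<^esub> m1' = m1 \<cdot>\<^bsub>E\<^esub> c" "a \<cdot>\<^bsub>B\<^esub> sa m1' = \<alpha>"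
    and 2: "m2 \<in> Arr E" "Dom E m2 = Cod E c" "Cod E m2 = Cod E n" "r \<cdot>\<^bsub>B\<^esub> sa m2 = \<phi>"
    "m2' \<in> Arr E" "Dom E m2' = Dom E c" "Cod E m2' = Dom E n" "n \<cdot>\<^bsub>E\<^esub> m2' = m2 \<cdot>\<^bsub>E\<^esub> c" "a \<cdot>\<^bsub>B\<^esub> sa m2' = \<alpha>"
    and e: "e \<cdot>\<^bsub>E\<^esub> m1' = e \<cdot>\<^bsub>E\<^esub> m2'"
  shows "m1 = m2"
  by (rule power_unique'[OF assms(1,2) _ _ _ transposesI[OF 1 e] transposesI[OF 2 refl]])
    (use 2 powerD[OF assms(1)] in simp_all)

lemma transposes_iso:
  assumes 0: "mpb P r a n" "e \<in> Arr E" "Dom E e = Dom E n"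
    and c: "mpb P \<phi> \<alpha> c" and c0: "mpb P \<phi> \<alpha>0 c0"
    and j: "j \<in> Arr E" "Dom E j = Dom E c0" "Cod E j = Dom E c" "c \<cdot>\<^bsub>E\<^esub> j = c0" "\<alpha> \<cdot>\<^bsub>B\<^esub> sa j = \<alpha>0" "Cod E c0 = Cod E c"
    and t: "transposes r a n e \<phi> \<alpha> c m g"
  shows "transposes r a n e \<phi> \<alpha>0 c0 m (g \<cdot>\<^bsub>E\<^esub> j)"
proof -
  obtain m' where 1: "m \<in> Arr E" "Dom E m = Cod E c" "Cod E m = Cod E n" "r \<cdot>\<^bsub>B\<^esub> sa m = \<phi>"
    "m' \<in> Arr E" "Dom E m' = Dom E c" "Cod E m' = Dom E n" "n \<cdot>\<^bsub>E\<^esub> m' = m \<cdot>\<^bsub>E\<^esub> c" "a \<cdot>\<^bsub>B\<^esub> sa m' = \<alpha>" "e \<cdot>\<^bsub>E\<^esub> m' = g"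
    by (rule transposesE[OF t])
  note d[simp] = mpbD[OF c] mpbD[OF 0(1)] 0(2,3) mpbD(4)[OF c0] j
  show ?thesis
    by (rule transposesI[where m' = "m' \<cdot>\<^bsub>E\<^esub> j"])
      (use 1(1-7) E.precomp[OF 1(8), of j] B.precomp[OF 1(9), of "sa j"] E.precomp[OF 1(10), of j] in simp_all)
qed

text \<open>Two pullbacks of \<open>P\<close> and \<phi> differ by an isomorphism, along which
  transposes correspond, so one pullback for each \<phi> is enough for the test.\<close>

lemma powerI:
  assumes 0: "mpb P r a n" "e \<in> Arr E" "Dom E e = Dom E n" "Cod E e = X"
    and ex: "\<And>Y \<phi>. Y \<in> Obj E \<Longrightarrow> \<phi> \<in> Arr B \<Longrightarrow> Dom B \<phi> = so Y \<Longrightarrow> Cod B \<phi> = Cod B P \<Longrightarrow>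
      \<exists>\<alpha> c. mpb P \<phi> \<alpha> c \<and> Cod E c = Y \<and> (\<forall>g. g \<in> Arr E \<longrightarrow> Dom E g = Dom E c \<longrightarrow> Cod E g = X \<longrightarrow>
        (\<exists>!m. transposes r a n e \<phi> \<alpha> c m g))"
  shows "is_power P X r a n e"
  unfolding is_power_def
proof (intro conjI allI impI 0)
  fix \<phi> \<alpha> c g
  assume c: "mpb P \<phi> \<alpha> c" and g[simp]: "g \<in> Arr E" "Dom E g = Dom E c" "Cod E g = X"
  note d[simp] = mpbD[OF c]
  obtain \<alpha>0 c0 where c0: "mpb P \<phi> \<alpha>0 c0" and [simp]: "Cod E c0 = Cod E c" and
    ex0: "\<And>g. g \<in> Arr E \<Longrightarrow> Dom E g = Dom E c0 \<Longrightarrow> Cod E g = X \<Longrightarrow> \<exists>!m. transposes r a n e \<phi> \<alpha>0 c0 m g"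
    using ex[of "Cod E c" \<phi>] d E.cod_in by metis
  note [simp] = mpbD(4)[OF c0]
  obtain i j where i[simp]: "i \<in> Arr E" "Dom E i = Dom E c" "Cod E i = Dom E c0" "c0 \<cdot>\<^bsub>E\<^esub> i = c" "\<alpha>0 \<cdot>\<^bsub>B\<^esub> sa i = \<alpha>"
     and j[simp]: "j \<in> Arr E" "Dom E j = Dom E c0" "Cod E j = Dom E c" "c \<cdot>\<^bsub>E\<^esub> j = c0" "\<alpha> \<cdot>\<^bsub>B\<^esub> sa j = \<alpha>0"
     and ij[simp]: "j \<cdot>\<^bsub>E\<^esub> i = Idt E (Dom E c)" "i \<cdot>\<^bsub>E\<^esub> j = Idt E (Dom E c0)"
    by (rule mpb_iso2[OF c c0]) simp
  have 1: "\<exists>!m. transposes r a n e \<phi> \<alpha>0 c0 m (g \<cdot>\<^bsub>E\<^esub> j)"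
    by (rule ex0) simp_all
  have "transposes r a n e \<phi> \<alpha>0 c0 m (g \<cdot>\<^bsub>E\<^esub> j) \<longleftrightarrow> transposes r a n e \<phi> \<alpha> c m g" for m
    using transposes_iso[OF 0(1-3) c c0 j, of m g] transposes_iso[OF 0(1-3) c0 c i, of m "g \<cdot>\<^bsub>E\<^esub> j"] by auto
  with 1 show "\<exists>!m. transposes r a n e \<phi> \<alpha> c m g"
    by simp
qed

end

end

locale categories_over = category_over E B so sa + D: category_over B B "\<lambda>x. x" "\<lambda>x. x"
  for E :: "('e, 'f) cat" and B :: "('b, 'g) cat" and so sa
begin

context notes [simp] = sa_simps
begin

lemma mpb_paste:
  assumes 1: "D.mpb v f q p" and 2: "mpb p u t c"
  shows "mpb v (f \<cdot>\<^bsub>B\<^esub> u) (q \<cdot>\<^bsub>B\<^esub> t) c"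
proof -
  note d[simp] = D.mpbD[OF 1] mpbD[OF 2]
  note p[simp] = B.precomp[OF d(9)]
  show ?thesis
  proof (intro mpbI)
    fix y s
    assume a[simp]: "y \<in> Arr E" "s \<in> Arr B" "Cod E y = Cod E c" "Dom B s = so (Dom E y)"
      "Cod B s = Dom B v" and eq: "v \<cdot>\<^bsub>B\<^esub> s = (f \<cdot>\<^bsub>B\<^esub> u) \<cdot>\<^bsub>B\<^esub> sa y"
    obtain z where z[simp]: "z \<in> Arr B" "Dom B z = so (Dom E y)" "Cod B z = Dom B q" "p \<cdot>\<^bsub>B\<^esub> z = u \<cdot>\<^bsub>B\<^esub> sa y"
      "q \<cdot>\<^bsub>B\<^esub> z = s"
      by (rule D.mpb_lift[OF 1, of "u \<cdot>\<^bsub>B\<^esub> sa y" s]) (use eq in simp_all)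
    obtain w where w[simp]: "w \<in> Arr E" "Dom E w = Dom E y" "Cod E w = Dom E c" "c \<cdot>\<^bsub>E\<^esub> w = y"
      "t \<cdot>\<^bsub>B\<^esub> sa w = z"
      by (rule mpb_lift[OF 2, of y z]) simp_all
    show "\<exists>z. z \<in> Arr E \<and> Dom E z = Dom E y \<and> Cod E z = Dom E c \<and> c \<cdot>\<^bsub>E\<^esub> z = y \<and> (q \<cdot>\<^bsub>B\<^esub> t) \<cdot>\<^bsub>B\<^esub> sa z = s"
      by (rule exI[of _ w]) simp
  next
    fix z z'
    assume a[simp]: "z \<in> Arr E" "z' \<in> Arr E" "Dom E z = Dom E z'" "Cod E z = Dom E c"
      "Cod E z' = Dom E c" and c: "c \<cdot>\<^bsub>E\<^esub> z = c \<cdot>\<^bsub>E\<^esub> z'" and t: "(q \<cdot>\<^bsub>B\<^esub> t) \<cdot>\<^bsub>B\<^esub> sa z = (q \<cdot>\<^bsub>B\<^esub> t) \<cdot>\<^bsub>B\<^esub> sa z'"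
    have "p \<cdot>\<^bsub>B\<^esub> (t \<cdot>\<^bsub>B\<^esub> sa x) = u \<cdot>\<^bsub>B\<^esub> sa (c \<cdot>\<^bsub>E\<^esub> x)" if "x \<in> Arr E" "Cod E x = Dom E c" for x
      using B.precomp[OF d(18), of "sa x"] that by simp
    from this[of z] this[of z'] have "t \<cdot>\<^bsub>B\<^esub> sa z = t \<cdot>\<^bsub>B\<^esub> sa z'"
      by - (rule D.mpb_unique[OF 1], use t c in simp_all)
    then show "z = z'"
      by - (rule mpb_unique[OF 2], use c in simp_all)
  qed (simp_all del: d(18) add: d(18)[symmetric])
qed

text \<open>The cancellation half of the pasting lemma: \<open>t'\<close> is induced by the square
  in \<open>B\<close>, and it inherits its universal property from the outer square.\<close>

lemma mpb_cancel:
  assumes 1: "D.mpb v f q p" and 2: "mpb v (f \<cdot>\<^bsub>B\<^esub> u) t c" and u[simp]: "u \<in> Arr B" "Cod B u = Dom B f"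
  obtains t' where "mpb p u t' c" "q \<cdot>\<^bsub>B\<^esub> t' = t"
proof -
  note d[simp] = D.mpbD[OF 1] mpbD(3,4,5,7,8)[OF 2]
  have e[simp]: "Dom B u = so (Cod E c)" and e9: "v \<cdot>\<^bsub>B\<^esub> t = f \<cdot>\<^bsub>B\<^esub> (u \<cdot>\<^bsub>B\<^esub> sa c)"
    using mpbD(6,9)[OF 2] by simp_all
  note p[simp] = B.precomp[OF d(9)]
  obtain t' where t'[simp]: "t' \<in> Arr B" "Dom B t' = Dom B t" "Cod B t' = Dom B p" "p \<cdot>\<^bsub>B\<^esub> t' = u \<cdot>\<^bsub>B\<^esub> sa c" "q \<cdot>\<^bsub>B\<^esub> t' = t"
    by (rule D.mpb_lift[OF 1, of "u \<cdot>\<^bsub>B\<^esub> sa c" t]) (use e9 in simp_all)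
  note p'[simp] = B.precomp[OF t'(4)] B.precomp[OF t'(5)]
  have "mpb p u t' c"
  proof (intro mpbI)
    fix y s
    assume a[simp]: "y \<in> Arr E" "s \<in> Arr B" "Cod E y = Cod E c" "Dom B s = so (Dom E y)"
      "Cod B s = Dom B p" and eq: "p \<cdot>\<^bsub>B\<^esub> s = u \<cdot>\<^bsub>B\<^esub> sa y"
    obtain w where w[simp]: "w \<in> Arr E" "Dom E w = Dom E y" "Cod E w = Dom E c" and w2: "c \<cdot>\<^bsub>E\<^esub> w = y"
      "t \<cdot>\<^bsub>B\<^esub> sa w = q \<cdot>\<^bsub>B\<^esub> s"
      by (rule mpb_lift[OF 2, of y "q \<cdot>\<^bsub>B\<^esub> s"]) (simp_all add: eq)
    have "t' \<cdot>\<^bsub>B\<^esub> sa w = s"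
      by (rule D.mpb_unique[OF 1]) (use w2 in \<open>auto simp: eq\<close>)
    with w2 show "\<exists>z. z \<in> Arr E \<and> Dom E z = Dom E y \<and> Cod E z = Dom E c \<and> c \<cdot>\<^bsub>E\<^esub> z = y \<and> t' \<cdot>\<^bsub>B\<^esub> sa z = s"
      by (intro exI[of _ w]) simp
  next
    fix z z'
    assume a[simp]: "z \<in> Arr E" "z' \<in> Arr E" "Dom E z = Dom E z'" "Cod E z = Dom E c"
      "Cod E z' = Dom E c" and c: "c \<cdot>\<^bsub>E\<^esub> z = c \<cdot>\<^bsub>E\<^esub> z'" and t: "t' \<cdot>\<^bsub>B\<^esub> sa z = t' \<cdot>\<^bsub>B\<^esub> sa z'"
    have "t \<cdot>\<^bsub>B\<^esub> sa z = t \<cdot>\<^bsub>B\<^esub> sa z'"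
      using p'(2)[of "sa z"] p'(2)[of "sa z'"] t by simp
    then show "z = z'"
      by - (rule mpb_unique[OF 2], use c in simp_all)
  qed simp_all
  then show ?thesis using that by simp
qed


end

end

section \<open>Transposition in both directions, classifying objects, functorial powers\<close>

context category_over
begin

context notes [simp] = sa_simps
begin

text \<open>Uncurrying. With \<open>power_ex1\<close> and \<open>transposes_determines\<close> the
  relation \<open>transposes\<close> becomes a bijection between arrows over \<phi> into the power
  and arrows from the pullback to \<open>X\<close>.\<close>

lemma transposes_ex:
  assumes 1: "is_power P X r a n e" and c: "mpb P \<phi> \<alpha> c"
    and m[simp]: "m \<in> Arr E" "Dom E m = Cod E c" "Cod E m = Cod E n" and r: "r \<cdot>\<^bsub>B\<^esub> sa m = \<phi>"
  obtains g where "transposes r a n e \<phi> \<alpha> c m g" "g \<in> Arr E" "Dom E g = Dom E c" "Cod E g = X"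
proof -
  note d[simp] = mpbD(1,3,4,5,7,8)[OF c] powerD(2,3,4)[OF 1] mpbD(2,3,4,5,6,7,8)[OF powerD(1)[OF 1]]
  have eq: "P \<cdot>\<^bsub>B\<^esub> \<alpha> = r \<cdot>\<^bsub>B\<^esub> (sa m \<cdot>\<^bsub>B\<^esub> sa c)"
    using mpbD(9)[OF c] r[symmetric] by simp
  obtain m' where m': "m' \<in> Arr E" "Dom E m' = Dom E c" "Cod E m' = Dom E n" "n \<cdot>\<^bsub>E\<^esub> m' = m \<cdot>\<^bsub>E\<^esub> c" "a \<cdot>\<^bsub>B\<^esub> sa m' = \<alpha>"
    by (rule mpb_lift[OF powerD(1)[OF 1], of "m \<cdot>\<^bsub>E\<^esub> c" \<alpha>]) (use eq in simp_all)
  show ?thesis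
    by (rule that[OF transposesI[OF m r m' refl]]) (use m' in simp_all)
qed

lemma transposes_determines:
  assumes 1: "is_power P X r a n e" and c: "c \<in> Arr E"
    and 2: "transposes r a n e \<phi> \<alpha> c m g" "transposes r a n e \<phi> \<alpha> c m g'"
  shows "g = g'"
proof -
  obtain m1 where m1: "m1 \<in> Arr E" "Dom E m1 = Dom E c" "Cod E m1 = Dom E n" "n \<cdot>\<^bsub>E\<^esub> m1 = m \<cdot>\<^bsub>E\<^esub> c" "a \<cdot>\<^bsub>B\<^esub> sa m1 = \<alpha>" "e \<cdot>\<^bsub>E\<^esub> m1 = g"
    by (rule transposesE[OF 2(1)])
  obtain m2 where m2: "m2 \<in> Arr E" "Dom E m2 = Dom E c" "Cod E m2 = Dom E n" "n \<cdot>\<^bsub>E\<^esub> m2 = m \<cdot>\<^bsub>E\<^esub> c" "a \<cdot>\<^bsub>B\<^esub> sa m2 = \<alpha>" "e \<cdot>\<^bsub>E\<^esub> m2 = g'"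
    by (rule transposesE[OF 2(2)])
  have "m1 = m2"
    by (rule mpb_unique[OF powerD(1)[OF 1]]) (use m1 m2 in simp_all)
  then show ?thesis
    using m1 m2 by simp
qed

text \<open>\<open>h\<close> displays the object of pairs of a point \<open>w\<close> of the codomain of \<open>u\<close> and an arrow to \<open>X\<close> from the fibre of \<open>G\<close> over \<open>w\<close>;
  \<open>\<chi>\<close> is the universal such arrow.\<close>

definition classifies :: "'g \<Rightarrow> 'e \<Rightarrow> 'e \<Rightarrow> 'g \<Rightarrow> 'g \<Rightarrow> 'f \<Rightarrow> 'f \<Rightarrow> bool" where
  "classifies u G X h t c \<chi> \<longleftrightarrow> mpb h u t c \<and> Cod E c = G \<and> \<chi> \<in> Arr E \<and> Dom E \<chi> = Dom E c \<and> Cod E \<chi> = X \<and>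
     (\<forall>w t' c' \<theta>. mpb w u t' c' \<longrightarrow> Cod E c' = G \<longrightarrow> \<theta> \<in> Arr E \<longrightarrow> Dom E \<theta> = Dom E c' \<longrightarrow> Cod E \<theta> = X \<longrightarrow>
       (\<exists>!k. k \<in> Arr B \<and> Dom B k = Dom B w \<and> Cod B k = Dom B h \<and> h \<cdot>\<^bsub>B\<^esub> k = w \<and>
         (\<exists>\<kappa>. \<kappa> \<in> Arr E \<and> Dom E \<kappa> = Dom E c' \<and> Cod E \<kappa> = Dom E c \<and> c \<cdot>\<^bsub>E\<^esub> \<kappa> = c' \<and> t \<cdot>\<^bsub>B\<^esub> sa \<kappa> = k \<cdot>\<^bsub>B\<^esub> t' \<and> \<chi> \<cdot>\<^bsub>E\<^esub> \<kappa> = \<theta>)))"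

lemma classifies_ex1:
  assumes "classifies u G X h t c \<chi>" "mpb w u t' c'" "Cod E c' = G" "\<theta> \<in> Arr E" "Dom E \<theta> = Dom E c'" "Cod E \<theta> = X"
  shows "\<exists>!k. k \<in> Arr B \<and> Dom B k = Dom B w \<and> Cod B k = Dom B h \<and> h \<cdot>\<^bsub>B\<^esub> k = w \<and>
         (\<exists>\<kappa>. \<kappa> \<in> Arr E \<and> Dom E \<kappa> = Dom E c' \<and> Cod E \<kappa> = Dom E c \<and> c \<cdot>\<^bsub>E\<^esub> \<kappa> = c' \<and> t \<cdot>\<^bsub>B\<^esub> sa \<kappa> = k \<cdot>\<^bsub>B\<^esub> t' \<and> \<chi> \<cdot>\<^bsub>E\<^esub> \<kappa> = \<theta>)"
    (is "\<exists>!k. ?P k")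
proof -
  have "mpb w u t' c' \<longrightarrow> Cod E c' = G \<longrightarrow> \<theta> \<in> Arr E \<longrightarrow> Dom E \<theta> = Dom E c' \<longrightarrow> Cod E \<theta> = X \<longrightarrow> (\<exists>!k. ?P k)"
    using assms(1) unfolding classifies_def by (elim conjE allE)
  then show ?thesis
    using assms(2-) by simp
qed

lemma classifies_ex:
  assumes "classifies u G X h t c \<chi>" "mpb w u t' c'" "Cod E c' = G" "\<theta> \<in> Arr E" "Dom E \<theta> = Dom E c'" "Cod E \<theta> = X"
  obtains k \<kappa> where "k \<in> Arr B" "Dom B k = Dom B w" "Cod B k = Dom B h" "h \<cdot>\<^bsub>B\<^esub> k = w"
    "\<kappa> \<in> Arr E" "Dom E \<kappa> = Dom E c'" "Cod E \<kappa> = Dom E c" "c \<cdot>\<^bsub>E\<^esub> \<kappa> = c'" "t \<cdot>\<^bsub>B\<^esub> sa \<kappa> = k \<cdot>\<^bsub>B\<^esub> t'" "\<chi> \<cdot>\<^bsub>E\<^esub> \<kappa> = \<theta>"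
  using ex1_implies_ex[OF classifies_ex1[OF assms]] by (elim exE conjE)

lemma classifies_unique:
  assumes "classifies u G X h t c \<chi>" "mpb w u t' c'" "Cod E c' = G"
    and k: "k1 \<in> Arr B" "Dom B k1 = Dom B w" "Cod B k1 = Dom B h" "h \<cdot>\<^bsub>B\<^esub> k1 = w"
      "\<kappa>1 \<in> Arr E" "Dom E \<kappa>1 = Dom E c'" "Cod E \<kappa>1 = Dom E c" "c \<cdot>\<^bsub>E\<^esub> \<kappa>1 = c'" "t \<cdot>\<^bsub>B\<^esub> sa \<kappa>1 = k1 \<cdot>\<^bsub>B\<^esub> t'"
    and k2: "k2 \<in> Arr B" "Dom B k2 = Dom B w" "Cod B k2 = Dom B h" "h \<cdot>\<^bsub>B\<^esub> k2 = w"
      "\<kappa>2 \<in> Arr E" "Dom E \<kappa>2 = Dom E c'" "Cod E \<kappa>2 = Dom E c" "c \<cdot>\<^bsub>E\<^esub> \<kappa>2 = c'" "t \<cdot>\<^bsub>B\<^esub> sa \<kappa>2 = k2 \<cdot>\<^bsub>B\<^esub> t'"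
    and e: "\<chi> \<cdot>\<^bsub>E\<^esub> \<kappa>1 = \<chi> \<cdot>\<^bsub>E\<^esub> \<kappa>2"
  shows "k1 = k2"
proof -
  have \<chi>: "\<chi> \<in> Arr E" "Dom E \<chi> = Dom E c" "Cod E \<chi> = X" "mpb h u t c"
    using assms(1) by (auto simp: classifies_def)
  have 0: "\<exists>!k. k \<in> Arr B \<and> Dom B k = Dom B w \<and> Cod B k = Dom B h \<and> h \<cdot>\<^bsub>B\<^esub> k = w \<and>
         (\<exists>\<kappa>. \<kappa> \<in> Arr E \<and> Dom E \<kappa> = Dom E c' \<and> Cod E \<kappa> = Dom E c \<and> c \<cdot>\<^bsub>E\<^esub> \<kappa> = c' \<and> t \<cdot>\<^bsub>B\<^esub> sa \<kappa> = k \<cdot>\<^bsub>B\<^esub> t' \<and> \<chi> \<cdot>\<^bsub>E\<^esub> \<kappa> = \<chi> \<cdot>\<^bsub>E\<^esub> \<kappa>1)"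
    (is "\<exists>!k. ?P k")
    by (rule classifies_ex1[OF assms(1-3)]) (use k \<chi> in simp_all)
  have 1: "?P k1" using k by (intro conjI exI[of _ \<kappa>1]) simp_all
  have 2: "?P k2" using k2 e by (intro conjI exI[of _ \<kappa>2]) simp_all
  show ?thesis
    by (rule trans[OF the1_equality[OF 0 1, symmetric] the1_equality[OF 0 2]])
qed

end

end

text \<open>A choice of powers by \<open>P\<close>. The action on arrows is specified only as the
  transpose of \<open>k\<close> after evaluation; uniqueness of transposes turns this into
  functoriality.\<close>

locale power_functor = category_over E B so sa
  for E :: "('e, 'f) cat" and B :: "('b, 'g) cat" and so sa +
  fixes P :: 'g and r a :: "'e \<Rightarrow> 'g" and n e :: "'e \<Rightarrow> 'f" and L :: "'f \<Rightarrow> 'f"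
  assumes power: "X \<in> Obj E \<Longrightarrow> is_power P X (r X) (a X) (n X) (e X)"
    and L_transposes: "k \<in> Arr E \<Longrightarrow> transposes (r (Cod E k)) (a (Cod E k)) (n (Cod E k)) (e (Cod E k))
      (r (Dom E k)) (a (Dom E k)) (n (Dom E k)) (L k) (k \<cdot>\<^bsub>E\<^esub> e (Dom E k))"
begin

lemma power_facts:
  assumes "X \<in> Obj E"
  shows "P \<in> Arr B" "r X \<in> Arr B" "a X \<in> Arr B" "n X \<in> Arr E" "e X \<in> Arr E" "Dom E (e X) = Dom E (n X)" "Cod E (e X) = X"
    "Cod B (r X) = Cod B P" "Dom B (r X) = so (Cod E (n X))" "Cod B (a X) = Dom B P" "Dom B (a X) = so (Dom E (n X))"
    "P \<cdot>\<^bsub>B\<^esub> a X = r X \<cdot>\<^bsub>B\<^esub> sa (n X)" "mpb P (r X) (a X) (n X)"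
  using powerD[OF power[OF assms]] mpbD[OF powerD(1)[OF power[OF assms]]] by simp_all

lemma L_facts:
  assumes "k \<in> Arr E"
  shows "L k \<in> Arr E" "Dom E (L k) = Cod E (n (Dom E k))" "Cod E (L k) = Cod E (n (Cod E k))"
    "r (Cod E k) \<cdot>\<^bsub>B\<^esub> sa (L k) = r (Dom E k)"
  using L_transposes[OF assms] by (auto elim: transposesE)

context notes [simp] = sa_simps power_facts L_facts
begin

text \<open>Naturality of transposition in \<open>X\<close>: the evaluation squares that witness
  \<open>y\<close> and \<open>L k\<close> are composed.\<close>

lemma transposes_L:
  assumes c: "mpb P \<phi> \<alpha> c" and t: "transposes (r X) (a X) (n X) (e X) \<phi> \<alpha> c y g"
    and k[simp]: "k \<in> Arr E" "Dom E k = X" "Cod E k = X'"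
  shows "transposes (r X') (a X') (n X') (e X') \<phi> \<alpha> c (L k \<cdot>\<^bsub>E\<^esub> y) (k \<cdot>\<^bsub>E\<^esub> g)"
proof -
  have [simp]: "X \<in> Obj E" "X' \<in> Obj E" using k E.dom_in E.cod_in by metis+
  note [simp] = mpbD(4)[OF c]
  obtain k' where k': "k' \<in> Arr E" "Dom E k' = Dom E (n X)" "Cod E k' = Dom E (n X')" "n X' \<cdot>\<^bsub>E\<^esub> k' = L k \<cdot>\<^bsub>E\<^esub> n X"
    "a X' \<cdot>\<^bsub>B\<^esub> sa k' = a X" "e X' \<cdot>\<^bsub>E\<^esub> k' = k \<cdot>\<^bsub>E\<^esub> e X"
    using L_transposes[OF k(1)] by (auto elim: transposesE)
  obtain y' where y: "y \<in> Arr E" "Dom E y = Cod E c" "Cod E y = Cod E (n X)" "r X \<cdot>\<^bsub>B\<^esub> sa y = \<phi>"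
    "y' \<in> Arr E" "Dom E y' = Dom E c" "Cod E y' = Dom E (n X)" "n X \<cdot>\<^bsub>E\<^esub> y' = y \<cdot>\<^bsub>E\<^esub> c" "a X \<cdot>\<^bsub>B\<^esub> sa y' = \<alpha>" "e X \<cdot>\<^bsub>E\<^esub> y' = g"
    by (rule transposesE[OF t])
  have "r X' \<cdot>\<^bsub>B\<^esub> (sa (L k) \<cdot>\<^bsub>B\<^esub> sa y) = \<phi>"
    using B.precomp[OF L_facts(4)[OF k(1)], of "sa y"] y by simp
  then show ?thesis
    using k' y E.precomp[OF k'(4), of y'] B.precomp[OF k'(5), of "sa y'"] E.precomp[OF k'(6), of y']
    by (intro transposesI[where m' = "k' \<cdot>\<^bsub>E\<^esub> y'"]) simp_all
qed

lemma transposes_idt: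
  assumes "X \<in> Obj E"
  shows "transposes (r X) (a X) (n X) (e X) (r X) (a X) (n X) (Idt E (Cod E (n X))) (e X)"
  using assms by (intro transposesI[where m' = "Idt E (Dom E (n X))"]) simp_all

lemma L_idt:
  assumes "X \<in> Obj E"
  shows "L (Idt E X) = Idt E (Cod E (n X))"
  by (rule power_unique'[OF power[OF assms] power_facts(13)[OF assms], of "e X"])
    (use assms transposes_idt[OF assms] L_transposes[of "Idt E X"] in simp_all)

lemma L_cmp:
  assumes k[simp]: "k \<in> Arr E" "k' \<in> Arr E" "Dom E k' = Cod E k"
  shows "L (k' \<cdot>\<^bsub>E\<^esub> k) = L k' \<cdot>\<^bsub>E\<^esub> L k"
proof -
  note 1 = power[of "Cod E k'"] and 2 = power_facts(13)[of "Dom E k"]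
  show ?thesis
  proof (rule power_unique'[OF 1 2])
    show "transposes (r (Cod E k')) (a (Cod E k')) (n (Cod E k')) (e (Cod E k')) (r (Dom E k)) (a (Dom E k))
       (n (Dom E k)) (L (k' \<cdot>\<^bsub>E\<^esub> k)) (k' \<cdot>\<^bsub>E\<^esub> k \<cdot>\<^bsub>E\<^esub> e (Dom E k))"
      using L_transposes[of "k' \<cdot>\<^bsub>E\<^esub> k"] by simp
    show "transposes (r (Cod E k')) (a (Cod E k')) (n (Cod E k')) (e (Cod E k')) (r (Dom E k)) (a (Dom E k))
       (n (Dom E k)) (L k' \<cdot>\<^bsub>E\<^esub> L k) (k' \<cdot>\<^bsub>E\<^esub> k \<cdot>\<^bsub>E\<^esub> e (Dom E k))"
      using transposes_L[OF 2 L_transposes[OF k(1)] k(2,3) refl] by simp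
  qed simp_all
qed

end

end

text \<open>\<open>mpb_exists\<close> restricts an object of \<open>E\<close> along any
  \<open>v\<close>, and \<open>sa_mpb\<close> says that the functor preserves such restrictions, so
  a single pullback in \<open>E\<close> serves for transposing in both categories.\<close>

locale container_setting = categories_over E B so sa
  for E :: "('e, 'f) cat" and B :: "('b, 'g) cat" and so sa +
  assumes sa_mpb: "mpb v u t c \<Longrightarrow> D.mpb v u t (sa c)"
    and mpb_exists: "v \<in> Arr B \<Longrightarrow> u \<in> Arr B \<Longrightarrow> Cod B u = Cod B v \<Longrightarrow> Y \<in> Obj E \<Longrightarrow> Dom B u = so Y \<Longrightarrow>
      \<exists>t c. mpb v u t c \<and> Cod E c = Y"

section \<open>Recursion along an initial object of trees\<close>

text \<open>The functor carries the powers of \<open>E\<close> strictly to those of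
  \<open>B\<close>: the shapes of \<open>X \<star> P\<close> are the power of the shapes of
  \<open>X\<close>. Strictness is what allows both powers to share \<open>r\<close> and
  \<open>a\<close>.\<close>

locale two_powers = container_setting E B so sa +
    D: power_functor B B "\<lambda>x. x" "\<lambda>x. x" P r a n e LB +
    power_functor E B so sa P "\<lambda>X. r (so X)" "\<lambda>X. a (so X)" nE eE LE
  for E :: "('e, 'f) cat" and B :: "('b, 'g) cat" and so sa and P r a n e LB nE eE LE +
  assumes sa_nE: "X \<in> Obj E \<Longrightarrow> sa (nE X) = n (so X)"
    and sa_eE: "X \<in> Obj E \<Longrightarrow> sa (eE X) = e (so X)"
    and sa_LE: "k \<in> Arr E \<Longrightarrow> sa (LE k) = LB (sa k)"
begin

context notes [simp] = sa_simps power_facts D.power_facts L_facts D.L_facts sa_nE sa_eE sa_LE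
begin

lemma sa_Dom[simp]: "X \<in> Obj E \<Longrightarrow> so (Dom E (nE X)) = Dom B (n (so X))"
  and sa_Cod[simp]: "X \<in> Obj E \<Longrightarrow> so (Cod E (nE X)) = Cod B (n (so X))"
  using sa_nE[of X] power_facts(4)[of X] dom_sa[of "nE X"] cod_sa[of "nE X"] by simp_all

lemma transposes_sa:
  assumes X[simp]: "X \<in> Obj E" and c: "mpb P \<phi> \<alpha> c"
    and t: "transposes (r (so X)) (a (so X)) (nE X) (eE X) \<phi> \<alpha> c y g"
  shows "D.transposes (r (so X)) (a (so X)) (n (so X)) (e (so X)) \<phi> \<alpha> (sa c) (sa y) (sa g)"
proof -
  note [simp] = mpbD(4)[OF c]
  obtain y' where y: "y \<in> Arr E" "Dom E y = Cod E c" "Cod E y = Cod E (nE X)" "r (so X) \<cdot>\<^bsub>B\<^esub> sa y = \<phi>"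
    "y' \<in> Arr E" "Dom E y' = Dom E c" "Cod E y' = Dom E (nE X)" "nE X \<cdot>\<^bsub>E\<^esub> y' = y \<cdot>\<^bsub>E\<^esub> c"
     "a (so X) \<cdot>\<^bsub>B\<^esub> sa y' = \<alpha>" "eE X \<cdot>\<^bsub>E\<^esub> y' = g"
    by (rule transposesE[OF t])
  have "sa (nE X \<cdot>\<^bsub>E\<^esub> y') = n (so X) \<cdot>\<^bsub>B\<^esub> sa y'" "sa (eE X \<cdot>\<^bsub>E\<^esub> y') = e (so X) \<cdot>\<^bsub>B\<^esub> sa y'"
    using y(1-7) by simp_all
  then show ?thesis
    using y(1-7,9) unfolding y(8,10) by (intro D.transposesI[where m' = "sa y'"]) simp_all
qed

text \<open>Powers are defined by maps into them, so they commute with pullbacks: a pair of maps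
  into the powers is uncurried, lifted through the given pullback, and curried again.\<close>

lemma L_preserves_mpb:
  assumes c: "mpb v u t c"
  shows "mpb (LB v) (LB u) (LB t) (LE c)"
proof -
  note d[simp] = mpbD(1-8)[OF c]
  define V W G G' where "V = Dom B v" and "W = Cod B v" and "G = Cod E c" and "G' = Dom E c"
  have o[simp]: "V \<in> Obj B" "W \<in> Obj B" "G \<in> Obj E" "G' \<in> Obj E"
    by (simp_all add: V_def W_def G_def G'_def)
  have f[simp]: "Dom B v = V" "Cod B v = W" "Cod E c = G" "Dom E c = G'" "Dom B u = so G" "Cod B u = W"
    "Dom B t = so G'" "Cod B t = V"
    by (simp_all add: V_def W_def G_def G'_def)
  have vt: "v \<cdot>\<^bsub>B\<^esub> t = u \<cdot>\<^bsub>B\<^esub> sa c" by (rule mpbD[OF c])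
  note R[simp] = D.L_facts(4)[of v, simplified] D.L_facts(4)[of u, simplified] D.L_facts(4)[of t, simplified]
  note R'[simp] = B.precomp[OF R(1)] B.precomp[OF R(2)] B.precomp[OF R(3)]
  show ?thesis
  proof (intro mpbI)
    have "LB (v \<cdot>\<^bsub>B\<^esub> t) = LB v \<cdot>\<^bsub>B\<^esub> LB t" "LB (u \<cdot>\<^bsub>B\<^esub> sa c) = LB u \<cdot>\<^bsub>B\<^esub> LB (sa c)"
      by (simp_all add: D.L_cmp)
    then show "LB v \<cdot>\<^bsub>B\<^esub> LB t = LB u \<cdot>\<^bsub>B\<^esub> sa (LE c)"
      using vt by simp
  next
    fix y s
    assume a[simp]: "y \<in> Arr E" "s \<in> Arr B" and "Cod E y = Cod E (LE c)"
      and a1[simp]: "Dom B s = so (Dom E y)"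
      and "Cod B s = Dom B (LB v)" and eq: "LB v \<cdot>\<^bsub>B\<^esub> s = LB u \<cdot>\<^bsub>B\<^esub> sa y"
    then have a2[simp]: "Cod E y = Cod E (nE G)" "Cod B s = Cod B (n V)" by simp_all
    have ry: "r (so G) \<cdot>\<^bsub>B\<^esub> sa y = r V \<cdot>\<^bsub>B\<^esub> s"
      using R'(1)[of s] R'(2)[of "sa y"] eq by simp
    \<comment> \<open>\<open>y\<close> and \<open>s\<close> lie over the same arrow to
      \<open>Cod B P\<close>, so one pullback \<open>cY\<close> uncurries both; by
      \<open>sa_mpb\<close> its image is a pullback in \<open>B\<close> as well.\<close>
    obtain \<alpha> cY where cY: "mpb P (r V \<cdot>\<^bsub>B\<^esub> s) \<alpha> cY" and cY1[simp]: "Cod E cY = Dom E y"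
      using mpb_exists[of P "r V \<cdot>\<^bsub>B\<^esub> s" "Dom E y"] by auto
    have cY2[simp]: "cY \<in> Arr E" by (rule mpbD[OF cY])
    obtain g where g: "transposes (r (so G)) (a (so G)) (nE G) (eE G) (r V \<cdot>\<^bsub>B\<^esub> s) \<alpha> cY y g"
        and [simp]: "g \<in> Arr E" "Dom E g = Dom E cY" "Cod E g = G"
      by (rule transposes_ex[OF power cY, of G y]) (simp_all add: ry)
    obtain \<sigma> where \<sigma>: "D.transposes (r V) (a V) (n V) (e V) (r V \<cdot>\<^bsub>B\<^esub> s) \<alpha> (sa cY) s \<sigma>"
      and [simp]: "\<sigma> \<in> Arr B" "Dom B \<sigma> = so (Dom E cY)" "Cod B \<sigma> = V"
      by (rule D.transposes_ex[OF D.power sa_mpb[OF cY], of V s]) simp_all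
    have 1: "D.transposes (r W) (a W) (n W) (e W) (r V \<cdot>\<^bsub>B\<^esub> s) \<alpha> (sa cY) (LB v \<cdot>\<^bsub>B\<^esub> s) (v \<cdot>\<^bsub>B\<^esub> \<sigma>)"
      by (rule D.transposes_L[OF sa_mpb[OF cY] \<sigma>]) simp_all
    have 2: "D.transposes (r W) (a W) (n W) (e W) (r V \<cdot>\<^bsub>B\<^esub> s) \<alpha> (sa cY) (LB u \<cdot>\<^bsub>B\<^esub> sa y) (u \<cdot>\<^bsub>B\<^esub> sa g)"
      by (rule D.transposes_L[OF sa_mpb[OF cY] transposes_sa[OF o(3) cY g]]) simp_all
    have vs: "v \<cdot>\<^bsub>B\<^esub> \<sigma> = u \<cdot>\<^bsub>B\<^esub> sa g"
      by (rule D.transposes_determines[OF D.power[OF o(2)] _ 1]) (use 2 eq in simp_all)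
    \<comment> \<open>The lift exists among the uncurried arrows; its transpose is the required
      \<open>z\<close>.\<close>
    obtain z' where z'[simp]: "z' \<in> Arr E" "Dom E z' = Dom E cY" "Cod E z' = G'" and z'2: "c \<cdot>\<^bsub>E\<^esub> z' = g" "t \<cdot>\<^bsub>B\<^esub> sa z' = \<sigma>"
      by (rule mpb_lift[OF c, of g \<sigma>]) (use vs in simp_all)
    obtain z where z: "transposes (r (so G')) (a (so G')) (nE G') (eE G') (r V \<cdot>\<^bsub>B\<^esub> s) \<alpha> cY z z'"
      using ex1_implies_ex[OF power_ex1[OF power[OF o(4)] cY, of z']] by auto
    then have zz[simp]: "z \<in> Arr E" "Dom E z = Dom E y" "Cod E z = Cod E (nE G')"
      by (auto elim: transposesE)
    have "transposes (r (so G)) (a (so G)) (nE G) (eE G) (r V \<cdot>\<^bsub>B\<^esub> s) \<alpha> cY (LE c \<cdot>\<^bsub>E\<^esub> z) (c \<cdot>\<^bsub>E\<^esub> z')"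
      by (rule transposes_L[OF cY z]) simp_all
    then have "LE c \<cdot>\<^bsub>E\<^esub> z = y"
      by (intro power_unique'[OF power[OF o(3)] cY _ _ _ _ g]) (simp_all add: z'2)
    moreover have "D.transposes (r V) (a V) (n V) (e V) (r V \<cdot>\<^bsub>B\<^esub> s) \<alpha> (sa cY) (LB t \<cdot>\<^bsub>B\<^esub> sa z) (t \<cdot>\<^bsub>B\<^esub> sa z')"
      by (rule D.transposes_L[OF sa_mpb[OF cY] transposes_sa[OF o(4) cY z]]) simp_all
    then have "LB t \<cdot>\<^bsub>B\<^esub> sa z = s"
      by (intro D.power_unique'[OF D.power[OF o(1)] sa_mpb[OF cY] _ _ _ _ \<sigma>]) (simp_all add: z'2)
    ultimately show "\<exists>z. z \<in> Arr E \<and> Dom E z = Dom E y \<and> Cod E z = Dom E (LE c) \<and> LE c \<cdot>\<^bsub>E\<^esub> z = y \<and> LB t \<cdot>\<^bsub>B\<^esub> sa z = s"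
      by (intro exI[of _ z]) simp
  next
    fix z1 z2
    assume a[simp]: "z1 \<in> Arr E" "z2 \<in> Arr E" "Dom E z1 = Dom E z2" and "Cod E z1 = Dom E (LE c)" "Cod E z2 = Dom E (LE c)"
      and c12: "LE c \<cdot>\<^bsub>E\<^esub> z1 = LE c \<cdot>\<^bsub>E\<^esub> z2" and t12: "LB t \<cdot>\<^bsub>B\<^esub> sa z1 = LB t \<cdot>\<^bsub>B\<^esub> sa z2"
    then have [simp]: "Cod E z1 = Cod E (nE G')" "Cod E z2 = Cod E (nE G')" by simp_all
    define \<phi> where "\<phi> = r (so G') \<cdot>\<^bsub>B\<^esub> sa z1"
    have \<phi>2: "r (so G') \<cdot>\<^bsub>B\<^esub> sa z2 = \<phi>"
      using R'(3)[of "sa z1"] R'(3)[of "sa z2"] t12 by (simp add: \<phi>_def)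
    have [simp]: "\<phi> \<in> Arr B" "Dom B \<phi> = so (Dom E z2)" "Cod B \<phi> = Cod B P"
      by (simp_all add: \<phi>_def)
    obtain \<alpha> cY where cY: "mpb P \<phi> \<alpha> cY" and cY1[simp]: "Cod E cY = Dom E z2"
      using mpb_exists[of P \<phi> "Dom E z2"] by auto
    have cY2[simp]: "cY \<in> Arr E" by (rule mpbD[OF cY])
    obtain g1 where g1: "transposes (r (so G')) (a (so G')) (nE G') (eE G') \<phi> \<alpha> cY z1 g1"
        and [simp]: "g1 \<in> Arr E" "Dom E g1 = Dom E cY" "Cod E g1 = G'"
      by (rule transposes_ex[OF power cY, of G' z1]) (simp_all add: \<phi>_def)
    obtain g2 where g2: "transposes (r (so G')) (a (so G')) (nE G') (eE G') \<phi> \<alpha> cY z2 g2"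
        and [simp]: "g2 \<in> Arr E" "Dom E g2 = Dom E cY" "Cod E g2 = G'"
      by (rule transposes_ex[OF power cY, of G' z2]) (simp_all add: \<phi>2)
    have "transposes (r (so G)) (a (so G)) (nE G) (eE G) \<phi> \<alpha> cY (LE c \<cdot>\<^bsub>E\<^esub> z1) (c \<cdot>\<^bsub>E\<^esub> g1)"
      by (rule transposes_L[OF cY g1]) simp_all
    moreover have "transposes (r (so G)) (a (so G)) (nE G) (eE G) \<phi> \<alpha> cY (LE c \<cdot>\<^bsub>E\<^esub> z2) (c \<cdot>\<^bsub>E\<^esub> g2)"
      by (rule transposes_L[OF cY g2]) simp_all
    ultimately have cg: "c \<cdot>\<^bsub>E\<^esub> g1 = c \<cdot>\<^bsub>E\<^esub> g2"
      unfolding c12 by (rule transposes_determines[OF power[OF o(3)] cY2])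
    have "D.transposes (r V) (a V) (n V) (e V) \<phi> \<alpha> (sa cY) (LB t \<cdot>\<^bsub>B\<^esub> sa z1) (t \<cdot>\<^bsub>B\<^esub> sa g1)"
      by (rule D.transposes_L[OF sa_mpb[OF cY] transposes_sa[OF o(4) cY g1]]) simp_all
    moreover have "D.transposes (r V) (a V) (n V) (e V) \<phi> \<alpha> (sa cY) (LB t \<cdot>\<^bsub>B\<^esub> sa z2) (t \<cdot>\<^bsub>B\<^esub> sa g2)"
      by (rule D.transposes_L[OF sa_mpb[OF cY] transposes_sa[OF o(4) cY g2]]) simp_all
    ultimately have tg: "t \<cdot>\<^bsub>B\<^esub> sa g1 = t \<cdot>\<^bsub>B\<^esub> sa g2"
      unfolding t12 by (intro D.transposes_determines[OF D.power[OF o(1)], of "sa cY"]) simp_all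
    have "g1 = g2"
      by (rule mpb_unique[OF c]) (use cg tg in simp_all)
    then show "z1 = z2"
      using g1 g2 by (intro power_unique'[OF power[OF o(4)] cY, of g2]) simp_all
  qed simp_all
qed


text \<open>By \<open>cl\<close>, arrows from \<open>G\<close> to \<open>X\<close> correspond to
  sections of \<open>h\<close>. The arrows \<open>q'\<close> and \<open>p'\<close> make
  \<open>H\<close> an algebra for the functor of \<open>W\<close>, and the compatible arrows are
  those whose section is a morphism of algebras. Initiality gives exactly one morphism
  \<open>k\<close>; it is a section because \<open>h \<cdot> k\<close> is an algebra endomorphism of
  \<open>W\<close>.\<close>

lemma recursion:
  assumes c1: "mpb e0 u b q" and Q: "Dom E q = Q" "Cod E q = G" "Dom B e0 = T"
    and c2: "mpb m0 u (LB u) p" and p: "Dom E p = Cod E (nE G)" "Cod E p = G"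
    and W: "Cod B u = W"
    and init: "\<And>Y b0 b1. b0 \<in> hom B T Y \<Longrightarrow> b1 \<in> hom B (Cod B (n Y)) Y \<Longrightarrow>
      \<exists>!k. k \<in> hom B W Y \<and> k \<cdot>\<^bsub>B\<^esub> e0 = b0 \<and> k \<cdot>\<^bsub>B\<^esub> m0 = b1 \<cdot>\<^bsub>B\<^esub> LB k"
    and cl: "classifies u G X h tH cH \<chi>"
    and q': "q' \<in> hom E Q X" and p': "p' \<in> hom E (Cod E (nE X)) X"
  shows "\<exists>!\<theta>. \<theta> \<in> hom E G X \<and> \<theta> \<cdot>\<^bsub>E\<^esub> q = q' \<and> \<theta> \<cdot>\<^bsub>E\<^esub> p = p' \<cdot>\<^bsub>E\<^esub> LE \<theta>"
proof -
  define H where "H = Dom B h"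
  define GH where "GH = Dom E cH"
  have \<chi>: "\<chi> \<in> Arr E" "Dom E \<chi> = GH" "Cod E \<chi> = X" "mpb h u tH cH" and [simp]: "Cod E cH = G"
    using cl by (auto simp: classifies_def GH_def)
  note [simp] = Q p W \<chi>(1-3) H_def[symmetric] GH_def[symmetric]
  have [simp]: "q \<in> Arr E" "p \<in> Arr E" "e0 \<in> Arr B" "m0 \<in> Arr B" "u \<in> Arr B" "b \<in> Arr B"
    using mpbD[OF c1] mpbD[OF c2] by simp_all
  have [simp]: "G \<in> Obj E" using E.cod_in[of p] by simp
  have [simp]: "Dom B u = so G" using mpbD[OF c1] by simp
  have o[simp]: "X \<in> Obj E" using E.cod_in[of \<chi>] by simp
  have [simp]: "W \<in> Obj B" using B.cod_in[of u] by simp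
  have [simp]: "T \<in> Obj B" using B.dom_in[of e0] by simp
  have [simp]: "Cod B e0 = W" "Cod B m0 = W" "Dom B b = so Q" "Cod B b = T"
    using mpbD(5-8)[OF c1] mpbD(5-8)[OF c2] by simp_all
  have [simp]: "Dom B m0 = Cod B (n W)"
    using mpbD(7)[OF c2] D.L_facts(3)[of u] by simp
  have [simp]: "h \<in> Arr B" "tH \<in> Arr B" "cH \<in> Arr E" "Cod B h = W" "Dom B tH = so GH" "Cod B tH = H"
    using mpbD(1-8)[OF \<chi>(4)] by simp_all
  have [simp]: "GH \<in> Obj E" using E.dom_in[of cH] by simp
  have [simp]: "H \<in> Obj B" using B.dom_in[of h] by simp
  have [simp]: "q' \<in> Arr E" "Dom E q' = Q" "Cod E q' = X" "p' \<in> Arr E" "Dom E p' = Cod E (nE X)" "Cod E p' = X"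
    using q' p' by (auto simp: E.hom_iff)
  have e0b: "e0 \<cdot>\<^bsub>B\<^esub> b = u \<cdot>\<^bsub>B\<^esub> sa q" and m0u: "m0 \<cdot>\<^bsub>B\<^esub> LB u = u \<cdot>\<^bsub>B\<^esub> sa p"
    and hH: "h \<cdot>\<^bsub>B\<^esub> tH = u \<cdot>\<^bsub>B\<^esub> sa cH"
    using mpbD(9)[OF c1] mpbD(9)[OF c2] mpbD(9)[OF \<chi>(4)] by simp_all

  \<comment> \<open>The leaf operation on \<open>H\<close>: over \<open>e0\<close> the fibre of
    \<open>G\<close> is \<open>Q\<close>, and \<open>q'\<close> is an arrow from it to
    \<open>X\<close>.\<close>
  obtain eH \<epsilon> where eH[simp]: "eH \<in> Arr B" "Dom B eH = T" "Cod B eH = H" and heH: "h \<cdot>\<^bsub>B\<^esub> eH = e0"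
    and \<epsilon>[simp]: "\<epsilon> \<in> Arr E" "Dom E \<epsilon> = Q" "Cod E \<epsilon> = GH"
    and \<epsilon>2: "cH \<cdot>\<^bsub>E\<^esub> \<epsilon> = q" "tH \<cdot>\<^bsub>B\<^esub> sa \<epsilon> = eH \<cdot>\<^bsub>B\<^esub> b" "\<chi> \<cdot>\<^bsub>E\<^esub> \<epsilon> = q'"
    by (rule classifies_ex[OF cl c1, of q']) simp_all

  \<comment> \<open>The node operation on \<open>H\<close>: over a node whose subtrees carry points
    of \<open>H\<close>, the fibre of \<open>G\<close> is the power of the universal fibre
    \<open>GH\<close>. \<open>LE \<chi>\<close> applies those points at the subtrees and
    \<open>p'\<close> collects the results.\<close>
  have c3: "mpb (m0 \<cdot>\<^bsub>B\<^esub> LB h) u (LB tH) (p \<cdot>\<^bsub>E\<^esub> LE cH)"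
    by (rule mpb_comp[OF c2 L_preserves_mpb[OF \<chi>(4)]]) simp
  obtain mH \<mu> where mH[simp]: "mH \<in> Arr B" "Dom B mH = Cod B (n H)" "Cod B mH = H" and hmH: "h \<cdot>\<^bsub>B\<^esub> mH = m0 \<cdot>\<^bsub>B\<^esub> LB h"
    and \<mu>[simp]: "\<mu> \<in> Arr E" "Dom E \<mu> = Cod E (nE GH)" "Cod E \<mu> = GH"
    and \<mu>2: "cH \<cdot>\<^bsub>E\<^esub> \<mu> = p \<cdot>\<^bsub>E\<^esub> LE cH" "tH \<cdot>\<^bsub>B\<^esub> sa \<mu> = mH \<cdot>\<^bsub>B\<^esub> LB tH" "\<chi> \<cdot>\<^bsub>E\<^esub> \<mu> = p' \<cdot>\<^bsub>E\<^esub> LE \<chi>"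
    by (rule classifies_ex[OF cl c3, of "p' \<cdot>\<^bsub>E\<^esub> LE \<chi>"]) simp_all

  have init_id: "k = Idt B W" if "k \<in> hom B W W" "k \<cdot>\<^bsub>B\<^esub> e0 = e0" "k \<cdot>\<^bsub>B\<^esub> m0 = m0 \<cdot>\<^bsub>B\<^esub> LB k" for k
  proof -
    have "\<exists>!k. k \<in> hom B W W \<and> k \<cdot>\<^bsub>B\<^esub> e0 = e0 \<and> k \<cdot>\<^bsub>B\<^esub> m0 = m0 \<cdot>\<^bsub>B\<^esub> LB k"
      by (rule init) (simp_all add: B.hom_iff)
    moreover have "Idt B W \<in> hom B W W \<and> Idt B W \<cdot>\<^bsub>B\<^esub> e0 = e0 \<and> Idt B W \<cdot>\<^bsub>B\<^esub> m0 = m0 \<cdot>\<^bsub>B\<^esub> LB (Idt B W)"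
      by (simp add: B.hom_iff D.L_idt)
    ultimately show ?thesis
      using that by (elim ex1E) metis
  qed
  have ex1: "\<exists>!k. k \<in> hom B W H \<and> k \<cdot>\<^bsub>B\<^esub> e0 = eH \<and> k \<cdot>\<^bsub>B\<^esub> m0 = mH \<cdot>\<^bsub>B\<^esub> LB k"
    by (rule init) (simp_all add: B.hom_iff)
  then obtain k where k0: "k \<in> hom B W H" and k: "k \<cdot>\<^bsub>B\<^esub> e0 = eH" "k \<cdot>\<^bsub>B\<^esub> m0 = mH \<cdot>\<^bsub>B\<^esub> LB k"
    by (elim ex1E conjE)
  have [simp]: "k \<in> Arr B" "Dom B k = W" "Cod B k = H" using k0 by (auto simp: B.hom_iff)
  have hk: "h \<cdot>\<^bsub>B\<^esub> k = Idt B W"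
  proof (rule init_id)
    show "h \<cdot>\<^bsub>B\<^esub> k \<in> hom B W W" by (simp add: B.hom_iff)
    show "(h \<cdot>\<^bsub>B\<^esub> k) \<cdot>\<^bsub>B\<^esub> e0 = e0" using k heH by simp
    show "(h \<cdot>\<^bsub>B\<^esub> k) \<cdot>\<^bsub>B\<^esub> m0 = m0 \<cdot>\<^bsub>B\<^esub> LB (h \<cdot>\<^bsub>B\<^esub> k)"
      using k(2) B.precomp[OF hmH, of "LB k"] by (simp add: D.L_cmp)
  qed
  \<comment> \<open>Over the identity of \<open>W\<close> the fibre of \<open>G\<close> is
    \<open>G\<close> itself, so sections of \<open>h\<close> classify arrows from \<open>G\<close>
    to \<open>X\<close>.\<close>
  have id: "mpb (Idt B W) u u (Idt E G)"
    using mpb_idt[of u G] by simp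
  obtain \<kappa> where \<kappa>[simp]: "\<kappa> \<in> Arr E" "Dom E \<kappa> = G" "Cod E \<kappa> = GH" and \<kappa>2: "cH \<cdot>\<^bsub>E\<^esub> \<kappa> = Idt E G" "tH \<cdot>\<^bsub>B\<^esub> sa \<kappa> = k \<cdot>\<^bsub>B\<^esub> u"
    by (rule mpb_lift[OF \<chi>(4), of "Idt E G" "k \<cdot>\<^bsub>B\<^esub> u"]) (use B.precomp[OF hk, of u] in simp_all)

  \<comment> \<open>Stated for an arbitrary section \<open>k'\<close> with its lift \<kappa>':
    existence needs it for the recursively defined \<open>k\<close>, uniqueness for the section of a
    competing \<theta>'.\<close>
  have along_q: "tH \<cdot>\<^bsub>B\<^esub> sa (\<kappa>' \<cdot>\<^bsub>E\<^esub> q) = (k' \<cdot>\<^bsub>B\<^esub> e0) \<cdot>\<^bsub>B\<^esub> b" "cH \<cdot>\<^bsub>E\<^esub> \<kappa>' \<cdot>\<^bsub>E\<^esub> q = q"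
    and along_p: "tH \<cdot>\<^bsub>B\<^esub> sa (\<kappa>' \<cdot>\<^bsub>E\<^esub> p) = (k' \<cdot>\<^bsub>B\<^esub> m0) \<cdot>\<^bsub>B\<^esub> LB u" "cH \<cdot>\<^bsub>E\<^esub> \<kappa>' \<cdot>\<^bsub>E\<^esub> p = p"
    and along_\<mu>: "tH \<cdot>\<^bsub>B\<^esub> sa (\<mu> \<cdot>\<^bsub>E\<^esub> LE \<kappa>') = (mH \<cdot>\<^bsub>B\<^esub> LB k') \<cdot>\<^bsub>B\<^esub> LB u" "cH \<cdot>\<^bsub>E\<^esub> \<mu> \<cdot>\<^bsub>E\<^esub> LE \<kappa>' = p"
      "\<chi> \<cdot>\<^bsub>E\<^esub> \<mu> \<cdot>\<^bsub>E\<^esub> LE \<kappa>' = p' \<cdot>\<^bsub>E\<^esub> LE (\<chi> \<cdot>\<^bsub>E\<^esub> \<kappa>')"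
    if [simp]: "\<kappa>' \<in> Arr E" "Dom E \<kappa>' = G" "Cod E \<kappa>' = GH" "k' \<in> Arr B" "Dom B k' = W" "Cod B k' = H" and
      \<kappa>': "cH \<cdot>\<^bsub>E\<^esub> \<kappa>' = Idt E G" "tH \<cdot>\<^bsub>B\<^esub> sa \<kappa>' = k' \<cdot>\<^bsub>B\<^esub> u" for \<kappa>' k'
  proof -
    show "tH \<cdot>\<^bsub>B\<^esub> sa (\<kappa>' \<cdot>\<^bsub>E\<^esub> q) = (k' \<cdot>\<^bsub>B\<^esub> e0) \<cdot>\<^bsub>B\<^esub> b" "cH \<cdot>\<^bsub>E\<^esub> \<kappa>' \<cdot>\<^bsub>E\<^esub> q = q"
       "tH \<cdot>\<^bsub>B\<^esub> sa (\<kappa>' \<cdot>\<^bsub>E\<^esub> p) = (k' \<cdot>\<^bsub>B\<^esub> m0) \<cdot>\<^bsub>B\<^esub> LB u" "cH \<cdot>\<^bsub>E\<^esub> \<kappa>' \<cdot>\<^bsub>E\<^esub> p = p"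
      using B.precomp[OF \<kappa>'(2), of "sa q"] E.precomp[OF \<kappa>'(1), of q] B.precomp[OF \<kappa>'(2), of "sa p"]
        E.precomp[OF \<kappa>'(1), of p] e0b m0u by simp_all
    have "LB tH \<cdot>\<^bsub>B\<^esub> LB (sa \<kappa>') = LB k' \<cdot>\<^bsub>B\<^esub> LB u"
      using arg_cong[OF \<kappa>'(2), of LB] by (simp add: D.L_cmp)
    then show "tH \<cdot>\<^bsub>B\<^esub> sa (\<mu> \<cdot>\<^bsub>E\<^esub> LE \<kappa>') = (mH \<cdot>\<^bsub>B\<^esub> LB k') \<cdot>\<^bsub>B\<^esub> LB u"
      using B.precomp[OF \<mu>2(2), of "LB (sa \<kappa>')"] by simp
    have "LE cH \<cdot>\<^bsub>E\<^esub> LE \<kappa>' = Idt E (Cod E (nE G))"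
      using arg_cong[OF \<kappa>'(1), of LE] by (simp add: L_cmp L_idt)
    then show "cH \<cdot>\<^bsub>E\<^esub> \<mu> \<cdot>\<^bsub>E\<^esub> LE \<kappa>' = p"
      using E.precomp[OF \<mu>2(1), of "LE \<kappa>'"] by simp
    show "\<chi> \<cdot>\<^bsub>E\<^esub> \<mu> \<cdot>\<^bsub>E\<^esub> LE \<kappa>' = p' \<cdot>\<^bsub>E\<^esub> LE (\<chi> \<cdot>\<^bsub>E\<^esub> \<kappa>')"
      using E.precomp[OF \<mu>2(3), of "LE \<kappa>'"] by (simp add: L_cmp)
  qed
  note aq = along_q[OF \<kappa> _ _ _ \<kappa>2] and ap = along_p[OF \<kappa> _ _ _ \<kappa>2] and am = along_\<mu>[OF \<kappa> _ _ _ \<kappa>2]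
  define \<theta> where "\<theta> = \<chi> \<cdot>\<^bsub>E\<^esub> \<kappa>"
  have "\<kappa> \<cdot>\<^bsub>E\<^esub> q = \<epsilon>"
    by (rule mpb_unique[OF \<chi>(4)]) (use aq \<epsilon>2 k in simp_all)
  then have 1: "\<theta> \<cdot>\<^bsub>E\<^esub> q = q'"
    using \<epsilon>2 by (simp add: \<theta>_def)
  have "\<kappa> \<cdot>\<^bsub>E\<^esub> p = \<mu> \<cdot>\<^bsub>E\<^esub> LE \<kappa>"
    by (rule mpb_unique[OF \<chi>(4)]) (use ap am k in simp_all)
  then have 2: "\<theta> \<cdot>\<^bsub>E\<^esub> p = p' \<cdot>\<^bsub>E\<^esub> LE \<theta>"
    using am by (simp add: \<theta>_def)
  show ?thesis
  proof (rule ex1I[of _ \<theta>])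
    show "\<theta> \<in> hom E G X \<and> \<theta> \<cdot>\<^bsub>E\<^esub> q = q' \<and> \<theta> \<cdot>\<^bsub>E\<^esub> p = p' \<cdot>\<^bsub>E\<^esub> LE \<theta>"
      using 1 2 by (simp add: E.hom_iff \<theta>_def)
    fix \<theta>'
    assume "\<theta>' \<in> hom E G X \<and> \<theta>' \<cdot>\<^bsub>E\<^esub> q = q' \<and> \<theta>' \<cdot>\<^bsub>E\<^esub> p = p' \<cdot>\<^bsub>E\<^esub> LE \<theta>'"
    then have t[simp]: "\<theta>' \<in> Arr E" "Dom E \<theta>' = G" "Cod E \<theta>' = X" and \<theta>q: "\<theta>' \<cdot>\<^bsub>E\<^esub> q = q'"
      and \<theta>p: "\<theta>' \<cdot>\<^bsub>E\<^esub> p = p' \<cdot>\<^bsub>E\<^esub> LE \<theta>'"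
      by (auto simp: E.hom_iff)
    \<comment> \<open>A competing solution is itself a section. The two comparisons below show that
      it respects \<open>eH\<close> and \<open>mH\<close>, so it coincides with
      \<open>k\<close>.\<close>
    obtain k' \<kappa>' where k'[simp]: "k' \<in> Arr B" "Dom B k' = W" "Cod B k' = H" and hk': "h \<cdot>\<^bsub>B\<^esub> k' = Idt B W"
      and \<kappa>'[simp]: "\<kappa>' \<in> Arr E" "Dom E \<kappa>' = G" "Cod E \<kappa>' = GH"
      and \<kappa>'2: "cH \<cdot>\<^bsub>E\<^esub> \<kappa>' = Idt E G" "tH \<cdot>\<^bsub>B\<^esub> sa \<kappa>' = k' \<cdot>\<^bsub>B\<^esub> u" and \<chi>\<kappa>: "\<chi> \<cdot>\<^bsub>E\<^esub> \<kappa>' = \<theta>'"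
      by (rule classifies_ex[OF cl id, of \<theta>']) simp_all
    note aq = along_q[OF \<kappa>' k' \<kappa>'2] and ap = along_p[OF \<kappa>' k' \<kappa>'2] and am = along_\<mu>[OF \<kappa>' k' \<kappa>'2]
    have "k' \<cdot>\<^bsub>B\<^esub> e0 = eH"
      by (rule classifies_unique[OF cl c1, of _ "\<kappa>' \<cdot>\<^bsub>E\<^esub> q" _ \<epsilon>])
        (use aq \<epsilon>2 heH \<theta>q E.precomp[OF \<chi>\<kappa>, of q] B.precomp[OF hk', of e0] in simp_all)
    moreover have "k' \<cdot>\<^bsub>B\<^esub> m0 = mH \<cdot>\<^bsub>B\<^esub> LB k'"
    proof (rule classifies_unique[OF cl c2, of _ "\<kappa>' \<cdot>\<^bsub>E\<^esub> p" _ "\<mu> \<cdot>\<^bsub>E\<^esub> LE \<kappa>'"])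
      have "LB h \<cdot>\<^bsub>B\<^esub> LB k' = Idt B (Cod B (n W))"
        using arg_cong[OF hk', of LB] by (simp add: D.L_cmp D.L_idt)
      then show "h \<cdot>\<^bsub>B\<^esub> (mH \<cdot>\<^bsub>B\<^esub> LB k') = m0"
        using B.precomp[OF hmH, of "LB k'"] by simp
    qed (use ap am \<theta>p \<chi>\<kappa> E.precomp[OF \<chi>\<kappa>, of p] B.precomp[OF hk', of m0] in simp_all)
    ultimately have "k' = k"
      using ex1 k0 k by (elim ex1E) (metis B.hom_iff k')
    then have "\<kappa>' = \<kappa>"
      by - (rule mpb_unique[OF \<chi>(4)], use \<kappa>2 \<kappa>'2 in simp_all)
    then show "\<theta>' = \<theta>"
      using \<chi>\<kappa> by (simp add: \<theta>_def)
  qed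
qed

end

end

section \<open>Restricting a power by paths to leaves and nodes\<close>

context two_powers
begin

context notes [simp] = sa_simps power_facts D.power_facts L_facts D.L_facts sa_nE sa_eE sa_LE sa_Dom sa_Cod
begin

text \<open>By \<open>sq\<close> the fibre of \<open>Dd\<close> over \<open>e0\<close> is a point,
  and the power of \<open>Q\<close> by a point is \<open>Q\<close>.\<close>

lemma power_restricts_leaf:
  assumes pow: "is_power Dd Q u a' n' \<epsilon>" and G: "Cod E n' = G"
    and sq: "D.mpb Dd e0 e1 (Idt B T)" and T: "is_terminal B T" and Q: "Q \<in> Obj E"
  obtains b q where "mpb e0 u b q" "Dom E q = Q" "Cod E q = G"
proof -
  have T'[simp]: "T \<in> Obj B" and Tex: "\<And>Y. Y \<in> Obj B \<Longrightarrow> \<exists>!f. f \<in> hom B Y T"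
    using T by (auto simp: is_terminal_def)
  have Tu: "f = g" if "f \<in> Arr B" "g \<in> Arr B" "Dom B f = Dom B g" "Cod B f = T" "Cod B g = T" for f g
    using Tex[of "Dom B f"] that by (auto simp: B.hom_iff)
  note [simp] = D.mpbD(1,2,3)[OF sq] Q
  have s[simp]: "Cod B e0 = Cod B Dd" "Dom B e0 = T" "Dom B e1 = T" "Cod B e1 = Dom B Dd" and e1: "Dd \<cdot>\<^bsub>B\<^esub> e1 = e0"
    using D.mpbD(5-9)[OF sq] by simp_all
  \<comment> \<open>Since the fibre is a point, pulling \<open>Dd\<close> back along any arrow that
    factors through \<open>e0\<close> gives an identity.\<close>
  have M: "mpb Dd (e0 \<cdot>\<^bsub>B\<^esub> b) (e1 \<cdot>\<^bsub>B\<^esub> b) (Idt E Y)"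
    if "b \<in> Arr B" "Dom B b = so Y" "Cod B b = T" "Y \<in> Obj E" for b Y
    using mpb_paste[OF sq, of b b "Idt E Y"] mpb_idt[of b Y] that by simp
  note [simp] = mpbD(3,4)[OF powerD(1)[OF pow]] powerD(2-4)[OF pow] G
  have [simp]: "u \<in> Arr B" "Cod B u = Cod B Dd" "Dom B u = so G" "Cod B a' = Dom B Dd" "Dom B a' = so (Dom E n')"
    using mpbD(1-8)[OF powerD(1)[OF pow]] by simp_all
  have [simp]: "G \<in> Obj E" using E.cod_in[of n'] by simp
  obtain b where b[simp]: "b \<in> Arr B" "Dom B b = so Q" "Cod B b = T"
    using Tex[of "so Q"] by (auto simp: B.hom_iff)
  \<comment> \<open>\<open>q\<close> is the transpose of the identity of \<open>Q\<close>.
    Conversely, \<epsilon> evaluates an arrow over \<open>e0\<close> at the only point of the fibre;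
    this is the lift \<open>z\<close> below.\<close>
  obtain q q' where q[simp]: "q \<in> Arr E" "Dom E q = Q" "Cod E q = G" and uq: "u \<cdot>\<^bsub>B\<^esub> sa q = e0 \<cdot>\<^bsub>B\<^esub> b"
    and q'[simp]: "q' \<in> Arr E" "Dom E q' = Q" "Cod E q' = Dom E n'" and q'2: "n' \<cdot>\<^bsub>E\<^esub> q' = q" "a' \<cdot>\<^bsub>B\<^esub> sa q' = e1 \<cdot>\<^bsub>B\<^esub> b" "\<epsilon> \<cdot>\<^bsub>E\<^esub> q' = Idt E Q"
    by (rule power_ex[OF pow M[of b Q], of "Idt E Q"]) simp_all
  have "mpb e0 u b q"
  proof (rule mpbI)
    fix y s
    assume [simp]: "y \<in> Arr E" "s \<in> Arr B" and "Cod E y = Cod E q" and [simp]: "Dom B s = so (Dom E y)"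
      and "Cod B s = Dom B e0" and eq: "e0 \<cdot>\<^bsub>B\<^esub> s = u \<cdot>\<^bsub>B\<^esub> sa y"
    then have [simp]: "Cod E y = G" "Cod B s = T" by simp_all
    obtain y' where y'[simp]: "y' \<in> Arr E" "Dom E y' = Dom E y" "Cod E y' = Dom E n'"
        and y'2: "n' \<cdot>\<^bsub>E\<^esub> y' = y" "a' \<cdot>\<^bsub>B\<^esub> sa y' = e1 \<cdot>\<^bsub>B\<^esub> s"
      by (rule mpb_lift[OF powerD(1)[OF pow], of y "e1 \<cdot>\<^bsub>B\<^esub> s"]) (use B.precomp[OF e1, of s] eq in simp_all)
    define z where "z = \<epsilon> \<cdot>\<^bsub>E\<^esub> y'"
    have [simp]: "z \<in> Arr E" "Dom E z = Dom E y" "Cod E z = Q" by (simp_all add: z_def)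
    have bz: "b \<cdot>\<^bsub>B\<^esub> sa z = s" by (rule Tu) simp_all
    have "q \<cdot>\<^bsub>E\<^esub> z = y"
      by (rule power_unique[OF pow M[of s "Dom E y"], of _ "q' \<cdot>\<^bsub>E\<^esub> z" _ y'])
        (use E.precomp[OF q'2(1), of z] B.precomp[OF q'2(2), of "sa z"] E.precomp[OF q'2(3), of z]
          B.precomp[OF uq, of "sa z"] y'2 eq bz in \<open>simp_all add: z_def[symmetric]\<close>)
    then show "\<exists>z. z \<in> Arr E \<and> Dom E z = Dom E y \<and> Cod E z = Dom E q \<and> q \<cdot>\<^bsub>E\<^esub> z = y \<and> b \<cdot>\<^bsub>B\<^esub> sa z = s"
      using bz by (intro exI[of _ z]) simp
  next
    fix z z'
    assume [simp]: "z \<in> Arr E" "z' \<in> Arr E" "Dom E z = Dom E z'" and "Cod E z = Dom E q" "Cod E z' = Dom E q"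
      and qz: "q \<cdot>\<^bsub>E\<^esub> z = q \<cdot>\<^bsub>E\<^esub> z'" and bz: "b \<cdot>\<^bsub>B\<^esub> sa z = b \<cdot>\<^bsub>B\<^esub> sa z'"
    then have [simp]: "Cod E z = Q" "Cod E z' = Q" by simp_all
    have "q' \<cdot>\<^bsub>E\<^esub> z = q' \<cdot>\<^bsub>E\<^esub> z'"
      by (rule mpb_unique[OF powerD(1)[OF pow]])
        (use E.precomp[OF q'2(1), of z] E.precomp[OF q'2(1), of z'] B.precomp[OF q'2(2), of "sa z"]
          B.precomp[OF q'2(2), of "sa z'"] qz bz in simp_all)
    then have "\<epsilon> \<cdot>\<^bsub>E\<^esub> (q' \<cdot>\<^bsub>E\<^esub> z) = \<epsilon> \<cdot>\<^bsub>E\<^esub> (q' \<cdot>\<^bsub>E\<^esub> z')" by simp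
    then show "z = z'"
      using E.precomp[OF q'2(3), of z] E.precomp[OF q'2(3), of z'] by simp
  qed (simp_all add: uq)
  then show thesis using that by simp
qed

text \<open>Currying. By \<open>xy\<close> and \<open>m\<close>, a point of \<open>Dd\<close> over
  \<open>m0 (i, f)\<close> is a direction \<open>a\<close> of \<open>P\<close> over \<open>i\<close>
  together with a point of \<open>Dd\<close> over \<open>f a\<close>. The power of \<open>Q\<close>
  by this fibre is therefore a power by \<open>P\<close> of powers by \<open>Dd\<close>.\<close>

lemma power_restricts_node:
  assumes pow: "is_power Dd Q u a' n' \<epsilon>" and Gn: "Cod E n' = G"
    and W: "Cod B Dd = W"
    and xy: "D.mpb Dd (e W) y x" and m: "D.mpb Dd m0 m1 (n W \<cdot>\<^bsub>B\<^esub> x)"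
  obtains p where "mpb m0 u (LB u) p" "Dom E p = Cod E (nE G)" "Cod E p = G"
proof -
  note [simp] = W Gn D.mpbD(1,3,4)[OF xy] D.mpbD(2,3)[OF m]
  have Wo[simp]: "W \<in> Obj B" using B.cod_in[of Dd] by simp
  have [simp]: "Cod B x = Dom B (n W)" "Cod B y = Dom B Dd" "Dom B y = Dom B x"
    using D.mpbD(5-8)[OF xy] by simp_all
  have [simp]: "Cod B m0 = W" "Dom B m0 = Cod B (n W)" "Cod B m1 = Dom B Dd" "Dom B m1 = Dom B x"
    using D.mpbD(5-8)[OF m] by simp_all
  note N = powerD(1)[OF pow]
  note [simp] = mpbD(3,4)[OF N] powerD(2-4)[OF pow]
  have [simp]: "u \<in> Arr B" "Cod B u = W" "Dom B u = so G" "Cod B a' = Dom B Dd" "Dom B a' = so (Dom E n')"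
    using mpbD(1-8)[OF N] by simp_all
  have Go[simp]: "G \<in> Obj E" using E.cod_in[of n'] by simp

  \<comment> \<open>For a generalised node \<sigma>, \<open>c\<close> adjoins a direction
    \<open>a\<close>, \<sigma>' is \<sigma> together with \<open>a\<close>, and \<open>c'\<close>
    adjoins a path in the subtree \<open>e W \<cdot> \<sigma>'\<close>. The two stages compose to
    the pullback of \<open>Dd\<close> along \<open>m0 \<cdot> \<sigma>\<close>.\<close>
  have leaves: "\<exists>\<sigma>' c' \<beta> \<tau>. mpb (n W) \<sigma> \<sigma>' c \<and> a W \<cdot>\<^bsub>B\<^esub> \<sigma>' = \<alpha> \<and> \<sigma>' \<in> Arr B \<and> Dom B \<sigma>' = so (Dom E c) \<and> Cod B \<sigma>' = Dom B (n W) \<and>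
      n W \<cdot>\<^bsub>B\<^esub> \<sigma>' = \<sigma> \<cdot>\<^bsub>B\<^esub> sa c \<and>
      mpb Dd (e W \<cdot>\<^bsub>B\<^esub> \<sigma>') \<beta> c' \<and> Cod E c' = Dom E c \<and> \<beta> \<in> Arr B \<and> c' \<in> Arr E \<and> Dom B \<beta> = so (Dom E c') \<and> Cod B \<beta> = Dom B Dd \<and>
      Dd \<cdot>\<^bsub>B\<^esub> \<beta> = e W \<cdot>\<^bsub>B\<^esub> (\<sigma>' \<cdot>\<^bsub>B\<^esub> sa c') \<and>
      \<tau> \<in> Arr B \<and> Dom B \<tau> = so (Dom E c') \<and> Cod B \<tau> = Dom B x \<and>
      x \<cdot>\<^bsub>B\<^esub> \<tau> = \<sigma>' \<cdot>\<^bsub>B\<^esub> sa c' \<and> y \<cdot>\<^bsub>B\<^esub> \<tau> = \<beta> \<and> mpb Dd (m0 \<cdot>\<^bsub>B\<^esub> \<sigma>) (m1 \<cdot>\<^bsub>B\<^esub> \<tau>) (c \<cdot>\<^bsub>E\<^esub> c')"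
    if s[simp]: "\<sigma> \<in> Arr B" "Cod B \<sigma> = Cod B (n W)" and c: "mpb P (r W \<cdot>\<^bsub>B\<^esub> \<sigma>) \<alpha> c" for \<sigma> \<alpha> c
  proof -
    have c0[simp]: "c \<in> Arr E" by (rule mpbD[OF c])
    obtain \<sigma>' where s': "mpb (n W) \<sigma> \<sigma>' c" "a W \<cdot>\<^bsub>B\<^esub> \<sigma>' = \<alpha>"
      by (rule mpb_cancel[OF D.power_facts(13)[OF Wo] c]) simp_all
    have [simp]: "\<sigma>' \<in> Arr B" "Dom B \<sigma>' = so (Dom E c)" "Cod B \<sigma>' = Dom B (n W)" and 1: "n W \<cdot>\<^bsub>B\<^esub> \<sigma>' = \<sigma> \<cdot>\<^bsub>B\<^esub> sa c"
      using mpbD[OF s'(1)] by simp_all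
    obtain \<beta> c' where c': "mpb Dd (e W \<cdot>\<^bsub>B\<^esub> \<sigma>') \<beta> c'" and [simp]: "Cod E c' = Dom E c"
      using mpb_exists[of Dd "e W \<cdot>\<^bsub>B\<^esub> \<sigma>'" "Dom E c"] by auto
    have c'0[simp]: "c' \<in> Arr E" "\<beta> \<in> Arr B" "Dom B \<beta> = so (Dom E c')" "Cod B \<beta> = Dom B Dd"
      and 2: "Dd \<cdot>\<^bsub>B\<^esub> \<beta> = e W \<cdot>\<^bsub>B\<^esub> (\<sigma>' \<cdot>\<^bsub>B\<^esub> sa c')" using mpbD[OF c'] by simp_all
    obtain \<tau> where t: "mpb x \<sigma>' \<tau> c'" "y \<cdot>\<^bsub>B\<^esub> \<tau> = \<beta>"
      by (rule mpb_cancel[OF xy c']) simp_all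
    have [simp]: "\<tau> \<in> Arr B" "Dom B \<tau> = so (Dom E c')" "Cod B \<tau> = Dom B x" and 3: "x \<cdot>\<^bsub>B\<^esub> \<tau> = \<sigma>' \<cdot>\<^bsub>B\<^esub> sa c'"
      using mpbD[OF t(1)] by simp_all
    have "mpb Dd (m0 \<cdot>\<^bsub>B\<^esub> \<sigma>) (m1 \<cdot>\<^bsub>B\<^esub> \<tau>) (c \<cdot>\<^bsub>E\<^esub> c')"
      by (rule mpb_paste[OF m mpb_comp[OF s'(1) t(1)]]) simp
    then show ?thesis
      using s' c' t 1 2 3 by (intro exI[of _ \<sigma>'] exI[of _ c'] exI[of _ \<beta>] exI[of _ \<tau>]) simp
  qed

  have K0[simp]: "mpb P (r W \<cdot>\<^bsub>B\<^esub> LB u) (a (so G)) (nE G)"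
    using power_facts(13)[OF Go] D.L_facts(4)[of u] by simp
  \<comment> \<open>The generic case: the stage is the power of \<open>G\<close> by
    \<open>P\<close>, and the node is given by \<open>LB u\<close>.\<close>
  obtain \<sigma>G k b \<tau>G where sG: "mpb (n W) (LB u) \<sigma>G (nE G)" and sG1[simp]: "\<sigma>G \<in> Arr B" "Dom B \<sigma>G = so (Dom E (nE G))" "Cod B \<sigma>G = Dom B (n W)"
    and sG2: "a W \<cdot>\<^bsub>B\<^esub> \<sigma>G = a (so G)" "n W \<cdot>\<^bsub>B\<^esub> \<sigma>G = LB u \<cdot>\<^bsub>B\<^esub> sa (nE G)"
    and k: "mpb Dd (e W \<cdot>\<^bsub>B\<^esub> \<sigma>G) b k" and k1[simp]: "Cod E k = Dom E (nE G)" "k \<in> Arr E" "b \<in> Arr B" "Dom B b = so (Dom E k)"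
      "Cod B b = Dom B Dd" and k2: "Dd \<cdot>\<^bsub>B\<^esub> b = e W \<cdot>\<^bsub>B\<^esub> (\<sigma>G \<cdot>\<^bsub>B\<^esub> sa k)"
    and tG[simp]: "\<tau>G \<in> Arr B" "Dom B \<tau>G = so (Dom E k)" "Cod B \<tau>G = Dom B x"
    and tG2: "x \<cdot>\<^bsub>B\<^esub> \<tau>G = \<sigma>G \<cdot>\<^bsub>B\<^esub> sa k" "y \<cdot>\<^bsub>B\<^esub> \<tau>G = b"
    and KG: "mpb Dd (m0 \<cdot>\<^bsub>B\<^esub> LB u) (m1 \<cdot>\<^bsub>B\<^esub> \<tau>G) (nE G \<cdot>\<^bsub>E\<^esub> k)"
    using leaves[of "LB u" "a (so G)" "nE G"] by auto
  \<comment> \<open>Both sides are transposes of \<open>LB u\<close>: the value at \<open>a\<close>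
    of a point of the power lies over the subtree at \<open>a\<close>.\<close>
  have eG: "e W \<cdot>\<^bsub>B\<^esub> \<sigma>G = u \<cdot>\<^bsub>B\<^esub> sa (eE G)"
  proof (rule D.transposes_determines[OF D.power[OF Wo]])
    show "D.transposes (r W) (a W) (n W) (e W) (r (so G)) (a (so G)) (n (so G)) (LB u) (e W \<cdot>\<^bsub>B\<^esub> \<sigma>G)"
      by (rule D.transposesI[where m' = \<sigma>G]) (use sG2 D.L_facts(4)[of u] in simp_all)
    show "D.transposes (r W) (a W) (n W) (e W) (r (so G)) (a (so G)) (n (so G)) (LB u) (u \<cdot>\<^bsub>B\<^esub> sa (eE G))"
      using D.L_transposes[of u] by simp
  qed simp
  \<comment> \<open>\<delta> is the value at \<open>a\<close> paired with a path in the subtree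
    below it, so \<open>\<epsilon> \<cdot> \<delta>\<close> evaluates twice. The arrow
    \<open>p\<close> is its transpose along the composite pullback \<open>KG\<close>, that is, the
    uncurrying of a point of the double power.\<close>
  obtain \<delta> where d[simp]: "\<delta> \<in> Arr E" "Dom E \<delta> = Dom E k" "Cod E \<delta> = Dom E n'"
    and d2: "n' \<cdot>\<^bsub>E\<^esub> \<delta> = eE G \<cdot>\<^bsub>E\<^esub> k" "a' \<cdot>\<^bsub>B\<^esub> sa \<delta> = b"
    by (rule mpb_lift[OF N, of "eE G \<cdot>\<^bsub>E\<^esub> k" b]) (use k2 B.precomp[OF eG, of "sa k"] in simp_all)
  obtain p p' where p[simp]: "p \<in> Arr E" "Dom E p = Cod E (nE G)" "Cod E p = G" and up: "u \<cdot>\<^bsub>B\<^esub> sa p = m0 \<cdot>\<^bsub>B\<^esub> LB u"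
    and p'[simp]: "p' \<in> Arr E" "Dom E p' = Dom E k" "Cod E p' = Dom E n'" and p'2: "n' \<cdot>\<^bsub>E\<^esub> p' = p \<cdot>\<^bsub>E\<^esub> (nE G \<cdot>\<^bsub>E\<^esub> k)"
      "a' \<cdot>\<^bsub>B\<^esub> sa p' = m1 \<cdot>\<^bsub>B\<^esub> \<tau>G" "\<epsilon> \<cdot>\<^bsub>E\<^esub> p' = \<epsilon> \<cdot>\<^bsub>E\<^esub> \<delta>"
    by (rule power_ex[OF pow KG, of "\<epsilon> \<cdot>\<^bsub>E\<^esub> \<delta>"]) simp_all

  \<comment> \<open>Evaluating \<open>p \<cdot> z\<close> once along \<open>c \<cdot> c'\<close>
    agrees with evaluating \<open>z\<close> in two stages. Existence and uniqueness of lifts are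
    both read off from this.\<close>
  have restrict: "\<exists>z' z''. z' \<in> Arr E \<and> Dom E z' = Dom E c \<and> Cod E z' = Dom E (nE G) \<and> nE G \<cdot>\<^bsub>E\<^esub> z' = z \<cdot>\<^bsub>E\<^esub> c \<and>
        a (so G) \<cdot>\<^bsub>B\<^esub> sa z' = \<alpha> \<and> u \<cdot>\<^bsub>B\<^esub> sa (eE G \<cdot>\<^bsub>E\<^esub> z') = e W \<cdot>\<^bsub>B\<^esub> \<sigma>' \<and>
        z'' \<in> Arr E \<and> Dom E z'' = Dom E c' \<and> Cod E z'' = Dom E k \<and>
        n' \<cdot>\<^bsub>E\<^esub> (p' \<cdot>\<^bsub>E\<^esub> z'') = (p \<cdot>\<^bsub>E\<^esub> z) \<cdot>\<^bsub>E\<^esub> (c \<cdot>\<^bsub>E\<^esub> c') \<and> a' \<cdot>\<^bsub>B\<^esub> sa (p' \<cdot>\<^bsub>E\<^esub> z'') = m1 \<cdot>\<^bsub>B\<^esub> \<tau> \<and>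
        \<epsilon> \<cdot>\<^bsub>E\<^esub> (p' \<cdot>\<^bsub>E\<^esub> z'') = \<epsilon> \<cdot>\<^bsub>E\<^esub> (\<delta> \<cdot>\<^bsub>E\<^esub> z'') \<and>
        n' \<cdot>\<^bsub>E\<^esub> (\<delta> \<cdot>\<^bsub>E\<^esub> z'') = (eE G \<cdot>\<^bsub>E\<^esub> z') \<cdot>\<^bsub>E\<^esub> c' \<and> a' \<cdot>\<^bsub>B\<^esub> sa (\<delta> \<cdot>\<^bsub>E\<^esub> z'') = \<beta>"
    if [simp]: "\<sigma> \<in> Arr B" "Cod B \<sigma> = Cod B (n W)" and c: "mpb P (r W \<cdot>\<^bsub>B\<^esub> \<sigma>) \<alpha> c"
      and s'[simp]: "\<sigma>' \<in> Arr B" "Dom B \<sigma>' = so (Dom E c)" "Cod B \<sigma>' = Dom B (n W)"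
      and s'2: "a W \<cdot>\<^bsub>B\<^esub> \<sigma>' = \<alpha>" "n W \<cdot>\<^bsub>B\<^esub> \<sigma>' = \<sigma> \<cdot>\<^bsub>B\<^esub> sa c"
      and c'[simp]: "c' \<in> Arr E" "Cod E c' = Dom E c" "\<beta> \<in> Arr B" "Dom B \<beta> = so (Dom E c')" "Cod B \<beta> = Dom B Dd"
      and c'2: "Dd \<cdot>\<^bsub>B\<^esub> \<beta> = e W \<cdot>\<^bsub>B\<^esub> (\<sigma>' \<cdot>\<^bsub>B\<^esub> sa c')"
      and t[simp]: "\<tau> \<in> Arr B" "Dom B \<tau> = so (Dom E c')" "Cod B \<tau> = Dom B x"
      and t2: "x \<cdot>\<^bsub>B\<^esub> \<tau> = \<sigma>' \<cdot>\<^bsub>B\<^esub> sa c'" "y \<cdot>\<^bsub>B\<^esub> \<tau> = \<beta>"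
      and z[simp]: "z \<in> Arr E" "Dom E z = Cod E c" "Cod E z = Cod E (nE G)" and zs: "LB u \<cdot>\<^bsub>B\<^esub> sa z = \<sigma>"
    for \<sigma> \<alpha> c \<sigma>' c' \<beta> \<tau> z
  proof -
    have c0[simp]: "c \<in> Arr E" "\<alpha> \<in> Arr B" "Dom B \<alpha> = so (Dom E c)" "Cod B \<alpha> = Dom B P"
      and cc: "P \<cdot>\<^bsub>B\<^esub> \<alpha> = (r W \<cdot>\<^bsub>B\<^esub> \<sigma>) \<cdot>\<^bsub>B\<^esub> sa c" using mpbD[OF c] by simp_all
    have rz: "r (so G) \<cdot>\<^bsub>B\<^esub> sa z = r W \<cdot>\<^bsub>B\<^esub> \<sigma>"
      using B.precomp[OF D.L_facts(4)[of u], of "sa z"] zs by simp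
    have Pc: "P \<cdot>\<^bsub>B\<^esub> \<alpha> = r (so G) \<cdot>\<^bsub>B\<^esub> sa (z \<cdot>\<^bsub>E\<^esub> c)"
      using cc B.precomp[OF rz, of "sa c"] by simp
    obtain z' where z'[simp]: "z' \<in> Arr E" "Dom E z' = Dom E c" "Cod E z' = Dom E (nE G)"
      and z'2: "nE G \<cdot>\<^bsub>E\<^esub> z' = z \<cdot>\<^bsub>E\<^esub> c" "a (so G) \<cdot>\<^bsub>B\<^esub> sa z' = \<alpha>"
      by (rule mpb_lift[OF power_facts(13)[OF Go], of "z \<cdot>\<^bsub>E\<^esub> c" \<alpha>]) (use Pc in simp_all)
    have nz': "n (so G) \<cdot>\<^bsub>B\<^esub> sa z' = sa z \<cdot>\<^bsub>B\<^esub> sa c"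
      using arg_cong[OF z'2(1), of sa] by simp
    have sz': "\<sigma>G \<cdot>\<^bsub>B\<^esub> sa z' = \<sigma>'"
      by (rule D.mpb_unique[OF D.power_facts(13)[OF Wo]])
        (use B.precomp[OF sG2(1), of "sa z'"] B.precomp[OF sG2(2), of "sa z'"] s'2 z'2 nz'
          B.precomp[OF zs, of "sa c"] in simp_all)
    have uz': "u \<cdot>\<^bsub>B\<^esub> (e (so G) \<cdot>\<^bsub>B\<^esub> sa z') = e W \<cdot>\<^bsub>B\<^esub> \<sigma>'"
      using B.precomp[OF eG, of "sa z'"] sz' by simp
    obtain z'' where z''[simp]: "z'' \<in> Arr E" "Dom E z'' = Dom E c'" "Cod E z'' = Dom E k"
      and z''2: "k \<cdot>\<^bsub>E\<^esub> z'' = z' \<cdot>\<^bsub>E\<^esub> c'" "b \<cdot>\<^bsub>B\<^esub> sa z'' = \<beta>"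
      by (rule mpb_lift[OF k, of "z' \<cdot>\<^bsub>E\<^esub> c'" \<beta>]) (use B.precomp[OF sz', of "sa c'"] c'2 in simp_all)
    have kz'': "sa k \<cdot>\<^bsub>B\<^esub> sa z'' = sa z' \<cdot>\<^bsub>B\<^esub> sa c'"
      using arg_cong[OF z''2(1), of sa] by simp
    have tz'': "\<tau>G \<cdot>\<^bsub>B\<^esub> sa z'' = \<tau>"
      by (rule D.mpb_unique[OF xy])
        (use B.precomp[OF tG2(1), of "sa z''"] B.precomp[OF tG2(2), of "sa z''"] t2 z''2 kz''
          B.precomp[OF sz', of "sa c'"] in simp_all)
    have 1: "n' \<cdot>\<^bsub>E\<^esub> (p' \<cdot>\<^bsub>E\<^esub> z'') = (p \<cdot>\<^bsub>E\<^esub> z) \<cdot>\<^bsub>E\<^esub> (c \<cdot>\<^bsub>E\<^esub> c')"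
      using E.precomp[OF p'2(1), of z''] z''2(1) E.precomp[OF z'2(1), of c'] by simp
    have 2: "a' \<cdot>\<^bsub>B\<^esub> sa (p' \<cdot>\<^bsub>E\<^esub> z'') = m1 \<cdot>\<^bsub>B\<^esub> \<tau>"
      using B.precomp[OF p'2(2), of "sa z''"] tz'' by simp
    have 3: "n' \<cdot>\<^bsub>E\<^esub> (\<delta> \<cdot>\<^bsub>E\<^esub> z'') = (eE G \<cdot>\<^bsub>E\<^esub> z') \<cdot>\<^bsub>E\<^esub> c'" "a' \<cdot>\<^bsub>B\<^esub> sa (\<delta> \<cdot>\<^bsub>E\<^esub> z'') = \<beta>"
      using E.precomp[OF d2(1), of z''] B.precomp[OF d2(2), of "sa z''"] z''2 by simp_all
    have 4: "\<epsilon> \<cdot>\<^bsub>E\<^esub> (p' \<cdot>\<^bsub>E\<^esub> z'') = \<epsilon> \<cdot>\<^bsub>E\<^esub> (\<delta> \<cdot>\<^bsub>E\<^esub> z'')"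
      using E.precomp[OF p'2(3), of z''] by simp
    show ?thesis
      by (rule exI[of _ z'], rule exI[of _ z'']) (use 1 2 3 4 uz' z'2 in simp)
  qed

  have "mpb m0 u (LB u) p"
  proof (rule mpbI)
    fix v \<sigma>
    assume v[simp]: "v \<in> Arr E" and s[simp]: "\<sigma> \<in> Arr B" and "Cod E v = Cod E p" and s1[simp]: "Dom B \<sigma> = so (Dom E v)"
      and "Cod B \<sigma> = Dom B m0" and eq: "m0 \<cdot>\<^bsub>B\<^esub> \<sigma> = u \<cdot>\<^bsub>B\<^esub> sa v"
    then have [simp]: "Cod E v = G" and s2[simp]: "Cod B \<sigma> = Cod B (n W)" by simp_all
    obtain \<alpha> c where c: "mpb P (r W \<cdot>\<^bsub>B\<^esub> \<sigma>) \<alpha> c" and c1[simp]: "Cod E c = Dom E v"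
      using mpb_exists[of P "r W \<cdot>\<^bsub>B\<^esub> \<sigma>" "Dom E v"] by auto
    have c2[simp]: "c \<in> Arr E" by (rule mpbD[OF c])
    obtain \<sigma>' c' \<beta> \<tau> where s'[simp]: "\<sigma>' \<in> Arr B" "Dom B \<sigma>' = so (Dom E c)" "Cod B \<sigma>' = Dom B (n W)"
      and s'2: "a W \<cdot>\<^bsub>B\<^esub> \<sigma>' = \<alpha>" "n W \<cdot>\<^bsub>B\<^esub> \<sigma>' = \<sigma> \<cdot>\<^bsub>B\<^esub> sa c"
      and c': "mpb Dd (e W \<cdot>\<^bsub>B\<^esub> \<sigma>') \<beta> c'" and c'1[simp]: "c' \<in> Arr E" "Cod E c' = Dom E c" "\<beta> \<in> Arr B" "Dom B \<beta> = so (Dom E c')" "Cod B \<beta> = Dom B Dd"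
      and c'2: "Dd \<cdot>\<^bsub>B\<^esub> \<beta> = e W \<cdot>\<^bsub>B\<^esub> (\<sigma>' \<cdot>\<^bsub>B\<^esub> sa c')"
      and t[simp]: "\<tau> \<in> Arr B" "Dom B \<tau> = so (Dom E c')" "Cod B \<tau> = Dom B x"
      and t2: "x \<cdot>\<^bsub>B\<^esub> \<tau> = \<sigma>' \<cdot>\<^bsub>B\<^esub> sa c'" "y \<cdot>\<^bsub>B\<^esub> \<tau> = \<beta>"
      and big: "mpb Dd (m0 \<cdot>\<^bsub>B\<^esub> \<sigma>) (m1 \<cdot>\<^bsub>B\<^esub> \<tau>) (c \<cdot>\<^bsub>E\<^esub> c')"
      using leaves[OF s s2 c] by auto
    \<comment> \<open>\<open>v\<close> is evaluated along both stages at once; the result is curried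
      over \<open>c'\<close> to give \<open>g'\<close>, and \<open>g'\<close> over \<open>c\<close>
      to give \<open>z\<close>.\<close>
    obtain v'' where v''[simp]: "v'' \<in> Arr E" "Dom E v'' = Dom E c'" "Cod E v'' = Dom E n'"
      and v''2: "n' \<cdot>\<^bsub>E\<^esub> v'' = v \<cdot>\<^bsub>E\<^esub> (c \<cdot>\<^bsub>E\<^esub> c')" "a' \<cdot>\<^bsub>B\<^esub> sa v'' = m1 \<cdot>\<^bsub>B\<^esub> \<tau>"
      by (rule mpb_lift[OF N, of "v \<cdot>\<^bsub>E\<^esub> (c \<cdot>\<^bsub>E\<^esub> c')" "m1 \<cdot>\<^bsub>B\<^esub> \<tau>"])
        (use mpbD(9)[OF big] B.precomp[OF eq, of "sa c \<cdot>\<^bsub>B\<^esub> sa c'"] in simp_all)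
    obtain g' g'' where g'[simp]: "g' \<in> Arr E" "Dom E g' = Dom E c" "Cod E g' = G" and ug': "u \<cdot>\<^bsub>B\<^esub> sa g' = e W \<cdot>\<^bsub>B\<^esub> \<sigma>'"
      and g''[simp]: "g'' \<in> Arr E" "Dom E g'' = Dom E c'" "Cod E g'' = Dom E n'"
      and g''2: "n' \<cdot>\<^bsub>E\<^esub> g'' = g' \<cdot>\<^bsub>E\<^esub> c'" "a' \<cdot>\<^bsub>B\<^esub> sa g'' = \<beta>" "\<epsilon> \<cdot>\<^bsub>E\<^esub> g'' = \<epsilon> \<cdot>\<^bsub>E\<^esub> v''"
      by (rule power_ex[OF pow c', of "\<epsilon> \<cdot>\<^bsub>E\<^esub> v''"]) simp_all
    obtain z w where z[simp]: "z \<in> Arr E" "Dom E z = Cod E c" "Cod E z = Cod E (nE G)" and rz: "r (so G) \<cdot>\<^bsub>B\<^esub> sa z = r W \<cdot>\<^bsub>B\<^esub> \<sigma>"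
      and w[simp]: "w \<in> Arr E" "Dom E w = Dom E c" "Cod E w = Dom E (nE G)"
      and w2: "nE G \<cdot>\<^bsub>E\<^esub> w = z \<cdot>\<^bsub>E\<^esub> c" "a (so G) \<cdot>\<^bsub>B\<^esub> sa w = \<alpha>" "eE G \<cdot>\<^bsub>E\<^esub> w = g'"
      by (rule power_ex[OF power[OF Go] c, of g']) simp_all
    have zt: "transposes (r (so G)) (a (so G)) (nE G) (eE G) (r W \<cdot>\<^bsub>B\<^esub> \<sigma>) \<alpha> c z g'"
      by (rule transposesI[where m' = w]) (use rz w2 in simp_all)
    \<comment> \<open>Both are the transpose of the subtree map
      \<open>e W \<cdot> \<sigma>'\<close>, over which \<open>g'\<close> lies.\<close>
    have zs: "LB u \<cdot>\<^bsub>B\<^esub> sa z = \<sigma>"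
    proof (rule D.power_unique'[OF D.power[OF Wo] sa_mpb[OF c]])
      show "D.transposes (r W) (a W) (n W) (e W) (r W \<cdot>\<^bsub>B\<^esub> \<sigma>) \<alpha> (sa c) (LB u \<cdot>\<^bsub>B\<^esub> sa z) (u \<cdot>\<^bsub>B\<^esub> sa g')"
        by (rule D.transposes_L[OF sa_mpb[OF c] transposes_sa[OF Go c zt]]) simp_all
      show "D.transposes (r W) (a W) (n W) (e W) (r W \<cdot>\<^bsub>B\<^esub> \<sigma>) \<alpha> (sa c) \<sigma> (u \<cdot>\<^bsub>B\<^esub> sa g')"
        by (rule D.transposesI[where m' = \<sigma>']) (use s'2 ug' in simp_all)
    qed simp_all
    obtain z' z'' where z'[simp]: "z' \<in> Arr E" "Dom E z' = Dom E c" "Cod E z' = Dom E (nE G)"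
      and z'2: "nE G \<cdot>\<^bsub>E\<^esub> z' = z \<cdot>\<^bsub>E\<^esub> c" "a (so G) \<cdot>\<^bsub>B\<^esub> sa z' = \<alpha>"
      and z''[simp]: "z'' \<in> Arr E" "Dom E z'' = Dom E c'" "Cod E z'' = Dom E k"
      and pz: "n' \<cdot>\<^bsub>E\<^esub> (p' \<cdot>\<^bsub>E\<^esub> z'') = (p \<cdot>\<^bsub>E\<^esub> z) \<cdot>\<^bsub>E\<^esub> (c \<cdot>\<^bsub>E\<^esub> c')" "a' \<cdot>\<^bsub>B\<^esub> sa (p' \<cdot>\<^bsub>E\<^esub> z'') = m1 \<cdot>\<^bsub>B\<^esub> \<tau>"
        "\<epsilon> \<cdot>\<^bsub>E\<^esub> (p' \<cdot>\<^bsub>E\<^esub> z'') = \<epsilon> \<cdot>\<^bsub>E\<^esub> (\<delta> \<cdot>\<^bsub>E\<^esub> z'')"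
      and dz: "n' \<cdot>\<^bsub>E\<^esub> (\<delta> \<cdot>\<^bsub>E\<^esub> z'') = (eE G \<cdot>\<^bsub>E\<^esub> z') \<cdot>\<^bsub>E\<^esub> c'" "a' \<cdot>\<^bsub>B\<^esub> sa (\<delta> \<cdot>\<^bsub>E\<^esub> z'') = \<beta>"
      using restrict[OF s s2 c s' s'2 c'1 c'2 t t2 z zs] by auto
    have "z' = w"
      by (rule mpb_unique[OF power_facts(13)[OF Go]]) (use w2 z'2 in simp_all)
    then have "\<delta> \<cdot>\<^bsub>E\<^esub> z'' = g''"
      by - (rule mpb_unique[OF N], use dz g''2 E.precomp[OF w2(3), of c'] in simp_all)
    then have "p \<cdot>\<^bsub>E\<^esub> z = v"
      by - (rule power_unique[OF pow big, of _ "p' \<cdot>\<^bsub>E\<^esub> z''" _ v''],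
        use pz v''2 g''2 eq B.precomp[OF up, of "sa z"] zs in simp_all)
    then show "\<exists>z. z \<in> Arr E \<and> Dom E z = Dom E v \<and> Cod E z = Dom E p \<and> p \<cdot>\<^bsub>E\<^esub> z = v \<and> LB u \<cdot>\<^bsub>B\<^esub> sa z = \<sigma>"
      using zs by (intro exI[of _ z]) simp
  next
    fix z1 z2
    assume zz[simp]: "z1 \<in> Arr E" "z2 \<in> Arr E" "Dom E z1 = Dom E z2" and "Cod E z1 = Dom E p" "Cod E z2 = Dom E p"
      and p12: "p \<cdot>\<^bsub>E\<^esub> z1 = p \<cdot>\<^bsub>E\<^esub> z2" and u12: "LB u \<cdot>\<^bsub>B\<^esub> sa z1 = LB u \<cdot>\<^bsub>B\<^esub> sa z2"
    then have zc[simp]: "Cod E z1 = Cod E (nE G)" "Cod E z2 = Cod E (nE G)" by simp_all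
    define \<sigma> where "\<sigma> = LB u \<cdot>\<^bsub>B\<^esub> sa z2"
    have s[simp]: "\<sigma> \<in> Arr B" and s1[simp]: "Dom B \<sigma> = so (Dom E z2)" and s2[simp]: "Cod B \<sigma> = Cod B (n W)"
      by (simp_all add: \<sigma>_def)
    obtain \<alpha> c where c: "mpb P (r W \<cdot>\<^bsub>B\<^esub> \<sigma>) \<alpha> c" and c1[simp]: "Cod E c = Dom E z2"
      using mpb_exists[of P "r W \<cdot>\<^bsub>B\<^esub> \<sigma>" "Dom E z2"] by auto
    have c2[simp]: "c \<in> Arr E" by (rule mpbD[OF c])
    obtain \<sigma>' c' \<beta> \<tau> where s'[simp]: "\<sigma>' \<in> Arr B" "Dom B \<sigma>' = so (Dom E c)" "Cod B \<sigma>' = Dom B (n W)"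
      and s'2: "a W \<cdot>\<^bsub>B\<^esub> \<sigma>' = \<alpha>" "n W \<cdot>\<^bsub>B\<^esub> \<sigma>' = \<sigma> \<cdot>\<^bsub>B\<^esub> sa c"
      and c': "mpb Dd (e W \<cdot>\<^bsub>B\<^esub> \<sigma>') \<beta> c'" and c'1[simp]: "c' \<in> Arr E" "Cod E c' = Dom E c" "\<beta> \<in> Arr B" "Dom B \<beta> = so (Dom E c')" "Cod B \<beta> = Dom B Dd"
      and c'2: "Dd \<cdot>\<^bsub>B\<^esub> \<beta> = e W \<cdot>\<^bsub>B\<^esub> (\<sigma>' \<cdot>\<^bsub>B\<^esub> sa c')"
      and t[simp]: "\<tau> \<in> Arr B" "Dom B \<tau> = so (Dom E c')" "Cod B \<tau> = Dom B x"
      and t2: "x \<cdot>\<^bsub>B\<^esub> \<tau> = \<sigma>' \<cdot>\<^bsub>B\<^esub> sa c'" "y \<cdot>\<^bsub>B\<^esub> \<tau> = \<beta>"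
      using leaves[OF s s2 c] by auto
    have "Dom E z1 = Cod E c" "Dom E z2 = Cod E c" "LB u \<cdot>\<^bsub>B\<^esub> sa z1 = \<sigma>" "LB u \<cdot>\<^bsub>B\<^esub> sa z2 = \<sigma>"
      using u12 by (simp_all add: \<sigma>_def)
    note R1 = restrict[OF s s2 c s' s'2 c'1 c'2 t t2 zz(1) this(1) zc(1) this(3)]
      and R2 = restrict[OF s s2 c s' s'2 c'1 c'2 t t2 zz(2) this(2) zc(2) this(4)]
    obtain z1' z1'' where z1'[simp]: "z1' \<in> Arr E" "Dom E z1' = Dom E c" "Cod E z1' = Dom E (nE G)"
      and z1'2: "nE G \<cdot>\<^bsub>E\<^esub> z1' = z1 \<cdot>\<^bsub>E\<^esub> c" "a (so G) \<cdot>\<^bsub>B\<^esub> sa z1' = \<alpha>" "u \<cdot>\<^bsub>B\<^esub> sa (eE G \<cdot>\<^bsub>E\<^esub> z1') = e W \<cdot>\<^bsub>B\<^esub> \<sigma>'"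
      and z1''[simp]: "z1'' \<in> Arr E" "Dom E z1'' = Dom E c'" "Cod E z1'' = Dom E k"
      and pz1: "n' \<cdot>\<^bsub>E\<^esub> (p' \<cdot>\<^bsub>E\<^esub> z1'') = (p \<cdot>\<^bsub>E\<^esub> z1) \<cdot>\<^bsub>E\<^esub> (c \<cdot>\<^bsub>E\<^esub> c')" "a' \<cdot>\<^bsub>B\<^esub> sa (p' \<cdot>\<^bsub>E\<^esub> z1'') = m1 \<cdot>\<^bsub>B\<^esub> \<tau>"
        "\<epsilon> \<cdot>\<^bsub>E\<^esub> (p' \<cdot>\<^bsub>E\<^esub> z1'') = \<epsilon> \<cdot>\<^bsub>E\<^esub> (\<delta> \<cdot>\<^bsub>E\<^esub> z1'')"
      and dz1: "n' \<cdot>\<^bsub>E\<^esub> (\<delta> \<cdot>\<^bsub>E\<^esub> z1'') = (eE G \<cdot>\<^bsub>E\<^esub> z1') \<cdot>\<^bsub>E\<^esub> c'" "a' \<cdot>\<^bsub>B\<^esub> sa (\<delta> \<cdot>\<^bsub>E\<^esub> z1'') = \<beta>"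
      using R1 by (elim exE conjE)
    obtain z2' z2'' where z2'[simp]: "z2' \<in> Arr E" "Dom E z2' = Dom E c" "Cod E z2' = Dom E (nE G)"
      and z2'2: "nE G \<cdot>\<^bsub>E\<^esub> z2' = z2 \<cdot>\<^bsub>E\<^esub> c" "a (so G) \<cdot>\<^bsub>B\<^esub> sa z2' = \<alpha>" "u \<cdot>\<^bsub>B\<^esub> sa (eE G \<cdot>\<^bsub>E\<^esub> z2') = e W \<cdot>\<^bsub>B\<^esub> \<sigma>'"
      and z2''[simp]: "z2'' \<in> Arr E" "Dom E z2'' = Dom E c'" "Cod E z2'' = Dom E k"
      and pz2: "n' \<cdot>\<^bsub>E\<^esub> (p' \<cdot>\<^bsub>E\<^esub> z2'') = (p \<cdot>\<^bsub>E\<^esub> z2) \<cdot>\<^bsub>E\<^esub> (c \<cdot>\<^bsub>E\<^esub> c')" "a' \<cdot>\<^bsub>B\<^esub> sa (p' \<cdot>\<^bsub>E\<^esub> z2'') = m1 \<cdot>\<^bsub>B\<^esub> \<tau>"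
        "\<epsilon> \<cdot>\<^bsub>E\<^esub> (p' \<cdot>\<^bsub>E\<^esub> z2'') = \<epsilon> \<cdot>\<^bsub>E\<^esub> (\<delta> \<cdot>\<^bsub>E\<^esub> z2'')"
      and dz2: "n' \<cdot>\<^bsub>E\<^esub> (\<delta> \<cdot>\<^bsub>E\<^esub> z2'') = (eE G \<cdot>\<^bsub>E\<^esub> z2') \<cdot>\<^bsub>E\<^esub> c'" "a' \<cdot>\<^bsub>B\<^esub> sa (\<delta> \<cdot>\<^bsub>E\<^esub> z2'') = \<beta>"
      using R2 by (elim exE conjE)
    have "p' \<cdot>\<^bsub>E\<^esub> z1'' = p' \<cdot>\<^bsub>E\<^esub> z2''"
      by (rule mpb_unique[OF N]) (use pz1(1,2) pz2(1,2) p12 in simp_all)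
    then have "\<epsilon> \<cdot>\<^bsub>E\<^esub> (\<delta> \<cdot>\<^bsub>E\<^esub> z1'') = \<epsilon> \<cdot>\<^bsub>E\<^esub> (\<delta> \<cdot>\<^bsub>E\<^esub> z2'')"
      using pz1(3) pz2(3) by simp
    then have g: "eE G \<cdot>\<^bsub>E\<^esub> z1' = eE G \<cdot>\<^bsub>E\<^esub> z2'"
      by - (rule power_unique[OF pow c', of _ "\<delta> \<cdot>\<^bsub>E\<^esub> z1''" _ "\<delta> \<cdot>\<^bsub>E\<^esub> z2''"],
        use dz1 dz2 z1'2 z2'2 in simp_all)
    have "r (so G) \<cdot>\<^bsub>B\<^esub> sa z1 = r W \<cdot>\<^bsub>B\<^esub> \<sigma>" "r (so G) \<cdot>\<^bsub>B\<^esub> sa z2 = r W \<cdot>\<^bsub>B\<^esub> \<sigma>"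
      using B.precomp[OF D.L_facts(4)[of u], of "sa z1"] B.precomp[OF D.L_facts(4)[of u], of "sa z2"] u12 by (simp_all add: \<sigma>_def)
    then show "z1 = z2"
      by - (rule power_unique[OF power[OF Go] c, of _ z1' _ z2'], use z1'2 z2'2 g in simp_all)
  qed (simp_all add: up)
  then show thesis using that by simp
qed

end

end

section \<open>Containers over the base category\<close>

lemma (in category) is_pullback_mpb:
  assumes "category_over C C (\<lambda>x. x) (\<lambda>x. x)"
  shows "is_pullback C f g p q \<longleftrightarrow> category_over.mpb C C (\<lambda>x. x) (\<lambda>x. x) f g p q" (is "?l \<longleftrightarrow> ?r")
proof -
  interpret D: category_over C C "\<lambda>x. x" "\<lambda>x. x" by (rule assms)
  show ?thesis
  proof
    assume ?l
    then have f: "f \<in> Arr C" "g \<in> Arr C" "Cod C f = Cod C g" "p \<in> Arr C" "q \<in> Arr C" "Dom C p = Dom C q"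
      "Cod C p = Dom C f" "Cod C q = Dom C g" "f \<cdot> p = g \<cdot> q"
      unfolding is_pullback_def by auto
    have U0: "\<forall>T\<in>Obj C. \<forall>u\<in>hom C T (Dom C f). \<forall>v\<in>hom C T (Dom C g). f \<cdot> u = g \<cdot> v \<longrightarrow>
        (\<exists>!h. h \<in> hom C T (Dom C p) \<and> p \<cdot> h = u \<and> q \<cdot> h = v)"
      using \<open>?l\<close> unfolding is_pullback_def by (elim conjE)
    have U: "\<exists>!h. h \<in> hom C T (Dom C p) \<and> p \<cdot> h = u \<and> q \<cdot> h = v"
      if "T \<in> Obj C" "u \<in> hom C T (Dom C f)" "v \<in> hom C T (Dom C g)" "f \<cdot> u = g \<cdot> v" for T u v
      using that U0 by (rule_tac mp[OF bspec[OF bspec[OF bspec[OF U0]]]])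
    show ?r
      unfolding D.mpb_def
    proof (intro conjI allI impI)
      fix y s
      assume a: "y \<in> Arr C" "s \<in> Arr C" "Cod C y = Cod C q" "Dom C s = Dom C y"
        "Cod C s = Dom C f" "f \<cdot> s = g \<cdot> y"
      have "\<exists>!h. h \<in> hom C (Dom C y) (Dom C p) \<and> p \<cdot> h = s \<and> q \<cdot> h = y"
        by (rule U) (use a f in \<open>simp_all add: hom_iff\<close>)
      then show "\<exists>!z. z \<in> hom C (Dom C y) (Dom C q) \<and> q \<cdot> z = y \<and> p \<cdot> z = s"
        unfolding f(6) by (simp only: conj_commute)
    qed (use f in simp_all)
  next
    assume r: ?r
    note d = D.mpbD[OF r]
    show ?l
      unfolding is_pullback_def
    proof (intro conjI ballI impI)
      fix T u v
      assume a: "T \<in> Obj C" "u \<in> hom C T (Dom C f)" "v \<in> hom C T (Dom C g)" "f \<cdot> u = g \<cdot> v"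
      show "\<exists>!h. h \<in> hom C T (Dom C p) \<and> p \<cdot> h = u \<and> q \<cdot> h = v"
      proof (rule ex_ex1I)
        obtain z where "z \<in> Arr C" "Dom C z = Dom C v" "Cod C z = Dom C q" "q \<cdot> z = v" "p \<cdot> z = u"
          by (rule D.mpb_lift[OF r, of v u]) (use a d in \<open>simp_all add: hom_iff\<close>)
        then show "\<exists>h. h \<in> hom C T (Dom C p) \<and> p \<cdot> h = u \<and> q \<cdot> h = v"
          using a d by (intro exI[of _ z]) (simp add: hom_iff)
      next
        fix h h'
        assume h: "h \<in> hom C T (Dom C p) \<and> p \<cdot> h = u \<and> q \<cdot> h = v" "h' \<in> hom C T (Dom C p) \<and> p \<cdot> h' = u \<and> q \<cdot> h' = v"
        show "h = h'"
          by (rule D.mpb_unique[OF r]) (use h d in \<open>simp_all add: hom_iff\<close>)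
      qed
    qed (use d in simp_all)
  qed
qed

locale lcc_category = category C for C :: "('o, 'm) cat" (structure) +
  assumes lcc: "locally_cartesian_closed C"
begin

sublocale D: category_over C C "\<lambda>x. x" "\<lambda>x. x"
  by unfold_locales (assumption | rule refl)+

lemmas pullback_iff = is_pullback_mpb[OF D.category_over_axioms]

lemma chosen_pullback:
  assumes "f \<in> Arr C" "g \<in> Arr C" "Cod C f = Cod C g"
  shows "is_pullback C f g (pr1 C f g) (pr2 C f g)"
proof -
  have "\<exists>x. case x of (p, q) \<Rightarrow> is_pullback C f g p q"
    using lcc assms unfolding locally_cartesian_closed_def has_pullbacks_def by auto
  from someI_ex[OF this] show ?thesis
    by (simp add: pr1_def pr2_def pr_def case_prod_unfold)
qed

lemma chosen_mpb: "f \<in> Arr C \<Longrightarrow> g \<in> Arr C \<Longrightarrow> Cod C f = Cod C g \<Longrightarrow> D.mpb f g (pr1 C f g) (pr2 C f g)"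
  using chosen_pullback by (simp add: pullback_iff)

lemma pr_arr[simp]:
  assumes "f \<in> Arr C" "g \<in> Arr C" "Cod C f = Cod C g"
  shows "pr1 C f g \<in> Arr C" "Dom C (pr1 C f g) = pb C f g" "Cod C (pr1 C f g) = Dom C f"
    "pr2 C f g \<in> Arr C" "Dom C (pr2 C f g) = pb C f g" "Cod C (pr2 C f g) = Dom C g"
  using chosen_pullback[OF assms] by (auto simp: is_pullback_def pb_def)

lemma pr_eq: "f \<in> Arr C \<Longrightarrow> g \<in> Arr C \<Longrightarrow> Cod C f = Cod C g \<Longrightarrow> f \<cdot> pr1 C f g = g \<cdot> pr2 C f g"
  using chosen_pullback[of f g] by (simp add: is_pullback_def)

lemma pr_eq': "f \<in> Arr C \<Longrightarrow> g \<in> Arr C \<Longrightarrow> Cod C f = Cod C g \<Longrightarrow> x \<in> Arr C \<Longrightarrow> Cod C x = pb C f g \<Longrightarrow>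
    f \<cdot> (pr1 C f g \<cdot> x) = g \<cdot> (pr2 C f g \<cdot> x)"
  using precomp[OF pr_eq[of f g], of x] by simp

lemma pair[simp]:
  assumes fg: "f \<in> Arr C" "g \<in> Arr C" "Cod C f = Cod C g" "u \<in> Arr C" "v \<in> Arr C" "Dom C u = Dom C v" "Cod C u = Dom C f" "Cod C v = Dom C g"
    "f \<cdot> u = g \<cdot> v"
  shows "pair C f g u v \<in> Arr C" "Dom C (pair C f g u v) = Dom C v" "Cod C (pair C f g u v) = pb C f g"
    "pr1 C f g \<cdot> pair C f g u v = u" "pr2 C f g \<cdot> pair C f g u v = v"
proof -
  have "\<exists>!h. h \<in> hom C (Dom C u) (Dom C (pr1 C f g)) \<and> pr1 C f g \<cdot> h = u \<and> pr2 C f g \<cdot> h = v"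
    using chosen_pullback[OF fg(1-3)] fg unfolding is_pullback_def
    by (elim conjE ballE[where x = "Dom C u"] ballE[where x = u] ballE[where x = v]) (simp_all add: hom_iff)
  from theI'[OF this] show "pair C f g u v \<in> Arr C" "Dom C (pair C f g u v) = Dom C v" "Cod C (pair C f g u v) = pb C f g"
    "pr1 C f g \<cdot> pair C f g u v = u" "pr2 C f g \<cdot> pair C f g u v = v"
    using fg by (simp_all add: pair_def hom_iff)
qed

lemma pb_eqI:
  assumes "f \<in> Arr C" "g \<in> Arr C" "Cod C f = Cod C g" "h \<in> Arr C" "k \<in> Arr C" "Dom C h = Dom C k" "Cod C h = pb C f g" "Cod C k = pb C f g"
    "pr1 C f g \<cdot> h = pr1 C f g \<cdot> k" "pr2 C f g \<cdot> h = pr2 C f g \<cdot> k"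
  shows "h = k"
  by (rule D.mpb_unique[OF chosen_mpb[OF assms(1-3)]]) (use assms in simp_all)

lemma pair_cmp[simp]:
  assumes [simp]: "f \<in> Arr C" "g \<in> Arr C" "Cod C f = Cod C g" "u \<in> Arr C" "v \<in> Arr C" "Dom C u = Dom C v" "Cod C u = Dom C f" "Cod C v = Dom C g"
    and e: "f \<cdot> u = g \<cdot> v" and [simp]: "x \<in> Arr C" "Cod C x = Dom C v"
  shows "pair C f g u v \<cdot> x = pair C f g (u \<cdot> x) (v \<cdot> x)"
proof -
  have e': "f \<cdot> (u \<cdot> x) = g \<cdot> (v \<cdot> x)" using precomp[OF e, of x] by simp
  note p = pair(4,5)[OF assms(1-9)]
  show ?thesis
    by (rule pb_eqI[of f g]) (use e e' precomp[OF p(1), of x] precomp[OF p(2), of x] in simp_all)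
qed

lemma pair_pr[simp]:
  assumes [simp]: "f \<in> Arr C" "g \<in> Arr C" "Cod C f = Cod C g"
  shows "pair C f g (pr1 C f g) (pr2 C f g) = Idt C (pb C f g)"
proof -
  have [simp]: "pb C f g \<in> Obj C" using dom_in[of "pr1 C f g"] by simp
  show ?thesis
    by (rule pb_eqI[of f g]) (simp_all add: pr_eq)
qed

definition shape :: "'m \<times> 'm \<times> 'm \<times> 'm \<Rightarrow> 'm" where
  "shape = (\<lambda>(P, \<phi>, \<psi>, Q). \<phi>)"

definition dirs :: "'m \<times> 'm \<times> 'm \<times> 'm \<Rightarrow> 'm" where
  "dirs = (\<lambda>(P, \<phi>, \<psi>, Q). \<psi>)"

abbreviation K where "K \<equiv> Cont C"

text \<open>The arrow \<open>(i, b) \<mapsto> \<psi> (i, b)\<close> evaluated at generalised elements \<open>t\<close> for \<open>i\<close> and \<open>b\<close>; it is junk unless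
  \<open>shape m \<cdot> t = Cod K m \<cdot> b\<close>.\<close>

definition act :: "'m \<times> 'm \<times> 'm \<times> 'm \<Rightarrow> 'm \<Rightarrow> 'm \<Rightarrow> 'm" where
  "act m t b = dirs m \<cdot> pair C (shape m) (Cod K m) t b"

lemma obj_K[simp]: "P \<in> Obj K \<longleftrightarrow> P \<in> Arr C"
  by (simp add: Cont_def)

lemma tuple_simps[simp]: "shape (P, \<phi>, \<psi>, Q) = \<phi>" "dirs (P, \<phi>, \<psi>, Q) = \<psi>" "Dom K (P, \<phi>, \<psi>, Q) = P" "Cod K (P, \<phi>, \<psi>, Q) = Q"
  by (simp_all add: shape_def dirs_def Cont_def)

lemma arr_K:
  assumes "m \<in> Arr K"
  shows "Dom K m \<in> Arr C" "Cod K m \<in> Arr C" "shape m \<in> Arr C" "Dom C (shape m) = Cod C (Dom K m)" "Cod C (shape m) = Cod C (Cod K m)"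
    "dirs m \<in> Arr C" "Dom C (dirs m) = pb C (shape m) (Cod K m)" "Cod C (dirs m) = Dom C (Dom K m)"
    "Dom K m \<cdot> dirs m = pr1 C (shape m) (Cod K m)" "m = (Dom K m, shape m, dirs m, Cod K m)"
  using assms by (auto simp: Cont_def shape_def dirs_def hom_iff)

lemma arr_K_I:
  assumes "P \<in> Arr C" "Q \<in> Arr C" "\<phi> \<in> Arr C" "Dom C \<phi> = Cod C P" "Cod C \<phi> = Cod C Q" "\<psi> \<in> Arr C" "Dom C \<psi> = pb C \<phi> Q"
    "Cod C \<psi> = Dom C P" "P \<cdot> \<psi> = pr1 C \<phi> Q"
  shows "(P, \<phi>, \<psi>, Q) \<in> Arr K"
  using assms by (auto simp: Cont_def hom_iff)

lemma act:
  assumes m: "m \<in> Arr K" and [simp]: "Dom K m = P" "Cod K m = Q"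
    and [simp]: "t \<in> Arr C" "b \<in> Arr C" "Dom C t = Dom C b" "Cod C t = Cod C P" "Cod C b = Dom C Q"
    and e: "shape m \<cdot> t = Q \<cdot> b"
  shows "act m t b \<in> Arr C" "Dom C (act m t b) = Dom C b" "Cod C (act m t b) = Dom C P" "P \<cdot> act m t b = t"
    "x \<in> Arr C \<Longrightarrow> Cod C x = Dom C b \<Longrightarrow> act m t b \<cdot> x = act m (t \<cdot> x) (b \<cdot> x)"
proof -
  note [simp] = arr_K(1-8)[OF m, simplified] e
  note d = arr_K(9)[OF m, simplified]
  show "act m t b \<in> Arr C" "Dom C (act m t b) = Dom C b" "Cod C (act m t b) = Dom C P"
    by (simp_all add: act_def)
  show "P \<cdot> act m t b = t"
    using precomp[OF d, of "pair C (shape m) Q t b"] by (simp add: act_def)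
  show "act m t b \<cdot> x = act m (t \<cdot> x) (b \<cdot> x)" if "x \<in> Arr C" "Cod C x = Dom C b"
    using that by (simp add: act_def)
qed

text \<open>Testing at the two projections of the chosen pullback already recovers the directions
  component, since the pairing of the projections is the identity. The form with generalised
  elements avoids computing with \<open>pair\<close>.\<close>

lemma K_ext:
  assumes m: "m \<in> Arr K" "m' \<in> Arr K" and [simp]: "Dom K m = P" "Dom K m' = P" "Cod K m = Q" "Cod K m' = Q" "shape m = \<phi>" "shape m' = \<phi>"
    and e: "\<And>t b. t \<in> Arr C \<Longrightarrow> b \<in> Arr C \<Longrightarrow> Dom C t = Dom C b \<Longrightarrow> Cod C t = Cod C P \<Longrightarrow> Cod C b = Dom C Q \<Longrightarrow> \<phi> \<cdot> t = Q \<cdot> b \<Longrightarrow>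
      act m t b = act m' t b"
  shows "m = m'"
proof -
  note [simp] = arr_K(1-8)[OF m(1), simplified] arr_K(6-8)[OF m(2), simplified]
  have "act m (pr1 C \<phi> Q) (pr2 C \<phi> Q) = act m' (pr1 C \<phi> Q) (pr2 C \<phi> Q)"
    by (rule e) (simp_all add: pr_eq)
  then have "dirs m = dirs m'"
    by (simp add: act_def)
  then show ?thesis
    using arr_K(10)[OF m(1)] arr_K(10)[OF m(2)] by simp
qed

lemma idt_K:
  assumes P[simp]: "P \<in> Arr C"
  shows "Idt K P \<in> Arr K" "Dom K (Idt K P) = P" "Cod K (Idt K P) = P" "shape (Idt K P) = Idt C (Cod C P)"
    "t \<in> Arr C \<Longrightarrow> b \<in> Arr C \<Longrightarrow> Dom C t = Dom C b \<Longrightarrow> Cod C t = Cod C P \<Longrightarrow> Cod C b = Dom C P \<Longrightarrow> t = P \<cdot> b \<Longrightarrow> act (Idt K P) t b = b"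
proof -
  have 1: "Idt K P = (P, Idt C (Cod C P), pr2 C (Idt C (Cod C P)) P, P)"
    by (simp add: Cont_def)
  show "Idt K P \<in> Arr K"
    unfolding 1 using pr_eq[of "Idt C (Cod C P)" P] by (intro arr_K_I) simp_all
  show "Dom K (Idt K P) = P" "Cod K (Idt K P) = P" "shape (Idt K P) = Idt C (Cod C P)"
    by (simp_all add: 1)
  show "act (Idt K P) t b = b" if "t \<in> Arr C" "b \<in> Arr C" "Dom C t = Dom C b" "Cod C t = Cod C P" "Cod C b = Dom C P" "t = P \<cdot> b"
    using that by (simp add: act_def 1)
qed

text \<open>In terms of \<open>act\<close>, composition on directions is contravariant substitution;
  with \<open>K_ext\<close> this turns the category laws for containers into equational
  reasoning.\<close>

lemma cmp_K:
  assumes m: "m \<in> Arr K" "m' \<in> Arr K" "Cod K m = Dom K m'"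
  shows "m' \<cdot>\<^bsub>K\<^esub> m \<in> Arr K" "Dom K (m' \<cdot>\<^bsub>K\<^esub> m) = Dom K m" "Cod K (m' \<cdot>\<^bsub>K\<^esub> m) = Cod K m'" "shape (m' \<cdot>\<^bsub>K\<^esub> m) = shape m' \<cdot> shape m"
    "t \<in> Arr C \<Longrightarrow> b \<in> Arr C \<Longrightarrow> Dom C t = Dom C b \<Longrightarrow> Cod C t = Cod C (Dom K m) \<Longrightarrow> Cod C b = Dom C (Cod K m') \<Longrightarrow>
      shape m' \<cdot> (shape m \<cdot> t) = Cod K m' \<cdot> b \<Longrightarrow> act (m' \<cdot>\<^bsub>K\<^esub> m) t b = act m t (act m' (shape m \<cdot> t) b)"
proof -
  define P Q R where PQR: "P = Dom K m" "Q = Dom K m'" "R = Cod K m'"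
  have PQR'[simp]: "Dom K m = P" "Cod K m = Q" "Dom K m' = Q" "Cod K m' = R" using PQR m(3) by simp_all
  note [simp] = arr_K(1-8)[OF m(1), simplified] arr_K(1-8)[OF m(2), simplified]
  let ?f = "shape m' \<cdot> shape m"
  have E: "shape m' \<cdot> (shape m \<cdot> pr1 C ?f R) = R \<cdot> pr2 C ?f R"
    using pr_eq[of ?f R] by simp
  note A' = act[OF m(2) PQR'(3,4), of "shape m \<cdot> pr1 C ?f R" "pr2 C ?f R", simplified, OF E]
  note A = act[OF m(1) PQR'(1,2), of "pr1 C ?f R" "act m' (shape m \<cdot> pr1 C ?f R) (pr2 C ?f R)", simplified A', simplified]
  have 1: "m' \<cdot>\<^bsub>K\<^esub> m = (P, ?f, act m (pr1 C ?f R) (act m' (shape m \<cdot> pr1 C ?f R) (pr2 C ?f R)), R)"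
  proof -
    have "m' \<cdot>\<^bsub>K\<^esub> m = (Q, shape m', dirs m', R) \<cdot>\<^bsub>K\<^esub> (P, shape m, dirs m, Q)"
      using arr_K(10)[OF m(1), unfolded PQR'] arr_K(10)[OF m(2), unfolded PQR']
      by (rule arg_cong2[rotated])
    then show ?thesis
      unfolding act_def PQR' by (simp add: Cont_def)
  qed
  show "m' \<cdot>\<^bsub>K\<^esub> m \<in> Arr K"
    unfolding 1 by (rule arr_K_I) (simp_all add: A A')
  show "Dom K (m' \<cdot>\<^bsub>K\<^esub> m) = Dom K m" "Cod K (m' \<cdot>\<^bsub>K\<^esub> m) = Cod K m'" "shape (m' \<cdot>\<^bsub>K\<^esub> m) = shape m' \<cdot> shape m"
    by (simp_all add: 1)
  show "act (m' \<cdot>\<^bsub>K\<^esub> m) t b = act m t (act m' (shape m \<cdot> t) b)"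
    if [simp]: "t \<in> Arr C" "b \<in> Arr C" "Dom C t = Dom C b" "Cod C t = Cod C (Dom K m)" "Cod C b = Dom C (Cod K m')" and
      e: "shape m' \<cdot> (shape m \<cdot> t) = Cod K m' \<cdot> b"
    using e by (subst act_def) (simp add: 1 A A')
qed

lemma category_K: "category K"
proof
  fix f assume "f \<in> Arr K"
  then show "Dom K f \<in> Obj K" "Cod K f \<in> Obj K" by (simp_all add: arr_K)
next
  fix X assume "X \<in> Obj K"
  then show "Idt K X \<in> hom K X X" by (simp add: hom_def idt_K)
next
  fix f g X Y Z assume "f \<in> hom K X Y" "g \<in> hom K Y Z"
  then show "g \<cdot>\<^bsub>K\<^esub> f \<in> hom K X Z" by (simp add: hom_def cmp_K)
next
  fix f X Y assume "f \<in> hom K X Y"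
  then have f: "f \<in> Arr K" "Dom K f = X" "Cod K f = Y" by (simp_all add: hom_def)
  note d[simp] = f arr_K(1-8)[OF f(1), simplified f]
  note i[simp] = idt_K(1-4)[OF d(4)] idt_K(1-4)[OF d(5)] and a[simp] = act[OF f]
  have "Idt K Y \<cdot>\<^bsub>K\<^esub> f \<in> Arr K" "f \<cdot>\<^bsub>K\<^esub> Idt K X \<in> Arr K" by (simp_all add: cmp_K)
  then show "Idt K Y \<cdot>\<^bsub>K\<^esub> f = f" "f \<cdot>\<^bsub>K\<^esub> Idt K X = f"
    by (auto intro!: K_ext simp: cmp_K idt_K(5))
next
  fix f g h W X Y Z assume 0: "f \<in> hom K W X" "g \<in> hom K X Y" "h \<in> hom K Y Z"
  then have f: "f \<in> Arr K" "Dom K f = W" "Cod K f = X" and g: "g \<in> Arr K" "Dom K g = X" "Cod K g = Y"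
    and h: "h \<in> Arr K" "Dom K h = Y" "Cod K h = Z" by (simp_all add: hom_def)
  note d[simp] = f g h arr_K(1-8)[OF f(1), simplified f] arr_K(1-8)[OF g(1), simplified g] arr_K(1-8)[OF h(1), simplified h]
  note a[simp] = act[OF f] act[OF g] act[OF h]
  have [simp]: "h \<cdot>\<^bsub>K\<^esub> g \<in> Arr K" "g \<cdot>\<^bsub>K\<^esub> f \<in> Arr K" "h \<cdot>\<^bsub>K\<^esub> g \<cdot>\<^bsub>K\<^esub> f \<in> Arr K" "h \<cdot>\<^bsub>K\<^esub> (g \<cdot>\<^bsub>K\<^esub> f) \<in> Arr K" by (simp_all add: cmp_K)
  show "(h \<cdot>\<^bsub>K\<^esub> g) \<cdot>\<^bsub>K\<^esub> f = h \<cdot>\<^bsub>K\<^esub> (g \<cdot>\<^bsub>K\<^esub> f)"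
  proof (rule K_ext)
    fix t b
    assume [simp]: "t \<in> Arr C" "b \<in> Arr C" "Dom C t = Dom C b" "Cod C t = Cod C W" "Cod C b = Dom C Z"
      and "(shape h \<cdot> (shape g \<cdot> shape f)) \<cdot> t = Z \<cdot> b"
    then have [simp]: "shape h \<cdot> (shape g \<cdot> (shape f \<cdot> t)) = Z \<cdot> b" by simp
    show "act ((h \<cdot>\<^bsub>K\<^esub> g) \<cdot>\<^bsub>K\<^esub> f) t b = act (h \<cdot>\<^bsub>K\<^esub> (g \<cdot>\<^bsub>K\<^esub> f)) t b"
      by (simp add: cmp_K)
  qed (simp_all add: cmp_K)
qed

sublocale KC: category_over K C "Cod C" shape
proof -
  interpret KK: category K by (rule category_K)
  show "category_over K C (Cod C) shape"
    by unfold_locales (simp_all add: arr_K idt_K cmp_K)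
qed

end

section \<open>Cartesian morphisms and pullbacks of containers\<close>

context lcc_category
begin

lemmas shape_simps = KC.sa_simps(2-6)

lemma act_simps[simp]:
  assumes "m \<in> Arr K" "t \<in> Arr C" "b \<in> Arr C" "Dom C t = Dom C b" "Cod C t = Cod C (Dom K m)" "Cod C b = Dom C (Cod K m)"
    "shape m \<cdot> t = Cod K m \<cdot> b"
  shows "act m t b \<in> Arr C" "Dom C (act m t b) = Dom C b" "Cod C (act m t b) = Dom C (Dom K m)"
    "Dom K m = P \<Longrightarrow> P \<cdot> act m t b = t"
    "x \<in> Arr C \<Longrightarrow> Cod C x = Dom C b \<Longrightarrow> act m t b \<cdot> x = act m (t \<cdot> x) (b \<cdot> x)"
  using act[OF assms(1) refl refl assms(2-7)] by auto

lemma act_idt[simp]: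
  "P \<in> Arr C \<Longrightarrow> t \<in> Arr C \<Longrightarrow> b \<in> Arr C \<Longrightarrow> Cod C b = Dom C P \<Longrightarrow> t = P \<cdot> b \<Longrightarrow> act (Idt K P) t b = b"
  using idt_K(5)[of P t b] by simp

lemma act_cmp[simp]:
  "m \<in> Arr K \<Longrightarrow> m' \<in> Arr K \<Longrightarrow> Cod K m = Dom K m' \<Longrightarrow>
    t \<in> Arr C \<Longrightarrow> b \<in> Arr C \<Longrightarrow> Dom C t = Dom C b \<Longrightarrow> Cod C t = Cod C (Dom K m) \<Longrightarrow> Cod C b = Dom C (Cod K m') \<Longrightarrow>
      shape m' \<cdot> (shape m \<cdot> t) = Cod K m' \<cdot> b \<Longrightarrow> act (m' \<cdot>\<^bsub>K\<^esub> m) t b = act m t (act m' (shape m \<cdot> t) b)"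
  by (rule cmp_K)

context notes [simp] = shape_simps
begin

lemma arr_K_objs[simp]: "m \<in> Arr K \<Longrightarrow> Dom K m \<in> Arr C" "m \<in> Arr K \<Longrightarrow> Cod K m \<in> Arr C"
  using arr_K by auto

lemma K_mk:
  assumes [simp]: "P \<in> Arr C" "Q \<in> Arr C" "\<phi> \<in> Arr C" "Dom C \<phi> = Cod C P" "Cod C \<phi> = Cod C Q"
    "d \<in> Arr C" "Dom C d = pb C \<phi> Q" "Cod C d = Dom C P" and "P \<cdot> d = pr1 C \<phi> Q"
  obtains m where "m \<in> Arr K" "Dom K m = P" "Cod K m = Q" "shape m = \<phi>" "\<And>t b. act m t b = d \<cdot> pair C \<phi> Q t b"
  using that[of "(P, \<phi>, d, Q)"] arr_K_I[OF assms] by (simp add: act_def)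

text \<open>The directions component of \<open>c\<close> is invertible, with inverse induced by \<open>x\<close>.\<close>

definition cartesian :: "'m \<times> 'm \<times> 'm \<times> 'm \<Rightarrow> 'm \<Rightarrow> bool" where
  "cartesian c x \<longleftrightarrow> c \<in> Arr K \<and> D.mpb (shape c) (Cod K c) (Dom K c) x \<and>
     (\<forall>a. a \<in> Arr C \<longrightarrow> Cod C a = Dom C (Dom K c) \<longrightarrow> act c (Dom K c \<cdot> a) (x \<cdot> a) = a)"

lemma cartesianD:
  assumes "cartesian c x"
  shows "c \<in> Arr K" "D.mpb (shape c) (Cod K c) (Dom K c) x" "x \<in> Arr C" "Dom C x = Dom C (Dom K c)" "Cod C x = Dom C (Cod K c)"
    "a \<in> Arr C \<Longrightarrow> Cod C a = Dom C (Dom K c) \<Longrightarrow> act c (Dom K c \<cdot> a) (x \<cdot> a) = a"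
  using assms D.mpbD[of "shape c" "Cod K c" "Dom K c" x] by (auto simp: cartesian_def)

text \<open>The directions component is the canonical isomorphism from the chosen pullback of
  \<open>f\<close> and \<open>P\<close> to the given one.\<close>

lemma cartesian_ex:
  assumes 1: "D.mpb f P \<pi> x"
  obtains c where "cartesian c x" "Dom K c = \<pi>" "Cod K c = P" "shape c = f"
proof -
  note [simp] = D.mpbD(1-4)[OF 1]
  have [simp]: "Cod C f = Cod C P" "Dom C f = Cod C \<pi>" "Cod C x = Dom C P" "Dom C x = Dom C \<pi>"
    using D.mpbD(5-8)[OF 1] by simp_all
  obtain d where d[simp]: "d \<in> Arr C" "Dom C d = pb C f P" "Cod C d = Dom C \<pi>" and d2: "x \<cdot> d = pr2 C f P" "\<pi> \<cdot> d = pr1 C f P"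
    by (rule D.mpb_lift[OF 1, of "pr2 C f P" "pr1 C f P"]) (simp_all add: pr_eq)
  obtain c where c: "c \<in> Arr K" "Dom K c = \<pi>" "Cod K c = P" "shape c = f" "\<And>t b. act c t b = d \<cdot> pair C f P t b"
    by (rule K_mk[of \<pi> P f d]) (use d2 in simp_all)
  have fa: "f \<cdot> (\<pi> \<cdot> a) = P \<cdot> (x \<cdot> a)" if "a \<in> Arr C" "Cod C a = Dom C \<pi>" for a
    using precomp[OF D.mpbD(9)[OF 1], of a] that by simp
  have "act c (\<pi> \<cdot> a) (x \<cdot> a) = a" if [simp]: "a \<in> Arr C" "Cod C a = Dom C \<pi>" for a
    unfolding c(5)
    by (rule D.mpb_unique[OF 1])
      (use fa precomp[OF d2(1), of "pair C f P (\<pi> \<cdot> a) (x \<cdot> a)"] precomp[OF d2(2), of "pair C f P (\<pi> \<cdot> a) (x \<cdot> a)"] in simp_all)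
  then show thesis
    using that[of c] c 1 by (simp add: cartesian_def)
qed

lemma cartesian_act:
  assumes c: "cartesian c x" and [simp]: "t \<in> Arr C" "b \<in> Arr C" "Dom C t = Dom C b" "Cod C t = Cod C (Dom K c)"
    "Cod C b = Dom C (Cod K c)" and e: "shape c \<cdot> t = Cod K c \<cdot> b"
  shows "x \<cdot> act c t b = b"
proof -
  note [simp] = cartesianD(1,3-6)[OF c]
  obtain z where z[simp]: "z \<in> Arr C" "Dom C z = Dom C b" "Cod C z = Dom C x" and z2: "x \<cdot> z = b" "Dom K c \<cdot> z = t"
    by (rule D.mpb_lift[OF cartesianD(2)[OF c], of b t]) (use e in simp_all)
  have "act c t b = z"
    using cartesianD(6)[OF c, of z] z2 by simp
  then show ?thesis using z2 by simp
qed

text \<open>A lift through \<open>c\<close> has no freedom on directions: those of \<open>c\<close>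
  are invertible, so the lift must send \<open>a\<close> to what \<open>y\<close> makes of
  \<open>x \<cdot> a\<close>. What remains is a lift of shapes, which the pullback in
  \<open>C\<close> supplies.\<close>

lemma cartesian_mpb:
  assumes c: "cartesian c x" and 1: "D.mpb v u t (shape c)"
  shows "KC.mpb v u t c"
proof -
  define \<pi> P f where "\<pi> = Dom K c" and "P = Cod K c" and "f = shape c"
  have n[simp]: "Dom K c = \<pi>" "Cod K c = P" "shape c = f" by (simp_all add: \<pi>_def P_def f_def)
  note c0[simp] = cartesianD(1)[OF c]
  have [simp]: "\<pi> \<in> Arr C" "P \<in> Arr C" "f \<in> Arr C" "Dom C f = Cod C \<pi>" "Cod C f = Cod C P"
    using arr_K[OF c0] by simp_all
  note x[simp] = cartesianD(3-5)[OF c, simplified] and ca = cartesianD(6)[OF c, simplified] and ac = cartesian_act[OF c, simplified]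
  have fx: "f \<cdot> \<pi> = P \<cdot> x" using D.mpbD(9)[OF cartesianD(2)[OF c]] by simp
  note d[simp] = D.mpbD(1,2,3,5,6,7,8)[OF 1, simplified] and d9 = D.mpbD(9)[OF 1, simplified]
  show ?thesis
  proof (rule KC.mpbI)
    fix y s
    assume y[simp]: "y \<in> Arr K" and s[simp]: "s \<in> Arr C" and "Cod K y = Cod K c" and "Dom C s = Cod C (Dom K y)"
      and s2[simp]: "Cod C s = Dom C v" and eq: "v \<cdot> s = u \<cdot> shape y"
    define Y where "Y = Dom K y"
    have y2[simp]: "Cod K y = P" "Dom K y = Y" "Dom C s = Cod C Y" using \<open>Cod K y = Cod K c\<close> \<open>Dom C s = _\<close> by (simp_all add: Y_def)
    have [simp]: "Y \<in> Arr C" using arr_K[OF y] by simp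
    obtain z0 where z0[simp]: "z0 \<in> Arr C" "Dom C z0 = Cod C Y" "Cod C z0 = Cod C \<pi>" and z02: "f \<cdot> z0 = shape y" "t \<cdot> z0 = s"
      by (rule D.mpb_lift[OF 1, of "shape y" s]) (use eq in simp_all)
    have e: "shape y \<cdot> \<tau> = P \<cdot> (x \<cdot> a)" if "\<tau> \<in> Arr C" "a \<in> Arr C" "z0 \<cdot> \<tau> = \<pi> \<cdot> a" "Cod C \<tau> = Cod C Y" "Cod C a = Dom C \<pi>" for \<tau> a
      using that precomp[OF z02(1), of \<tau>] precomp[OF fx, of a] by simp
    let ?d = "act y (pr1 C z0 \<pi>) (x \<cdot> pr2 C z0 \<pi>)"
    have e1: "shape y \<cdot> pr1 C z0 \<pi> = P \<cdot> (x \<cdot> pr2 C z0 \<pi>)" by (rule e) (simp_all add: pr_eq)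
    obtain z where z[simp]: "z \<in> Arr K" "Dom K z = Y" "Cod K z = \<pi>" "shape z = z0" and za: "\<And>\<tau> a. act z \<tau> a = ?d \<cdot> pair C z0 \<pi> \<tau> a"
      by (rule K_mk[of Y \<pi> z0 ?d]) (simp_all add: e1)
    have za': "act z \<tau> a = act y \<tau> (x \<cdot> a)" if [simp]: "\<tau> \<in> Arr C" "a \<in> Arr C" "Dom C \<tau> = Dom C a" "Cod C \<tau> = Cod C Y" "Cod C a = Dom C \<pi>"
      and [simp]: "z0 \<cdot> \<tau> = \<pi> \<cdot> a" for \<tau> a
      by (simp add: za e1)
    have "c \<cdot>\<^bsub>K\<^esub> z = y"
    proof (rule K_ext[of _ _ Y P "shape y"])
      fix \<tau> b
      assume \<tau>[simp]: "\<tau> \<in> Arr C" "b \<in> Arr C" "Dom C \<tau> = Dom C b" "Cod C \<tau> = Cod C Y" "Cod C b = Dom C P" and e2: "shape y \<cdot> \<tau> = P \<cdot> b"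
      have e3: "f \<cdot> (z0 \<cdot> \<tau>) = P \<cdot> b" using precomp[OF z02(1), of \<tau>] e2 by simp
      have A: "act c (z0 \<cdot> \<tau>) b \<in> Arr C" "Dom C (act c (z0 \<cdot> \<tau>) b) = Dom C b" "Cod C (act c (z0 \<cdot> \<tau>) b) = Dom C \<pi>"
        "\<pi> \<cdot> act c (z0 \<cdot> \<tau>) b = z0 \<cdot> \<tau>" by (simp_all add: e3)
      have "act (c \<cdot>\<^bsub>K\<^esub> z) \<tau> b = act z \<tau> (act c (z0 \<cdot> \<tau>) b)" by (simp add: e3)
      also have "\<dots> = act y \<tau> (x \<cdot> act c (z0 \<cdot> \<tau>) b)" by (rule za') (simp_all add: A)
      also have "x \<cdot> act c (z0 \<cdot> \<tau>) b = b" by (rule ac) (simp_all add: e3)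
      finally show "act (c \<cdot>\<^bsub>K\<^esub> z) \<tau> b = act y \<tau> b" .
    qed (simp_all add: z02)
    then show "\<exists>z. z \<in> Arr K \<and> Dom K z = Dom K y \<and> Cod K z = Dom K c \<and> c \<cdot>\<^bsub>K\<^esub> z = y \<and> t \<cdot> shape z = s"
      using z02 by (intro exI[of _ z]) simp
  next
    fix z z'
    assume z[simp]: "z \<in> Arr K" "z' \<in> Arr K" "Dom K z = Dom K z'" and "Cod K z = Dom K c" "Cod K z' = Dom K c"
      and cz: "c \<cdot>\<^bsub>K\<^esub> z = c \<cdot>\<^bsub>K\<^esub> z'" and tz: "t \<cdot> shape z = t \<cdot> shape z'"
    then have z2[simp]: "Cod K z = \<pi>" "Cod K z' = \<pi>" by simp_all
    have fz: "f \<cdot> shape z = f \<cdot> shape z'" using arg_cong[OF cz, of shape] by simp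
    have s: "shape z = shape z'"
      by (rule D.mpb_unique[OF 1]) (use fz tz in simp_all)
    show "z = z'"
    proof (rule K_ext[of _ _ "Dom K z'" \<pi> "shape z'"])
      fix \<tau> a
      assume \<tau>[simp]: "\<tau> \<in> Arr C" "a \<in> Arr C" "Dom C \<tau> = Dom C a" "Cod C \<tau> = Cod C (Dom K z')" "Cod C a = Dom C \<pi>" and e2: "shape z' \<cdot> \<tau> = \<pi> \<cdot> a"
      have e3: "f \<cdot> (shape z' \<cdot> \<tau>) = P \<cdot> (x \<cdot> a)" using precomp[OF fx, of a] e2 by simp
      have "act (c \<cdot>\<^bsub>K\<^esub> z) \<tau> (x \<cdot> a) = act z \<tau> a" "act (c \<cdot>\<^bsub>K\<^esub> z') \<tau> (x \<cdot> a) = act z' \<tau> a"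
        using e2 e3 ca[of a] by (simp_all add: s)
      then show "act z \<tau> a = act z' \<tau> a" using cz by simp
    qed (simp_all add: s)
  qed (simp_all add: d9)
qed

text \<open>\<open>Idt C T\<close> has one direction over each shape, so a morphism out of it
  carries no information beyond its shape map. Together with \<open>Idt_arr_eq\<close> this makes
  \<open>Idt C\<close> left adjoint to the shape functor.\<close>

lemma Idt_arr_ex:
  assumes [simp]: "T \<in> Obj C" "G \<in> Arr C" "y \<in> Arr C" "Dom C y = T" "Cod C y = Cod C G"
  obtains m where "m \<in> Arr K" "Dom K m = Idt C T" "Cod K m = G" "shape m = y"
  by (rule K_mk[of "Idt C T" G y "pr1 C y G"]) simp_all

lemma Idt_arr_eq:
  assumes m[simp]: "m \<in> Arr K" "m' \<in> Arr K" "Dom K m = Idt C T" "Dom K m' = Idt C T" "Cod K m = Cod K m'" "shape m = shape m'" and T[simp]: "T \<in> Obj C"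
  shows "m = m'"
proof (rule K_ext[of _ _ "Idt C T" "Cod K m'" "shape m'"])
  fix t b
  assume [simp]: "t \<in> Arr C" "b \<in> Arr C" "Dom C t = Dom C b" "Cod C t = Cod C (Idt C T)" "Cod C b = Dom C (Cod K m')"
    "shape m' \<cdot> t = Cod K m' \<cdot> b"
  have 1: "Idt C T \<cdot> act m t b = t" "Idt C T \<cdot> act m' t b = t"
    by (rule act_simps; simp)+
  have 2: "Idt C T \<cdot> act m t b = act m t b" "Idt C T \<cdot> act m' t b = act m' t b"
    by (rule cmp_idt_left; simp)+
  show "act m t b = act m' t b"
    by (rule trans[OF trans[OF 2(1)[symmetric] 1(1)] trans[OF 1(2)[symmetric] 2(2)]])
qed simp_all

text \<open>As a right adjoint the shape functor preserves these pullbacks: a test arrow in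
  \<open>C\<close> is replaced by the morphism out of an identity container with that shape
  map.\<close>

lemma shape_mpb:
  assumes 1: "KC.mpb v u t c"
  shows "D.mpb v u t (shape c)"
proof -
  note c0[simp] = KC.mpbD(1-8)[OF 1]
  define \<pi> P where "\<pi> = Dom K c" and "P = Cod K c"
  have n[simp]: "Dom K c = \<pi>" "Cod K c = P" by (simp_all add: \<pi>_def P_def)
  have [simp]: "\<pi> \<in> Arr C" "P \<in> Arr C" using arr_K[OF c0(4)] by simp_all
  show ?thesis
  proof (rule D.mpbI)
    fix y s
    assume y: "y \<in> Arr C" and s: "s \<in> Arr C" and "Cod C y = Cod C (shape c)" and s2: "Dom C s = Dom C y"
      and s3: "Cod C s = Dom C v" and eq: "v \<cdot> s = u \<cdot> y"
    then have y2[simp]: "Cod C y = Cod C P" by simp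
    note [simp] = y s s2 s3
    obtain m where m[simp]: "m \<in> Arr K" "Dom K m = Idt C (Dom C y)" "Cod K m = P" "shape m = y"
      by (rule Idt_arr_ex[of "Dom C y" P y]) simp_all
    obtain z where z[simp]: "z \<in> Arr K" "Dom K z = Idt C (Dom C y)" "Cod K z = \<pi>" and z2: "c \<cdot>\<^bsub>K\<^esub> z = m" "t \<cdot> shape z = s"
      by (rule KC.mpb_lift[OF 1, of m s]) (use eq in simp_all)
    have "shape c \<cdot> shape z = y" using arg_cong[OF z2(1), of shape] by simp
    then show "\<exists>z. z \<in> Arr C \<and> Dom C z = Dom C y \<and> Cod C z = Dom C (shape c) \<and> shape c \<cdot> z = y \<and> t \<cdot> z = s"
      using z2 by (intro exI[of _ "shape z"]) simp
  next
    fix z z'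
    assume z: "z \<in> Arr C" "z' \<in> Arr C" "Dom C z = Dom C z'" and "Cod C z = Dom C (shape c)" "Cod C z' = Dom C (shape c)"
      and cz: "shape c \<cdot> z = shape c \<cdot> z'" and tz: "t \<cdot> z = t \<cdot> z'"
    then have z2[simp]: "Cod C z = Cod C \<pi>" "Cod C z' = Cod C \<pi>" by simp_all
    note [simp] = z
    obtain m where m[simp]: "m \<in> Arr K" "Dom K m = Idt C (Dom C z')" "Cod K m = \<pi>" "shape m = z"
      by (rule Idt_arr_ex[of "Dom C z'" \<pi> z]) simp_all
    obtain m' where m'[simp]: "m' \<in> Arr K" "Dom K m' = Idt C (Dom C z')" "Cod K m' = \<pi>" "shape m' = z'"
      by (rule Idt_arr_ex[of "Dom C z'" \<pi> z']) simp_all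
    have e: "c \<cdot>\<^bsub>K\<^esub> m = c \<cdot>\<^bsub>K\<^esub> m'"
      by (rule Idt_arr_eq[where T = "Dom C z'"]) (use cz in simp_all)
    have "m = m'"
      by (rule KC.mpb_unique[OF 1]) (use e tz in simp_all)
    then show "z = z'" using m(4) m'(4) by metis
  qed (use KC.mpbD(9)[OF 1] in simp_all)
qed

text \<open>The restricted container has the pullback of \<open>v\<close> and \<open>u\<close> as
  shapes and the directions of \<open>Y\<close> pulled back to them; the projection is
  cartesian.\<close>

lemma mpb_exists:
  assumes v: "v \<in> Arr C" "u \<in> Arr C" "Cod C u = Cod C v" "Y \<in> Obj K" "Dom C u = Cod C Y"
  shows "\<exists>t c. KC.mpb v u t c \<and> Cod K c = Y"
proof -
  note [simp] = v v(4)[simplified]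
  have 1: "D.mpb v u (pr1 C v u) (pr2 C v u)" by (rule chosen_mpb) simp_all
  have 2: "D.mpb (pr2 C v u) Y (pr1 C (pr2 C v u) Y) (pr2 C (pr2 C v u) Y)" by (rule chosen_mpb) simp_all
  obtain c where c: "cartesian c (pr2 C (pr2 C v u) Y)" "Cod K c = Y" "shape c = pr2 C v u"
    by (rule cartesian_ex[OF 2]) simp
  have "KC.mpb v u (pr1 C v u) c"
    by (rule cartesian_mpb[OF c(1)]) (use 1 c(3) in simp)
  then show ?thesis
    using c(2) by blast
qed

end

sublocale KC: container_setting K C "Cod C" shape
proof -
  interpret KK: category K by (rule category_K)
  show "container_setting K C (Cod C) shape"
    by unfold_locales (use shape_mpb mpb_exists in auto)
qed

end

section \<open>Slices and dependent products\<close>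

lemma slice_simps[simp]:
  "Obj (slice C I) = {f \<in> Arr C. Cod C f = I}"
  "(f, h, g) \<in> Arr (slice C I) \<longleftrightarrow> f \<in> Arr C \<and> Cod C f = I \<and> g \<in> Arr C \<and> Cod C g = I \<and>
              h \<in> hom C (Dom C f) (Dom C g) \<and> g \<cdot>\<^bsub>C\<^esub> h = f"
  "Dom (slice C I) (f, h, g) = f" "Cod (slice C I) (f, h, g) = g"
  "(g', k, g'') \<cdot>\<^bsub>slice C I\<^esub> (f, h, f') = (f, k \<cdot>\<^bsub>C\<^esub> h, g'')"
  by (simp_all add: slice_def)

lemma hom_slice:
  "m \<in> hom (slice C I) f g \<longleftrightarrow> (\<exists>h. m = (f, h, g) \<and> f \<in> Arr C \<and> Cod C f = I \<and> g \<in> Arr C \<and> Cod C g = I \<and>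
      h \<in> Arr C \<and> Dom C h = Dom C f \<and> Cod C h = Dom C g \<and> g \<cdot>\<^bsub>C\<^esub> h = f)"
  by (cases m) (auto simp: hom_def)

context lcc_category
begin

lemma terminal: "is_terminal C (terminal_obj C)"
  using lcc someI_ex[of "is_terminal C"] unfolding locally_cartesian_closed_def terminal_obj_def by blast

lemma bang[simp]:
  assumes "X \<in> Obj C"
  shows "bang C X \<in> Arr C" "Dom C (bang C X) = X" "Cod C (bang C X) = terminal_obj C"
proof -
  have "\<exists>!f. f \<in> hom C X (terminal_obj C)" using terminal assms by (auto simp: is_terminal_def)
  from theI'[OF this] show "bang C X \<in> Arr C" "Dom C (bang C X) = X" "Cod C (bang C X) = terminal_obj C"
    by (simp_all add: bang_def hom_iff)
qed

lemma terminal_in[simp]: "terminal_obj C \<in> Obj C"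
  using terminal by (simp add: is_terminal_def)

lemma terminal_unique:
  assumes "f \<in> Arr C" "g \<in> Arr C" "Dom C f = Dom C g" "Cod C f = terminal_obj C" "Cod C g = terminal_obj C"
  shows "f = g"
proof -
  have "\<exists>!h. h \<in> hom C (Dom C g) (terminal_obj C)" using terminal assms by (auto simp: is_terminal_def)
  then show ?thesis using assms by (auto simp: hom_iff)
qed

lemma bang_cmp[simp]: "f \<in> Arr C \<Longrightarrow> X \<in> Obj C \<Longrightarrow> Cod C f = X \<Longrightarrow> bang C X \<cdot> f = bang C (Dom C f)"
  by (rule terminal_unique) simp_all

abbreviation Pi where "Pi f y \<equiv> FObj (dep_prod C f) y"

definition Pi_ev where "Pi_ev f y = underlying (dep_prod_counit C f y)"

lemma Pi_cofree:
  assumes "f \<in> Arr C" "y \<in> Arr C" "Cod C y = Dom C f"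
  shows "cofree (slice C (Cod C f)) (slice C (Dom C f)) (base_change C f) y (Pi f y) (dep_prod_counit C f y)"
proof -
  have "has_right_adjoint (slice C (Cod C f)) (slice C (Dom C f)) (base_change C f)"
    using lcc assms(1) unfolding locally_cartesian_closed_def by blast
  then have "\<exists>R e. cofree (slice C (Cod C f)) (slice C (Dom C f)) (base_change C f) y R e"
    using assms unfolding has_right_adjoint_def by simp
  then have "\<exists>x. case x of (R, e) \<Rightarrow> cofree (slice C (Cod C f)) (slice C (Dom C f)) (base_change C f) y R e"
    by auto
  from someI_ex[OF this] show ?thesis
    by (simp add: dep_prod_def dep_prod_counit_def right_adjoint_def counit_def radj_data_def case_prod_unfold)
qed

lemma Pi_arr:
  assumes "f \<in> Arr C" "y \<in> Arr C" "Cod C y = Dom C f"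
  shows "Pi f y \<in> Arr C" "Cod C (Pi f y) = Cod C f" "Pi_ev f y \<in> Arr C" "Dom C (Pi_ev f y) = pb C f (Pi f y)"
    "Cod C (Pi_ev f y) = Dom C y" "y \<cdot> Pi_ev f y = pr1 C f (Pi f y)" "dep_prod_counit C f y = (pr1 C f (Pi f y), Pi_ev f y, y)"
proof -
  have 1: "Pi f y \<in> Obj (slice C (Cod C f))" "dep_prod_counit C f y \<in> hom (slice C (Dom C f)) (FObj (base_change C f) (Pi f y)) y"
    using Pi_cofree[OF assms] by (simp_all add: cofree_def)
  then show "Pi f y \<in> Arr C" "Cod C (Pi f y) = Cod C f" by simp_all
  then show "Pi_ev f y \<in> Arr C" "Dom C (Pi_ev f y) = pb C f (Pi f y)"
    "Cod C (Pi_ev f y) = Dom C y" "y \<cdot> Pi_ev f y = pr1 C f (Pi f y)" "dep_prod_counit C f y = (pr1 C f (Pi f y), Pi_ev f y, y)"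
    using 1(2) assms by (auto simp: hom_slice base_change_def underlying_def Pi_ev_def)
qed

lemma Pi_slice_ex1:
  assumes f: "f \<in> Arr C" "y \<in> Arr C" "Cod C y = Dom C f" and p: "\<phi> \<in> Arr C" "Cod C \<phi> = Cod C f"
    and k: "k \<in> Arr C" "Dom C k = pb C f \<phi>" "Cod C k = Dom C y" "y \<cdot> k = pr1 C f \<phi>"
  shows "\<exists>!H. H \<in> hom (slice C (Cod C f)) \<phi> (Pi f y) \<and>
    dep_prod_counit C f y \<cdot>\<^bsub>slice C (Dom C f)\<^esub> FArr (base_change C f) H = (pr1 C f \<phi>, k, y)"
proof -
  have "\<phi> \<in> Obj (slice C (Cod C f))" using p by simp
  moreover have "(pr1 C f \<phi>, k, y) \<in> hom (slice C (Dom C f)) (FObj (base_change C f) \<phi>) y"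
    using f p k by (simp add: hom_slice base_change_def)
  ultimately show ?thesis
    using Pi_cofree[OF f] unfolding cofree_def by blast
qed

text \<open>The adjunction between slices speaks of the chosen pullback of \<open>f\<close> and
  \<phi>. The isomorphism \<open>i\<close>, \<open>j\<close> moves its universal property to an
  arbitrary pullback, and the triples of the slice category disappear from the statement.\<close>

lemma Pi_ex:
  assumes f: "f \<in> Arr C" "y \<in> Arr C" "Cod C y = Dom C f" and pq: "D.mpb f \<phi> p q"
    and k: "k \<in> Arr C" "Dom C k = Dom C q" "Cod C k = Dom C y" "y \<cdot> k = p"
  obtains h where "h \<in> Arr C" "Dom C h = Dom C \<phi>" "Cod C h = Dom C (Pi f y)" "Pi f y \<cdot> h = \<phi>"
    "Pi_ev f y \<cdot> pair C f (Pi f y) p (h \<cdot> q) = k"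
proof -
  note [simp] = f k(1-3) Pi_arr(1-5)[OF f] D.mpbD(1-8)[OF pq]
  have [simp]: "Cod C \<phi> = Cod C f" using D.mpbD(5)[OF pq] by simp
  obtain i j where i[simp]: "i \<in> Arr C" "Dom C i = pb C f \<phi>" "Cod C i = Dom C q" and i2: "q \<cdot> i = pr2 C f \<phi>" "p \<cdot> i = pr1 C f \<phi>"
    and j[simp]: "j \<in> Arr C" "Dom C j = Dom C q" "Cod C j = pb C f \<phi>" and j2: "pr2 C f \<phi> \<cdot> j = q" "pr1 C f \<phi> \<cdot> j = p"
    and ij: "i \<cdot> j = Idt C (Dom C q)"
    by (rule D.mpb_iso2[OF chosen_mpb[of f \<phi>] pq]) simp_all
  have yk: "y \<cdot> (k \<cdot> i) = pr1 C f \<phi>" using precomp[OF k(4), of i] i2 by simp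
  obtain H where "H \<in> hom (slice C (Cod C f)) \<phi> (Pi f y)" and
    H: "dep_prod_counit C f y \<cdot>\<^bsub>slice C (Dom C f)\<^esub> FArr (base_change C f) H = (pr1 C f \<phi>, k \<cdot> i, y)"
    using ex1_implies_ex[OF Pi_slice_ex1[OF f, of \<phi> "k \<cdot> i"]] yk by auto
  then obtain h where h: "H = (\<phi>, h, Pi f y)" and h2[simp]: "h \<in> Arr C" "Dom C h = Dom C \<phi>" "Cod C h = Dom C (Pi f y)" and h3: "Pi f y \<cdot> h = \<phi>"
    by (auto simp: hom_slice)
  have e: "f \<cdot> pr1 C f \<phi> = Pi f y \<cdot> (h \<cdot> pr2 C f \<phi>)"
    using precomp[OF h3, of "pr2 C f \<phi>"] pr_eq[of f \<phi>] by simp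
  have "Pi_ev f y \<cdot> pair C f (Pi f y) (pr1 C f \<phi>) (h \<cdot> pr2 C f \<phi>) = k \<cdot> i"
    using H unfolding h Pi_arr(7)[OF f] by (simp add: base_change_def)
  from precomp[OF this, of j] have "Pi_ev f y \<cdot> pair C f (Pi f y) p (h \<cdot> q) = k"
    using e j2 ij by simp
  then show thesis using that[of h] h3 by simp
qed

lemma Pi_unique:
  assumes f: "f \<in> Arr C" "y \<in> Arr C" "Cod C y = Dom C f" and pq: "D.mpb f \<phi> p q"
    and h: "h \<in> Arr C" "Dom C h = Dom C \<phi>" "Cod C h = Dom C (Pi f y)" "Pi f y \<cdot> h = \<phi>"
    and h': "h' \<in> Arr C" "Dom C h' = Dom C \<phi>" "Cod C h' = Dom C (Pi f y)" "Pi f y \<cdot> h' = \<phi>"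
    and eq: "Pi_ev f y \<cdot> pair C f (Pi f y) p (h \<cdot> q) = Pi_ev f y \<cdot> pair C f (Pi f y) p (h' \<cdot> q)"
  shows "h = h'"
proof -
  note [simp] = f h(1-3) h'(1-3) Pi_arr(1-5)[OF f] D.mpbD(1-8)[OF pq]
  have [simp]: "Cod C \<phi> = Cod C f" using D.mpbD(5)[OF pq] by simp
  obtain i where i[simp]: "i \<in> Arr C" "Dom C i = pb C f \<phi>" "Cod C i = Dom C q" and i2: "q \<cdot> i = pr2 C f \<phi>" "p \<cdot> i = pr1 C f \<phi>"
    by (rule D.mpb_iso2[OF chosen_mpb[of f \<phi>] pq]) simp_all
  note hx[simp] = precomp[OF h(4)] precomp[OF h'(4)] D.mpbD(9)[OF pq]
  have [simp]: "f \<cdot> pr1 C f \<phi> = \<phi> \<cdot> pr2 C f \<phi>" by (rule pr_eq) simp_all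
  let ?k = "Pi_ev f y \<cdot> pair C f (Pi f y) (pr1 C f \<phi>) (h \<cdot> pr2 C f \<phi>)"
  have k: "?k = Pi_ev f y \<cdot> pair C f (Pi f y) (pr1 C f \<phi>) (h' \<cdot> pr2 C f \<phi>)"
    using precomp[OF eq, of i] i2 by simp
  have yk: "y \<cdot> ?k = pr1 C f \<phi>" using precomp[OF Pi_arr(6)[OF f], of "pair C f (Pi f y) (pr1 C f \<phi>) (h \<cdot> pr2 C f \<phi>)"] by simp
  have U: "\<exists>!H. H \<in> hom (slice C (Cod C f)) \<phi> (Pi f y) \<and>
    dep_prod_counit C f y \<cdot>\<^bsub>slice C (Dom C f)\<^esub> FArr (base_change C f) H = (pr1 C f \<phi>, ?k, y)"
    by (rule Pi_slice_ex1[OF f]) (use yk in simp_all)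
  have 1: "(\<phi>, h, Pi f y) \<in> hom (slice C (Cod C f)) \<phi> (Pi f y) \<and>
    dep_prod_counit C f y \<cdot>\<^bsub>slice C (Dom C f)\<^esub> FArr (base_change C f) (\<phi>, h, Pi f y) = (pr1 C f \<phi>, ?k, y)"
    unfolding Pi_arr(7)[OF f] using h by (simp add: hom_slice base_change_def)
  have 2: "(\<phi>, h', Pi f y) \<in> hom (slice C (Cod C f)) \<phi> (Pi f y) \<and>
    dep_prod_counit C f y \<cdot>\<^bsub>slice C (Dom C f)\<^esub> FArr (base_change C f) (\<phi>, h', Pi f y) = (pr1 C f \<phi>, ?k, y)"
    unfolding Pi_arr(7)[OF f] using h' k by (simp add: hom_slice base_change_def)
  have "(\<phi>, h, Pi f y) = (\<phi>, h', Pi f y)"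
    by (rule trans[OF the1_equality[OF U 1, symmetric] the1_equality[OF U 2]])
  then show ?thesis by simp
qed

text \<open>Unfolds the definite description in \<open>right_adjoint\<close>: the action of
  \<open>k\<close> is the arrow over \<open>Cod C f\<close> whose evaluation is \<open>k\<close>
  after evaluation.\<close>

lemma Pi_map:
  assumes f: "f \<in> Arr C" "y \<in> Arr C" "Cod C y = Dom C f" and f': "y' \<in> Arr C" "Cod C y' = Dom C f"
    and k: "k \<in> Arr C" "Dom C k = Dom C y" "Cod C k = Dom C y'" "y' \<cdot> k = y"
  defines "h \<equiv> underlying (FArr (dep_prod C f) (y, k, y'))"
  shows "h \<in> Arr C" "Dom C h = Dom C (Pi f y)" "Cod C h = Dom C (Pi f y')" "Pi f y' \<cdot> h = Pi f y"
    "Pi_ev f y' \<cdot> pair C f (Pi f y') (pr1 C f (Pi f y)) (h \<cdot> pr2 C f (Pi f y)) = k \<cdot> Pi_ev f y"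
    "FArr (dep_prod C f) (y, k, y') = (Pi f y, h, Pi f y')"
proof -
  note f'' = f(1) f'
  note [simp] = f f' k(1-3) Pi_arr(1-5)[OF f] Pi_arr(1-5)[OF f'']
  have e: "y' \<cdot> (k \<cdot> Pi_ev f y) = pr1 C f (Pi f y)"
    using precomp[OF k(4), of "Pi_ev f y"] Pi_arr(6)[OF f] by simp
  have U: "\<exists>!H. H \<in> hom (slice C (Cod C f)) (Pi f y) (Pi f y') \<and>
    dep_prod_counit C f y' \<cdot>\<^bsub>slice C (Dom C f)\<^esub> FArr (base_change C f) H = (pr1 C f (Pi f y), k \<cdot> Pi_ev f y, y')"
    by (rule Pi_slice_ex1[OF f'']) (use e in simp_all)
  let ?H = "FArr (dep_prod C f) (y, k, y')"
  have "?H = (THE H. H \<in> hom (slice C (Cod C f)) (Pi f y) (Pi f y') \<and>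
    dep_prod_counit C f y' \<cdot>\<^bsub>slice C (Dom C f)\<^esub> FArr (base_change C f) H = (pr1 C f (Pi f y), k \<cdot> Pi_ev f y, y'))"
    unfolding dep_prod_counit_def[symmetric] using Pi_arr(7)[OF f]
    by (simp add: dep_prod_def right_adjoint_def dep_prod_counit_def)
  then have H: "?H \<in> hom (slice C (Cod C f)) (Pi f y) (Pi f y')"
    and H2: "dep_prod_counit C f y' \<cdot>\<^bsub>slice C (Dom C f)\<^esub> FArr (base_change C f) ?H = (pr1 C f (Pi f y), k \<cdot> Pi_ev f y, y')"
    using theI'[OF U] by simp_all
  from H have h: "?H = (Pi f y, h, Pi f y')" and
    1: "h \<in> Arr C" "Dom C h = Dom C (Pi f y)" "Cod C h = Dom C (Pi f y')" "Pi f y' \<cdot> h = Pi f y"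
    by (auto simp: hom_slice h_def underlying_def)
  show "h \<in> Arr C" "Dom C h = Dom C (Pi f y)" "Cod C h = Dom C (Pi f y')" "Pi f y' \<cdot> h = Pi f y" by (fact 1)+
  show "FArr (dep_prod C f) (y, k, y') = (Pi f y, h, Pi f y')" by (fact h)
  show "Pi_ev f y' \<cdot> pair C f (Pi f y') (pr1 C f (Pi f y)) (h \<cdot> pr2 C f (Pi f y)) = k \<cdot> Pi_ev f y"
    using H2 unfolding h Pi_arr(7)[OF f''] by (simp add: base_change_def)
qed

lemma seq_shape_arr_facts:
  assumes [simp]: "P \<in> Arr C" "J \<in> Obj C"
  shows "seq_shape C P J \<in> Arr C" "Cod C (seq_shape C P J) = Cod C P" "seq_ev C P J \<in> Arr C"
    "Dom C (seq_ev C P J) = pb C P (seq_shape C P J)" "Cod C (seq_ev C P J) = J"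
    "seq_shape C P J = Pi P (pr1 C (bang C (Dom C P)) (bang C J))"
proof -
  let ?y = "pr1 C (bang C (Dom C P)) (bang C J)"
  have "seq_shape C P J = Pi P ?y" "seq_ev C P J = pr2 C (bang C (Dom C P)) (bang C J) \<cdot> Pi_ev P ?y"
    by (simp_all add: seq_shape_def seq_ev_def base_change_def Pi_ev_def)
  then show "seq_shape C P J \<in> Arr C" "Cod C (seq_shape C P J) = Cod C P" "seq_ev C P J \<in> Arr C"
    "Dom C (seq_ev C P J) = pb C P (seq_shape C P J)" "Cod C (seq_ev C P J) = J"
    "seq_shape C P J = Pi P ?y"
    using Pi_arr(1-5)[of P ?y] by simp_all
qed

text \<open>\<open>seq_shape\<close> is the dependent product of the projection to
  \<open>Dom C P\<close> from its product with \<open>J\<close>. An arrow into that product over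
  \<open>Dom C P\<close> is just an arrow to \<open>J\<close>, so the dependent product classifies
  arrows to \<open>J\<close> from pullbacks of \<open>P\<close>.\<close>

lemma shape_power:
  assumes [simp]: "P \<in> Arr C" "J \<in> Obj C"
  shows "D.is_power P J (seq_shape C P J) (pr1 C P (seq_shape C P J)) (pr2 C P (seq_shape C P J)) (seq_ev C P J)"
proof -
  let ?s = "seq_shape C P J" and ?b = "bang C (Dom C P)" and ?b' = "bang C J"
  let ?y = "pr1 C ?b ?b'"
  note s[simp] = seq_shape_arr_facts(1-5)[OF assms] and s6 = seq_shape_arr_facts(6)[OF assms]
  have y: "P \<in> Arr C" "?y \<in> Arr C" "Cod C ?y = Dom C P" by simp_all
  note ev[simp] = Pi_arr(3-5)[OF y, folded s6]
  have ev': "?y \<cdot> Pi_ev P ?y = pr1 C P ?s" using Pi_arr(6)[OF y] by (simp add: s6)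
  have se: "seq_ev C P J = pr2 C ?b ?b' \<cdot> Pi_ev P ?y" by (simp add: seq_ev_def base_change_def Pi_ev_def)
  show ?thesis
    unfolding D.is_power_def
  proof (intro conjI allI impI)
    show "D.mpb P ?s (pr1 C P ?s) (pr2 C P ?s)" by (rule chosen_mpb) simp_all
    fix \<phi> \<alpha> c g
    assume c: "D.mpb P \<phi> \<alpha> c" and g[simp]: "g \<in> Arr C" "Dom C g = Dom C c" "Cod C g = J"
    note [simp] = D.mpbD(2,3,4,6,8)[OF c]
    have [simp]: "Cod C \<phi> = Cod C P" "Cod C \<alpha> = Dom C P" using D.mpbD(5,7)[OF c] by simp_all
    \<comment> \<open>\<open>Pi_ev\<close> yields a pair and \<open>seq_ev\<close> its second
      component; the first component is forced to be \<alpha>.\<close>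
    have evp: "seq_ev C P J \<cdot> pair C P ?s \<alpha> (m \<cdot> c) = g \<longleftrightarrow> Pi_ev P ?y \<cdot> pair C P ?s \<alpha> (m \<cdot> c) = pair C ?b ?b' \<alpha> g"
      if m[simp]: "m \<in> Arr C" "Dom C m = Cod C c" "Cod C m = Dom C ?s" and sm: "?s \<cdot> m = \<phi>" for m
    proof -
      have e[simp]: "P \<cdot> \<alpha> = ?s \<cdot> (m \<cdot> c)" using precomp[OF sm, of c] D.mpbD(9)[OF c] by simp
      have 1: "?y \<cdot> (Pi_ev P ?y \<cdot> pair C P ?s \<alpha> (m \<cdot> c)) = \<alpha>"
        using precomp[OF ev', of "pair C P ?s \<alpha> (m \<cdot> c)"] by simp
      have 2: "seq_ev C P J \<cdot> pair C P ?s \<alpha> (m \<cdot> c) = pr2 C ?b ?b' \<cdot> (Pi_ev P ?y \<cdot> pair C P ?s \<alpha> (m \<cdot> c))"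
        by (simp add: se)
      show ?thesis
      proof
        assume "seq_ev C P J \<cdot> pair C P ?s \<alpha> (m \<cdot> c) = g"
        then show "Pi_ev P ?y \<cdot> pair C P ?s \<alpha> (m \<cdot> c) = pair C ?b ?b' \<alpha> g"
          using 1 2 by - (rule pb_eqI[of ?b ?b'], simp_all)
      next
        assume "Pi_ev P ?y \<cdot> pair C P ?s \<alpha> (m \<cdot> c) = pair C ?b ?b' \<alpha> g"
        then show "seq_ev C P J \<cdot> pair C P ?s \<alpha> (m \<cdot> c) = g"
          using 2 by simp
      qed
    qed
    show "\<exists>!m. D.transposes ?s (pr1 C P ?s) (pr2 C P ?s) (seq_ev C P J) \<phi> \<alpha> c m g"
    proof (rule ex_ex1I)
      obtain m where m[simp]: "m \<in> Arr C" "Dom C m = Cod C c" "Cod C m = Dom C ?s" and sm: "?s \<cdot> m = \<phi>"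
        and mk: "Pi_ev P ?y \<cdot> pair C P ?s \<alpha> (m \<cdot> c) = pair C ?b ?b' \<alpha> g"
        by (rule Pi_ex[OF y c, of "pair C ?b ?b' \<alpha> g", folded s6]) simp_all
      have e[simp]: "P \<cdot> \<alpha> = ?s \<cdot> (m \<cdot> c)" using precomp[OF sm, of c] D.mpbD(9)[OF c] by simp
      have "D.transposes ?s (pr1 C P ?s) (pr2 C P ?s) (seq_ev C P J) \<phi> \<alpha> c m g"
        by (rule D.transposesI[where m' = "pair C P ?s \<alpha> (m \<cdot> c)"]) (use evp[of m] mk sm in simp_all)
      then show "\<exists>m. D.transposes ?s (pr1 C P ?s) (pr2 C P ?s) (seq_ev C P J) \<phi> \<alpha> c m g" by blast
    next
      have *: "Pi_ev P ?y \<cdot> pair C P ?s \<alpha> (m \<cdot> c) = pair C ?b ?b' \<alpha> g"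
        if t: "D.transposes ?s (pr1 C P ?s) (pr2 C P ?s) (seq_ev C P J) \<phi> \<alpha> c m g" for m
      proof -
        obtain m' where m: "m \<in> Arr C" "Dom C m = Cod C c" "Cod C m = Cod C (pr2 C P ?s)" and sm: "?s \<cdot> m = \<phi>"
          and m': "m' \<in> Arr C" "Dom C m' = Dom C c" "Cod C m' = Dom C (pr2 C P ?s)" "pr2 C P ?s \<cdot> m' = m \<cdot> c"
            "pr1 C P ?s \<cdot> m' = \<alpha>" "seq_ev C P J \<cdot> m' = g"
          by (rule D.transposesE[OF t])
        note [simp] = m m'(1-3)
        have e[simp]: "P \<cdot> \<alpha> = ?s \<cdot> (m \<cdot> c)" using precomp[OF sm, of c] D.mpbD(9)[OF c] by simp
        have "m' = pair C P ?s \<alpha> (m \<cdot> c)"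
          by (rule pb_eqI[of P ?s]) (use m' in simp_all)
        then show ?thesis using evp[of m] m' sm by simp
      qed
      fix m1 m2
      assume t: "D.transposes ?s (pr1 C P ?s) (pr2 C P ?s) (seq_ev C P J) \<phi> \<alpha> c m1 g"
        "D.transposes ?s (pr1 C P ?s) (pr2 C P ?s) (seq_ev C P J) \<phi> \<alpha> c m2 g"
      have m: "m1 \<in> Arr C" "Dom C m1 = Cod C c" "Cod C m1 = Dom C ?s" "?s \<cdot> m1 = \<phi>"
        "m2 \<in> Arr C" "Dom C m2 = Cod C c" "Cod C m2 = Dom C ?s" "?s \<cdot> m2 = \<phi>"
        using t by (auto elim: D.transposesE)
      show "m1 = m2"
        by (rule Pi_unique[OF y c, folded s6]) (use m *[OF t(1)] *[OF t(2)] in simp_all)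
    qed
  qed simp_all
qed

text \<open>The factor \<open>Dom C P\<close> in the definition of \<open>seq_shape_arr\<close> is
  carried along unchanged, so after projection to the second component the action is composition
  with \<open>k\<close>.\<close>

lemma seq_shape_arr_transposes:
  assumes P[simp]: "P \<in> Arr C" and k[simp]: "k \<in> Arr C" and V: "Dom C k = V" "Cod C k = V'"
  shows "D.transposes (seq_shape C P V') (pr1 C P (seq_shape C P V')) (pr2 C P (seq_shape C P V')) (seq_ev C P V')
    (seq_shape C P V) (pr1 C P (seq_shape C P V)) (pr2 C P (seq_shape C P V)) (seq_shape_arr C P k) (k \<cdot> seq_ev C P V)"
proof -
  have o[simp]: "V \<in> Obj C" "V' \<in> Obj C" using V k dom_in cod_in by metis+
  let ?s = "seq_shape C P V" and ?s' = "seq_shape C P V'" and ?b = "bang C (Dom C P)" and ?b' = "bang C V" and ?b'' = "bang C V'"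
  let ?y = "pr1 C ?b ?b'" and ?y' = "pr1 C ?b ?b''"
  note [simp] = V
  note s[simp] = seq_shape_arr_facts(1-5)[OF P o(1)] seq_shape_arr_facts(1-5)[OF P o(2)]
    and s6 = seq_shape_arr_facts(6)[OF P o(1)] seq_shape_arr_facts(6)[OF P o(2)]
  have y: "P \<in> Arr C" "?y \<in> Arr C" "Cod C ?y = Dom C P" and y': "?y' \<in> Arr C" "Cod C ?y' = Dom C P" by simp_all
  note ev[simp] = Pi_arr(3-5)[OF y, folded s6] Pi_arr(3-5)[OF y(1) y', folded s6]
  let ?k = "pair C ?b ?b'' ?y (k \<cdot> pr2 C ?b ?b')"
  let ?h = "seq_shape_arr C P k"
  have h: "?h = underlying (FArr (dep_prod C P) (?y, ?k, ?y'))"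
    by (simp add: seq_shape_arr_def base_change_def)
  have k': "?k \<in> Arr C" "Dom C ?k = Dom C ?y" "Cod C ?k = Dom C ?y'" "?y' \<cdot> ?k = ?y"
    by (simp_all add: pr_eq)
  note H[simp] = Pi_map(1-3)[OF y y' k', folded h s6] and H4 = Pi_map(4)[OF y y' k', folded h s6] and H5 = Pi_map(5)[OF y y' k', folded h s6]
  have e[simp]: "P \<cdot> pr1 C P ?s = ?s' \<cdot> (?h \<cdot> pr2 C P ?s)"
    using precomp[OF H4, of "pr2 C P ?s"] pr_eq[of P ?s] by simp
  have se: "seq_ev C P V = pr2 C ?b ?b' \<cdot> Pi_ev P ?y" "seq_ev C P V' = pr2 C ?b ?b'' \<cdot> Pi_ev P ?y'"
    by (simp_all add: seq_ev_def base_change_def Pi_ev_def)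
  have "seq_ev C P V' \<cdot> pair C P ?s' (pr1 C P ?s) (?h \<cdot> pr2 C P ?s) = pr2 C ?b ?b'' \<cdot> (?k \<cdot> Pi_ev P ?y)"
    using H5 by (simp add: se del: pair_cmp)
  also have "\<dots> = k \<cdot> seq_ev C P V"
    using precomp[OF pair(5)[of ?b ?b'' ?y "k \<cdot> pr2 C ?b ?b'"], of "Pi_ev P ?y"]
    by (simp add: se del: pair_cmp)
  finally show ?thesis
    by (intro D.transposesI[where m' = "pair C P ?s' (pr1 C P ?s) (?h \<cdot> pr2 C P ?s)"]) (simp_all add: H4)
qed

end

section \<open>The sequential product as a power of containers\<close>

context lcc_category
begin

context notes [simp] = shape_simps
begin

text \<open>The restriction of \<open>X \<star> P\<close> along \<open>P\<close>: its shapes are the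
  \<open>(a, (i, f))\<close>, and the directions over such a shape are those of
  \<open>X \<star> P\<close> over \<open>(i, f)\<close>. It plays the role of \<open>n\<close> in
  \<open>is_power\<close>.\<close>

definition seq_base :: "'m \<Rightarrow> 'm \<Rightarrow> 'm \<times> 'm \<times> 'm \<times> 'm" where
  "seq_base P X = (let n = pr2 C P (seq_shape C P (Cod C X)); R = X \<star> P in
     (pr1 C n R, n, Idt C (pb C n R), R))"

text \<open>Evaluation at \<open>a\<close>: the shape \<open>(a, (i, f))\<close> goes to
  \<open>f a\<close>, and a direction \<open>b\<close> over \<open>f a\<close> goes back to the
  direction \<open>(a, b)\<close> of \<open>X \<star> P\<close>.\<close>

definition seq_counit :: "'m \<Rightarrow> 'm \<Rightarrow> 'm \<times> 'm \<times> 'm \<times> 'm" where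
  "seq_counit P X = (let n = pr2 C P (seq_shape C P (Cod C X)); R = X \<star> P; ev = seq_ev C P (Cod C X) in
     (pr1 C n R, ev, pair C n R (pr1 C ev X) (Idt C (pb C ev X)), X))"

lemmas seq_facts = seq_shape_arr_facts(1-5)

lemma seq_arr_facts[simp]:
  assumes [simp]: "P \<in> Arr C" "X \<in> Arr C"
  shows "X \<star> P \<in> Arr C" "Dom C (X \<star> P) = pb C (seq_ev C P (Cod C X)) X" "Cod C (X \<star> P) = Dom C (seq_shape C P (Cod C X))"
  by (simp_all add: seq_def seq_facts)

lemma seq_base:
  assumes P[simp]: "P \<in> Arr C" and X[simp]: "X \<in> Arr C"
  defines "n \<equiv> pr2 C P (seq_shape C P (Cod C X))"
  shows "seq_base P X \<in> Arr K" "Dom K (seq_base P X) = pr1 C n (X \<star> P)" "Cod K (seq_base P X) = X \<star> P"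
    "shape (seq_base P X) = n" "act (seq_base P X) t b = Idt C (pb C n (X \<star> P)) \<cdot> pair C n (X \<star> P) t b"
    "cartesian (seq_base P X) (pr2 C n (X \<star> P))"
proof -
  note [simp] = seq_facts[OF P cod_in[OF X]]
  have n[simp]: "n \<in> Arr C" "Dom C n = pb C P (seq_shape C P (Cod C X))" "Cod C n = Dom C (seq_shape C P (Cod C X))"
    by (simp_all add: n_def)
  have o[simp]: "pb C n (X \<star> P) \<in> Obj C" using dom_in[of "pr1 C n (X \<star> P)"] by simp
  have eq: "seq_base P X = (pr1 C n (X \<star> P), n, Idt C (pb C n (X \<star> P)), X \<star> P)"
    by (simp add: seq_base_def n_def Let_def)
  show 1: "seq_base P X \<in> Arr K"
    unfolding eq by (rule arr_K_I) simp_all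
  show 2: "Dom K (seq_base P X) = pr1 C n (X \<star> P)" "Cod K (seq_base P X) = X \<star> P" "shape (seq_base P X) = n"
    by (simp_all add: eq)
  show 3: "act (seq_base P X) t b = Idt C (pb C n (X \<star> P)) \<cdot> pair C n (X \<star> P) t b" for t b
    by (simp add: act_def eq)
  have "pair C n (X \<star> P) (pr1 C n (X \<star> P) \<cdot> a) (pr2 C n (X \<star> P) \<cdot> a) = a" if [simp]: "a \<in> Arr C" "Cod C a = pb C n (X \<star> P)" for a
    by (rule pb_eqI[of n "X \<star> P"]) (simp_all add: pr_eq')
  then show "cartesian (seq_base P X) (pr2 C n (X \<star> P))"
    unfolding cartesian_def 2 3 using 1 by (simp add: chosen_mpb pr_eq')
qed

lemma seq_counit:
  assumes P[simp]: "P \<in> Arr C" and X[simp]: "X \<in> Arr C"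
  defines "n \<equiv> pr2 C P (seq_shape C P (Cod C X))" and "ev \<equiv> seq_ev C P (Cod C X)"
  shows "seq_counit P X \<in> Arr K" "Dom K (seq_counit P X) = pr1 C n (X \<star> P)" "Cod K (seq_counit P X) = X"
    "shape (seq_counit P X) = ev"
    "t \<in> Arr C \<Longrightarrow> b \<in> Arr C \<Longrightarrow> Dom C t = Dom C b \<Longrightarrow> Cod C t = Dom C ev \<Longrightarrow> Cod C b = Dom C X \<Longrightarrow> ev \<cdot> t = X \<cdot> b \<Longrightarrow>
      act (seq_counit P X) t b = act (seq_base P X) t (pair C ev X t b)"
proof -
  note [simp] = seq_facts[OF P cod_in[OF X], folded ev_def]
  have n[simp]: "n \<in> Arr C" "Dom C n = pb C P (seq_shape C P (Cod C X))" "Cod C n = Dom C (seq_shape C P (Cod C X))"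
    by (simp_all add: n_def)
  note [simp] = seq_arr_facts[OF P X, folded ev_def]
  have R: "X \<star> P = n \<cdot> pr1 C ev X" by (simp add: seq_def n_def ev_def)
  have o[simp]: "pb C ev X \<in> Obj C" using dom_in[of "pr1 C ev X"] by simp
  have o[simp]: "pb C n (X \<star> P) \<in> Obj C" using dom_in[of "pr1 C n (X \<star> P)"] by simp
  have eq: "seq_counit P X = (pr1 C n (X \<star> P), ev, pair C n (X \<star> P) (pr1 C ev X) (Idt C (pb C ev X)), X)"
    by (simp add: seq_counit_def n_def ev_def Let_def)
  have nR[simp]: "n \<cdot> pr1 C ev X = X \<star> P" by (simp add: R)
  show "seq_counit P X \<in> Arr K"
    unfolding eq by (rule arr_K_I) simp_all
  show 2: "Dom K (seq_counit P X) = pr1 C n (X \<star> P)" "Cod K (seq_counit P X) = X" "shape (seq_counit P X) = ev"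
    by (simp_all add: eq)
  show "act (seq_counit P X) t b = act (seq_base P X) t (pair C ev X t b)"
    if [simp]: "t \<in> Arr C" "b \<in> Arr C" "Dom C t = Dom C b" "Cod C t = Dom C ev" "Cod C b = Dom C X" "ev \<cdot> t = X \<cdot> b"
  proof -
    have [simp]: "n \<cdot> t = (X \<star> P) \<cdot> pair C ev X t b" by (simp add: R del: nR)
    show ?thesis
      unfolding seq_base(5)[OF P X, folded n_def] by (simp add: act_def eq)
  qed
qed

text \<open>On directions transposition is pairing: evaluating \<open>m\<close> at \<open>a\<close>
  and acting on \<open>b\<close> is the action of \<open>m\<close> on the direction
  \<open>(a, b)\<close>.\<close>

lemma act_counit:
  assumes P[simp]: "P \<in> Arr C" and X[simp]: "X \<in> Arr C"
    and [simp]: "c \<in> Arr K" "m \<in> Arr K" "m' \<in> Arr K" "Dom K m = Cod K c" "Dom K m' = Dom K c" "Cod K m = X \<star> P"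
      "Cod K m' = Dom K (seq_base P X)" and eq: "seq_base P X \<cdot>\<^bsub>K\<^esub> m' = m \<cdot>\<^bsub>K\<^esub> c"
    and [simp]: "f \<in> Arr C" "b \<in> Arr C" "Dom C f = Dom C b" "Cod C f = Cod C (Dom K c)" "Cod C b = Dom C X"
    and e[simp]: "seq_ev C P (Cod C X) \<cdot> (shape m' \<cdot> f) = X \<cdot> b"
  shows "act (seq_counit P X \<cdot>\<^bsub>K\<^esub> m') f b = act c f (act m (shape c \<cdot> f) (pair C (seq_ev C P (Cod C X)) X (shape m' \<cdot> f) b))"
proof -
  note [simp] = seq_facts[OF P cod_in[OF X]] seq_base(1-4)[OF P X] seq_counit(1-4)[OF P X]
  let ?e = "shape m' \<cdot> f" and ?ev = "seq_ev C P (Cod C X)" and ?n = "pr2 C P (seq_shape C P (Cod C X))"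
  have R: "(X \<star> P) \<cdot> pair C ?ev X ?e b = ?n \<cdot> ?e" by (simp add: seq_def)
  have "shape (seq_base P X \<cdot>\<^bsub>K\<^esub> m') = shape (m \<cdot>\<^bsub>K\<^esub> c)" by (simp only: eq)
  then have "shape m \<cdot> shape c = ?n \<cdot> shape m'" by simp
  from precomp[OF this, of f] have mc: "shape m \<cdot> (shape c \<cdot> f) = ?n \<cdot> ?e" by simp
  have "act (seq_counit P X \<cdot>\<^bsub>K\<^esub> m') f b = act m' f (act (seq_counit P X) ?e b)" by simp
  also have "\<dots> = act m' f (act (seq_base P X) ?e (pair C ?ev X ?e b))" by (simp add: seq_counit(5)[OF P X])
  also have "\<dots> = act (seq_base P X \<cdot>\<^bsub>K\<^esub> m') f (pair C ?ev X ?e b)" by (simp add: R)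
  also have "\<dots> = act (m \<cdot>\<^bsub>K\<^esub> c) f (pair C ?ev X ?e b)" by (simp only: eq)
  also have "\<dots> = act c f (act m (shape c \<cdot> f) (pair C ?ev X ?e b))" by (simp add: R mc)
  finally show ?thesis .
qed

lemma seq_base_mpb:
  assumes P[simp]: "P \<in> Arr C" and X[simp]: "X \<in> Arr C"
  shows "KC.mpb P (seq_shape C P (Cod C X)) (pr1 C P (seq_shape C P (Cod C X))) (seq_base P X)"
  using cartesian_mpb[OF seq_base(6)[OF P X]] chosen_mpb[of P "seq_shape C P (Cod C X)"] seq_facts[OF P cod_in[OF X]]
  by (simp add: seq_base(4))

text \<open>Shapes are settled by \<open>shape_power\<close>. A direction of
  \<open>X \<star> P\<close> is a pair \<open>(a, b)\<close>, and a transpose of \<open>g\<close>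
  must send it to the direction that \<open>g\<close> at \<open>a\<close> assigns to
  \<open>b\<close>, so nothing is left to choose.\<close>

lemma seq_power:
  assumes P[simp]: "P \<in> Arr C" and X[simp]: "X \<in> Arr C"
  shows "KC.is_power P X (seq_shape C P (Cod C X)) (pr1 C P (seq_shape C P (Cod C X))) (seq_base P X) (seq_counit P X)"
proof -
  define s ev R where "s = seq_shape C P (Cod C X)" and "ev = seq_ev C P (Cod C X)" and "R = X \<star> P"
  define n0 where "n0 = pr2 C P s"
  note B = seq_base[OF P X, folded s_def R_def, folded n0_def] and CU = seq_counit[OF P X, folded s_def ev_def R_def, folded n0_def]
    and AC = act_counit[OF P X, folded ev_def R_def]
  note Bm = seq_base_mpb[OF P X, folded s_def]
  note [simp] = seq_facts[OF P cod_in[OF X], folded s_def ev_def] seq_arr_facts[OF P X, folded s_def ev_def R_def] B(1-4) CU(1-4)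
  have n0[simp]: "n0 \<in> Arr C" "Dom C n0 = pb C P s" "Cod C n0 = Dom C s" by (simp_all add: n0_def)
  have R: "R = n0 \<cdot> pr1 C ev X" by (simp add: seq_def n0_def s_def ev_def R_def)
  note SP = shape_power[OF P cod_in[OF X], folded s_def ev_def, folded n0_def]
  show ?thesis
    unfolding s_def[symmetric]
  proof (rule KC.powerI[OF Bm])
    fix Y \<phi>
    assume "Y \<in> Obj K" and [simp]: "\<phi> \<in> Arr C" "Dom C \<phi> = Cod C Y" "Cod C \<phi> = Cod C P"
    then have Y[simp]: "Y \<in> Arr C" by simp
    define q \<alpha> where "q = pr2 C P \<phi>" and "\<alpha> = pr1 C P \<phi>"
    have q[simp]: "q \<in> Arr C" "\<alpha> \<in> Arr C" "Dom C q = pb C P \<phi>" "Dom C \<alpha> = pb C P \<phi>" "Cod C q = Cod C Y" "Cod C \<alpha> = Dom C P"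
      by (simp_all add: q_def \<alpha>_def)
    have qb: "D.mpb P \<phi> \<alpha> q" unfolding q_def \<alpha>_def by (rule chosen_mpb) simp_all
    have pq: "P \<cdot> \<alpha> = \<phi> \<cdot> q" using D.mpbD(9)[OF qb] .
    define \<pi> x where "\<pi> = pr1 C q Y" and "x = pr2 C q Y"
    have \<pi>[simp]: "\<pi> \<in> Arr C" "x \<in> Arr C" "Dom C \<pi> = Dom C x" "Cod C \<pi> = pb C P \<phi>" "Cod C x = Dom C Y"
      by (simp_all add: \<pi>_def x_def)
    have pib: "D.mpb q Y \<pi> x" unfolding \<pi>_def x_def by (rule chosen_mpb) simp_all
    have Yx: "Y \<cdot> x = q \<cdot> \<pi>" using D.mpbD(9)[OF pib] by simp
    obtain c where c: "cartesian c x" and c1[simp]: "Dom K c = \<pi>" "Cod K c = Y" "shape c = q"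
      by (rule cartesian_ex[OF pib])
    note c0[simp] = cartesianD(1)[OF c] and ca = cartesianD(6)[OF c, simplified] and ac = cartesian_act[OF c, simplified]
    have cm: "KC.mpb P \<phi> \<alpha> c" by (rule cartesian_mpb[OF c]) (simp add: qb)
    have "\<exists>!m. KC.transposes s (pr1 C P s) (seq_base P X) (seq_counit P X) \<phi> \<alpha> c m g"
      if g[simp]: "g \<in> Arr K" "Dom K g = Dom K c" "Cod K g = X" for g
    proof -
      have g'[simp]: "shape g \<in> Arr C" "Dom C (shape g) = pb C P \<phi>" "Cod C (shape g) = Cod C X" by simp_all
      obtain m0 m0' where m0[simp]: "m0 \<in> Arr C" "Dom C m0 = Cod C Y" "Cod C m0 = Dom C s" and m02: "s \<cdot> m0 = \<phi>"
        and m0'[simp]: "m0' \<in> Arr C" "Dom C m0' = pb C P \<phi>" "Cod C m0' = pb C P s" and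
        m0'2: "n0 \<cdot> m0' = m0 \<cdot> q" "pr1 C P s \<cdot> m0' = \<alpha>" "ev \<cdot> m0' = shape g"
        by (rule D.power_ex[OF SP qb, of "shape g"]) simp_all
      \<comment> \<open>If \<open>d\<close> stands for \<open>((a, (i, f)), b)\<close>, a direction
        over \<open>m0 \<cdot> t\<close>, then \<open>F t d\<close> is \<open>(a, t)\<close>, the
        point at which \<open>g\<close> has to act on \<open>b\<close>.\<close>
      define F where "F t d = pair C P \<phi> (pr1 C P s \<cdot> (pr1 C ev X \<cdot> d)) t" for t d
      have elem: "F t d \<in> Arr C" "Dom C (F t d) = Dom C d" "Cod C (F t d) = pb C P \<phi>" "q \<cdot> F t d = t" "m0' \<cdot> F t d = pr1 C ev X \<cdot> d"
        "shape g \<cdot> F t d = X \<cdot> (pr2 C ev X \<cdot> d)" "m0 \<cdot> t = n0 \<cdot> (pr1 C ev X \<cdot> d)"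
        "y \<in> Arr C \<Longrightarrow> Cod C y = Dom C d \<Longrightarrow> F t d \<cdot> y = F (t \<cdot> y) (d \<cdot> y)"
        if t[simp]: "t \<in> Arr C" "d \<in> Arr C" "Dom C t = Dom C d" "Cod C t = Cod C Y" "Cod C d = pb C ev X" and td: "m0 \<cdot> t = R \<cdot> d" for t d y
      proof -
        have md: "m0 \<cdot> t = n0 \<cdot> (pr1 C ev X \<cdot> d)" using td by (simp add: R)
        then show "m0 \<cdot> t = n0 \<cdot> (pr1 C ev X \<cdot> d)" .
        have e[simp]: "P \<cdot> (pr1 C P s \<cdot> (pr1 C ev X \<cdot> d)) = \<phi> \<cdot> t"
          using pr_eq'[of P s "pr1 C ev X \<cdot> d"] md precomp[OF m02, of t] by (simp add: n0_def)
        show "F t d \<in> Arr C" "Dom C (F t d) = Dom C d" "Cod C (F t d) = pb C P \<phi>"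
          by (simp_all add: F_def)
        have qF: "q \<cdot> F t d = t" "\<alpha> \<cdot> F t d = pr1 C P s \<cdot> (pr1 C ev X \<cdot> d)"
          by (simp_all add: F_def q_def \<alpha>_def)
        then show "q \<cdot> F t d = t" by simp
        show mF: "m0' \<cdot> F t d = pr1 C ev X \<cdot> d"
          by (rule pb_eqI[of P s])
            (use qF md precomp[OF m0'2(1), of "F t d"] precomp[OF m0'2(2), of "F t d"] in \<open>simp_all add: F_def n0_def\<close>)
        show "shape g \<cdot> F t d = X \<cdot> (pr2 C ev X \<cdot> d)"
          using precomp[OF m0'2(3), of "F t d"] mF pr_eq'[of ev X d] by (simp add: F_def)
        show "F t d \<cdot> y = F (t \<cdot> y) (d \<cdot> y)" if "y \<in> Arr C" "Cod C y = Dom C d"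
          using that by (simp add: F_def)
      qed
      \<comment> \<open>The formula forced on the directions of every transpose. It proves
        uniqueness and dictates the arrow \<open>A\<close> in the existence part.\<close>
      have main: "act m t d = x \<cdot> act g (F t d) (pr2 C ev X \<cdot> d)"
        if m[simp]: "m \<in> Arr K" "Dom K m = Y" "Cod K m = R" "shape m = m0" and
          m'[simp]: "m' \<in> Arr K" "Dom K m' = \<pi>" "Cod K m' = pr1 C n0 R" "shape m' = m0'"
          and nm: "seq_base P X \<cdot>\<^bsub>K\<^esub> m' = m \<cdot>\<^bsub>K\<^esub> c" and eg: "seq_counit P X \<cdot>\<^bsub>K\<^esub> m' = g"
          and t[simp]: "t \<in> Arr C" "d \<in> Arr C" "Dom C t = Dom C d" "Cod C t = Cod C Y" "Cod C d = pb C ev X" and td: "m0 \<cdot> t = R \<cdot> d"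
        for m m' t d
      proof -
        note [simp] = elem(1-3)[OF t td] and el = elem(4-7)[OF t td]
        have pd: "pair C ev X (pr1 C ev X \<cdot> d) (pr2 C ev X \<cdot> d) = d"
          by (rule pb_eqI[of ev X]) (simp_all add: pr_eq')
        have "act g (F t d) (pr2 C ev X \<cdot> d) = act c (F t d) (act m t d)"
          using AC[of c m m' "F t d" "pr2 C ev X \<cdot> d"] nm eg el pd by (simp add: pr_eq')
        also have "x \<cdot> \<dots> = act m t d"
          by (rule ac) (use el td in simp_all)
        finally show ?thesis by simp
      qed
      show ?thesis
      proof (rule ex_ex1I)
        let ?t = "pr1 C m0 R" and ?d = "pr2 C m0 R"
        have td: "m0 \<cdot> ?t = R \<cdot> ?d" by (rule pr_eq) simp_all
        have t0: "?t \<in> Arr C" "?d \<in> Arr C" "Dom C ?t = Dom C ?d" "Cod C ?t = Cod C Y" "Cod C ?d = pb C ev X" by simp_all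
        note eg = elem[OF t0 td]
        note [simp] = eg(1-3)
        define A where "A = act g (F ?t ?d) (pr2 C ev X \<cdot> ?d)"
        have A[simp]: "A \<in> Arr C" "Dom C A = pb C m0 R" "Cod C A = Dom C x" and A4: "\<pi> \<cdot> A = F ?t ?d"
          using eg(6) by (simp_all add: A_def)
        have YD: "Y \<cdot> (x \<cdot> A) = ?t"
          using precomp[OF Yx, of A] A4 eg(4) by simp
        obtain m where m[simp]: "m \<in> Arr K" "Dom K m = Y" "Cod K m = R" "shape m = m0" and ma: "\<And>t b. act m t b = (x \<cdot> A) \<cdot> pair C m0 R t b"
          by (rule K_mk[of Y R m0 "x \<cdot> A"]) (use YD in simp_all)
        have ma': "act m t d = x \<cdot> act g (F t d) (pr2 C ev X \<cdot> d)"
          if t[simp]: "t \<in> Arr C" "d \<in> Arr C" "Dom C t = Dom C d" "Cod C t = Cod C Y" "Cod C d = pb C ev X" and td: "m0 \<cdot> t = R \<cdot> d"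
          for t d
        proof -
          have p: "pair C m0 R t d \<in> Arr C" "Dom C (pair C m0 R t d) = Dom C d" "Cod C (pair C m0 R t d) = pb C m0 R"
             "?t \<cdot> pair C m0 R t d = t" "?d \<cdot> pair C m0 R t d = d"
            using td by simp_all
          have "A \<cdot> pair C m0 R t d = act g (F ?t ?d \<cdot> pair C m0 R t d) ((pr2 C ev X \<cdot> ?d) \<cdot> pair C m0 R t d)"
            unfolding A_def by (rule act_simps(5)) (use eg(6) p(1-3) in simp_all)
          also have "F ?t ?d \<cdot> pair C m0 R t d = F t d"
            using eg(8)[of "pair C m0 R t d"] p by simp
          also have "(pr2 C ev X \<cdot> ?d) \<cdot> pair C m0 R t d = pr2 C ev X \<cdot> d"
            using p by simp
          finally show ?thesis
            unfolding ma using p(1-3) by simp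
        qed
        obtain m' where m'[simp]: "m' \<in> Arr K" "Dom K m' = \<pi>" "Cod K m' = pr1 C n0 R" and m'2: "seq_base P X \<cdot>\<^bsub>K\<^esub> m' = m \<cdot>\<^bsub>K\<^esub> c" "pr1 C P s \<cdot> shape m' = \<alpha>"
          by (rule KC.mpb_lift[OF Bm, of "m \<cdot>\<^bsub>K\<^esub> c" \<alpha>]) (use pq precomp[OF m02, of q] in simp_all)
        have "shape (seq_base P X \<cdot>\<^bsub>K\<^esub> m') = shape (m \<cdot>\<^bsub>K\<^esub> c)" by (simp only: m'2)
        then have n0m: "n0 \<cdot> shape m' = m0 \<cdot> q" by simp
        have [simp]: "shape m' = m0'"
          by (rule pb_eqI[of P s]) (use n0m m'2 m0'2 in \<open>simp_all add: n0_def\<close>)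
        have "seq_counit P X \<cdot>\<^bsub>K\<^esub> m' = g"
        proof (rule K_ext[of _ _ \<pi> X "shape g"])
          fix f b
          assume f[simp]: "f \<in> Arr C" "b \<in> Arr C" "Dom C f = Dom C b" "Cod C f = Cod C \<pi>" "Cod C b = Dom C X" and fb: "shape g \<cdot> f = X \<cdot> b"
          have evb: "ev \<cdot> (m0' \<cdot> f) = X \<cdot> b" using precomp[OF m0'2(3), of f] fb by simp
          let ?d = "pair C ev X (m0' \<cdot> f) b"
          have d: "?d \<in> Arr C" "Dom C ?d = Dom C b" "Cod C ?d = pb C ev X" "pr1 C ev X \<cdot> ?d = m0' \<cdot> f" "pr2 C ev X \<cdot> ?d = b"
            using evb by simp_all
          have td: "m0 \<cdot> (q \<cdot> f) = R \<cdot> ?d" using d precomp[OF m0'2(1), of f] by (simp add: R)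
          have af: "pr1 C P s \<cdot> (pr1 C ev X \<cdot> ?d) = \<alpha> \<cdot> f" unfolding d(4) using precomp[OF m0'2(2), of f] by simp
          have Paf: "P \<cdot> (\<alpha> \<cdot> f) = \<phi> \<cdot> (q \<cdot> f)" using precomp[OF pq, of f] by simp
          have "pair C P \<phi> (\<alpha> \<cdot> f) (q \<cdot> f) = f"
            by (rule pb_eqI[of P \<phi>, folded \<alpha>_def q_def]) (use Paf pair(4,5)[of P \<phi> "\<alpha> \<cdot> f" "q \<cdot> f", folded \<alpha>_def q_def] in simp_all)
          then have Ff: "F (q \<cdot> f) ?d = f" unfolding F_def af .
          have "act (seq_counit P X \<cdot>\<^bsub>K\<^esub> m') f b = act c f (act m (q \<cdot> f) ?d)"
            using AC[of c m m' f b] m'2 evb by simp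
          also have "\<dots> = act c f (x \<cdot> act g f b)"
            using ma'[of "q \<cdot> f" ?d] d td Ff by simp
          also have "\<dots> = act g f b"
            using ca[of "act g f b"] fb by simp
          finally show "act (seq_counit P X \<cdot>\<^bsub>K\<^esub> m') f b = act g f b" .
        qed (simp_all add: m0'2)
        then have "KC.transposes s (pr1 C P s) (seq_base P X) (seq_counit P X) \<phi> \<alpha> c m g"
          using m'2 m02 by (intro KC.transposesI[where m' = m']) simp_all
        then show "\<exists>m. KC.transposes s (pr1 C P s) (seq_base P X) (seq_counit P X) \<phi> \<alpha> c m g" by blast
      next
        \<comment> \<open>By uniqueness for the power of shapes every transpose has shape part
          \<open>m0\<close> with evaluation \<open>m0'\<close>, so \<open>main\<close> applies to
          it.\<close>
        have T: "m \<in> Arr K \<and> Dom K m = Y \<and> Cod K m = R \<and> shape m = m0 \<and> (\<exists>m'. m' \<in> Arr K \<and> Dom K m' = \<pi> \<and> Cod K m' = pr1 C n0 R \<and>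
            shape m' = m0' \<and> seq_base P X \<cdot>\<^bsub>K\<^esub> m' = m \<cdot>\<^bsub>K\<^esub> c \<and> seq_counit P X \<cdot>\<^bsub>K\<^esub> m' = g)"
          if t: "KC.transposes s (pr1 C P s) (seq_base P X) (seq_counit P X) \<phi> \<alpha> c m g" for m
        proof -
          obtain m' where m: "m \<in> Arr K" "Dom K m = Cod K c" "Cod K m = Cod K (seq_base P X)" and sm: "s \<cdot> shape m = \<phi>"
            and m': "m' \<in> Arr K" "Dom K m' = Dom K c" "Cod K m' = Dom K (seq_base P X)"
            and nm: "seq_base P X \<cdot>\<^bsub>K\<^esub> m' = m \<cdot>\<^bsub>K\<^esub> c" and am: "pr1 C P s \<cdot> shape m' = \<alpha>" and eg: "seq_counit P X \<cdot>\<^bsub>K\<^esub> m' = g"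
            by (rule KC.transposesE[OF t])
          note [simp] = m m'
          have "shape (seq_base P X \<cdot>\<^bsub>K\<^esub> m') = shape (m \<cdot>\<^bsub>K\<^esub> c)" by (simp only: nm)
          then have n0m: "n0 \<cdot> shape m' = shape m \<cdot> q" by simp
          have "shape (seq_counit P X \<cdot>\<^bsub>K\<^esub> m') = shape g" by (simp only: eg)
          then have em: "ev \<cdot> shape m' = shape g" by simp
          have s: "shape m = m0"
            by (rule D.power_unique[OF SP qb, of _ "shape m'" _ m0']) (use sm m02 m0'2 n0m am em in simp_all)
          moreover have "shape m' = m0'"
            by (rule pb_eqI[of P s]) (use n0m am m0'2 s in \<open>simp_all add: n0_def\<close>)
          ultimately show ?thesis using nm eg by (intro conjI exI[of _ m']) simp_all
        qed
        fix m1 m2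
        assume t: "KC.transposes s (pr1 C P s) (seq_base P X) (seq_counit P X) \<phi> \<alpha> c m1 g"
          "KC.transposes s (pr1 C P s) (seq_base P X) (seq_counit P X) \<phi> \<alpha> c m2 g"
        note T1 = T[OF t(1)] and T2 = T[OF t(2)]
        show "m1 = m2"
        proof (rule K_ext[of _ _ Y R m0])
          fix t d
          assume a: "t \<in> Arr C" "d \<in> Arr C" "Dom C t = Dom C d" "Cod C t = Cod C Y" "Cod C d = Dom C R" "m0 \<cdot> t = R \<cdot> d"
          have "Cod C d = pb C ev X" using a(5) by simp
          note a' = a(1-4) this a(6)
          have "act m1 t d = x \<cdot> act g (F t d) (pr2 C ev X \<cdot> d)"
            using T1 main[OF _ _ _ _ _ _ _ _ _ _ a'] by blast
          moreover have "act m2 t d = x \<cdot> act g (F t d) (pr2 C ev X \<cdot> d)"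
            using T2 main[OF _ _ _ _ _ _ _ _ _ _ a'] by blast
          ultimately show "act m1 t d = act m2 t d" by simp
        qed (use T1 T2 in simp_all)
      qed
    qed
    then show "\<exists>\<alpha> c. KC.mpb P \<phi> \<alpha> c \<and> Cod K c = Y \<and> (\<forall>g. g \<in> Arr K \<longrightarrow> Dom K g = Dom K c \<longrightarrow> Cod K g = X \<longrightarrow>
        (\<exists>!m. KC.transposes s (pr1 C P s) (seq_base P X) (seq_counit P X) \<phi> \<alpha> c m g))"
      using cm by (intro exI[of _ \<alpha>] exI[of _ c]) simp
  qed simp_all
qed

text \<open>Shows that the elementwise formula of \<open>seq_arr\<close> is the action induced by
  the power, so that functoriality and the preservation of pullbacks, proved for abstract powers,
  hold for it.\<close>

lemma seq_arr_transposes: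
  assumes P[simp]: "P \<in> Arr C" and k[simp]: "k \<in> Arr K" and X: "Dom K k = X" and X': "Cod K k = X'"
  shows "KC.transposes (seq_shape C P (Cod C X')) (pr1 C P (seq_shape C P (Cod C X'))) (seq_base P X') (seq_counit P X')
    (seq_shape C P (Cod C X)) (pr1 C P (seq_shape C P (Cod C X))) (seq_base P X) (seq_arr C P k) (k \<cdot>\<^bsub>K\<^esub> seq_counit P X)"
    and "shape (seq_arr C P k) = seq_shape_arr C P (shape k)"
proof -
  have XX[simp]: "X \<in> Arr C" "X' \<in> Arr C" using X X' arr_K[OF k] by simp_all
  define s ev R n where "s = seq_shape C P (Cod C X)" and "ev = seq_ev C P (Cod C X)" and "R = X \<star> P" and "n = pr2 C P s"
  define s' ev' R' n' where "s' = seq_shape C P (Cod C X')" and "ev' = seq_ev C P (Cod C X')" and "R' = X' \<star> P" and "n' = pr2 C P s'"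
  note D1 = s_def[symmetric] ev_def[symmetric] R_def[symmetric] n_def[symmetric]
  note D2 = s'_def[symmetric] ev'_def[symmetric] R'_def[symmetric] n'_def[symmetric]
  note [simp] = X X' seq_facts[OF P cod_in[OF XX(1)], unfolded D1] seq_facts[OF P cod_in[OF XX(2)], unfolded D2]
    seq_arr_facts[OF P XX(1), unfolded D1] seq_arr_facts[OF P XX(2), unfolded D2]
    seq_base(1-4)[OF P XX(1), unfolded D1] seq_base(1-4)[OF P XX(2), unfolded D2]
    seq_counit(1-4)[OF P XX(1), unfolded D1] seq_counit(1-4)[OF P XX(2), unfolded D2]
  have n[simp]: "n \<in> Arr C" "Dom C n = pb C P s" "Cod C n = Dom C s" "n' \<in> Arr C" "Dom C n' = pb C P s'" "Cod C n' = Dom C s'"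
    by (simp_all add: n_def n'_def)
  have R: "R = n \<cdot> pr1 C ev X" and R': "R' = n' \<cdot> pr1 C ev' X'" by (simp_all add: seq_def R_def R'_def n_def n'_def s_def s'_def ev_def ev'_def)
  define \<phi> h where "\<phi> = shape k" and "h = seq_shape_arr C P \<phi>"
  have \<phi>[simp]: "\<phi> \<in> Arr C" "Dom C \<phi> = Cod C X" "Cod C \<phi> = Cod C X'" "shape k = \<phi>" by (simp_all add: \<phi>_def)
  obtain m0 where h[simp]: "h \<in> Arr C" "Dom C h = Dom C s" "Cod C h = Dom C s'" and sh: "s' \<cdot> h = s"
    and m0[simp]: "m0 \<in> Arr C" "Dom C m0 = pb C P s" "Cod C m0 = pb C P s'" and m02: "n' \<cdot> m0 = h \<cdot> n" "pr1 C P s' \<cdot> m0 = pr1 C P s"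
    "ev' \<cdot> m0 = \<phi> \<cdot> ev"
    by (rule D.transposesE[OF seq_shape_arr_transposes[OF P \<phi>(1-3), unfolded D1 D2, folded h_def n_def n'_def]]) simp
  define \<tau> d where "\<tau> = pr1 C h R'" and "d = pr2 C h R'"
  have \<tau>[simp]: "\<tau> \<in> Arr C" "d \<in> Arr C" "Dom C \<tau> = pb C h R'" "Dom C d = pb C h R'" "Cod C \<tau> = Dom C s" "Cod C d = pb C ev' X'"
    by (simp_all add: \<tau>_def d_def)
  have hd: "h \<cdot> \<tau> = R' \<cdot> d" unfolding \<tau>_def d_def by (rule pr_eq) simp_all
  define e' b where "e' = pr1 C ev' X' \<cdot> d" and "b = pr2 C ev' X' \<cdot> d"
  have e'[simp]: "e' \<in> Arr C" "b \<in> Arr C" "Dom C e' = pb C h R'" "Dom C b = pb C h R'" "Cod C e' = pb C P s'" "Cod C b = Dom C X'"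
    by (simp_all add: e'_def b_def)
  have ht: "h \<cdot> \<tau> = n' \<cdot> e'" using hd by (simp add: R' e'_def)
  have eb: "ev' \<cdot> e' = X' \<cdot> b" by (simp add: e'_def b_def pr_eq')
  define as where "as = pair C P s (pr1 C P s' \<cdot> e') \<tau>"
  have Pe: "P \<cdot> (pr1 C P s' \<cdot> e') = s \<cdot> \<tau>"
    using pr_eq'[of P s' e'] ht precomp[OF sh, of \<tau>] by (simp add: n'_def)
  have as[simp]: "as \<in> Arr C" "Dom C as = pb C h R'" "Cod C as = pb C P s" and as2: "pr1 C P s \<cdot> as = pr1 C P s' \<cdot> e'" "n \<cdot> as = \<tau>"
    using Pe by (simp_all add: as_def n_def)
  have mas: "m0 \<cdot> as = e'"
    by (rule pb_eqI[of P s'], unfold n'_def[symmetric])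
      (use as2 ht precomp[OF m02(1), of as] precomp[OF m02(2), of as] in simp_all)
  have pas: "\<phi> \<cdot> (ev \<cdot> as) = X' \<cdot> b"
    using precomp[OF m02(3), of as] mas eb by simp
  define A where "A = act k (ev \<cdot> as) b"
  have A[simp]: "A \<in> Arr C" "Dom C A = pb C h R'" "Cod C A = Dom C X" and XA: "X \<cdot> A = ev \<cdot> as"
    using pas by (simp_all add: A_def)
  define \<psi> where "\<psi> = pair C ev X as A"
  have \<psi>[simp]: "\<psi> \<in> Arr C" "Dom C \<psi> = pb C h R'" "Cod C \<psi> = pb C ev X" and \<psi>1: "pr1 C ev X \<cdot> \<psi> = as"
    using XA by (simp_all add: \<psi>_def)
  have "seq_arr C P k = seq_arr C P (X, \<phi>, dirs k, X')"
    using arr_K(10)[OF k, unfolded X X' \<phi>(4)] by (rule arg_cong)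
  then have S: "seq_arr C P k = (R, h, \<psi>, R')"
    by (simp add: seq_arr_def Let_def D1 D2 h_def[symmetric] \<psi>_def A_def act_def as_def e'_def b_def d_def[symmetric] \<tau>_def[symmetric]
      del: assoc pair_cmp)
  have R\<psi>: "R \<cdot> \<psi> = \<tau>" using \<psi>1 as2 by (simp add: R)
  have a[simp]: "seq_arr C P k \<in> Arr K" "Dom K (seq_arr C P k) = R" "Cod K (seq_arr C P k) = R'" "shape (seq_arr C P k) = h"
    unfolding S using R\<psi> by (auto intro!: arr_K_I simp: \<tau>_def)
  show "shape (seq_arr C P k) = seq_shape_arr C P (shape k)" by (simp add: h_def)
  \<comment> \<open>Elementwise: with \<open>f\<close> standing for a point
    \<open>(a, \<sigma>)\<close>, the direction \<open>(a, c)\<close> of \<open>X' \<star> P\<close>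
    goes back to \<open>(a, c')\<close>, where \<open>c'\<close> is what \<open>k\<close> makes of
    \<open>c\<close> at the value of \<sigma> in \<open>a\<close>.\<close>
  have on_pair: "act (seq_arr C P k) (n \<cdot> f) (pair C ev' X' (m0 \<cdot> f) c) = pair C ev X f (act k (ev \<cdot> f) c)"
    if f[simp]: "f \<in> Arr C" "c \<in> Arr C" "Dom C f = Dom C c" "Cod C f = pb C P s" "Cod C c = Dom C X'" and fc: "\<phi> \<cdot> (ev \<cdot> f) = X' \<cdot> c" for f c
  proof -
    have ec: "ev' \<cdot> (m0 \<cdot> f) = X' \<cdot> c" using precomp[OF m02(3), of f] fc by simp
    let ?dd = "pair C ev' X' (m0 \<cdot> f) c"
    have dd: "?dd \<in> Arr C" "Dom C ?dd = Dom C c" "Cod C ?dd = pb C ev' X'" "pr1 C ev' X' \<cdot> ?dd = m0 \<cdot> f" "pr2 C ev' X' \<cdot> ?dd = c"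
      using ec by simp_all
    have hn: "h \<cdot> (n \<cdot> f) = R' \<cdot> ?dd" using dd precomp[OF m02(1), of f] by (simp add: R')
    let ?x = "pair C h R' (n \<cdot> f) ?dd"
    have x: "?x \<in> Arr C" "Dom C ?x = Dom C c" "Cod C ?x = pb C h R'" "\<tau> \<cdot> ?x = n \<cdot> f" "d \<cdot> ?x = ?dd"
      using hn dd by (simp_all add: \<tau>_def d_def)
    have ex: "e' \<cdot> ?x = m0 \<cdot> f" "b \<cdot> ?x = c" using x dd by (simp_all add: e'_def b_def)
    have "as \<cdot> ?x = f"
      by (rule pb_eqI[of P s], unfold n_def[symmetric])
        (use x(1-4) ex precomp[OF as2(1), of ?x] precomp[OF as2(2), of ?x] precomp[OF m02(2), of f] in simp_all)
    moreover have "A \<cdot> ?x = act k ((ev \<cdot> as) \<cdot> ?x) (b \<cdot> ?x)"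
      unfolding A_def by (rule act_simps(5)) (use pas x(1-3) in simp_all)
    ultimately have "A \<cdot> ?x = act k (ev \<cdot> f) c" using ex x(1-3) by simp
    moreover have "act (seq_arr C P k) (n \<cdot> f) ?dd = \<psi> \<cdot> ?x"
      by (simp add: act_def S)
    moreover have "\<psi> \<cdot> ?x = pair C ev X (as \<cdot> ?x) (A \<cdot> ?x)"
      unfolding \<psi>_def by (rule pair_cmp) (use x(1-3) XA in simp_all)
    ultimately show ?thesis using \<open>as \<cdot> ?x = f\<close> by simp
  qed
  have Ps: "P \<cdot> pr1 C P s = s' \<cdot> (h \<cdot> n)"
    using precomp[OF sh, of n] pr_eq[of P s] by (simp add: n_def)
  obtain m' where m'[simp]: "m' \<in> Arr K" "Dom K m' = pr1 C n R" "Cod K m' = pr1 C n' R'"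
    and m'2: "seq_base P X' \<cdot>\<^bsub>K\<^esub> m' = seq_arr C P k \<cdot>\<^bsub>K\<^esub> seq_base P X" "pr1 C P s' \<cdot> shape m' = pr1 C P s"
    by (rule KC.mpb_lift[OF seq_base_mpb[OF P XX(2), unfolded D2], of "seq_arr C P k \<cdot>\<^bsub>K\<^esub> seq_base P X" "pr1 C P s"])
      (use Ps in simp_all)
  have "shape (seq_base P X' \<cdot>\<^bsub>K\<^esub> m') = shape (seq_arr C P k \<cdot>\<^bsub>K\<^esub> seq_base P X)" by (simp only: m'2)
  then have nm: "n' \<cdot> shape m' = h \<cdot> n" by simp
  have sm[simp]: "shape m' = m0"
    by (rule pb_eqI[of P s'], unfold n'_def[symmetric]) (use nm m'2 m02 in simp_all)
  have "seq_counit P X' \<cdot>\<^bsub>K\<^esub> m' = k \<cdot>\<^bsub>K\<^esub> seq_counit P X"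
  proof (rule K_ext[of _ _ "pr1 C n R" X' "\<phi> \<cdot> ev"])
    fix f c
    assume f[simp]: "f \<in> Arr C" "c \<in> Arr C" "Dom C f = Dom C c" and "Cod C f = Cod C (pr1 C n R)" and c[simp]: "Cod C c = Dom C X'"
      and "(\<phi> \<cdot> ev) \<cdot> f = X' \<cdot> c"
    then have f2[simp]: "Cod C f = pb C P s" and fc: "\<phi> \<cdot> (ev \<cdot> f) = X' \<cdot> c" by simp_all
    have ec: "ev' \<cdot> (m0 \<cdot> f) = X' \<cdot> c" using precomp[OF m02(3), of f] fc by simp
    have "act (seq_counit P X' \<cdot>\<^bsub>K\<^esub> m') f c = act (seq_base P X) f (act (seq_arr C P k) (n \<cdot> f) (pair C ev' X' (m0 \<cdot> f) c))"
      using act_counit[OF P XX(2), of "seq_base P X" "seq_arr C P k" m' f c, unfolded D2] m'2(1) ec by simp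
    also have "\<dots> = act (seq_base P X) f (pair C ev X f (act k (ev \<cdot> f) c))"
      using on_pair[OF f f2 c fc] by simp
    also have "\<dots> = act (seq_counit P X) f (act k (ev \<cdot> f) c)"
      using seq_counit(5)[OF P XX(1), of f "act k (ev \<cdot> f) c", unfolded D1] fc by simp
    also have "\<dots> = act (k \<cdot>\<^bsub>K\<^esub> seq_counit P X) f c"
      using fc by simp
    finally show "act (seq_counit P X' \<cdot>\<^bsub>K\<^esub> m') f c = act (k \<cdot>\<^bsub>K\<^esub> seq_counit P X) f c" .
  qed (use m02 in simp_all)
  then show "KC.transposes (seq_shape C P (Cod C X')) (pr1 C P (seq_shape C P (Cod C X'))) (seq_base P X') (seq_counit P X')
    (seq_shape C P (Cod C X)) (pr1 C P (seq_shape C P (Cod C X))) (seq_base P X) (seq_arr C P k) (k \<cdot>\<^bsub>K\<^esub> seq_counit P X)"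
    unfolding D1 D2 using m'2 sh by (intro KC.transposesI[where m' = m']) simp_all
qed

text \<open>The strictness required by the locale holds because \<open>seq_base\<close>,
  \<open>seq_counit\<close> and \<open>seq_arr\<close> have the data of the power of shapes as their
  shape components.\<close>

lemma two_powers:
  assumes P: "P \<in> Arr C"
  shows "two_powers K C (Cod C) shape P (seq_shape C P) (\<lambda>J. pr1 C P (seq_shape C P J)) (\<lambda>J. pr2 C P (seq_shape C P J))
    (seq_ev C P) (seq_shape_arr C P) (seq_base P) (seq_counit P) (seq_arr C P)"
proof -
  interpret KK: category K by (rule category_K)
  show ?thesis
    by unfold_locales
      (use P shape_power seq_shape_arr_transposes seq_power seq_arr_transposes seq_base(4) seq_counit(4) in simp_all)
qed

section \<open>Classifying objects of container morphisms\<close>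

lemma D_mpb_sym:
  assumes 1: "D.mpb v u t c"
  shows "D.mpb u v c t"
proof -
  note [simp] = D.mpbD(1-4)[OF 1]
  have [simp]: "Cod C u = Cod C v" "Cod C t = Dom C v" "Cod C c = Dom C u" "Dom C t = Dom C c" using D.mpbD(5-8)[OF 1] by simp_all
  show ?thesis
  proof (rule D.mpbI)
    fix y s
    assume [simp]: "y \<in> Arr C" "s \<in> Arr C" "Cod C y = Cod C t" "Dom C s = Dom C y" "Cod C s = Dom C u" and eq: "u \<cdot> s = v \<cdot> y"
    obtain z where "z \<in> Arr C" "Dom C z = Dom C s" "Cod C z = Dom C c" "c \<cdot> z = s" "t \<cdot> z = y"
      by (rule D.mpb_lift[OF 1, of s y]) (use eq in simp_all)
    then show "\<exists>z. z \<in> Arr C \<and> Dom C z = Dom C y \<and> Cod C z = Dom C t \<and> t \<cdot> z = y \<and> c \<cdot> z = s"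
      by (intro exI[of _ z]) simp
  next
    fix z z'
    assume "z \<in> Arr C" "z' \<in> Arr C" "Dom C z = Dom C z'" "Cod C z = Dom C t" "Cod C z' = Dom C t" "t \<cdot> z = t \<cdot> z'" "c \<cdot> z = c \<cdot> z'"
    then show "z = z'" by - (rule D.mpb_unique[OF 1], simp_all)
  qed (use D.mpbD(9)[OF 1] in simp_all)
qed

text \<open>A cartesian \<open>c0\<close> over the same shape map is a pullback of the same data, so
  it differs from \<open>c\<close> by an isomorphism \<open>i\<close>, \<open>j\<close>. The shape
  parts of \<open>i\<close> and \<open>j\<close> are identities, hence the direction map
  \<open>m\<close> is invertible and carries cartesianness from \<open>c0\<close> to
  \<open>c\<close>.\<close>

lemma mpb_cartesian:
  assumes 1: "KC.mpb v u t c"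
  obtains x where "cartesian c x"
proof -
  note d[simp] = KC.mpbD(1-8)[OF 1]
  define \<pi> P f where "\<pi> = Dom K c" and "P = Cod K c" and "f = shape c"
  have P[simp]: "P \<in> Arr C" "\<pi> \<in> Arr C" "Dom K c = \<pi>" "Cod K c = P" "shape c = f" by (simp_all add: P_def \<pi>_def f_def)
  have f[simp]: "f \<in> Arr C" "Dom C f = Cod C \<pi>" "Cod C f = Cod C P" using arr_K(3-5)[OF d(4)] by simp_all
  define \<pi>0 x0 where "\<pi>0 = pr1 C f P" and "x0 = pr2 C f P"
  have D: "D.mpb f P \<pi>0 x0" unfolding \<pi>0_def x0_def by (rule chosen_mpb) simp_all
  have \<pi>0[simp]: "\<pi>0 \<in> Arr C" "x0 \<in> Arr C" "Cod C \<pi>0 = Cod C \<pi>" "Cod C x0 = Dom C P" "Dom C x0 = Dom C \<pi>0" by (simp_all add: \<pi>0_def x0_def)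
  obtain c0 where c0: "cartesian c0 x0" and c01[simp]: "Dom K c0 = \<pi>0" "Cod K c0 = P" "shape c0 = f"
    by (rule cartesian_ex[OF D])
  note [simp] = cartesianD(1)[OF c0] and ca = cartesianD(6)[OF c0, simplified]
  have "D.mpb v u t (shape c0)" using shape_mpb[OF 1] by simp
  then have 0: "KC.mpb v u t c0" by (rule cartesian_mpb[OF c0])
  obtain i j where i[simp]: "i \<in> Arr K" "Dom K i = \<pi>" "Cod K i = \<pi>0" and i2: "c0 \<cdot>\<^bsub>K\<^esub> i = c" "t \<cdot> shape i = t"
    and j[simp]: "j \<in> Arr K" "Dom K j = \<pi>0" "Cod K j = \<pi>" and j2: "c \<cdot>\<^bsub>K\<^esub> j = c0" "t \<cdot> shape j = t"
    and ji: "j \<cdot>\<^bsub>K\<^esub> i = Idt K \<pi>" and ij: "i \<cdot>\<^bsub>K\<^esub> j = Idt K \<pi>0"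
    by (rule KC.mpb_iso2[OF 1 0]) simp_all
  have ident: "g = Idt C (Cod C \<pi>)"
    if "g \<in> Arr C" "Dom C g = Cod C \<pi>" "Cod C g = Cod C \<pi>" "f \<cdot> g = f" "t \<cdot> g = t" for g
    by (rule D.mpb_unique[OF shape_mpb[OF 1, simplified]]) (use that in simp_all)
  have "shape (c0 \<cdot>\<^bsub>K\<^esub> i) = f" "shape (c \<cdot>\<^bsub>K\<^esub> j) = f" by (simp_all only: i2 j2 P c01)
  then have "f \<cdot> shape i = f" "f \<cdot> shape j = f" by simp_all
  then have sij[simp]: "shape i = Idt C (Cod C \<pi>)" "shape j = Idt C (Cod C \<pi>)"
    using i2(2) j2(2) by (simp_all add: ident)
  define m where "m = act j \<pi> (Idt C (Dom C \<pi>))"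
  have m[simp]: "m \<in> Arr C" "Dom C m = Dom C \<pi>" "Cod C m = Dom C \<pi>0" and pm: "\<pi>0 \<cdot> m = \<pi>" by (simp_all add: m_def)
  have ma: "m \<cdot> a = act j (\<pi> \<cdot> a) a" if "a \<in> Arr C" "Cod C a = Dom C \<pi>" for a using that by (simp add: m_def)
  have ima: "act i (\<pi> \<cdot> a) (m \<cdot> a) = a" if [simp]: "a \<in> Arr C" "Cod C a = Dom C \<pi>" for a
  proof -
    have "act i (\<pi> \<cdot> a) (m \<cdot> a) = act (j \<cdot>\<^bsub>K\<^esub> i) (\<pi> \<cdot> a) a" unfolding ma[OF that] by simp
    then show ?thesis by (simp add: ji)
  qed
  have mia: "m \<cdot> act i (\<pi>0 \<cdot> a) a = a" if [simp]: "a \<in> Arr C" "Cod C a = Dom C \<pi>0" for a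
  proof -
    have "m \<cdot> act i (\<pi>0 \<cdot> a) a = act (i \<cdot>\<^bsub>K\<^esub> j) (\<pi>0 \<cdot> a) a" by (simp add: ma)
    then show ?thesis by (simp add: ij)
  qed
  have px: "P \<cdot> x0 = f \<cdot> \<pi>0" using D.mpbD(9)[OF D] by simp
  have "cartesian c (x0 \<cdot> m)"
    unfolding cartesian_def
  proof (intro conjI allI impI)
    show "D.mpb (shape c) (Cod K c) (Dom K c) (x0 \<cdot> m)"
    proof (rule D.mpbI)
      show "shape c \<cdot> Dom K c = Cod K c \<cdot> (x0 \<cdot> m)" using precomp[OF px, of m] pm by simp
    next
      fix y s
      assume y[simp]: "y \<in> Arr C" "s \<in> Arr C" and "Cod C y = Cod C (x0 \<cdot> m)" "Dom C s = Dom C y" "Cod C s = Dom C (shape c)" "shape c \<cdot> s = Cod K c \<cdot> y"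
      then have y2[simp]: "Cod C y = Dom C P" "Dom C s = Dom C y" "Cod C s = Cod C \<pi>" and fs: "f \<cdot> s = P \<cdot> y" by simp_all
      obtain z where z[simp]: "z \<in> Arr C" "Dom C z = Dom C y" "Cod C z = Dom C \<pi>0" and z2: "x0 \<cdot> z = y" "\<pi>0 \<cdot> z = s"
        by (rule D.mpb_lift[OF D, of y s]) (use fs in simp_all)
      have "\<pi> \<cdot> act i s z = s" using z2 by simp
      moreover have "x0 \<cdot> (m \<cdot> act i s z) = y" using mia[of z] z2 by simp
      ultimately show "\<exists>z. z \<in> Arr C \<and> Dom C z = Dom C y \<and> Cod C z = Dom C (x0 \<cdot> m) \<and> (x0 \<cdot> m) \<cdot> z = y \<and> Dom K c \<cdot> z = s"
        using z2 by (intro exI[of _ "act i s z"]) simp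
    next
      fix z z'
      assume z[simp]: "z \<in> Arr C" "z' \<in> Arr C" "Dom C z = Dom C z'" and "Cod C z = Dom C (x0 \<cdot> m)" "Cod C z' = Dom C (x0 \<cdot> m)"
        "(x0 \<cdot> m) \<cdot> z = (x0 \<cdot> m) \<cdot> z'" "Dom K c \<cdot> z = Dom K c \<cdot> z'"
      then have z2[simp]: "Cod C z = Dom C \<pi>" "Cod C z' = Dom C \<pi>" and e: "x0 \<cdot> (m \<cdot> z) = x0 \<cdot> (m \<cdot> z')" "\<pi> \<cdot> z = \<pi> \<cdot> z'" by simp_all
      have "m \<cdot> z = m \<cdot> z'"
        by (rule D.mpb_unique[OF D]) (use e precomp[OF pm, of z] precomp[OF pm, of z'] in simp_all)
      then have "act i (\<pi> \<cdot> z) (m \<cdot> z) = act i (\<pi> \<cdot> z') (m \<cdot> z')" by (simp only: e(2))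
      then show "z = z'" unfolding ima[OF z(1) z2(1)] ima[OF z(2) z2(2)] .
    qed simp_all
    fix a assume "a \<in> Arr C" "Cod C a = Dom C (Dom K c)"
    then have a[simp]: "a \<in> Arr C" "Cod C a = Dom C \<pi>" by simp_all
    have pma: "\<pi>0 \<cdot> (m \<cdot> a) = \<pi> \<cdot> a" using precomp[OF pm, of a] by simp
    have e: "f \<cdot> (\<pi> \<cdot> a) = P \<cdot> (x0 \<cdot> (m \<cdot> a))" using precomp[OF px, of "m \<cdot> a"] pma by simp
    have "act (c0 \<cdot>\<^bsub>K\<^esub> i) (\<pi> \<cdot> a) (x0 \<cdot> (m \<cdot> a)) = act i (\<pi> \<cdot> a) (act c0 (\<pi> \<cdot> a) (x0 \<cdot> (m \<cdot> a)))"
      using e by simp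
    also have "act c0 (\<pi> \<cdot> a) (x0 \<cdot> (m \<cdot> a)) = m \<cdot> a"
      using ca[of "m \<cdot> a"] pma by simp
    finally show "act c (Dom K c \<cdot> a) ((x0 \<cdot> m) \<cdot> a) = a"
      by (simp add: i2 ima)
  qed simp
  then show thesis by (rule that)
qed

text \<open>The object of triples \<open>(s, x, k)\<close> with \<open>s\<close> a shape of
  \<open>G\<close>, \<open>x\<close> a shape of \<open>X\<close>, and \<open>k\<close> a map from
  the directions of \<open>X\<close> over \<open>x\<close> to those of \<open>G\<close> over
  \<open>s\<close>: the container morphisms to \<open>X\<close> from the part of \<open>G\<close>
  over one shape. The arrows \<nu> and \<xi> project to \<open>s\<close> and \<open>x\<close>, and
  \<rho> applies \<open>k\<close> to a direction.\<close>

lemma fibrewise_extension: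
  assumes G[simp]: "G \<in> Arr C" and X[simp]: "X \<in> Arr C"
  obtains \<nu> \<xi> \<rho> where "\<nu> \<in> Arr C" "\<xi> \<in> Arr C" "Dom C \<xi> = Dom C \<nu>" "Cod C \<nu> = Cod C G" "Cod C \<xi> = Cod C X"
    "\<And>t b. t \<in> Arr C \<Longrightarrow> b \<in> Arr C \<Longrightarrow> Dom C t = Dom C b \<Longrightarrow> Cod C t = Dom C \<nu> \<Longrightarrow> Cod C b = Dom C X \<Longrightarrow> \<xi> \<cdot> t = X \<cdot> b \<Longrightarrow>
       \<rho> t b \<in> Arr C \<and> Dom C (\<rho> t b) = Dom C b \<and> Cod C (\<rho> t b) = Dom C G \<and> G \<cdot> \<rho> t b = \<nu> \<cdot> t"
    "\<And>t b y. t \<in> Arr C \<Longrightarrow> b \<in> Arr C \<Longrightarrow> Dom C t = Dom C b \<Longrightarrow> Cod C t = Dom C \<nu> \<Longrightarrow> Cod C b = Dom C X \<Longrightarrow> \<xi> \<cdot> t = X \<cdot> b \<Longrightarrow>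
       y \<in> Arr C \<Longrightarrow> Cod C y = Dom C b \<Longrightarrow> \<rho> t b \<cdot> y = \<rho> (t \<cdot> y) (b \<cdot> y)"
    "\<And>f x \<kappa>. f \<in> Arr C \<Longrightarrow> x \<in> Arr C \<Longrightarrow> Dom C f = Dom C x \<Longrightarrow> Cod C f = Cod C G \<Longrightarrow> Cod C x = Cod C X \<Longrightarrow> \<kappa> \<in> Arr C \<Longrightarrow>
       Dom C \<kappa> = pb C x X \<Longrightarrow> Cod C \<kappa> = Dom C G \<Longrightarrow> G \<cdot> \<kappa> = f \<cdot> pr1 C x X \<Longrightarrow>
       \<exists>h. h \<in> Arr C \<and> Dom C h = Dom C x \<and> Cod C h = Dom C \<nu> \<and> \<nu> \<cdot> h = f \<and> \<xi> \<cdot> h = x \<and> \<rho> (h \<cdot> pr1 C x X) (pr2 C x X) = \<kappa>"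
    "\<And>h h' x. h \<in> Arr C \<Longrightarrow> h' \<in> Arr C \<Longrightarrow> Dom C h = Dom C h' \<Longrightarrow> Cod C h = Dom C \<nu> \<Longrightarrow> Cod C h' = Dom C \<nu> \<Longrightarrow>
       \<nu> \<cdot> h = \<nu> \<cdot> h' \<Longrightarrow> \<xi> \<cdot> h = x \<Longrightarrow> \<xi> \<cdot> h' = x \<Longrightarrow>
       \<rho> (h \<cdot> pr1 C x X) (pr2 C x X) = \<rho> (h' \<cdot> pr1 C x X) (pr2 C x X) \<Longrightarrow> h = h'"
proof -
  define bS bX where "bS = bang C (Cod C G)" and "bX = bang C (Cod C X)"
  have b[simp]: "bS \<in> Arr C" "bX \<in> Arr C" "Cod C bS = Cod C bX" "Dom C bS = Cod C G" "Dom C bX = Cod C X"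
    by (simp_all add: bS_def bX_def)
  have bu[simp]: "bS \<cdot> f = bX \<cdot> x" if "f \<in> Arr C" "x \<in> Arr C" "Dom C f = Dom C x" "Cod C f = Cod C G" "Cod C x = Cod C X" for f x
    using that by (simp add: bS_def bX_def)
  define z1 z2 where "z1 = pr1 C bS bX" and "z2 = pr2 C bS bX"
  have z[simp]: "z1 \<in> Arr C" "z2 \<in> Arr C" "Dom C z1 = pb C bS bX" "Dom C z2 = pb C bS bX" "Cod C z1 = Cod C G" "Cod C z2 = Cod C X"
    by (simp_all add: z1_def z2_def)
  have zeq: "h = h'" if "h \<in> Arr C" "h' \<in> Arr C" "Dom C h = Dom C h'" "Cod C h = pb C bS bX" "Cod C h' = pb C bS bX"
    "z1 \<cdot> h = z1 \<cdot> h'" "z2 \<cdot> h = z2 \<cdot> h'" for h h'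
    by (rule pb_eqI[of bS bX]) (use that in \<open>simp_all add: z1_def z2_def\<close>)
  \<comment> \<open>The pullback of \<open>z1\<close> with \<open>z2\<close> above is the object of
    pairs \<open>(s, x)\<close>. Here \<open>b\<close> over \<open>x\<close> is adjoined, below
    \<open>y\<close> adjoins a direction of \<open>G\<close> over \<open>s\<close>, and the
    dependent product of \<open>y\<close> along \<open>j\<close> then quantifies over
    \<open>b\<close>.\<close>
  define j jx where "j = pr1 C z2 X" and "jx = pr2 C z2 X"
  have j[simp]: "j \<in> Arr C" "jx \<in> Arr C" "Dom C j = pb C z2 X" "Dom C jx = pb C z2 X" "Cod C j = pb C bS bX" "Cod C jx = Dom C X"
    by (simp_all add: j_def jx_def)
  have zj: "z2 \<cdot> j = X \<cdot> jx" by (simp add: j_def jx_def pr_eq)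
  have jeq: "h = h'" if "h \<in> Arr C" "h' \<in> Arr C" "Dom C h = Dom C h'" "Cod C h = pb C z2 X" "Cod C h' = pb C z2 X"
    "j \<cdot> h = j \<cdot> h'" "jx \<cdot> h = jx \<cdot> h'" for h h'
    by (rule pb_eqI[of z2 X]) (use that in \<open>simp_all add: j_def jx_def\<close>)
  have jp[simp]: "j \<cdot> pair C z2 X u v = u" "jx \<cdot> pair C z2 X u v = v"
    if "u \<in> Arr C" "v \<in> Arr C" "Dom C u = Dom C v" "Cod C u = pb C bS bX" "Cod C v = Dom C X" "z2 \<cdot> u = X \<cdot> v" for u v
    using that by (simp_all add: j_def jx_def)
  define y yg where "y = pr1 C (z1 \<cdot> j) G" and "yg = pr2 C (z1 \<cdot> j) G"
  have y[simp]: "y \<in> Arr C" "yg \<in> Arr C" "Dom C y = pb C (z1 \<cdot> j) G" "Dom C yg = pb C (z1 \<cdot> j) G" "Cod C y = pb C z2 X" "Cod C yg = Dom C G"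
    by (simp_all add: y_def yg_def)
  have Gyg: "G \<cdot> yg = z1 \<cdot> (j \<cdot> y)" using pr_eq[of "z1 \<cdot> j" G] by (simp add: y_def yg_def)
  have yeq: "h = h'" if "h \<in> Arr C" "h' \<in> Arr C" "Dom C h = Dom C h'" "Cod C h = pb C (z1 \<cdot> j) G" "Cod C h' = pb C (z1 \<cdot> j) G"
    "y \<cdot> h = y \<cdot> h'" "yg \<cdot> h = yg \<cdot> h'" for h h'
    by (rule pb_eqI[of "z1 \<cdot> j" G]) (use that in \<open>simp_all add: y_def yg_def\<close>)
  have jy: "j \<in> Arr C" "y \<in> Arr C" "Cod C y = Dom C j" by simp_all
  define n ev where "n = Pi j y" and "ev = Pi_ev j y"
  note PI[simp] = Pi_arr(1-5)[OF jy, folded n_def ev_def, simplified]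
  have yev: "y \<cdot> ev = pr1 C j n" using Pi_arr(6)[OF jy] by (simp add: n_def ev_def)
  define \<rho> where "\<rho> t b = yg \<cdot> (ev \<cdot> pair C j n (pair C z2 X (n \<cdot> t) b) t)" for t b
  have W: "pair C z2 X (n \<cdot> t) b \<in> Arr C" "Dom C (pair C z2 X (n \<cdot> t) b) = Dom C b" "Cod C (pair C z2 X (n \<cdot> t) b) = pb C z2 X"
      "j \<cdot> pair C z2 X (n \<cdot> t) b = n \<cdot> t" "jx \<cdot> pair C z2 X (n \<cdot> t) b = b"
      "ev \<cdot> pair C j n (pair C z2 X (n \<cdot> t) b) t \<in> Arr C" "Dom C (ev \<cdot> pair C j n (pair C z2 X (n \<cdot> t) b) t) = Dom C b"
      "Cod C (ev \<cdot> pair C j n (pair C z2 X (n \<cdot> t) b) t) = pb C (z1 \<cdot> j) G"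
      "y \<cdot> (ev \<cdot> pair C j n (pair C z2 X (n \<cdot> t) b) t) = pair C z2 X (n \<cdot> t) b"
    if [simp]: "t \<in> Arr C" "b \<in> Arr C" "Dom C t = Dom C b" "Cod C t = Dom C n" "Cod C b = Dom C X" and e: "z2 \<cdot> (n \<cdot> t) = X \<cdot> b" for t b
    using e precomp[OF yev, of "pair C j n (pair C z2 X (n \<cdot> t) b) t"] by simp_all
  show thesis
  proof (rule that[of "z1 \<cdot> n" "z2 \<cdot> n" \<rho>])
    fix t b
    assume t[simp]: "t \<in> Arr C" "b \<in> Arr C" "Dom C t = Dom C b" and "Cod C t = Dom C (z1 \<cdot> n)" and t2[simp]: "Cod C b = Dom C X"
      and "(z2 \<cdot> n) \<cdot> t = X \<cdot> b"
    then have t3[simp]: "Cod C t = Dom C n" and e: "z2 \<cdot> (n \<cdot> t) = X \<cdot> b" by simp_all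
    note w[simp] = W(1-3,6-8)[OF t t3 t2 e] and w' = W(4,9)[OF t t3 t2 e]
    have "G \<cdot> \<rho> t b = z1 \<cdot> (n \<cdot> t)"
      unfolding \<rho>_def using precomp[OF Gyg, of "ev \<cdot> pair C j n (pair C z2 X (n \<cdot> t) b) t"] w' by (simp del: pair_cmp)
    then show "\<rho> t b \<in> Arr C \<and> Dom C (\<rho> t b) = Dom C b \<and> Cod C (\<rho> t b) = Dom C G \<and> G \<cdot> \<rho> t b = (z1 \<cdot> n) \<cdot> t"
      by (simp add: \<rho>_def w')
    fix r assume r: "r \<in> Arr C" "Cod C r = Dom C b"
    have "z2 \<cdot> (n \<cdot> (t \<cdot> r)) = X \<cdot> (b \<cdot> r)" using precomp[OF e, of r] r by simp
    then show "\<rho> t b \<cdot> r = \<rho> (t \<cdot> r) (b \<cdot> r)"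
      using r e by (simp add: \<rho>_def w')
  next
    fix f x \<kappa>
    assume f[simp]: "f \<in> Arr C" "x \<in> Arr C" "Dom C f = Dom C x" "Cod C f = Cod C G" "Cod C x = Cod C X" "\<kappa> \<in> Arr C"
       "Dom C \<kappa> = pb C x X" "Cod C \<kappa> = Dom C G" and G\<kappa>: "G \<cdot> \<kappa> = f \<cdot> pr1 C x X"
    define zz q xx where "zz = pair C bS bX f x" and "q = pr1 C x X" and "xx = pr2 C x X"
    have zz[simp]: "zz \<in> Arr C" "Dom C zz = Dom C x" "Cod C zz = pb C bS bX" and zz2: "z1 \<cdot> zz = f" "z2 \<cdot> zz = x"
      by (simp_all add: zz_def z1_def z2_def)
    have q[simp]: "q \<in> Arr C" "xx \<in> Arr C" "Dom C q = pb C x X" "Dom C xx = pb C x X" "Cod C q = Dom C x" "Cod C xx = Dom C X"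
      by (simp_all add: q_def xx_def)
    have xq: "x \<cdot> q = X \<cdot> xx" by (simp add: q_def xx_def pr_eq)
    have zzq: "z2 \<cdot> (zz \<cdot> q) = X \<cdot> xx" "z1 \<cdot> (zz \<cdot> q) = f \<cdot> q" using precomp[OF zz2(1), of q] precomp[OF zz2(2), of q] xq by simp_all
    define p where "p = pair C z2 X (zz \<cdot> q) xx"
    have p[simp]: "p \<in> Arr C" "Dom C p = pb C x X" "Cod C p = pb C z2 X" and p2: "j \<cdot> p = zz \<cdot> q" "jx \<cdot> p = xx"
      using zzq by (simp_all add: p_def)
    \<comment> \<open>The pullback of \<open>X\<close> along \<open>x\<close> is also the pullback
      of \<open>j\<close> along the point \<open>zz\<close>, which stands for \<open>(f, x)\<close>.
      This is the form in which the dependent product takes it.\<close>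
    have M: "D.mpb j zz p q"
    proof (rule D.mpbI)
      fix v s
      assume v[simp]: "v \<in> Arr C" "s \<in> Arr C" and "Cod C v = Cod C q" "Dom C s = Dom C v" "Cod C s = Dom C j" and js: "j \<cdot> s = zz \<cdot> v"
      then have v2[simp]: "Cod C v = Dom C x" "Dom C s = Dom C v" "Cod C s = pb C z2 X" by simp_all
      have e: "x \<cdot> v = X \<cdot> (jx \<cdot> s)" using precomp[OF zj, of s] precomp[OF zz2(2), of v] js by simp
      let ?z = "pair C x X v (jx \<cdot> s)"
      have z: "?z \<in> Arr C" "Dom C ?z = Dom C v" "Cod C ?z = pb C x X" "q \<cdot> ?z = v" "xx \<cdot> ?z = jx \<cdot> s" using e by (simp_all add: q_def xx_def)
      have "p \<cdot> ?z = s"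
        by (rule jeq) (use z(1-3) js precomp[OF p2(1), of ?z] precomp[OF p2(2), of ?z] z(4,5) in \<open>simp_all del: pair_cmp\<close>)
      then show "\<exists>z. z \<in> Arr C \<and> Dom C z = Dom C v \<and> Cod C z = Dom C q \<and> q \<cdot> z = v \<and> p \<cdot> z = s"
        using z by (intro exI[of _ ?z]) simp
    next
      fix r r'
      assume r[simp]: "r \<in> Arr C" "r' \<in> Arr C" "Dom C r = Dom C r'" and "Cod C r = Dom C q" "Cod C r' = Dom C q"
        and qr: "q \<cdot> r = q \<cdot> r'" and pr: "p \<cdot> r = p \<cdot> r'"
      then have r2[simp]: "Cod C r = pb C x X" "Cod C r' = pb C x X" by simp_all
      have "jx \<cdot> (p \<cdot> r) = jx \<cdot> (p \<cdot> r')" using pr by (simp only:)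
      then have "xx \<cdot> r = xx \<cdot> r'" using precomp[OF p2(2), of r] precomp[OF p2(2), of r'] by simp
      then show "r = r'" using qr by - (rule pb_eqI[of x X], simp_all add: q_def xx_def)
    qed (simp_all add: p2)
    define kk where "kk = pair C (z1 \<cdot> j) G p \<kappa>"
    have e: "(z1 \<cdot> j) \<cdot> p = G \<cdot> \<kappa>" using p2 zzq G\<kappa> by (simp add: q_def[symmetric])
    have kk[simp]: "kk \<in> Arr C" "Dom C kk = pb C x X" "Cod C kk = pb C (z1 \<cdot> j) G" and kk2: "y \<cdot> kk = p" "yg \<cdot> kk = \<kappa>"
      using pair[of "z1 \<cdot> j" G p \<kappa>] e by (simp_all add: kk_def y_def yg_def)
    obtain h where h[simp]: "h \<in> Arr C" "Dom C h = Dom C zz" "Cod C h = Dom C n" and h2: "n \<cdot> h = zz" "ev \<cdot> pair C j n p (h \<cdot> q) = kk"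
      by (rule Pi_ex[OF jy M, of kk, folded n_def ev_def]) (simp_all add: kk2)
    have nhq: "n \<cdot> (h \<cdot> q) = zz \<cdot> q" using precomp[OF h2(1), of q] by simp
    have "\<rho> (h \<cdot> q) xx = \<kappa>"
      unfolding \<rho>_def nhq p_def[symmetric] h2(2) by (rule kk2)
    then show "\<exists>h. h \<in> Arr C \<and> Dom C h = Dom C x \<and> Cod C h = Dom C (z1 \<cdot> n) \<and> (z1 \<cdot> n) \<cdot> h = f \<and> (z2 \<cdot> n) \<cdot> h = x \<and>
        \<rho> (h \<cdot> pr1 C x X) (pr2 C x X) = \<kappa>"
      using h2(1) zz2 by (intro exI[of _ h]) (simp add: q_def xx_def)
  next
    fix h h' x
    assume h[simp]: "h \<in> Arr C" "h' \<in> Arr C" "Dom C h = Dom C h'" and "Cod C h = Dom C (z1 \<cdot> n)" "Cod C h' = Dom C (z1 \<cdot> n)"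
       "(z1 \<cdot> n) \<cdot> h = (z1 \<cdot> n) \<cdot> h'" "(z2 \<cdot> n) \<cdot> h = x" "(z2 \<cdot> n) \<cdot> h' = x" and
       rr: "\<rho> (h \<cdot> pr1 C x X) (pr2 C x X) = \<rho> (h' \<cdot> pr1 C x X) (pr2 C x X)"
    then have h2[simp]: "Cod C h = Dom C n" "Cod C h' = Dom C n" and hh: "z1 \<cdot> (n \<cdot> h) = z1 \<cdot> (n \<cdot> h')"
      and hx: "x = z2 \<cdot> (n \<cdot> h)" "x = z2 \<cdot> (n \<cdot> h')" by simp_all
    have x[simp]: "x \<in> Arr C" "Dom C x = Dom C h'" "Cod C x = Cod C X" using hx(2) by simp_all
    define zz q xx where "zz = n \<cdot> h" and "q = pr1 C x X" and "xx = pr2 C x X"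
    have zz2: "n \<cdot> h' = zz" unfolding zz_def by (rule zeq) (use hh hx in simp_all)
    have zz[simp]: "zz \<in> Arr C" "Dom C zz = Dom C h'" "Cod C zz = pb C bS bX" by (simp_all add: zz_def)
    have q[simp]: "q \<in> Arr C" "xx \<in> Arr C" "Dom C q = pb C x X" "Dom C xx = pb C x X" "Cod C q = Dom C h'" "Cod C xx = Dom C X"
      by (simp_all add: q_def xx_def)
    have xq: "x \<cdot> q = X \<cdot> xx" by (simp add: q_def xx_def pr_eq)
    have xz: "z2 \<cdot> zz = x" using hx(1) by (simp add: zz_def)
    have zzq: "z2 \<cdot> (zz \<cdot> q) = X \<cdot> xx" using precomp[OF xz, of q] xq by simp
    define p where "p = pair C z2 X (zz \<cdot> q) xx"
    have p[simp]: "p \<in> Arr C" "Dom C p = pb C x X" "Cod C p = pb C z2 X" and p2: "j \<cdot> p = zz \<cdot> q" "jx \<cdot> p = xx"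
      using zzq by (simp_all add: p_def)
    have M: "D.mpb j zz p q"
    proof (rule D.mpbI)
      fix v s
      assume v[simp]: "v \<in> Arr C" "s \<in> Arr C" and "Cod C v = Cod C q" "Dom C s = Dom C v" "Cod C s = Dom C j" and js: "j \<cdot> s = zz \<cdot> v"
      then have v2[simp]: "Cod C v = Dom C h'" "Dom C s = Dom C v" "Cod C s = pb C z2 X" by simp_all
      have e: "x \<cdot> v = X \<cdot> (jx \<cdot> s)" using precomp[OF zj, of s] precomp[OF xz, of v] js by simp
      let ?z = "pair C x X v (jx \<cdot> s)"
      have z: "?z \<in> Arr C" "Dom C ?z = Dom C v" "Cod C ?z = pb C x X" "q \<cdot> ?z = v" "xx \<cdot> ?z = jx \<cdot> s" using e by (simp_all add: q_def xx_def)
      have "p \<cdot> ?z = s"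
        by (rule jeq) (use z(1-3) js precomp[OF p2(1), of ?z] precomp[OF p2(2), of ?z] z(4,5) in \<open>simp_all del: pair_cmp\<close>)
      then show "\<exists>z. z \<in> Arr C \<and> Dom C z = Dom C v \<and> Cod C z = Dom C q \<and> q \<cdot> z = v \<and> p \<cdot> z = s"
        using z by (intro exI[of _ ?z]) simp
    next
      fix r r'
      assume r[simp]: "r \<in> Arr C" "r' \<in> Arr C" "Dom C r = Dom C r'" and "Cod C r = Dom C q" "Cod C r' = Dom C q"
        and qr: "q \<cdot> r = q \<cdot> r'" and pr: "p \<cdot> r = p \<cdot> r'"
      then have r2[simp]: "Cod C r = pb C x X" "Cod C r' = pb C x X" by simp_all
      have "jx \<cdot> (p \<cdot> r) = jx \<cdot> (p \<cdot> r')" using pr by (simp only:)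
      then have "xx \<cdot> r = xx \<cdot> r'" using precomp[OF p2(2), of r] precomp[OF p2(2), of r'] by simp
      then show "r = r'" using qr by - (rule pb_eqI[of x X], simp_all add: q_def xx_def)
    qed (simp_all add: p2)
    have nhq: "n \<cdot> (h \<cdot> q) = zz \<cdot> q" "n \<cdot> (h' \<cdot> q) = zz \<cdot> q"
      using precomp[OF zz2, of q] by (simp_all add: zz_def)
    have A: "h \<cdot> q \<in> Arr C" "xx \<in> Arr C" "Dom C (h \<cdot> q) = Dom C xx" "Cod C (h \<cdot> q) = Dom C n" "Cod C xx = Dom C X" "z2 \<cdot> (n \<cdot> (h \<cdot> q)) = X \<cdot> xx"
      using zzq by (simp_all add: nhq(1))
    have A': "h' \<cdot> q \<in> Arr C" "xx \<in> Arr C" "Dom C (h' \<cdot> q) = Dom C xx" "Cod C (h' \<cdot> q) = Dom C n" "Cod C xx = Dom C X" "z2 \<cdot> (n \<cdot> (h' \<cdot> q)) = X \<cdot> xx"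
      using zzq by (simp_all add: nhq(2))
    note W1 = W(6-9)[OF A, unfolded nhq p_def[symmetric]] and W2 = W(6-9)[OF A', unfolded nhq p_def[symmetric]]
    have "yg \<cdot> (ev \<cdot> pair C j n p (h \<cdot> q)) = yg \<cdot> (ev \<cdot> pair C j n p (h' \<cdot> q))"
      using rr unfolding q_def[symmetric] xx_def[symmetric] \<rho>_def nhq p_def[symmetric] .
    then have "ev \<cdot> pair C j n p (h \<cdot> q) = ev \<cdot> pair C j n p (h' \<cdot> q)"
      by (intro yeq[OF W1(1) W2(1)]) (simp_all only: W1 W2)
    then show "h = h'"
      by - (rule Pi_unique[OF jy M, folded n_def ev_def], simp_all add: zz_def[symmetric] zz2)
  qed simp_all
qed

text \<open>\<open>h\<close> is the dependent product of \<nu> along \<open>u\<close>. A point over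
  \<open>w\<close> assigns to each shape of \<open>G\<close> above \<open>w\<close> a shape of
  \<open>X\<close> and a map of directions back, which is a container morphism from the fibre of
  \<open>G\<close> over \<open>w\<close> to \<open>X\<close>.\<close>

lemma classifier_exists:
  assumes G[simp]: "G \<in> Arr C" and X[simp]: "X \<in> Arr C" and u[simp]: "u \<in> Arr C" "Dom C u = Cod C G"
  obtains h t c \<chi> where "KC.classifies u G X h t c \<chi>"
proof (rule fibrewise_extension[OF G X])
  fix \<nu> \<xi> \<rho>
  assume n[simp]: "\<nu> \<in> Arr C" "\<xi> \<in> Arr C" "Dom C \<xi> = Dom C \<nu>" "Cod C \<nu> = Cod C G" "Cod C \<xi> = Cod C X" and
    R: "\<And>t b. t \<in> Arr C \<Longrightarrow> b \<in> Arr C \<Longrightarrow> Dom C t = Dom C b \<Longrightarrow> Cod C t = Dom C \<nu> \<Longrightarrow> Cod C b = Dom C X \<Longrightarrow> \<xi> \<cdot> t = X \<cdot> b \<Longrightarrow>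
       \<rho> t b \<in> Arr C \<and> Dom C (\<rho> t b) = Dom C b \<and> Cod C (\<rho> t b) = Dom C G \<and> G \<cdot> \<rho> t b = \<nu> \<cdot> t"
    and Rn: "\<And>t b y. t \<in> Arr C \<Longrightarrow> b \<in> Arr C \<Longrightarrow> Dom C t = Dom C b \<Longrightarrow> Cod C t = Dom C \<nu> \<Longrightarrow> Cod C b = Dom C X \<Longrightarrow> \<xi> \<cdot> t = X \<cdot> b \<Longrightarrow>
       y \<in> Arr C \<Longrightarrow> Cod C y = Dom C b \<Longrightarrow> \<rho> t b \<cdot> y = \<rho> (t \<cdot> y) (b \<cdot> y)"
    and Rex: "\<And>f x \<kappa>. f \<in> Arr C \<Longrightarrow> x \<in> Arr C \<Longrightarrow> Dom C f = Dom C x \<Longrightarrow> Cod C f = Cod C G \<Longrightarrow> Cod C x = Cod C X \<Longrightarrow> \<kappa> \<in> Arr C \<Longrightarrow>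
       Dom C \<kappa> = pb C x X \<Longrightarrow> Cod C \<kappa> = Dom C G \<Longrightarrow> G \<cdot> \<kappa> = f \<cdot> pr1 C x X \<Longrightarrow>
       \<exists>h. h \<in> Arr C \<and> Dom C h = Dom C x \<and> Cod C h = Dom C \<nu> \<and> \<nu> \<cdot> h = f \<and> \<xi> \<cdot> h = x \<and> \<rho> (h \<cdot> pr1 C x X) (pr2 C x X) = \<kappa>"
    and Run: "\<And>h h' x. h \<in> Arr C \<Longrightarrow> h' \<in> Arr C \<Longrightarrow> Dom C h = Dom C h' \<Longrightarrow> Cod C h = Dom C \<nu> \<Longrightarrow> Cod C h' = Dom C \<nu> \<Longrightarrow>
       \<nu> \<cdot> h = \<nu> \<cdot> h' \<Longrightarrow> \<xi> \<cdot> h = x \<Longrightarrow> \<xi> \<cdot> h' = x \<Longrightarrow>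
       \<rho> (h \<cdot> pr1 C x X) (pr2 C x X) = \<rho> (h' \<cdot> pr1 C x X) (pr2 C x X) \<Longrightarrow> h = h'"
  have un: "u \<in> Arr C" "\<nu> \<in> Arr C" "Cod C \<nu> = Dom C u" by simp_all
  define h ev where "h = Pi u \<nu>" and "ev = Pi_ev u \<nu>"
  note PI[simp] = Pi_arr(1-5)[OF un, folded h_def ev_def]
  define \<sigma> t where "\<sigma> = pr1 C u h" and "t = pr2 C u h"
  have \<nu>ev: "\<nu> \<cdot> ev = \<sigma>" using Pi_arr(6)[OF un] by (simp add: \<sigma>_def h_def ev_def)
  have \<sigma>[simp]: "\<sigma> \<in> Arr C" "t \<in> Arr C" "Dom C \<sigma> = pb C u h" "Dom C t = pb C u h" "Cod C \<sigma> = Cod C G" "Cod C t = Dom C h"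
    by (simp_all add: \<sigma>_def t_def)
  have uh: "D.mpb u h \<sigma> t" unfolding \<sigma>_def t_def by (rule chosen_mpb) simp_all
  define \<pi> g where "\<pi> = pr1 C \<sigma> G" and "g = pr2 C \<sigma> G"
  have \<pi>[simp]: "\<pi> \<in> Arr C" "g \<in> Arr C" "Dom C \<pi> = Dom C g" "Cod C \<pi> = pb C u h" "Cod C g = Dom C G" by (simp_all add: \<pi>_def g_def)
  have pg: "D.mpb \<sigma> G \<pi> g" unfolding \<pi>_def g_def by (rule chosen_mpb) simp_all
  obtain c where c: "cartesian c g" and c1[simp]: "Dom K c = \<pi>" "Cod K c = G" "shape c = \<sigma>"
    by (rule cartesian_ex[OF pg])
  note c0[simp] = cartesianD(1)[OF c]
  have cm: "KC.mpb h u t c" by (rule cartesian_mpb[OF c]) (simp add: D_mpb_sym[OF uh])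
  let ?x = "\<xi> \<cdot> ev"
  let ?t = "pr1 C ?x X" and ?b = "pr2 C ?x X"
  have xe: "\<xi> \<cdot> (ev \<cdot> ?t) = X \<cdot> ?b" using pr_eq[of ?x X] by simp
  have sR: "\<sigma> \<cdot> \<tau> = G \<cdot> \<rho> (ev \<cdot> \<tau>) b \<and> \<rho> (ev \<cdot> \<tau>) b \<in> Arr C \<and> Dom C (\<rho> (ev \<cdot> \<tau>) b) = Dom C b \<and> Cod C (\<rho> (ev \<cdot> \<tau>) b) = Dom C G"
    if "\<tau> \<in> Arr C" "b \<in> Arr C" "Dom C \<tau> = Dom C b" "Cod C \<tau> = pb C u h" "Cod C b = Dom C X" "\<xi> \<cdot> (ev \<cdot> \<tau>) = X \<cdot> b" for \<tau> b
    using that R[of "ev \<cdot> \<tau>" b] precomp[OF \<nu>ev, of \<tau>] by simp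
  \<comment> \<open>The universal morphism \<chi> has shape part \<open>\<xi> \<cdot> ev\<close>.
    Its directions come from \<rho>, which lands in \<open>G\<close>; \<open>act c\<close> moves
    them to the restricted container.\<close>
  let ?d = "act c ?t (\<rho> (ev \<cdot> ?t) ?b)"
  have s0: "\<sigma> \<cdot> ?t = G \<cdot> \<rho> (ev \<cdot> ?t) ?b" "\<rho> (ev \<cdot> ?t) ?b \<in> Arr C" "Dom C (\<rho> (ev \<cdot> ?t) ?b) = pb C ?x X" "Cod C (\<rho> (ev \<cdot> ?t) ?b) = Dom C G"
    using sR[of ?t ?b] xe by simp_all
  have d: "?d \<in> Arr C" "Dom C ?d = pb C ?x X" "Cod C ?d = Dom C \<pi>" "\<pi> \<cdot> ?d = ?t"
    using s0 by simp_all
  obtain \<chi> where \<chi>[simp]: "\<chi> \<in> Arr K" "Dom K \<chi> = \<pi>" "Cod K \<chi> = X" "shape \<chi> = ?x" and \<chi>a: "\<And>\<tau> b. act \<chi> \<tau> b = ?d \<cdot> pair C ?x X \<tau> b"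
    by (rule K_mk[of \<pi> X ?x ?d]) (use d in simp_all)
  have \<chi>b: "act \<chi> \<tau> b = act c \<tau> (\<rho> (ev \<cdot> \<tau>) b)"
    if \<tau>[simp]: "\<tau> \<in> Arr C" "b \<in> Arr C" "Dom C \<tau> = Dom C b" "Cod C \<tau> = pb C u h" "Cod C b = Dom C X" and e: "\<xi> \<cdot> (ev \<cdot> \<tau>) = X \<cdot> b" for \<tau> b
  proof -
    let ?p = "pair C ?x X \<tau> b"
    have p: "?p \<in> Arr C" "Dom C ?p = Dom C b" "Cod C ?p = pb C ?x X" "?t \<cdot> ?p = \<tau>" "?b \<cdot> ?p = b" using e by simp_all
    have "?d \<cdot> ?p = act c (?t \<cdot> ?p) (\<rho> (ev \<cdot> ?t) ?b \<cdot> ?p)"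
      by (rule act_simps(5)) (use s0 p(1-3) in simp_all)
    also have "\<rho> (ev \<cdot> ?t) ?b \<cdot> ?p = \<rho> ((ev \<cdot> ?t) \<cdot> ?p) (?b \<cdot> ?p)"
      by (rule Rn) (use xe p(1-3) in simp_all)
    also have "(ev \<cdot> ?t) \<cdot> ?p = ev \<cdot> \<tau>" using p by simp
    finally show ?thesis unfolding \<chi>a p(4,5) .
  qed
  have "KC.classifies u G X h t c \<chi>"
    unfolding KC.classifies_def
  proof (intro conjI allI impI)
    fix w t' c' \<theta>
    assume c'm: "KC.mpb w u t' c'" and "Cod K c' = G" and \<theta>[simp]: "\<theta> \<in> Arr K" "Dom K \<theta> = Dom K c'" "Cod K \<theta> = X"
    define G' f where "G' = Dom K c'" and "f = shape c'"
    have c'1[simp]: "Dom K c' = G'" "Cod K c' = G" "shape c' = f" using \<open>Cod K c' = G\<close> by (simp_all add: G'_def f_def)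
    have c'0[simp]: "c' \<in> Arr K" by (rule KC.mpbD[OF c'm])
    have G'[simp]: "G' \<in> Arr C" "f \<in> Arr C" "Dom C f = Cod C G'" "Cod C f = Cod C G" using arr_K[OF c'0] by simp_all
    obtain x' where x': "cartesian c' x'" by (rule mpb_cartesian[OF c'm])
    note x'0[simp] = cartesianD(3-5)[OF x', simplified] and ca' = cartesianD(6)[OF x', simplified] and ac' = cartesian_act[OF x', simplified]
    have fx': "f \<cdot> G' = G \<cdot> x'" using D.mpbD(9)[OF cartesianD(2)[OF x']] by simp
    have M: "D.mpb u w f t'" using D_mpb_sym[OF shape_mpb[OF c'm]] by simp
    have w[simp]: "w \<in> Arr C" "t' \<in> Arr C" "Dom C t' = Cod C G'" "Cod C t' = Dom C w" "Cod C w = Cod C u"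
      using D.mpbD(1-8)[OF M] by simp_all
    have ut: "u \<cdot> f = w \<cdot> t'" by (rule D.mpbD[OF M])
    define x where "x = shape \<theta>"
    have x[simp]: "x \<in> Arr C" "Dom C x = Cod C G'" "Cod C x = Cod C X" "shape \<theta> = x" using arr_K[OF \<theta>(1)] by (simp_all add: x_def)
    let ?q = "pr1 C x X" and ?xx = "pr2 C x X"
    have qxx[simp]: "x \<cdot> ?q = X \<cdot> ?xx" by (rule pr_eq) simp_all
    \<comment> \<open>Fibrewise reading of \<theta>: its shape part \<open>x\<close> and its
      directions, sent to \<open>G\<close> by the cartesian identification \<open>x'\<close>, form
      an arrow \<open>h'\<close> from the shapes of \<open>G'\<close> to the object of triples.
      Transposing \<open>h'\<close> along \<open>u\<close> gives \<open>k\<close>.\<close>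
    define A where "A = act \<theta> ?q ?xx"
    have A[simp]: "A \<in> Arr C" "Dom C A = pb C x X" "Cod C A = Dom C G'" and GA: "G' \<cdot> A = ?q" by (simp_all add: A_def)
    define \<kappa> where "\<kappa> = x' \<cdot> A"
    have \<kappa>[simp]: "\<kappa> \<in> Arr C" "Dom C \<kappa> = pb C x X" "Cod C \<kappa> = Dom C G" by (simp_all add: \<kappa>_def)
    have "f \<cdot> (G' \<cdot> A) = (G \<cdot> x') \<cdot> A" by (rule precomp[OF fx']) simp_all
    then have G\<kappa>: "G \<cdot> \<kappa> = f \<cdot> ?q" by (simp add: \<kappa>_def GA)
    obtain h' where h'[simp]: "h' \<in> Arr C" "Dom C h' = Dom C x" "Cod C h' = Dom C \<nu>" and h'2: "\<nu> \<cdot> h' = f" "\<xi> \<cdot> h' = x" "\<rho> (h' \<cdot> ?q) ?xx = \<kappa>"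
      using Rex[of f x \<kappa>] G\<kappa> by auto
    show "\<exists>!k. k \<in> Arr C \<and> Dom C k = Dom C w \<and> Cod C k = Dom C h \<and> h \<cdot> k = w \<and>
         (\<exists>\<kappa>. \<kappa> \<in> Arr K \<and> Dom K \<kappa> = Dom K c' \<and> Cod K \<kappa> = Dom K c \<and> c \<cdot>\<^bsub>K\<^esub> \<kappa> = c' \<and> t \<cdot> shape \<kappa> = k \<cdot> t' \<and> \<chi> \<cdot>\<^bsub>K\<^esub> \<kappa> = \<theta>)"
    proof (rule ex_ex1I)
      obtain k where k[simp]: "k \<in> Arr C" "Dom C k = Dom C w" "Cod C k = Dom C h" and k2: "h \<cdot> k = w" "ev \<cdot> pair C u h f (k \<cdot> t') = h'"
        by (rule Pi_ex[OF un M, of h', folded h_def ev_def]) (use h'2 in simp_all)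
      have hkt: "h \<cdot> (k \<cdot> t') = u \<cdot> f" using precomp[OF k2(1), of t'] ut by simp
      obtain l where l[simp]: "l \<in> Arr K" "Dom K l = G'" "Cod K l = \<pi>" and l2: "c \<cdot>\<^bsub>K\<^esub> l = c'" "t \<cdot> shape l = k \<cdot> t'"
        by (rule KC.mpb_lift[OF cm, of c' "k \<cdot> t'"]) (use hkt in simp_all)
      have "shape (c \<cdot>\<^bsub>K\<^esub> l) = f" by (simp only: l2 c'1)
      then have sl: "\<sigma> \<cdot> shape l = f" by simp
      have "shape l = pair C u h f (k \<cdot> t')"
        by (rule D.mpb_unique[OF uh]) (use sl l2 hkt in \<open>simp_all add: \<sigma>_def t_def\<close>)
      then have el: "ev \<cdot> shape l = h'" using k2 by simp
      have "\<chi> \<cdot>\<^bsub>K\<^esub> l = \<theta>"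
      proof (rule K_ext[of _ _ G' X x])
        fix \<tau> b
        assume \<tau>[simp]: "\<tau> \<in> Arr C" "b \<in> Arr C" "Dom C \<tau> = Dom C b" "Cod C \<tau> = Cod C G'" "Cod C b = Dom C X" and e: "x \<cdot> \<tau> = X \<cdot> b"
        let ?p = "pair C x X \<tau> b"
        have p: "?p \<in> Arr C" "Dom C ?p = Dom C b" "Cod C ?p = pb C x X" "?q \<cdot> ?p = \<tau>" "?xx \<cdot> ?p = b" using e by simp_all
        have xh: "\<xi> \<cdot> (h' \<cdot> ?q) = X \<cdot> ?xx" using precomp[OF h'2(2), of ?q] by simp
        have "\<rho> (h' \<cdot> \<tau>) b = \<rho> ((h' \<cdot> ?q) \<cdot> ?p) (?xx \<cdot> ?p)" using p by simp
        also have "\<dots> = \<rho> (h' \<cdot> ?q) ?xx \<cdot> ?p"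
          by (rule Rn[symmetric]) (use xh p(1-3) in simp_all)
        also have "\<dots> = x' \<cdot> (A \<cdot> ?p)" unfolding h'2(3) \<kappa>_def by (rule assoc) (use p(1-3) in simp_all)
        also have "A \<cdot> ?p = act \<theta> (?q \<cdot> ?p) (?xx \<cdot> ?p)" unfolding A_def by (rule act_simps(5)) (use p(1-3) in simp_all)
        also have "\<dots> = act \<theta> \<tau> b" by (simp only: p)
        finally have rho: "\<rho> (h' \<cdot> \<tau>) b = x' \<cdot> act \<theta> \<tau> b" .
        have elt: "ev \<cdot> (shape l \<cdot> \<tau>) = h' \<cdot> \<tau>" using precomp[OF el, of \<tau>] by simp
        have xel: "\<xi> \<cdot> (ev \<cdot> (shape l \<cdot> \<tau>)) = X \<cdot> b" using elt precomp[OF h'2(2), of \<tau>] e by simp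
        have A: "act \<theta> \<tau> b \<in> Arr C" "Cod C (act \<theta> \<tau> b) = Dom C G'" "G' \<cdot> act \<theta> \<tau> b = \<tau>" "Dom C (act \<theta> \<tau> b) = Dom C b" using e by simp_all
        have fA: "f \<cdot> \<tau> = G \<cdot> (x' \<cdot> act \<theta> \<tau> b)" using precomp[OF fx', of "act \<theta> \<tau> b"] A by simp
        have slt: "\<sigma> \<cdot> (shape l \<cdot> \<tau>) = G \<cdot> (x' \<cdot> act \<theta> \<tau> b)" using precomp[OF sl, of \<tau>] fA by simp
        have "act (\<chi> \<cdot>\<^bsub>K\<^esub> l) \<tau> b = act l \<tau> (act \<chi> (shape l \<cdot> \<tau>) b)" using xel by simp
        also have "act \<chi> (shape l \<cdot> \<tau>) b = act c (shape l \<cdot> \<tau>) (\<rho> (ev \<cdot> (shape l \<cdot> \<tau>)) b)"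
          by (rule \<chi>b) (use xel in simp_all)
        also have "\<rho> (ev \<cdot> (shape l \<cdot> \<tau>)) b = x' \<cdot> act \<theta> \<tau> b" by (simp only: elt rho)
        also have "act l \<tau> (act c (shape l \<cdot> \<tau>) (x' \<cdot> act \<theta> \<tau> b)) = act (c \<cdot>\<^bsub>K\<^esub> l) \<tau> (x' \<cdot> act \<theta> \<tau> b)"
          by (rule act_cmp[symmetric]) (use slt A in simp_all)
        also have "\<dots> = act \<theta> \<tau> b"
          using ca'[OF A(1,2)] unfolding A(3) l2(1) .
        finally show "act (\<chi> \<cdot>\<^bsub>K\<^esub> l) \<tau> b = act \<theta> \<tau> b" .
      qed (use el h'2 in simp_all)
      then show "\<exists>k. k \<in> Arr C \<and> Dom C k = Dom C w \<and> Cod C k = Dom C h \<and> h \<cdot> k = w \<and>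
         (\<exists>\<kappa>. \<kappa> \<in> Arr K \<and> Dom K \<kappa> = Dom K c' \<and> Cod K \<kappa> = Dom K c \<and> c \<cdot>\<^bsub>K\<^esub> \<kappa> = c' \<and> t \<cdot> shape \<kappa> = k \<cdot> t' \<and> \<chi> \<cdot>\<^bsub>K\<^esub> \<kappa> = \<theta>)"
        using k2 l2 by (intro exI[of _ k] conjI exI[of _ l]) simp_all
    next
      \<comment> \<open>Any \<open>k\<close> that classifies \<theta> has \<open>h'\<close> as its
        evaluation, because \<chi> acts through \<rho>; uniqueness of transposes along
        \<open>u\<close> then identifies two such \<open>k\<close>.\<close>
      have U: "ev \<cdot> pair C u h f (k \<cdot> t') = h'"
        if k[simp]: "k \<in> Arr C" "Dom C k = Dom C w" "Cod C k = Dom C h" and k2: "h \<cdot> k = w"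
          and l[simp]: "l \<in> Arr K" and ld: "Dom K l = Dom K c'" "Cod K l = Dom K c" and l2: "c \<cdot>\<^bsub>K\<^esub> l = c'" "t \<cdot> shape l = k \<cdot> t'"
          and \<chi>l: "\<chi> \<cdot>\<^bsub>K\<^esub> l = \<theta>"
        for k l
      proof -
        have [simp]: "Dom K l = G'" "Cod K l = \<pi>" using ld by simp_all
        have hkt: "h \<cdot> (k \<cdot> t') = u \<cdot> f" using precomp[OF k2(1), of t'] ut by simp
        have "shape (c \<cdot>\<^bsub>K\<^esub> l) = f" by (simp only: l2 c'1)
        then have sl: "\<sigma> \<cdot> shape l = f" by simp
        have sp: "shape l = pair C u h f (k \<cdot> t')"
          by (rule D.mpb_unique[OF uh]) (use sl l2 hkt in \<open>simp_all add: \<sigma>_def t_def\<close>)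
        have "shape (\<chi> \<cdot>\<^bsub>K\<^esub> l) = x" by (simp only: \<chi>l x)
        then have xel: "\<xi> \<cdot> (ev \<cdot> shape l) = x" by simp
        let ?h = "ev \<cdot> shape l"
        have nh: "\<nu> \<cdot> ?h = f" using precomp[OF \<nu>ev, of "shape l"] sl by simp
        have xhq: "\<xi> \<cdot> (ev \<cdot> (shape l \<cdot> ?q)) = X \<cdot> ?xx" using precomp[OF xel, of ?q] by simp
        let ?r = "\<rho> (ev \<cdot> (shape l \<cdot> ?q)) ?xx"
        have r: "?r \<in> Arr C" "Dom C ?r = pb C x X" "Cod C ?r = Dom C G" "\<sigma> \<cdot> (shape l \<cdot> ?q) = G \<cdot> ?r"
          using sR[of "shape l \<cdot> ?q" ?xx] xhq by simp_all
        have fr: "f \<cdot> ?q = G \<cdot> ?r" using precomp[OF sl, of ?q] r(4) by simp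
        have "act \<theta> ?q ?xx = act (\<chi> \<cdot>\<^bsub>K\<^esub> l) ?q ?xx" by (simp only: \<chi>l)
        also have "\<dots> = act l ?q (act \<chi> (shape l \<cdot> ?q) ?xx)" using xhq by simp
        also have "act \<chi> (shape l \<cdot> ?q) ?xx = act c (shape l \<cdot> ?q) ?r" by (rule \<chi>b) (use xhq in simp_all)
        also have "act l ?q \<dots> = act (c \<cdot>\<^bsub>K\<^esub> l) ?q ?r" by (rule act_cmp[symmetric]) (use r in simp_all)
        also have "\<dots> = act c' ?q ?r" by (simp only: l2)
        finally have "x' \<cdot> act \<theta> ?q ?xx = x' \<cdot> act c' ?q ?r" by simp
        also have "\<dots> = ?r" by (rule ac') (use r fr in simp_all)
        finally have "?r = \<kappa>" by (simp add: \<kappa>_def A_def)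
        then have "?h = h'"
          by (intro Run[of ?h h' x]) (use nh xel h'2 in simp_all)
        then show ?thesis by (simp only: sp)
      qed
      fix k1 k2
      assume "k1 \<in> Arr C \<and> Dom C k1 = Dom C w \<and> Cod C k1 = Dom C h \<and> h \<cdot> k1 = w \<and>
         (\<exists>\<kappa>. \<kappa> \<in> Arr K \<and> Dom K \<kappa> = Dom K c' \<and> Cod K \<kappa> = Dom K c \<and> c \<cdot>\<^bsub>K\<^esub> \<kappa> = c' \<and> t \<cdot> shape \<kappa> = k1 \<cdot> t' \<and> \<chi> \<cdot>\<^bsub>K\<^esub> \<kappa> = \<theta>)"
      then obtain l1 where k1: "k1 \<in> Arr C" "Dom C k1 = Dom C w" "Cod C k1 = Dom C h" "h \<cdot> k1 = w" and
        l1: "l1 \<in> Arr K" "Dom K l1 = Dom K c'" "Cod K l1 = Dom K c" "c \<cdot>\<^bsub>K\<^esub> l1 = c'" "t \<cdot> shape l1 = k1 \<cdot> t'" "\<chi> \<cdot>\<^bsub>K\<^esub> l1 = \<theta>"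
        by (elim conjE exE)
      assume "k2 \<in> Arr C \<and> Dom C k2 = Dom C w \<and> Cod C k2 = Dom C h \<and> h \<cdot> k2 = w \<and>
         (\<exists>\<kappa>. \<kappa> \<in> Arr K \<and> Dom K \<kappa> = Dom K c' \<and> Cod K \<kappa> = Dom K c \<and> c \<cdot>\<^bsub>K\<^esub> \<kappa> = c' \<and> t \<cdot> shape \<kappa> = k2 \<cdot> t' \<and> \<chi> \<cdot>\<^bsub>K\<^esub> \<kappa> = \<theta>)"
      then obtain l2 where k2: "k2 \<in> Arr C" "Dom C k2 = Dom C w" "Cod C k2 = Dom C h" "h \<cdot> k2 = w" and
        l2: "l2 \<in> Arr K" "Dom K l2 = Dom K c'" "Cod K l2 = Dom K c" "c \<cdot>\<^bsub>K\<^esub> l2 = c'" "t \<cdot> shape l2 = k2 \<cdot> t'" "\<chi> \<cdot>\<^bsub>K\<^esub> l2 = \<theta>"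
        by (elim conjE exE)
      show "k1 = k2"
        by (rule Pi_unique[OF un M, folded h_def ev_def])
          (use k1 k2 in \<open>simp_all add: U[OF k1 l1] U[OF k2 l2]\<close>)
    qed
  qed (use cm in simp_all)
  then show thesis by (rule that)
qed

end

end

section \<open>Coproducts, extensivity and sums of containers\<close>

context category
begin

lemma coproduct_arr:
  assumes "is_coproduct C i j"
  shows "i \<in> Arr C" "j \<in> Arr C" "Cod C j = Cod C i"
  using assms by (auto simp: is_coproduct_def)

lemma coproduct_ex1:
  assumes "is_coproduct C i j" and u: "u \<in> Arr C" "v \<in> Arr C" "Dom C u = Dom C i" "Dom C v = Dom C j" "Cod C u = T" "Cod C v = T"
  shows "\<exists>!h. h \<in> hom C (Cod C i) T \<and> h \<cdot> i = u \<and> h \<cdot> j = v"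
proof -
  have U: "\<forall>T\<in>Obj C. \<forall>u\<in>hom C (Dom C i) T. \<forall>v\<in>hom C (Dom C j) T. \<exists>!h. h \<in> hom C (Cod C i) T \<and> h \<cdot> i = u \<and> h \<cdot> j = v"
    using assms(1) unfolding is_coproduct_def by (elim conjE)
  have T: "T \<in> Obj C" "u \<in> hom C (Dom C i) T" "v \<in> hom C (Dom C j) T"
    using u cod_in[of u] by (auto simp: hom_iff)
  show ?thesis by (rule bspec[OF bspec[OF bspec[OF U T(1)] T(2)] T(3)])
qed

lemma coproduct_ex:
  assumes "is_coproduct C i j" and u: "u \<in> Arr C" "v \<in> Arr C" "Dom C u = Dom C i" "Dom C v = Dom C j" "Cod C u = T" "Cod C v = T"
  obtains h where "h \<in> Arr C" "Dom C h = Cod C i" "Cod C h = T" "h \<cdot> i = u" "h \<cdot> j = v"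
  using ex1_implies_ex[OF coproduct_ex1[OF assms]] unfolding hom_iff by (elim exE conjE)

lemma coproduct_unique:
  assumes c: "is_coproduct C i j" and h: "h \<in> Arr C" "h' \<in> Arr C" "Dom C h = Cod C i" "Dom C h' = Cod C i" "Cod C h = Cod C h'"
    "h \<cdot> i = h' \<cdot> i" "h \<cdot> j = h' \<cdot> j"
  shows "h = h'"
proof -
  note [simp] = coproduct_arr[OF c] h(1-5)
  have 0: "\<exists>!g. g \<in> hom C (Cod C i) (Cod C h') \<and> g \<cdot> i = h' \<cdot> i \<and> g \<cdot> j = h' \<cdot> j"
    by (rule coproduct_ex1[OF c]) simp_all
  have 1: "h \<in> hom C (Cod C i) (Cod C h') \<and> h \<cdot> i = h' \<cdot> i \<and> h \<cdot> j = h' \<cdot> j"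
    and 2: "h' \<in> hom C (Cod C i) (Cod C h') \<and> h' \<cdot> i = h' \<cdot> i \<and> h' \<cdot> j = h' \<cdot> j"
    using h by (simp_all add: hom_iff)
  show ?thesis by (rule trans[OF the1_equality[OF 0 1, symmetric] the1_equality[OF 0 2]])
qed

lemma coproductI:
  assumes "i \<in> Arr C" "j \<in> Arr C" "Cod C j = Cod C i"
    and "\<And>u v T. u \<in> Arr C \<Longrightarrow> v \<in> Arr C \<Longrightarrow> Dom C u = Dom C i \<Longrightarrow> Dom C v = Dom C j \<Longrightarrow> Cod C u = T \<Longrightarrow> Cod C v = T \<Longrightarrow>
      \<exists>h. h \<in> Arr C \<and> Dom C h = Cod C i \<and> Cod C h = T \<and> h \<cdot> i = u \<and> h \<cdot> j = v"
    and "\<And>h h'. h \<in> Arr C \<Longrightarrow> h' \<in> Arr C \<Longrightarrow> Dom C h = Cod C i \<Longrightarrow> Dom C h' = Cod C i \<Longrightarrow> Cod C h = Cod C h' \<Longrightarrow>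
      h \<cdot> i = h' \<cdot> i \<Longrightarrow> h \<cdot> j = h' \<cdot> j \<Longrightarrow> h = h'"
  shows "is_coproduct C i j"
  unfolding is_coproduct_def
proof (intro conjI ballI)
  fix T u v assume "u \<in> hom C (Dom C i) T" "v \<in> hom C (Dom C j) T"
  then have u: "u \<in> Arr C" "v \<in> Arr C" "Dom C u = Dom C i" "Dom C v = Dom C j" "Cod C u = T" "Cod C v = T" by (simp_all add: hom_iff)
  show "\<exists>!h. h \<in> hom C (Cod C i) T \<and> h \<cdot> i = u \<and> h \<cdot> j = v"
  proof (rule ex_ex1I)
    show "\<exists>h. h \<in> hom C (Cod C i) T \<and> h \<cdot> i = u \<and> h \<cdot> j = v"
      using assms(4)[OF u] by (simp add: hom_iff)
    fix h h'
    assume "h \<in> hom C (Cod C i) T \<and> h \<cdot> i = u \<and> h \<cdot> j = v" "h' \<in> hom C (Cod C i) T \<and> h' \<cdot> i = u \<and> h' \<cdot> j = v"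
    then show "h = h'" by - (rule assms(5), simp_all add: hom_iff)
  qed
qed (use assms(1-3) in simp_all)

lemma inverse_arrow_eq:
  assumes "f \<in> Arr C" "g \<in> Arr C" "Dom C g = Cod C f" "Cod C g = Dom C f" "g \<cdot> f = Idt C (Dom C f)" "f \<cdot> g = Idt C (Cod C f)"
  shows "inverse_arrow C f = g"
  unfolding inverse_arrow_def
proof (rule the_equality)
  show "g \<in> hom C (Cod C f) (Dom C f) \<and> g \<cdot> f = Idt C (Dom C f) \<and> f \<cdot> g = Idt C (Cod C f)"
    using assms by (simp add: hom_iff)
  fix h assume "h \<in> hom C (Cod C f) (Dom C f) \<and> h \<cdot> f = Idt C (Dom C f) \<and> f \<cdot> h = Idt C (Cod C f)"
  then have h: "h \<in> Arr C" "Dom C h = Cod C f" "Cod C h = Dom C f" and hf: "h \<cdot> f = Idt C (Dom C f)" by (simp_all add: hom_iff)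
  have "(h \<cdot> f) \<cdot> g = h \<cdot> (f \<cdot> g)" using assms h by simp
  then show "h = g" unfolding hf assms(6) using assms(1-4) h by simp
qed

end

locale extensive_lcc = lcc_category +
  assumes extensive: "extensive C"
begin

context notes [simp] = shape_simps
begin

lemma injections:
  assumes "A \<in> Obj C" "B \<in> Obj C"
  shows "is_coproduct C (inl C A B) (inr C A B)" "Dom C (inl C A B) = A" "Dom C (inr C A B) = B"
    "inl C A B \<in> Arr C" "inr C A B \<in> Arr C" "Cod C (inl C A B) = coprod C A B" "Cod C (inr C A B) = coprod C A B"
proof -
  have "\<exists>i j. is_coproduct C i j \<and> Dom C i = A \<and> Dom C j = B"
    using extensive assms unfolding extensive_def has_finite_coproducts_def by blast
  then have "\<exists>x. case x of (i, j) \<Rightarrow> is_coproduct C i j \<and> Dom C i = A \<and> Dom C j = B" by simp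
  from someI_ex[OF this] show 1: "is_coproduct C (inl C A B) (inr C A B)" "Dom C (inl C A B) = A" "Dom C (inr C A B) = B"
    by (simp_all add: inl_def inr_def injections_def case_prod_unfold)
  show "inl C A B \<in> Arr C" "inr C A B \<in> Arr C" "Cod C (inl C A B) = coprod C A B" "Cod C (inr C A B) = coprod C A B"
    using coproduct_arr[OF 1(1)] by (simp_all add: coprod_def)
qed

declare injections(2-7)[simp]

lemma coproduct_eqI:
  assumes "A \<in> Obj C" "B \<in> Obj C" "h \<in> Arr C" "h' \<in> Arr C" "Dom C h = coprod C A B" "Dom C h' = coprod C A B" "Cod C h = Cod C h'"
    "h \<cdot> inl C A B = h' \<cdot> inl C A B" "h \<cdot> inr C A B = h' \<cdot> inr C A B"
  shows "h = h'"
  by (rule coproduct_unique[OF injections(1)[OF assms(1,2)]]) (use assms in simp_all)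

lemma copair[simp]:
  assumes "u \<in> Arr C" "v \<in> Arr C" "Cod C u = Cod C v" "Dom C u = A" "Dom C v = B"
  shows "copair C u v \<in> Arr C" "Dom C (copair C u v) = coprod C A B" "Cod C (copair C u v) = Cod C v"
    "copair C u v \<cdot> inl C A B = u" "copair C u v \<cdot> inr C A B = v"
proof -
  have AB: "A \<in> Obj C" "B \<in> Obj C" using assms dom_in by metis+
  have E: "\<exists>!h. h \<in> hom C (coprod C A B) (Cod C v) \<and> h \<cdot> inl C A B = u \<and> h \<cdot> inr C A B = v"
    by (rule coproduct_ex1[OF injections(1)[OF AB], of u v "Cod C v", unfolded injections(6)[OF AB]]) (use assms AB in simp_all)
  have "copair C u v = (THE h. h \<in> hom C (coprod C A B) (Cod C v) \<and> h \<cdot> inl C A B = u \<and> h \<cdot> inr C A B = v)"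
    unfolding copair_def assms(3-5) by (rule refl)
  with theI'[OF E] show "copair C u v \<in> Arr C" "Dom C (copair C u v) = coprod C A B" "Cod C (copair C u v) = Cod C v"
    "copair C u v \<cdot> inl C A B = u" "copair C u v \<cdot> inr C A B = v"
    by (simp_all only: hom_iff)
qed

lemma coprod_arr[simp]:
  assumes "f \<in> Arr C" "g \<in> Arr C" "Dom C f = A" "Dom C g = B"
  shows "coprod_arr C f g \<in> Arr C" "Dom C (coprod_arr C f g) = coprod C A B" "Cod C (coprod_arr C f g) = coprod C (Cod C f) (Cod C g)"
    "coprod_arr C f g \<cdot> inl C A B = inl C (Cod C f) (Cod C g) \<cdot> f" "coprod_arr C f g \<cdot> inr C A B = inr C (Cod C f) (Cod C g) \<cdot> g"
  using assms by (simp_all add: coprod_arr_def)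

text \<open>This and \<open>coproduct_square_pullback\<close> are the two directions of extensivity.
  The first splits generalised elements of a coproduct into their parts, the second computes the
  fibres of a sum of arrows over the summands.\<close>

lemma pullback_of_coproduct:
  assumes c: "is_coproduct C i j" and 1: "D.mpb i z x u" and 2: "D.mpb j z y v"
  shows "is_coproduct C u v"
proof -
  have ex: "\<forall>X Y Z x y z u v.
           x \<in> hom C X (Dom C i) \<and> y \<in> hom C Y (Dom C j) \<and> z \<in> hom C Z (Cod C i) \<and>
           u \<in> hom C X Z \<and> v \<in> hom C Y Z \<and> i \<cdot> x = z \<cdot> u \<and> j \<cdot> y = z \<cdot> v \<longrightarrow>
           (is_pullback C i z x u \<and> is_pullback C j z y v \<longleftrightarrow> is_coproduct C u v)"
    using extensive c unfolding extensive_def by blast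
  have "x \<in> hom C (Dom C x) (Dom C i) \<and> y \<in> hom C (Dom C y) (Dom C j) \<and> z \<in> hom C (Dom C z) (Cod C i) \<and>
           u \<in> hom C (Dom C x) (Dom C z) \<and> v \<in> hom C (Dom C y) (Dom C z) \<and> i \<cdot> x = z \<cdot> u \<and> j \<cdot> y = z \<cdot> v"
    using D.mpbD[OF 1] D.mpbD[OF 2] by (simp add: hom_iff)
  then have "is_pullback C i z x u \<and> is_pullback C j z y v \<longleftrightarrow> is_coproduct C u v"
    using ex by blast
  then show ?thesis using 1 2 by (simp add: pullback_iff)
qed

lemma coproduct_square_pullback:
  assumes c: "is_coproduct C i j" and uv: "is_coproduct C u v" and
    z: "z \<in> Arr C" "Dom C z = Cod C u" "Cod C z = Cod C i" and x: "x \<in> Arr C" "Dom C x = Dom C u" "Cod C x = Dom C i"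
    and y: "y \<in> Arr C" "Dom C y = Dom C v" "Cod C y = Dom C j" and eq: "i \<cdot> x = z \<cdot> u" "j \<cdot> y = z \<cdot> v"
  shows "D.mpb i z x u" "D.mpb j z y v"
proof -
  have ex: "\<forall>X Y Z x y z u v.
           x \<in> hom C X (Dom C i) \<and> y \<in> hom C Y (Dom C j) \<and> z \<in> hom C Z (Cod C i) \<and>
           u \<in> hom C X Z \<and> v \<in> hom C Y Z \<and> i \<cdot> x = z \<cdot> u \<and> j \<cdot> y = z \<cdot> v \<longrightarrow>
           (is_pullback C i z x u \<and> is_pullback C j z y v \<longleftrightarrow> is_coproduct C u v)"
    using extensive c unfolding extensive_def by blast
  have "x \<in> hom C (Dom C x) (Dom C i) \<and> y \<in> hom C (Dom C y) (Dom C j) \<and> z \<in> hom C (Dom C z) (Cod C i) \<and>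
           u \<in> hom C (Dom C x) (Dom C z) \<and> v \<in> hom C (Dom C y) (Dom C z) \<and> i \<cdot> x = z \<cdot> u \<and> j \<cdot> y = z \<cdot> v"
    using z x y eq coproduct_arr[OF uv] by (simp add: hom_iff)
  then have "is_pullback C i z x u \<and> is_pullback C j z y v \<longleftrightarrow> is_coproduct C u v"
    using ex by blast
  then show "D.mpb i z x u" "D.mpb j z y v" using uv by (simp_all add: pullback_iff)
qed

text \<open>By extensivity the sum of \<open>P\<close> and \<open>Q\<close> has over a left shape
  exactly the directions of \<open>P\<close>, and over a right shape those of \<open>Q\<close>. This
  makes the container injections cartesian.\<close>

lemma sum_pullbacks:
  assumes P[simp]: "P \<in> Arr C" and Q[simp]: "Q \<in> Arr C"
  shows "D.mpb (inl C (Cod C P) (Cod C Q)) (coprod_arr C P Q) P (inl C (Dom C P) (Dom C Q))"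
    "D.mpb (inr C (Cod C P) (Cod C Q)) (coprod_arr C P Q) Q (inr C (Dom C P) (Dom C Q))"
  by (rule coproduct_square_pullback[OF injections(1) injections(1)]; simp)+

text \<open>Specified by its shape and by the pullback that makes it cartesian, rather than by a
  tuple, because \<open>cartesian_act\<close> and \<open>cartesian_mpb\<close> are what later proofs
  use.\<close>

definition in1 :: "'b \<Rightarrow> 'b \<Rightarrow> 'b \<times> 'b \<times> 'b \<times> 'b" where
  "in1 P Q = (SOME c. cartesian c (inl C (Dom C P) (Dom C Q)) \<and> Dom K c = P \<and> Cod K c = coprod_arr C P Q \<and> shape c = inl C (Cod C P) (Cod C Q))"

definition in2 :: "'b \<Rightarrow> 'b \<Rightarrow> 'b \<times> 'b \<times> 'b \<times> 'b" where
  "in2 P Q = (SOME c. cartesian c (inr C (Dom C P) (Dom C Q)) \<and> Dom K c = Q \<and> Cod K c = coprod_arr C P Q \<and> shape c = inr C (Cod C P) (Cod C Q))"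

lemma in12:
  assumes P: "P \<in> Arr C" and Q: "Q \<in> Arr C"
  shows "cartesian (in1 P Q) (inl C (Dom C P) (Dom C Q))" "Dom K (in1 P Q) = P" "Cod K (in1 P Q) = coprod_arr C P Q" "shape (in1 P Q) = inl C (Cod C P) (Cod C Q)"
    "cartesian (in2 P Q) (inr C (Dom C P) (Dom C Q))" "Dom K (in2 P Q) = Q" "Cod K (in2 P Q) = coprod_arr C P Q" "shape (in2 P Q) = inr C (Cod C P) (Cod C Q)"
proof -
  obtain c where "cartesian c (inl C (Dom C P) (Dom C Q)) \<and> Dom K c = P \<and> Cod K c = coprod_arr C P Q \<and> shape c = inl C (Cod C P) (Cod C Q)"
    using cartesian_ex[OF sum_pullbacks(1)[OF P Q]] by metis
  from someI[of "\<lambda>c. cartesian c (inl C (Dom C P) (Dom C Q)) \<and> Dom K c = P \<and> Cod K c = coprod_arr C P Q \<and> shape c = inl C (Cod C P) (Cod C Q)", OF this]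
  show "cartesian (in1 P Q) (inl C (Dom C P) (Dom C Q))" "Dom K (in1 P Q) = P" "Cod K (in1 P Q) = coprod_arr C P Q" "shape (in1 P Q) = inl C (Cod C P) (Cod C Q)"
    unfolding in1_def by blast+
  obtain c where "cartesian c (inr C (Dom C P) (Dom C Q)) \<and> Dom K c = Q \<and> Cod K c = coprod_arr C P Q \<and> shape c = inr C (Cod C P) (Cod C Q)"
    using cartesian_ex[OF sum_pullbacks(2)[OF P Q]] by metis
  from someI[of "\<lambda>c. cartesian c (inr C (Dom C P) (Dom C Q)) \<and> Dom K c = Q \<and> Cod K c = coprod_arr C P Q \<and> shape c = inr C (Cod C P) (Cod C Q)", OF this]
  show "cartesian (in2 P Q) (inr C (Dom C P) (Dom C Q))" "Dom K (in2 P Q) = Q" "Cod K (in2 P Q) = coprod_arr C P Q" "shape (in2 P Q) = inr C (Cod C P) (Cod C Q)"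
    unfolding in2_def by blast+
qed

lemma in12_arr: "P \<in> Arr C \<Longrightarrow> Q \<in> Arr C \<Longrightarrow> in1 P Q \<in> Arr K" "P \<in> Arr C \<Longrightarrow> Q \<in> Arr C \<Longrightarrow> in2 P Q \<in> Arr K"
  using in12(1,5) cartesianD(1) by blast+

text \<open>Composing with \<open>c\<close> changes directions by an invertible map, so the
  directions of \<open>k\<close> can be recovered over every shape that comes from
  \<open>c\<close>.\<close>

lemma cartesian_cancel:
  assumes c: "cartesian c x" and k[simp]: "k \<in> Arr K" "k' \<in> Arr K" "Dom K k = Cod K c" "Dom K k' = Cod K c" "Cod K k = X" "Cod K k' = X"
    and s: "shape k = shape k'" and eq: "k \<cdot>\<^bsub>K\<^esub> c = k' \<cdot>\<^bsub>K\<^esub> c"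
    and t[simp]: "t \<in> Arr C" "b \<in> Arr C" "Dom C t = Dom C b" "Cod C t = Cod C (Dom K c)" "Cod C b = Dom C X" and e: "shape k' \<cdot> (shape c \<cdot> t) = X \<cdot> b"
  shows "act k (shape c \<cdot> t) b = act k' (shape c \<cdot> t) b"
proof -
  note [simp] = cartesianD(1)[OF c]
  have X: "X \<in> Arr C" using arr_K(2)[OF k(1)] by simp
  have "act c t (act k (shape c \<cdot> t) b) = act (k \<cdot>\<^bsub>K\<^esub> c) t b"
    by (rule act_cmp[symmetric]) (use e s in simp_all)
  also have "\<dots> = act c t (act k' (shape c \<cdot> t) b)"
    unfolding eq by (rule act_cmp) (use e s in simp_all)
  finally have 1: "x \<cdot> act c t (act k (shape c \<cdot> t) b) = x \<cdot> act c t (act k' (shape c \<cdot> t) b)" by simp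
  have 2: "x \<cdot> act c t (act k (shape c \<cdot> t) b) = act k (shape c \<cdot> t) b" "x \<cdot> act c t (act k' (shape c \<cdot> t) b) = act k' (shape c \<cdot> t) b"
    by (rule cartesian_act[OF c]; use e s in simp)+
  show ?thesis by (rule trans[OF trans[OF 2(1)[symmetric] 1] 2(2)])
qed

text \<open>By extensivity a generalised shape \<open>t\<close> of the sum is the coproduct of its
  pullbacks along the two injections, and on each part the directions of a morphism are determined
  by its composite with a cartesian injection.\<close>

lemma sum_coproduct:
  assumes P[simp]: "P \<in> Arr C" and Q[simp]: "Q \<in> Arr C"
  shows "is_coproduct K (in1 P Q) (in2 P Q)"
proof (rule category.coproductI[OF category_K])
  let ?S = "coprod_arr C P Q" and ?i = "inl C (Cod C P) (Cod C Q)" and ?j = "inr C (Cod C P) (Cod C Q)"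
  let ?i' = "inl C (Dom C P) (Dom C Q)" and ?j' = "inr C (Dom C P) (Dom C Q)"
  note [simp] = in12(2-4,6-8)[OF P Q] in12_arr[OF P Q]
  note c1 = in12(1)[OF P Q] and c2 = in12(5)[OF P Q]
  show "in1 P Q \<in> Arr K" "in2 P Q \<in> Arr K" "Cod K (in2 P Q) = Cod K (in1 P Q)" by simp_all
  have Z: "is_coproduct C (pr2 C ?i t) (pr2 C ?j t)"
    if "t \<in> Arr C" "Cod C t = coprod C (Cod C P) (Cod C Q)" for t
    by (rule pullback_of_coproduct[OF injections(1)[of "Cod C P" "Cod C Q"] chosen_mpb chosen_mpb]) (use that in simp_all)
  {
    fix k1 k2 X
    assume k[simp]: "k1 \<in> Arr K" "k2 \<in> Arr K" and "Dom K k1 = Dom K (in1 P Q)" "Dom K k2 = Dom K (in2 P Q)" and kX[simp]: "Cod K k1 = X" "Cod K k2 = X"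
    then have kd[simp]: "Dom K k1 = P" "Dom K k2 = Q" by simp_all
    have X[simp]: "X \<in> Arr C" using arr_K(2)[OF k(1)] by simp
    obtain \<phi> where p[simp]: "\<phi> \<in> Arr C" "Dom C \<phi> = coprod C (Cod C P) (Cod C Q)" "Cod C \<phi> = Cod C X" and p2: "\<phi> \<cdot> ?i = shape k1" "\<phi> \<cdot> ?j = shape k2"
      by (rule coproduct_ex[OF injections(1)[of "Cod C P" "Cod C Q"], of "shape k1" "shape k2" "Cod C X"]) simp_all
    define t b where "t = pr1 C \<phi> X" and "b = pr2 C \<phi> X"
    have t[simp]: "t \<in> Arr C" "b \<in> Arr C" "Dom C t = pb C \<phi> X" "Dom C b = pb C \<phi> X" "Cod C t = coprod C (Cod C P) (Cod C Q)" "Cod C b = Dom C X"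
      by (simp_all add: t_def b_def)
    have tb: "\<phi> \<cdot> t = X \<cdot> b" by (simp add: t_def b_def pr_eq)
    define t1 u1 t2 u2 where "t1 = pr1 C ?i t" and "u1 = pr2 C ?i t" and "t2 = pr1 C ?j t" and "u2 = pr2 C ?j t"
    have u[simp]: "t1 \<in> Arr C" "u1 \<in> Arr C" "t2 \<in> Arr C" "u2 \<in> Arr C" "Dom C t1 = Dom C u1" "Dom C t2 = Dom C u2"
      "Cod C t1 = Cod C P" "Cod C t2 = Cod C Q" "Cod C u1 = pb C \<phi> X" "Cod C u2 = pb C \<phi> X"
      by (simp_all add: t1_def u1_def t2_def u2_def)
    have tu: "?i \<cdot> t1 = t \<cdot> u1" "?j \<cdot> t2 = t \<cdot> u2" by (simp_all add: t1_def u1_def t2_def u2_def pr_eq)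
    have U: "is_coproduct C u1 u2" unfolding u1_def u2_def by (rule Z) simp_all
    have k1t: "shape k1 \<cdot> t1 = X \<cdot> (b \<cdot> u1)" "shape k2 \<cdot> t2 = X \<cdot> (b \<cdot> u2)"
      using precomp[OF p2(1), of t1] precomp[OF p2(2), of t2] tu precomp[OF tb, of u1] precomp[OF tb, of u2] by simp_all
    define a1 a2 where "a1 = act k1 t1 (b \<cdot> u1)" and "a2 = act k2 t2 (b \<cdot> u2)"
    have a[simp]: "a1 \<in> Arr C" "Dom C a1 = Dom C u1" "Cod C a1 = Dom C P" "a2 \<in> Arr C" "Dom C a2 = Dom C u2" "Cod C a2 = Dom C Q"
      and a2: "P \<cdot> a1 = t1" "Q \<cdot> a2 = t2"
      using k1t by (simp_all add: a1_def a2_def)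
    \<comment> \<open>Here \<open>t\<close> is the generic shape at which the directions component
      is evaluated; \<open>d\<close> is that component, glued from the two parts of
      \<open>t\<close>.\<close>
    obtain d where d[simp]: "d \<in> Arr C" "Dom C d = pb C \<phi> X" "Cod C d = coprod C (Dom C P) (Dom C Q)" and du: "d \<cdot> u1 = ?i' \<cdot> a1" "d \<cdot> u2 = ?j' \<cdot> a2"
      by (rule coproduct_ex[OF U, of "?i' \<cdot> a1" "?j' \<cdot> a2" "coprod C (Dom C P) (Dom C Q)"]) simp_all
    have Si: "?S \<cdot> (?i' \<cdot> a1) = ?i \<cdot> (P \<cdot> a1)" "?S \<cdot> (?j' \<cdot> a2) = ?j \<cdot> (Q \<cdot> a2)"
      using precomp[OF coprod_arr(4)[of P Q], of _ _ a1] precomp[OF coprod_arr(5)[of P Q], of _ _ a2] by simp_all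
    have Sd: "?S \<cdot> d = t"
      by (rule coproduct_unique[OF U]) (use du Si a2 tu in simp_all)
    obtain m where m[simp]: "m \<in> Arr K" "Dom K m = ?S" "Cod K m = X" "shape m = \<phi>" and ma: "\<And>\<tau> \<beta>. act m \<tau> \<beta> = d \<cdot> pair C \<phi> X \<tau> \<beta>"
      by (rule K_mk[of ?S X \<phi> d]) (use Sd in \<open>simp_all add: t_def\<close>)
    \<comment> \<open>Both injections at once: \<open>da\<close> describes \<open>d\<close> on the
      generic part, and \<open>w\<close> carries this to an arbitrary pair \<tau>, \<beta>.\<close>
    have restrict: "m \<cdot>\<^bsub>K\<^esub> c = k" if c: "cartesian c x" and [simp]: "Dom K c = R" "Cod K c = ?S" "shape c = i"
       and i[simp]: "i \<in> Arr C" "Dom C i = Cod C R" "Cod C i = coprod C (Cod C P) (Cod C Q)"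
       and k[simp]: "k \<in> Arr K" "Dom K k = R" "Cod K k = X" and pi: "\<phi> \<cdot> i = shape k"
       and da: "d \<cdot> pr2 C i t = x \<cdot> act k (pr1 C i t) (b \<cdot> pr2 C i t)" and R[simp]: "R \<in> Arr C" for c x R i k
    proof (rule K_ext[of _ _ R X "shape k"])
      note [simp] = cartesianD(1,3,4,5)[OF c, simplified] and ca = cartesianD(6)[OF c, simplified]
      fix \<tau> \<beta>
      assume \<tau>[simp]: "\<tau> \<in> Arr C" "\<beta> \<in> Arr C" "Dom C \<tau> = Dom C \<beta>" "Cod C \<tau> = Cod C R" "Cod C \<beta> = Dom C X" and e: "shape k \<cdot> \<tau> = X \<cdot> \<beta>"
      have pit: "\<phi> \<cdot> (i \<cdot> \<tau>) = X \<cdot> \<beta>" using precomp[OF pi, of \<tau>] e by simp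
      define p where "p = pair C \<phi> X (i \<cdot> \<tau>) \<beta>"
      have p[simp]: "p \<in> Arr C" "Dom C p = Dom C \<beta>" "Cod C p = pb C \<phi> X" and p2: "t \<cdot> p = i \<cdot> \<tau>" "b \<cdot> p = \<beta>"
        using pit by (simp_all add: p_def t_def b_def)
      define w where "w = pair C i t \<tau> p"
      let ?t = "pr1 C i t" and ?u = "pr2 C i t"
      have w[simp]: "w \<in> Arr C" "Dom C w = Dom C \<beta>" "Cod C w = pb C i t" and w2: "?t \<cdot> w = \<tau>" "?u \<cdot> w = p"
        using p2 by (simp_all add: w_def)
      have kt: "shape k \<cdot> ?t = X \<cdot> (b \<cdot> ?u)"
        using precomp[OF pi, of ?t] precomp[OF tb, of ?u] pr_eq[of i t] by simp
      have A: "act k \<tau> \<beta> \<in> Arr C" "Cod C (act k \<tau> \<beta>) = Dom C R" "R \<cdot> act k \<tau> \<beta> = \<tau>" using e by simp_all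
      have "d \<cdot> p = (d \<cdot> ?u) \<cdot> w" using w2 by simp
      also have "\<dots> = x \<cdot> (act k ?t (b \<cdot> ?u) \<cdot> w)" unfolding da by (rule assoc) (use kt in simp_all)
      also have "act k ?t (b \<cdot> ?u) \<cdot> w = act k (?t \<cdot> w) ((b \<cdot> ?u) \<cdot> w)" by (rule act_simps(5)) (use kt in simp_all)
      also have "(b \<cdot> ?u) \<cdot> w = \<beta>" using w2 p2 by simp
      finally have "act m (i \<cdot> \<tau>) \<beta> = x \<cdot> act k \<tau> \<beta>" unfolding ma w2(1) p_def .
      moreover have "act (m \<cdot>\<^bsub>K\<^esub> c) \<tau> \<beta> = act c \<tau> (act m (i \<cdot> \<tau>) \<beta>)" using pit by simp
      ultimately show "act (m \<cdot>\<^bsub>K\<^esub> c) \<tau> \<beta> = act k \<tau> \<beta>"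
        using ca[OF A(1,2)] unfolding A(3) by simp
    next
      show "m \<cdot>\<^bsub>K\<^esub> c \<in> Arr K" "Dom K (m \<cdot>\<^bsub>K\<^esub> c) = R" "Cod K (m \<cdot>\<^bsub>K\<^esub> c) = X" "shape (m \<cdot>\<^bsub>K\<^esub> c) = shape k"
        using cartesianD(1)[OF c] pi by simp_all
    qed simp_all
    have "m \<cdot>\<^bsub>K\<^esub> in1 P Q = k1"
      by (rule restrict[OF c1, of P ?i k1]) (use p2 du in \<open>simp_all add: a1_def u1_def t1_def\<close>)
    moreover have "m \<cdot>\<^bsub>K\<^esub> in2 P Q = k2"
      by (rule restrict[OF c2, of Q ?j k2]) (use p2 du in \<open>simp_all add: a2_def u2_def t2_def\<close>)
    ultimately show "\<exists>h. h \<in> Arr K \<and> Dom K h = Cod K (in1 P Q) \<and> Cod K h = X \<and> h \<cdot>\<^bsub>K\<^esub> in1 P Q = k1 \<and> h \<cdot>\<^bsub>K\<^esub> in2 P Q = k2"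
      by (intro exI[of _ m]) simp
  }
  {
    fix k k'
    assume k[simp]: "k \<in> Arr K" "k' \<in> Arr K" and "Dom K k = Cod K (in1 P Q)" "Dom K k' = Cod K (in1 P Q)" and kc: "Cod K k = Cod K k'"
      and e1: "k \<cdot>\<^bsub>K\<^esub> in1 P Q = k' \<cdot>\<^bsub>K\<^esub> in1 P Q" and e2: "k \<cdot>\<^bsub>K\<^esub> in2 P Q = k' \<cdot>\<^bsub>K\<^esub> in2 P Q"
    then have kd[simp]: "Dom K k = ?S" "Dom K k' = ?S" by simp_all
    define X \<phi> where "X = Cod K k'" and "\<phi> = shape k'"
    have X[simp]: "X \<in> Arr C" "Cod K k = X" "Cod K k' = X" using kc by (simp_all add: X_def)
    have "shape (k \<cdot>\<^bsub>K\<^esub> in1 P Q) = shape (k' \<cdot>\<^bsub>K\<^esub> in1 P Q)" "shape (k \<cdot>\<^bsub>K\<^esub> in2 P Q) = shape (k' \<cdot>\<^bsub>K\<^esub> in2 P Q)"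
      by (simp_all only: e1 e2)
    then have s: "shape k = shape k'"
      by - (rule coproduct_eqI[of "Cod C P" "Cod C Q"], simp_all)
    show "k = k'"
    proof (rule K_ext[of _ _ ?S X "shape k'"])
      fix t b
      assume t[simp]: "t \<in> Arr C" "b \<in> Arr C" "Dom C t = Dom C b" and t2: "Cod C t = Cod C ?S" and b[simp]: "Cod C b = Dom C X" and tb: "shape k' \<cdot> t = X \<cdot> b"
      have t3[simp]: "Cod C t = coprod C (Cod C P) (Cod C Q)" using t2 by simp
      have part: "act k t b \<cdot> pr2 C i t = act k' t b \<cdot> pr2 C i t"
        if c: "cartesian c x" and c2[simp]: "Dom K c = R" "Cod K c = ?S" and sc: "shape c = i" and i[simp]: "i \<in> Arr C" "Dom C i = Cod C R" "Cod C i = coprod C (Cod C P) (Cod C Q)"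
          and eq: "k \<cdot>\<^bsub>K\<^esub> c = k' \<cdot>\<^bsub>K\<^esub> c" and R[simp]: "R \<in> Arr C" for c x R i
      proof -
        have it: "i \<cdot> pr1 C i t = t \<cdot> pr2 C i t" by (rule pr_eq) simp_all
        have e: "shape k' \<cdot> (t \<cdot> pr2 C i t) = X \<cdot> (b \<cdot> pr2 C i t)" using precomp[OF tb, of "pr2 C i t"] by simp
        have "act k (shape c \<cdot> pr1 C i t) (b \<cdot> pr2 C i t) = act k' (shape c \<cdot> pr1 C i t) (b \<cdot> pr2 C i t)"
          by (rule cartesian_cancel[OF c _ _ _ _ _ _ s eq]) (use e in \<open>simp_all add: sc it\<close>)
        moreover have "act k t b \<cdot> pr2 C i t = act k (t \<cdot> pr2 C i t) (b \<cdot> pr2 C i t)" "act k' t b \<cdot> pr2 C i t = act k' (t \<cdot> pr2 C i t) (b \<cdot> pr2 C i t)"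
          by (rule act_simps(5); use tb in \<open>simp add: s\<close>)+
        ultimately show ?thesis by (simp only: sc it)
      qed
      show "act k t b = act k' t b"
      proof (rule coproduct_unique[OF Z[OF t(1) t3]])
        show "act k t b \<cdot> pr2 C ?i t = act k' t b \<cdot> pr2 C ?i t" by (rule part[OF c1, of P ?i]) (use e1 in simp_all)
        show "act k t b \<cdot> pr2 C ?j t = act k' t b \<cdot> pr2 C ?j t" by (rule part[OF c2, of Q ?j]) (use e2 in simp_all)
      qed (use tb in \<open>simp_all add: s\<close>)
    qed (use s in simp_all)
  }
qed

text \<open>Over a shape that comes from \<open>c'\<close> every direction of \<open>S'\<close> has
  the form \<open>x' \<cdot> \<beta>\<close>, so the square is decided by its action on
  those.\<close>

lemma cartesian_square:
  assumes c: "cartesian c x" "Dom K c = P" "Cod K c = S" "shape c = i"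
    and c': "cartesian c' x'" "Dom K c' = P'" "Cod K c' = S'" "shape c' = i'"
    and m: "m \<in> Arr K" "Dom K m = P" "Cod K m = P'" and s: "s \<in> Arr K" "Dom K s = S" "Cod K s = S'"
    and si: "shape s \<cdot> i = i' \<cdot> shape m"
    and act: "\<And>\<tau> \<beta>. \<tau> \<in> Arr C \<Longrightarrow> \<beta> \<in> Arr C \<Longrightarrow> Dom C \<tau> = Dom C \<beta> \<Longrightarrow> Cod C \<tau> = Cod C P \<Longrightarrow> Cod C \<beta> = Dom C P' \<Longrightarrow>
      shape m \<cdot> \<tau> = P' \<cdot> \<beta> \<Longrightarrow> act s (i \<cdot> \<tau>) (x' \<cdot> \<beta>) = x \<cdot> act m \<tau> \<beta>"
  shows "s \<cdot>\<^bsub>K\<^esub> c = c' \<cdot>\<^bsub>K\<^esub> m"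
proof -
  note [simp] = c(2-4) c'(2-4) m s cartesianD(1)[OF c(1)] cartesianD(1)[OF c'(1)]
  note [simp] = cartesianD(3-5)[OF c(1), simplified] cartesianD(3-5)[OF c'(1), simplified]
  have [simp]: "P \<in> Arr C" "S \<in> Arr C" "P' \<in> Arr C" "S' \<in> Arr C" using arr_K(1,2)[OF m(1)] arr_K(1,2)[OF s(1)] by simp_all
  have [simp]: "i \<in> Arr C" "Dom C i = Cod C P" "Cod C i = Cod C S" "i' \<in> Arr C" "Dom C i' = Cod C P'" "Cod C i' = Cod C S'"
    using arr_K(3-5)[OF cartesianD(1)[OF c(1)]] arr_K(3-5)[OF cartesianD(1)[OF c'(1)]] by simp_all
  note ca = cartesianD(6)[OF c(1), simplified] and ca' = cartesianD(6)[OF c'(1), simplified]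
  show ?thesis
  proof (rule K_ext[of _ _ P S' "i' \<cdot> shape m"])
    fix \<tau> \<gamma>
    assume \<tau>[simp]: "\<tau> \<in> Arr C" "\<gamma> \<in> Arr C" "Dom C \<tau> = Dom C \<gamma>" "Cod C \<tau> = Cod C P" "Cod C \<gamma> = Dom C S'"
      and "(i' \<cdot> shape m) \<cdot> \<tau> = S' \<cdot> \<gamma>"
    then have e: "i' \<cdot> (shape m \<cdot> \<tau>) = S' \<cdot> \<gamma>" by simp
    obtain \<beta> where b[simp]: "\<beta> \<in> Arr C" "Dom C \<beta> = Dom C \<gamma>" "Cod C \<beta> = Dom C P'" and b2: "x' \<cdot> \<beta> = \<gamma>" "P' \<cdot> \<beta> = shape m \<cdot> \<tau>"
      by (rule D.mpb_lift[OF cartesianD(2)[OF c'(1)], of \<gamma> "shape m \<cdot> \<tau>"]) (use e in simp_all)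
    have e2: "shape s \<cdot> (i \<cdot> \<tau>) = S' \<cdot> \<gamma>" using precomp[OF si, of \<tau>] e by simp
    have A: "act m \<tau> \<beta> \<in> Arr C" "Cod C (act m \<tau> \<beta>) = Dom C P" "P \<cdot> act m \<tau> \<beta> = \<tau>" using b2 by simp_all
    have "act (s \<cdot>\<^bsub>K\<^esub> c) \<tau> \<gamma> = act c \<tau> (act s (shape c \<cdot> \<tau>) \<gamma>)" by (rule act_cmp) (use e2 in simp_all)
    also have "act s (shape c \<cdot> \<tau>) \<gamma> = x \<cdot> act m \<tau> \<beta>"
      unfolding c(4) b2(1)[symmetric] by (rule act) (use b2 in simp_all)
    also have "act c \<tau> (x \<cdot> act m \<tau> \<beta>) = act m \<tau> \<beta>" using ca[OF A(1,2)] unfolding A(3) .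
    also have "\<dots> = act m \<tau> (act c' (shape m \<cdot> \<tau>) \<gamma>)" using ca'[OF b(1,3)] unfolding b2 by (simp only:)
    also have "\<dots> = act (c' \<cdot>\<^bsub>K\<^esub> m) \<tau> \<gamma>" by (rule act_cmp[symmetric]) (use e in simp_all)
    finally show "act (s \<cdot>\<^bsub>K\<^esub> c) \<tau> \<gamma> = act (c' \<cdot>\<^bsub>K\<^esub> m) \<tau> \<gamma>" .
  qed (simp_all add: si)
qed

text \<open>Identifies the formula of \<open>sum_cont_arr\<close>, in which an inverse arrow occurs,
  with the morphism induced by the coproduct of containers.\<close>

lemma sum_arr:
  assumes m: "m \<in> Arr K" "Dom K m = P" "Cod K m = P'" and m': "m' \<in> Arr K" "Dom K m' = Q" "Cod K m' = Q'"
  shows "sum_cont_arr C m m' \<in> Arr K" "Dom K (sum_cont_arr C m m') = coprod_arr C P Q" "Cod K (sum_cont_arr C m m') = coprod_arr C P' Q'"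
    "sum_cont_arr C m m' \<cdot>\<^bsub>K\<^esub> in1 P Q = in1 P' Q' \<cdot>\<^bsub>K\<^esub> m" "sum_cont_arr C m m' \<cdot>\<^bsub>K\<^esub> in2 P Q = in2 P' Q' \<cdot>\<^bsub>K\<^esub> m'"
proof -
  note [simp] = m m'
  have P[simp]: "P \<in> Arr C" "P' \<in> Arr C" "Q \<in> Arr C" "Q' \<in> Arr C" using arr_K(1,2)[OF m(1)] arr_K(1,2)[OF m'(1)] by simp_all
  define f f' d d' where "f = shape m" and "f' = shape m'" and "d = dirs m" and "d' = dirs m'"
  have f[simp]: "f \<in> Arr C" "Dom C f = Cod C P" "Cod C f = Cod C P'" "f' \<in> Arr C" "Dom C f' = Cod C Q" "Cod C f' = Cod C Q'" "shape m = f" "shape m' = f'"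
    "d \<in> Arr C" "Dom C d = pb C f P'" "Cod C d = Dom C P" "d' \<in> Arr C" "Dom C d' = pb C f' Q'" "Cod C d' = Dom C Q"
    and Pd: "P \<cdot> d = pr1 C f P'" "Q \<cdot> d' = pr1 C f' Q'"
    using arr_K[OF m(1)] arr_K[OF m'(1)] by (simp_all add: f_def f'_def d_def d'_def)
  have [simp]: "pb C f P' \<in> Obj C" "pb C f' Q' \<in> Obj C" using dom_in[of d] dom_in[of d'] by simp_all
  define S S' F where "S = coprod_arr C P Q" and "S' = coprod_arr C P' Q'" and "F = coprod_arr C f f'"
  define i j k l where "i = inl C (Cod C P) (Cod C Q)" and "j = inr C (Cod C P) (Cod C Q)"
    and "k = inl C (Cod C P') (Cod C Q')" and "l = inr C (Cod C P') (Cod C Q')"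
  define a b a' b' where "a = inl C (Dom C P) (Dom C Q)" and "b = inr C (Dom C P) (Dom C Q)"
    and "a' = inl C (Dom C P') (Dom C Q')" and "b' = inr C (Dom C P') (Dom C Q')"
  note ijkl = i_def[symmetric] j_def[symmetric] k_def[symmetric] l_def[symmetric] a_def[symmetric] b_def[symmetric] a'_def[symmetric] b'_def[symmetric]
    S_def[symmetric] S'_def[symmetric] F_def[symmetric]
  have ty[simp]: "i \<in> Arr C" "j \<in> Arr C" "k \<in> Arr C" "l \<in> Arr C" "a \<in> Arr C" "b \<in> Arr C" "a' \<in> Arr C" "b' \<in> Arr C"
    "Dom C i = Cod C P" "Dom C j = Cod C Q" "Dom C k = Cod C P'" "Dom C l = Cod C Q'" "Dom C a = Dom C P" "Dom C b = Dom C Q" "Dom C a' = Dom C P'" "Dom C b' = Dom C Q'"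
    "Cod C i = coprod C (Cod C P) (Cod C Q)" "Cod C j = coprod C (Cod C P) (Cod C Q)" "Cod C k = coprod C (Cod C P') (Cod C Q')" "Cod C l = coprod C (Cod C P') (Cod C Q')"
    "Cod C a = coprod C (Dom C P) (Dom C Q)" "Cod C b = coprod C (Dom C P) (Dom C Q)" "Cod C a' = coprod C (Dom C P') (Dom C Q')" "Cod C b' = coprod C (Dom C P') (Dom C Q')"
    "S \<in> Arr C" "S' \<in> Arr C" "F \<in> Arr C" "Dom C S = coprod C (Dom C P) (Dom C Q)" "Dom C S' = coprod C (Dom C P') (Dom C Q')" "Dom C F = coprod C (Cod C P) (Cod C Q)"
    "Cod C S = coprod C (Cod C P) (Cod C Q)" "Cod C S' = coprod C (Cod C P') (Cod C Q')" "Cod C F = coprod C (Cod C P') (Cod C Q')"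
    by (simp_all add: i_def j_def k_def l_def a_def b_def a'_def b'_def S_def S'_def F_def)
  have eqs: "S \<cdot> a = i \<cdot> P" "S \<cdot> b = j \<cdot> Q" "S' \<cdot> a' = k \<cdot> P'" "S' \<cdot> b' = l \<cdot> Q'" "F \<cdot> i = k \<cdot> f" "F \<cdot> j = l \<cdot> f'"
    by (simp_all add: i_def j_def k_def l_def a_def b_def a'_def b'_def S_def S'_def F_def)
  have cij: "is_coproduct C i j" and ckl: "is_coproduct C k l" unfolding i_def j_def k_def l_def by (rule injections; simp)+
  have pbS: "D.mpb k S' P' a'" "D.mpb l S' Q' b'"
    unfolding k_def l_def S'_def a'_def b'_def by (rule sum_pullbacks; simp)+
  define t u where "t = pr1 C F S'" and "u = pr2 C F S'"
  have t[simp]: "t \<in> Arr C" "u \<in> Arr C" "Dom C t = pb C F S'" "Dom C u = pb C F S'" "Cod C t = coprod C (Cod C P) (Cod C Q)" "Cod C u = coprod C (Dom C P') (Dom C Q')"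
    by (simp_all add: t_def u_def)
  \<comment> \<open>Each half of the comparison is a pullback of an injection along
    \<open>t\<close>. By extensivity the two halves \<open>l1\<close> and \<open>l2\<close> form a
    coproduct, which makes the comparison invertible with inverse \<open>g\<close>.\<close>
  have half: "\<exists>l1. l1 \<in> Arr C \<and> Dom C l1 = pb C g R' \<and> Cod C l1 = pb C F S' \<and> l1 = pair C F S' (ii \<cdot> pr1 C g R') (aa \<cdot> pr2 C g R') \<and>
      t \<cdot> l1 = ii \<cdot> pr1 C g R' \<and> u \<cdot> l1 = aa \<cdot> pr2 C g R' \<and> D.mpb ii t (pr1 C g R') l1"
    if g[simp]: "g \<in> Arr C" "R' \<in> Arr C" "Cod C g = Cod C R'" "ii \<in> Arr C" "Dom C ii = Dom C g" "Cod C ii = coprod C (Cod C P) (Cod C Q)"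
      "aa \<in> Arr C" "Dom C aa = Dom C R'" "Cod C aa = coprod C (Dom C P') (Dom C Q')"
      "kk \<in> Arr C" "Dom C kk = Cod C R'" "Cod C kk = coprod C (Cod C P') (Cod C Q')"
      and e: "F \<cdot> ii = kk \<cdot> g" "S' \<cdot> aa = kk \<cdot> R'" and M: "D.mpb kk S' R' aa"
    for g R' ii aa kk
  proof -
    let ?x = "pr1 C g R'" and ?y = "pr2 C g R'"
    define l1 where "l1 = pair C F S' (ii \<cdot> ?x) (aa \<cdot> ?y)"
    have FS: "F \<cdot> (ii \<cdot> ?x) = S' \<cdot> (aa \<cdot> ?y)"
      using precomp[OF e(1), of ?x] precomp[OF e(2), of ?y] pr_eq[of g R'] by simp
    have l1[simp]: "l1 \<in> Arr C" "Dom C l1 = pb C g R'" "Cod C l1 = pb C F S'" and tl: "t \<cdot> l1 = ii \<cdot> ?x" "u \<cdot> l1 = aa \<cdot> ?y"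
      using FS by (simp_all add: l1_def t_def u_def)
    have "D.mpb ii t ?x l1"
    proof (rule D.mpbI)
      fix y s
      assume y[simp]: "y \<in> Arr C" "s \<in> Arr C" and "Cod C y = Cod C l1" "Dom C s = Dom C y" "Cod C s = Dom C ii" and es: "ii \<cdot> s = t \<cdot> y"
      then have y2[simp]: "Cod C y = pb C F S'" "Dom C s = Dom C y" "Cod C s = Dom C g" by simp_all
      have "kk \<cdot> (g \<cdot> s) = S' \<cdot> (u \<cdot> y)"
        using precomp[OF e(1), of s] es pr_eq'[of F S' y] by (simp add: t_def u_def)
      then obtain r where r[simp]: "r \<in> Arr C" "Dom C r = Dom C y" "Cod C r = Dom C R'" and r2: "aa \<cdot> r = u \<cdot> y" "R' \<cdot> r = g \<cdot> s"
        by - (rule D.mpb_lift[OF M, of "u \<cdot> y" "g \<cdot> s"], simp_all)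
      define z where "z = pair C g R' s r"
      have z[simp]: "z \<in> Arr C" "Dom C z = Dom C y" "Cod C z = pb C g R'" and z2: "?x \<cdot> z = s" "?y \<cdot> z = r"
        using r2 by (simp_all add: z_def)
      have "l1 \<cdot> z = y"
        by (rule pb_eqI[of F S'], unfold t_def[symmetric] u_def[symmetric])
          (use z2 r2 es precomp[OF tl(1), of z] precomp[OF tl(2), of z] in simp_all)
      then show "\<exists>z. z \<in> Arr C \<and> Dom C z = Dom C y \<and> Cod C z = Dom C l1 \<and> l1 \<cdot> z = y \<and> ?x \<cdot> z = s"
        using z2 by (intro exI[of _ z]) simp
    next
      fix z z'
      assume z[simp]: "z \<in> Arr C" "z' \<in> Arr C" "Dom C z = Dom C z'" and "Cod C z = Dom C l1" "Cod C z' = Dom C l1"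
        and lz: "l1 \<cdot> z = l1 \<cdot> z'" and xz: "?x \<cdot> z = ?x \<cdot> z'"
      then have z2[simp]: "Cod C z = pb C g R'" "Cod C z' = pb C g R'" by simp_all
      have "u \<cdot> (l1 \<cdot> z) = u \<cdot> (l1 \<cdot> z')" by (simp only: lz)
      then have az: "aa \<cdot> (?y \<cdot> z) = aa \<cdot> (?y \<cdot> z')" using precomp[OF tl(2), of z] precomp[OF tl(2), of z'] by simp
      have Rz: "R' \<cdot> (?y \<cdot> z) = R' \<cdot> (?y \<cdot> z')" using pr_eq'[of g R' z] pr_eq'[of g R' z'] xz by simp
      have "?y \<cdot> z = ?y \<cdot> z'"
        by (rule D.mpb_unique[OF M]) (use az Rz in simp_all)
      then show "z = z'" using xz by - (rule pb_eqI[of g R'], simp_all)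
    qed (simp_all add: tl)
    then show ?thesis using tl by (intro exI[of _ l1]) (simp add: l1_def[symmetric])
  qed
  have "\<exists>l1. l1 \<in> Arr C \<and> Dom C l1 = pb C f P' \<and> Cod C l1 = pb C F S' \<and> l1 = pair C F S' (i \<cdot> pr1 C f P') (a' \<cdot> pr2 C f P') \<and>
      t \<cdot> l1 = i \<cdot> pr1 C f P' \<and> u \<cdot> l1 = a' \<cdot> pr2 C f P' \<and> D.mpb i t (pr1 C f P') l1"
    by (rule half[OF _ _ _ _ _ _ _ _ _ _ _ _ eqs(5) eqs(3) pbS(1)]) simp_all
  then obtain l1 where l1[simp]: "l1 \<in> Arr C" "Dom C l1 = pb C f P'" "Cod C l1 = pb C F S'" and l1d: "l1 = pair C F S' (i \<cdot> pr1 C f P') (a' \<cdot> pr2 C f P')"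
      and l12: "t \<cdot> l1 = i \<cdot> pr1 C f P'" "u \<cdot> l1 = a' \<cdot> pr2 C f P'" and l1M: "D.mpb i t (pr1 C f P') l1"
    by (elim exE conjE)
  have "\<exists>l1. l1 \<in> Arr C \<and> Dom C l1 = pb C f' Q' \<and> Cod C l1 = pb C F S' \<and> l1 = pair C F S' (j \<cdot> pr1 C f' Q') (b' \<cdot> pr2 C f' Q') \<and>
      t \<cdot> l1 = j \<cdot> pr1 C f' Q' \<and> u \<cdot> l1 = b' \<cdot> pr2 C f' Q' \<and> D.mpb j t (pr1 C f' Q') l1"
    by (rule half[OF _ _ _ _ _ _ _ _ _ _ _ _ eqs(6) eqs(4) pbS(2)]) simp_all
  then obtain l2 where l2[simp]: "l2 \<in> Arr C" "Dom C l2 = pb C f' Q'" "Cod C l2 = pb C F S'" and l2d: "l2 = pair C F S' (j \<cdot> pr1 C f' Q') (b' \<cdot> pr2 C f' Q')"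
      and l22: "t \<cdot> l2 = j \<cdot> pr1 C f' Q'" "u \<cdot> l2 = b' \<cdot> pr2 C f' Q'" and l2M: "D.mpb j t (pr1 C f' Q') l2"
    by (elim exE conjE)
  have cl: "is_coproduct C l1 l2" by (rule pullback_of_coproduct[OF cij l1M l2M])
  define cmp where "cmp = sum_compare C f P' f' Q'"
  have cmp: "cmp = copair C l1 l2"
    unfolding cmp_def sum_compare_def f ijkl l1d l2d by (rule refl)
  define p q where "p = inl C (pb C f P') (pb C f' Q')" and "q = inr C (pb C f P') (pb C f' Q')"
  have pq[simp]: "p \<in> Arr C" "q \<in> Arr C" "Dom C p = pb C f P'" "Dom C q = pb C f' Q'" "Cod C p = coprod C (pb C f P') (pb C f' Q')" "Cod C q = coprod C (pb C f P') (pb C f' Q')"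
    by (simp_all add: p_def q_def)
  have cmp0[simp]: "cmp \<in> Arr C" "Dom C cmp = coprod C (pb C f P') (pb C f' Q')" "Cod C cmp = pb C F S'" and cmp2: "cmp \<cdot> p = l1" "cmp \<cdot> q = l2"
    by (simp_all add: cmp p_def q_def)
  obtain g where g[simp]: "g \<in> Arr C" "Dom C g = pb C F S'" "Cod C g = coprod C (pb C f P') (pb C f' Q')" and g2: "g \<cdot> l1 = p" "g \<cdot> l2 = q"
    by (rule coproduct_ex[OF cl, of p q]) simp_all
  have o[simp]: "coprod C (pb C f P') (pb C f' Q') \<in> Obj C" "pb C F S' \<in> Obj C" using cod_in[of g] dom_in[of g] by simp_all
  have "g \<cdot> cmp = Idt C (Dom C cmp)"
    by (rule coproduct_eqI[of "pb C f P'" "pb C f' Q'"]) (use cmp2 g2 in \<open>simp_all add: p_def[symmetric] q_def[symmetric]\<close>)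
  moreover have "cmp \<cdot> g = Idt C (Cod C cmp)"
    by (rule coproduct_unique[OF cl]) (use cmp2 g2 in simp_all)
  ultimately have inv: "inverse_arrow C cmp = g"
    by (intro inverse_arrow_eq) simp_all
  define h where "h = coprod_arr C d d' \<cdot> g"
  have h[simp]: "h \<in> Arr C" "Dom C h = pb C F S'" "Cod C h = coprod C (Dom C P) (Dom C Q)" by (simp_all add: h_def)
  have "coprod_arr C d d' \<cdot> p = a \<cdot> d" "coprod_arr C d d' \<cdot> q = b \<cdot> d'" by (simp_all add: p_def q_def a_def b_def)
  then have hl: "h \<cdot> l1 = a \<cdot> d" "h \<cdot> l2 = b \<cdot> d'" by (simp_all add: h_def g2)
  have Sh: "S \<cdot> h = t"
    by (rule coproduct_unique[OF cl])
      (use hl l12 l22 Pd precomp[OF eqs(1), of d] precomp[OF eqs(2), of d'] in simp_all)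
  have "sum_cont_arr C m m' = sum_cont_arr C (P, f, d, P') (Q, f', d', Q')"
    using arr_K(10)[OF m(1), unfolded m(2,3) f_def[symmetric] d_def[symmetric]] arr_K(10)[OF m'(1), unfolded m'(2,3) f'_def[symmetric] d'_def[symmetric]]
    by (rule arg_cong2)
  also have "\<dots> = (S, F, h, S')"
    unfolding sum_cont_arr_def prod.case cmp_def[symmetric] inv h_def[symmetric] ijkl by (rule refl)
  finally have s: "sum_cont_arr C m m' = (S, F, h, S')" .
  define s where "s = sum_cont_arr C m m'"
  have s0: "s \<in> Arr K" "Dom K s = S" "Cod K s = S'" "shape s = F"
    unfolding s_def s using Sh by (auto intro!: arr_K_I simp: t_def)
  have sa: "act s \<tau> \<beta> = h \<cdot> pair C F S' \<tau> \<beta>" for \<tau> \<beta> by (simp add: act_def s_def s)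
  show "sum_cont_arr C m m' \<in> Arr K" "Dom K (sum_cont_arr C m m') = coprod_arr C P Q" "Cod K (sum_cont_arr C m m') = coprod_arr C P' Q'"
    using s0 by (simp_all add: s_def S_def S'_def)
  \<comment> \<open>For either summand: along \<open>l1\<close> or \<open>l2\<close>, here
    \<open>ll\<close>, the directions component \<open>h\<close> reduces to that of the summand
    \<open>n\<close>.\<close>
  have part: "act s (ii \<cdot> \<tau>) (aa \<cdot> \<beta>) = x \<cdot> act n \<tau> \<beta>"
    if n: "n \<in> Arr K" "shape n = g" "Cod K n = R'" and g[simp]: "g \<in> Arr C" "R' \<in> Arr C" "Cod C g = Cod C R'" "dirs n \<in> Arr C" "Dom C (dirs n) = pb C g R'"
      and x[simp]: "x \<in> Arr C" "Dom C x = Cod C (dirs n)" and ii[simp]: "ii \<in> Arr C" "Dom C ii = Dom C g" "Cod C ii = coprod C (Cod C P) (Cod C Q)"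
      "aa \<in> Arr C" "Dom C aa = Dom C R'" "Cod C aa = coprod C (Dom C P') (Dom C Q')"
      and ll[simp]: "ll \<in> Arr C" "Dom C ll = pb C g R'" "Cod C ll = pb C F S'" and ll2: "t \<cdot> ll = ii \<cdot> pr1 C g R'" "u \<cdot> ll = aa \<cdot> pr2 C g R'" "h \<cdot> ll = x \<cdot> dirs n"
      and \<tau>[simp]: "\<tau> \<in> Arr C" "\<beta> \<in> Arr C" "Dom C \<tau> = Dom C \<beta>" "Cod C \<tau> = Dom C g" "Cod C \<beta> = Dom C R'" and e: "g \<cdot> \<tau> = R' \<cdot> \<beta>"
    for n g R' x ii aa ll \<tau> \<beta>
  proof -
    define y where "y = pair C g R' \<tau> \<beta>"
    have y[simp]: "y \<in> Arr C" "Dom C y = Dom C \<beta>" "Cod C y = pb C g R'" and y2: "pr1 C g R' \<cdot> y = \<tau>" "pr2 C g R' \<cdot> y = \<beta>"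
      using e by (simp_all add: y_def)
    have tly: "t \<cdot> (ll \<cdot> y) = ii \<cdot> \<tau>" "u \<cdot> (ll \<cdot> y) = aa \<cdot> \<beta>"
      using precomp[OF ll2(1), of y] precomp[OF ll2(2), of y] y2 by simp_all
    have FS: "F \<cdot> (ii \<cdot> \<tau>) = S' \<cdot> (aa \<cdot> \<beta>)"
      using pr_eq'[of F S' "ll \<cdot> y"] tly by (simp add: t_def u_def)
    have "pair C F S' (ii \<cdot> \<tau>) (aa \<cdot> \<beta>) = ll \<cdot> y"
      by (rule pb_eqI[of F S']) (use FS tly in \<open>simp_all add: t_def u_def\<close>)
    then have "act s (ii \<cdot> \<tau>) (aa \<cdot> \<beta>) = h \<cdot> (ll \<cdot> y)" by (simp only: sa)
    also have "\<dots> = (x \<cdot> dirs n) \<cdot> y" by (rule precomp[OF ll2(3)]) simp_all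
    also have "\<dots> = x \<cdot> (dirs n \<cdot> y)" by simp
    also have "dirs n \<cdot> y = act n \<tau> \<beta>" by (simp add: act_def n y_def)
    finally show ?thesis .
  qed
  note I = in12[of P Q, unfolded ijkl] and I' = in12[of P' Q', unfolded ijkl]
  have "s \<cdot>\<^bsub>K\<^esub> in1 P Q = in1 P' Q' \<cdot>\<^bsub>K\<^esub> m"
  proof (rule cartesian_square[OF I(1-4) I'(1-4)])
    fix \<tau> \<beta>
    assume \<tau>: "\<tau> \<in> Arr C" "\<beta> \<in> Arr C" "Dom C \<tau> = Dom C \<beta>" "Cod C \<tau> = Cod C P" "Cod C \<beta> = Dom C P'" "shape m \<cdot> \<tau> = P' \<cdot> \<beta>"
    show "act s (i \<cdot> \<tau>) (a' \<cdot> \<beta>) = a \<cdot> act m \<tau> \<beta>"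
      by (rule part[of m f P' a i a' l1 \<tau> \<beta>]) (use \<tau> l12 hl in \<open>simp_all add: d_def[symmetric]\<close>)
  qed (use s0 eqs in simp_all)
  then show "sum_cont_arr C m m' \<cdot>\<^bsub>K\<^esub> in1 P Q = in1 P' Q' \<cdot>\<^bsub>K\<^esub> m" by (simp only: s_def)
  have "s \<cdot>\<^bsub>K\<^esub> in2 P Q = in2 P' Q' \<cdot>\<^bsub>K\<^esub> m'"
  proof (rule cartesian_square[OF I(5-8) I'(5-8)])
    fix \<tau> \<beta>
    assume \<tau>: "\<tau> \<in> Arr C" "\<beta> \<in> Arr C" "Dom C \<tau> = Dom C \<beta>" "Cod C \<tau> = Cod C Q" "Cod C \<beta> = Dom C Q'" "shape m' \<cdot> \<tau> = Q' \<cdot> \<beta>"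
    show "act s (j \<cdot> \<tau>) (b' \<cdot> \<beta>) = b \<cdot> act m' \<tau> \<beta>"
      by (rule part[of m' f' Q' b j b' l2 \<tau> \<beta>]) (use \<tau> l22 hl in \<open>simp_all add: d'_def[symmetric]\<close>)
  qed (use s0 eqs in simp_all)
  then show "sum_cont_arr C m m' \<cdot>\<^bsub>K\<^esub> in2 P Q = in2 P' Q' \<cdot>\<^bsub>K\<^esub> m'" by (simp only: s_def)
qed

text \<open>Since the sum is a coproduct, an algebra on \<open>X\<close> is a pair of morphisms from
  \<open>Q\<close> and from \<open>X \<star> P\<close>. This is the form that
  \<open>recursion\<close> produces.\<close>

lemma initial_algebra_iff:
  assumes P[simp]: "P \<in> Arr C" and Q[simp]: "Q \<in> Arr C" and G[simp]: "G \<in> Arr C" and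
    a: "\<alpha> \<in> Arr K" "Dom K \<alpha> = coprod_arr C Q (G \<star> P)" "Cod K \<alpha> = G"
  shows "initial_algebra K (step C Q P) G \<alpha> \<longleftrightarrow> (\<forall>X q' p'. X \<in> Arr C \<longrightarrow> q' \<in> hom K Q X \<longrightarrow> p' \<in> hom K (X \<star> P) X \<longrightarrow>
    (\<exists>!\<theta>. \<theta> \<in> hom K G X \<and> \<theta> \<cdot>\<^bsub>K\<^esub> (\<alpha> \<cdot>\<^bsub>K\<^esub> in1 Q (G \<star> P)) = q' \<and> \<theta> \<cdot>\<^bsub>K\<^esub> (\<alpha> \<cdot>\<^bsub>K\<^esub> in2 Q (G \<star> P)) = p' \<cdot>\<^bsub>K\<^esub> seq_arr C P \<theta>))"
proof -
  note [simp] = a seq_arr_facts(1)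
  interpret tp: two_powers K C "Cod C" shape P "seq_shape C P" "\<lambda>J. pr1 C P (seq_shape C P J)" "\<lambda>J. pr2 C P (seq_shape C P J)"
    "seq_ev C P" "seq_shape_arr C P" "seq_base P" "seq_counit P" "seq_arr C P"
    by (rule two_powers[OF P])
  have FO: "FObj (step C Q P) X = coprod_arr C Q (X \<star> P)" and FA: "FArr (step C Q P) k = sum_cont_arr C (Idt K Q) (seq_arr C P k)" for X k
    by (simp_all add: step_def)
  have SA[simp]: "seq_arr C P k \<in> Arr K" "Dom K (seq_arr C P k) = Dom K k \<star> P" "Cod K (seq_arr C P k) = Cod K k \<star> P" if "k \<in> Arr K" for k
    using tp.L_facts(1-3)[OF that] that by (simp_all add: seq_base)
  have key: "(\<theta> \<cdot>\<^bsub>K\<^esub> \<alpha> = b \<cdot>\<^bsub>K\<^esub> FArr (step C Q P) \<theta>) \<longleftrightarrow>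
      \<theta> \<cdot>\<^bsub>K\<^esub> (\<alpha> \<cdot>\<^bsub>K\<^esub> in1 Q (G \<star> P)) = b \<cdot>\<^bsub>K\<^esub> in1 Q (X \<star> P) \<and>
      \<theta> \<cdot>\<^bsub>K\<^esub> (\<alpha> \<cdot>\<^bsub>K\<^esub> in2 Q (G \<star> P)) = (b \<cdot>\<^bsub>K\<^esub> in2 Q (X \<star> P)) \<cdot>\<^bsub>K\<^esub> seq_arr C P \<theta>"
    if t: "\<theta> \<in> Arr K" "Dom K \<theta> = G" "Cod K \<theta> = X" and b: "b \<in> Arr K" "Dom K b = coprod_arr C Q (X \<star> P)" "Cod K b = X" for X \<theta> b
  proof -
    note [simp] = t b
    have X[simp]: "X \<in> Arr C" using arr_K(2)[OF b(1)] by simp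
    have i: "Idt K Q \<in> Arr K" "Dom K (Idt K Q) = Q" "Cod K (Idt K Q) = Q" by simp_all
    have s: "seq_arr C P \<theta> \<in> Arr K" "Dom K (seq_arr C P \<theta>) = G \<star> P" "Cod K (seq_arr C P \<theta>) = X \<star> P" by simp_all
    note S[simp] = sum_arr[OF i s]
    note I[simp] = in12(2,3,6,7)[OF Q, of "G \<star> P"] in12(2,3,6,7)[OF Q, of "X \<star> P"] in12_arr[OF Q, of "G \<star> P"] in12_arr[OF Q, of "X \<star> P"]
    have c: "is_coproduct K (in1 Q (G \<star> P)) (in2 Q (G \<star> P))" by (rule sum_coproduct) simp_all
    show ?thesis
    proof
      assume "\<theta> \<cdot>\<^bsub>K\<^esub> \<alpha> = b \<cdot>\<^bsub>K\<^esub> FArr (step C Q P) \<theta>"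
      then have e: "(\<theta> \<cdot>\<^bsub>K\<^esub> \<alpha>) \<cdot>\<^bsub>K\<^esub> in1 Q (G \<star> P) = (b \<cdot>\<^bsub>K\<^esub> sum_cont_arr C (Idt K Q) (seq_arr C P \<theta>)) \<cdot>\<^bsub>K\<^esub> in1 Q (G \<star> P)"
         "(\<theta> \<cdot>\<^bsub>K\<^esub> \<alpha>) \<cdot>\<^bsub>K\<^esub> in2 Q (G \<star> P) = (b \<cdot>\<^bsub>K\<^esub> sum_cont_arr C (Idt K Q) (seq_arr C P \<theta>)) \<cdot>\<^bsub>K\<^esub> in2 Q (G \<star> P)"
        unfolding FA by simp_all
      show "\<theta> \<cdot>\<^bsub>K\<^esub> (\<alpha> \<cdot>\<^bsub>K\<^esub> in1 Q (G \<star> P)) = b \<cdot>\<^bsub>K\<^esub> in1 Q (X \<star> P) \<and>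
        \<theta> \<cdot>\<^bsub>K\<^esub> (\<alpha> \<cdot>\<^bsub>K\<^esub> in2 Q (G \<star> P)) = (b \<cdot>\<^bsub>K\<^esub> in2 Q (X \<star> P)) \<cdot>\<^bsub>K\<^esub> seq_arr C P \<theta>"
        using e by simp
    next
      assume "\<theta> \<cdot>\<^bsub>K\<^esub> (\<alpha> \<cdot>\<^bsub>K\<^esub> in1 Q (G \<star> P)) = b \<cdot>\<^bsub>K\<^esub> in1 Q (X \<star> P) \<and>
        \<theta> \<cdot>\<^bsub>K\<^esub> (\<alpha> \<cdot>\<^bsub>K\<^esub> in2 Q (G \<star> P)) = (b \<cdot>\<^bsub>K\<^esub> in2 Q (X \<star> P)) \<cdot>\<^bsub>K\<^esub> seq_arr C P \<theta>"
      then show "\<theta> \<cdot>\<^bsub>K\<^esub> \<alpha> = b \<cdot>\<^bsub>K\<^esub> FArr (step C Q P) \<theta>"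
        unfolding FA by - (rule KC.E.coproduct_unique[OF c], simp_all)
    qed
  qed
  show ?thesis
  proof
    assume ia: "initial_algebra K (step C Q P) G \<alpha>"
    show "\<forall>X q' p'. X \<in> Arr C \<longrightarrow> q' \<in> hom K Q X \<longrightarrow> p' \<in> hom K (X \<star> P) X \<longrightarrow>
      (\<exists>!\<theta>. \<theta> \<in> hom K G X \<and> \<theta> \<cdot>\<^bsub>K\<^esub> (\<alpha> \<cdot>\<^bsub>K\<^esub> in1 Q (G \<star> P)) = q' \<and> \<theta> \<cdot>\<^bsub>K\<^esub> (\<alpha> \<cdot>\<^bsub>K\<^esub> in2 Q (G \<star> P)) = p' \<cdot>\<^bsub>K\<^esub> seq_arr C P \<theta>)"
    proof (intro allI impI)
      fix X q' p' assume X[simp]: "X \<in> Arr C" and q': "q' \<in> hom K Q X" and p': "p' \<in> hom K (X \<star> P) X"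
      note I[simp] = in12(2,3,6,7)[OF Q, of "X \<star> P"] in12_arr[OF Q, of "X \<star> P"]
      have c: "is_coproduct K (in1 Q (X \<star> P)) (in2 Q (X \<star> P))" by (rule sum_coproduct) simp_all
      obtain b where b: "b \<in> Arr K" "Dom K b = Cod K (in1 Q (X \<star> P))" "Cod K b = X" "b \<cdot>\<^bsub>K\<^esub> in1 Q (X \<star> P) = q'" "b \<cdot>\<^bsub>K\<^esub> in2 Q (X \<star> P) = p'"
        by (rule KC.E.coproduct_ex[OF c, of q' p' X]) (use q' p' in \<open>simp_all add: hom_def\<close>)
      have bD: "Dom K b = coprod_arr C Q (X \<star> P)" using b by simp
      have "\<exists>!h. h \<in> hom K G X \<and> h \<cdot>\<^bsub>K\<^esub> \<alpha> = b \<cdot>\<^bsub>K\<^esub> FArr (step C Q P) h"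
      proof -
        have "X \<in> Obj K" "b \<in> hom K (FObj (step C Q P) X) X" using b bD by (simp_all add: hom_def FO)
        then show ?thesis using ia unfolding initial_algebra_def by blast
      qed
      moreover have "(h \<in> hom K G X \<and> h \<cdot>\<^bsub>K\<^esub> \<alpha> = b \<cdot>\<^bsub>K\<^esub> FArr (step C Q P) h) \<longleftrightarrow>
        (h \<in> hom K G X \<and> h \<cdot>\<^bsub>K\<^esub> (\<alpha> \<cdot>\<^bsub>K\<^esub> in1 Q (G \<star> P)) = q' \<and> h \<cdot>\<^bsub>K\<^esub> (\<alpha> \<cdot>\<^bsub>K\<^esub> in2 Q (G \<star> P)) = p' \<cdot>\<^bsub>K\<^esub> seq_arr C P h)" for h
      proof (cases "h \<in> hom K G X")
        case True
        then have h: "h \<in> Arr K" "Dom K h = G" "Cod K h = X" by (simp_all add: hom_def)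
        show ?thesis using key[OF h b(1) bD b(3)] True unfolding b(4,5) by (simp only: simp_thms)
      qed (simp only: simp_thms)
      ultimately show "\<exists>!\<theta>. \<theta> \<in> hom K G X \<and> \<theta> \<cdot>\<^bsub>K\<^esub> (\<alpha> \<cdot>\<^bsub>K\<^esub> in1 Q (G \<star> P)) = q' \<and> \<theta> \<cdot>\<^bsub>K\<^esub> (\<alpha> \<cdot>\<^bsub>K\<^esub> in2 Q (G \<star> P)) = p' \<cdot>\<^bsub>K\<^esub> seq_arr C P \<theta>"
        by (simp only:)
    qed
  next
    assume U: "\<forall>X q' p'. X \<in> Arr C \<longrightarrow> q' \<in> hom K Q X \<longrightarrow> p' \<in> hom K (X \<star> P) X \<longrightarrow>
      (\<exists>!\<theta>. \<theta> \<in> hom K G X \<and> \<theta> \<cdot>\<^bsub>K\<^esub> (\<alpha> \<cdot>\<^bsub>K\<^esub> in1 Q (G \<star> P)) = q' \<and> \<theta> \<cdot>\<^bsub>K\<^esub> (\<alpha> \<cdot>\<^bsub>K\<^esub> in2 Q (G \<star> P)) = p' \<cdot>\<^bsub>K\<^esub> seq_arr C P \<theta>)"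
    show "initial_algebra K (step C Q P) G \<alpha>"
      unfolding initial_algebra_def
    proof (intro conjI ballI)
      show "G \<in> Obj K" "\<alpha> \<in> hom K (FObj (step C Q P) G) G" by (simp_all add: hom_def FO)
      fix X b assume "X \<in> Obj K" and "b \<in> hom K (FObj (step C Q P) X) X"
      then have X[simp]: "X \<in> Arr C" and b[simp]: "b \<in> Arr K" "Dom K b = coprod_arr C Q (X \<star> P)" "Cod K b = X" by (simp_all add: hom_def FO)
      note I[simp] = in12(2,3,6,7)[OF Q, of "X \<star> P"] in12_arr[OF Q, of "X \<star> P"]
      have q: "b \<cdot>\<^bsub>K\<^esub> in1 Q (X \<star> P) \<in> hom K Q X" and p: "b \<cdot>\<^bsub>K\<^esub> in2 Q (X \<star> P) \<in> hom K (X \<star> P) X" by (simp_all add: hom_def)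
      have "\<exists>!\<theta>. \<theta> \<in> hom K G X \<and> \<theta> \<cdot>\<^bsub>K\<^esub> (\<alpha> \<cdot>\<^bsub>K\<^esub> in1 Q (G \<star> P)) = b \<cdot>\<^bsub>K\<^esub> in1 Q (X \<star> P) \<and>
        \<theta> \<cdot>\<^bsub>K\<^esub> (\<alpha> \<cdot>\<^bsub>K\<^esub> in2 Q (G \<star> P)) = (b \<cdot>\<^bsub>K\<^esub> in2 Q (X \<star> P)) \<cdot>\<^bsub>K\<^esub> seq_arr C P \<theta>"
        by (rule U[rule_format, OF X q p])
      moreover have "(h \<in> hom K G X \<and> h \<cdot>\<^bsub>K\<^esub> \<alpha> = b \<cdot>\<^bsub>K\<^esub> FArr (step C Q P) h) \<longleftrightarrow>
        (h \<in> hom K G X \<and> h \<cdot>\<^bsub>K\<^esub> (\<alpha> \<cdot>\<^bsub>K\<^esub> in1 Q (G \<star> P)) = b \<cdot>\<^bsub>K\<^esub> in1 Q (X \<star> P) \<and>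
          h \<cdot>\<^bsub>K\<^esub> (\<alpha> \<cdot>\<^bsub>K\<^esub> in2 Q (G \<star> P)) = (b \<cdot>\<^bsub>K\<^esub> in2 Q (X \<star> P)) \<cdot>\<^bsub>K\<^esub> seq_arr C P h)" for h
      proof (cases "h \<in> hom K G X")
        case True
        then have h: "h \<in> Arr K" "Dom K h = G" "Cod K h = X" by (simp_all add: hom_def)
        show ?thesis using key[OF h b] True by (simp only: simp_thms)
      qed (simp only: simp_thms)
      ultimately show "\<exists>!h. h \<in> hom K G X \<and> h \<cdot>\<^bsub>K\<^esub> \<alpha> = b \<cdot>\<^bsub>K\<^esub> FArr (step C Q P) h"
        by (simp only:)
    qed
  qed
qed

end

end

section \<open>Trees and paths as dependent W-types\<close>

context extensive_lcc
begin

lemma zero: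
  obtains Z where "Z \<in> Obj C" "\<And>X. X \<in> Obj C \<Longrightarrow> \<exists>f. f \<in> Arr C \<and> Dom C f = Z \<and> Cod C f = X"
    "\<And>f g. f \<in> Arr C \<Longrightarrow> g \<in> Arr C \<Longrightarrow> Dom C f = Z \<Longrightarrow> Dom C g = Z \<Longrightarrow> Cod C f = Cod C g \<Longrightarrow> f = g"
proof -
  obtain Z where Z: "is_initial C Z" using extensive unfolding extensive_def has_finite_coproducts_def by blast
  then have ex: "\<And>X. X \<in> Obj C \<Longrightarrow> \<exists>!f. f \<in> hom C Z X" and Zo: "Z \<in> Obj C" by (auto simp: is_initial_def)
  show thesis
  proof (rule that[OF Zo])
    fix X assume "X \<in> Obj C"
    then show "\<exists>f. f \<in> Arr C \<and> Dom C f = Z \<and> Cod C f = X" using ex1_implies_ex[OF ex] by (auto simp: hom_iff)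
  next
    fix f g assume "f \<in> Arr C" "g \<in> Arr C" "Dom C f = Z" "Dom C g = Z" "Cod C f = Cod C g"
    moreover from this have "Cod C g \<in> Obj C" by simp
    ultimately show "f = g" using ex[of "Cod C g"] by (auto simp: hom_iff)
  qed
qed

text \<open>\<open>Z\<close> is the coproduct of two copies of itself, with identities as
  injections. Pulled back along \<open>z\<close> this makes \<open>Dom C z\<close> such a coproduct
  too, so two arrows from it with the same codomain have a common copairing and are equal.\<close>

lemma strict_zero:
  assumes Z[simp]: "Z \<in> Obj C" and
    Zu: "\<And>f g. f \<in> Arr C \<Longrightarrow> g \<in> Arr C \<Longrightarrow> Dom C f = Z \<Longrightarrow> Dom C g = Z \<Longrightarrow> Cod C f = Cod C g \<Longrightarrow> f = g"
    and z[simp]: "z \<in> Arr C" "Cod C z = Z"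
    and f: "f \<in> Arr C" "g \<in> Arr C" "Dom C f = Dom C z" "Dom C g = Dom C z" "Cod C f = Cod C g"
  shows "f = g"
proof -
  have c: "is_coproduct C (Idt C Z) (Idt C Z)"
  proof (rule coproductI)
    fix u v T assume a: "u \<in> Arr C" "v \<in> Arr C" "Dom C u = Dom C (Idt C Z)" "Dom C v = Dom C (Idt C Z)" "Cod C u = T" "Cod C v = T"
    then have "u = v" by (intro Zu) simp_all
    then show "\<exists>h. h \<in> Arr C \<and> Dom C h = Cod C (Idt C Z) \<and> Cod C h = T \<and> h \<cdot> Idt C Z = u \<and> h \<cdot> Idt C Z = v"
      using a by (intro exI[of _ u]) simp
  qed simp_all
  have M: "D.mpb (Idt C Z) z z (Idt C (Dom C z))" by (rule D.mpbI) auto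
  have "is_coproduct C (Idt C (Dom C z)) (Idt C (Dom C z))" by (rule pullback_of_coproduct[OF c M M])
  then obtain h where h: "h \<in> Arr C" "Dom C h = Dom C z" "h \<cdot> Idt C (Dom C z) = f" "h \<cdot> Idt C (Dom C z) = g"
    by (rule coproduct_ex[of _ _ f g "Cod C g"]) (use f in simp_all)
  then show ?thesis by simp
qed

text \<open>\<open>A\<close>, as the coproduct of \<open>A\<close> and \<open>Z\<close>, lies over
  the coproduct of \<open>A\<close> and \<open>B\<close>, and extensivity makes both squares
  pullbacks. They say that the injection is monic and that the injections are disjoint.\<close>

lemma injection_pullbacks:
  assumes A[simp]: "A \<in> Obj C" and B[simp]: "B \<in> Obj C" and Z[simp]: "Z \<in> Obj C"
    and Zex: "\<And>X. X \<in> Obj C \<Longrightarrow> \<exists>f. f \<in> Arr C \<and> Dom C f = Z \<and> Cod C f = X"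
    and Zu: "\<And>f g. f \<in> Arr C \<Longrightarrow> g \<in> Arr C \<Longrightarrow> Dom C f = Z \<Longrightarrow> Dom C g = Z \<Longrightarrow> Cod C f = Cod C g \<Longrightarrow> f = g"
  obtains v w where "D.mpb (inl C A B) (inl C A B) (Idt C A) (Idt C A)" "D.mpb (inr C A B) (inl C A B) v w" "Dom C v = Z"
proof -
  obtain w where w[simp]: "w \<in> Arr C" "Dom C w = Z" "Cod C w = A" using Zex[OF A] by blast
  obtain v where v[simp]: "v \<in> Arr C" "Dom C v = Z" "Cod C v = B" using Zex[OF B] by blast
  have c: "is_coproduct C (Idt C A) w"
  proof (rule coproductI)
    fix f g T assume a: "f \<in> Arr C" "g \<in> Arr C" "Dom C f = Dom C (Idt C A)" "Dom C g = Dom C w" "Cod C f = T" "Cod C g = T"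
    then have "f \<cdot> w = g" by (intro Zu) simp_all
    then show "\<exists>h. h \<in> Arr C \<and> Dom C h = Cod C (Idt C A) \<and> Cod C h = T \<and> h \<cdot> Idt C A = f \<and> h \<cdot> w = g"
      using a by (intro exI[of _ f]) simp
  qed simp_all
  have e: "inr C A B \<cdot> v = inl C A B \<cdot> w" by (rule Zu) simp_all
  have 1: "D.mpb (inl C A B) (inl C A B) (Idt C A) (Idt C A)"
    by (rule coproduct_square_pullback(1)[OF injections(1)[OF A B] c, of _ _ v]) (simp_all add: e)
  have 2: "D.mpb (inr C A B) (inl C A B) v w"
    by (rule coproduct_square_pullback(2)[OF injections(1)[OF A B] c, of _ "Idt C A"]) (simp_all add: e)
  show thesis by (rule that[OF 1 2 v(2)])
qed

text \<open>\<open>r\<close> is a dependent product of \<open>y\<close> along \<open>P\<close> with evaluation \<open>e\<close>, phrased with arbitrary pullbacks of \<open>P\<close>.\<close>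

definition is_pi :: "'b \<Rightarrow> 'b \<Rightarrow> 'b \<Rightarrow> 'b \<Rightarrow> bool" where
  "is_pi P y r e \<longleftrightarrow> r \<in> Arr C \<and> Cod C r = Cod C P \<and> e \<in> Arr C \<and> Dom C e = pb C P r \<and> Cod C e = Dom C y \<and> y \<cdot> e = pr1 C P r \<and>
    (\<forall>\<phi> p q k. D.mpb P \<phi> p q \<longrightarrow> k \<in> Arr C \<longrightarrow> Dom C k = Dom C q \<longrightarrow> Cod C k = Dom C y \<longrightarrow> y \<cdot> k = p \<longrightarrow>
      (\<exists>h. h \<in> Arr C \<and> Dom C h = Dom C \<phi> \<and> Cod C h = Dom C r \<and> r \<cdot> h = \<phi> \<and> e \<cdot> pair C P r p (h \<cdot> q) = k)) \<and>
    (\<forall>\<phi> p q h h'. D.mpb P \<phi> p q \<longrightarrow> h \<in> Arr C \<longrightarrow> h' \<in> Arr C \<longrightarrow> Dom C h = Dom C \<phi> \<longrightarrow> Dom C h' = Dom C \<phi> \<longrightarrow>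
      Cod C h = Dom C r \<longrightarrow> Cod C h' = Dom C r \<longrightarrow> r \<cdot> h = \<phi> \<longrightarrow> r \<cdot> h' = \<phi> \<longrightarrow>
      e \<cdot> pair C P r p (h \<cdot> q) = e \<cdot> pair C P r p (h' \<cdot> q) \<longrightarrow> h = h')"

lemma is_piD:
  assumes "is_pi P y r e"
  shows "r \<in> Arr C" "Cod C r = Cod C P" "e \<in> Arr C" "Dom C e = pb C P r" "Cod C e = Dom C y" "y \<cdot> e = pr1 C P r"
  using assms unfolding is_pi_def by blast+

lemma is_pi_ex:
  assumes "is_pi P y r e" and a: "D.mpb P \<phi> p q" "k \<in> Arr C" "Dom C k = Dom C q" "Cod C k = Dom C y" "y \<cdot> k = p"
  obtains h where "h \<in> Arr C" "Dom C h = Dom C \<phi>" "Cod C h = Dom C r" "r \<cdot> h = \<phi>" "e \<cdot> pair C P r p (h \<cdot> q) = k"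
proof -
  have "D.mpb P \<phi> p q \<longrightarrow> k \<in> Arr C \<longrightarrow> Dom C k = Dom C q \<longrightarrow> Cod C k = Dom C y \<longrightarrow> y \<cdot> k = p \<longrightarrow>
      (\<exists>h. h \<in> Arr C \<and> Dom C h = Dom C \<phi> \<and> Cod C h = Dom C r \<and> r \<cdot> h = \<phi> \<and> e \<cdot> pair C P r p (h \<cdot> q) = k)"
    using assms(1) unfolding is_pi_def by (elim conjE allE)
  from this[rule_format, OF a] show thesis using that by (elim exE conjE)
qed

lemma is_pi_unique:
  assumes "is_pi P y r e" and a: "D.mpb P \<phi> p q" "h \<in> Arr C" "h' \<in> Arr C" "Dom C h = Dom C \<phi>" "Dom C h' = Dom C \<phi>"
      "Cod C h = Dom C r" "Cod C h' = Dom C r" "r \<cdot> h = \<phi>" "r \<cdot> h' = \<phi>"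
      "e \<cdot> pair C P r p (h \<cdot> q) = e \<cdot> pair C P r p (h' \<cdot> q)"
  shows "h = h'"
proof -
  have "\<forall>\<phi> p q h h'. D.mpb P \<phi> p q \<longrightarrow> h \<in> Arr C \<longrightarrow> h' \<in> Arr C \<longrightarrow> Dom C h = Dom C \<phi> \<longrightarrow> Dom C h' = Dom C \<phi> \<longrightarrow>
      Cod C h = Dom C r \<longrightarrow> Cod C h' = Dom C r \<longrightarrow> r \<cdot> h = \<phi> \<longrightarrow> r \<cdot> h' = \<phi> \<longrightarrow>
      e \<cdot> pair C P r p (h \<cdot> q) = e \<cdot> pair C P r p (h' \<cdot> q) \<longrightarrow> h = h'"
    using assms(1) unfolding is_pi_def by (elim conjE)
  from this[rule_format, OF a] show ?thesis .
qed

lemma Pi_is_pi: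
  assumes "P \<in> Arr C" "y \<in> Arr C" "Cod C y = Dom C P"
  shows "is_pi P y (Pi P y) (Pi_ev P y)"
  unfolding is_pi_def
proof (intro conjI allI impI Pi_arr[OF assms])
  fix \<phi> p q k
  assume "D.mpb P \<phi> p q" "k \<in> Arr C" "Dom C k = Dom C q" "Cod C k = Dom C y" "y \<cdot> k = p"
  then show "\<exists>h. h \<in> Arr C \<and> Dom C h = Dom C \<phi> \<and> Cod C h = Dom C (Pi P y) \<and> Pi P y \<cdot> h = \<phi> \<and> Pi_ev P y \<cdot> pair C P (Pi P y) p (h \<cdot> q) = k"
    by (rule Pi_ex[OF assms]) blast
next
  fix \<phi> p q h h'
  assume a: "D.mpb P \<phi> p q" "h \<in> Arr C" "h' \<in> Arr C" "Dom C h = Dom C \<phi>" "Dom C h' = Dom C \<phi>" "Cod C h = Dom C (Pi P y)" "Cod C h' = Dom C (Pi P y)"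
    "Pi P y \<cdot> h = \<phi>" "Pi P y \<cdot> h' = \<phi>" "Pi_ev P y \<cdot> pair C P (Pi P y) p (h \<cdot> q) = Pi_ev P y \<cdot> pair C P (Pi P y) p (h' \<cdot> q)"
  show "h = h'" by (rule Pi_unique[OF assms a(1,2,4,6,8,3,5,7,9,10)])
qed

lemma pullback_of_idt:
  assumes E: "E \<in> Obj C" and M: "D.mpb (Idt C E) \<phi> p q"
  obtains z where "z \<in> Arr C" "Dom C z = Cod C q" "Cod C z = Dom C q" "q \<cdot> z = Idt C (Cod C q)" "p \<cdot> z = \<phi>"
proof -
  note m = D.mpbD[OF M]
  have [simp]: "Cod C q \<in> Obj C" using m by simp
  have phi: "\<phi> \<in> Arr C" "Dom C \<phi> = Cod C q" "Cod C \<phi> = E" "Cod C p = E" using m E by simp_all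
  obtain z where "z \<in> Arr C" "Dom C z = Dom C (Idt C (Cod C q))" "Cod C z = Dom C q" "q \<cdot> z = Idt C (Cod C q)" "p \<cdot> z = \<phi>"
  proof (rule D.mpb_lift[OF M, of "Idt C (Cod C q)" \<phi>])
    show "Idt C E \<cdot> \<phi> = \<phi> \<cdot> Idt C (Cod C q)" using phi by (simp add: phi(2)[symmetric] del: phi(2))
  qed (use phi E in simp_all)
  then show thesis by (intro that[of z]) simp_all
qed

text \<open>The case needed for paths: a path continues into exactly one subtree, so the product
  along a fibre degenerates to a single factor.\<close>

lemma idt_is_pi:
  assumes y[simp]: "y \<in> Arr C" "Cod C y = E"
  shows "is_pi (Idt C E) y y (pr2 C (Idt C E) y)"
proof -
  have E[simp]: "E \<in> Obj C" using cod_in[of y] by simp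
  have pe: "pr2 C (Idt C E) y \<cdot> pair C (Idt C E) y p z = z"
    if "p \<in> Arr C" "z \<in> Arr C" "Dom C p = Dom C z" "Cod C p = E" "Cod C z = Dom C y" "p = y \<cdot> z" for p z
    using that by simp
  show ?thesis
    unfolding is_pi_def
  proof (intro conjI allI impI)
    show "y \<cdot> pr2 C (Idt C E) y = pr1 C (Idt C E) y" using pr_eq[of "Idt C E" y] by simp
  next
    fix \<phi> p q k
    assume M: "D.mpb (Idt C E) \<phi> p q" and k[simp]: "k \<in> Arr C" "Dom C k = Dom C q" "Cod C k = Dom C y" "y \<cdot> k = p"
    have [simp]: "\<phi> \<in> Arr C" "p \<in> Arr C" "q \<in> Arr C" "Cod C \<phi> = E" "Cod C p = E" "Dom C \<phi> = Cod C q" "Dom C p = Dom C q" and pq: "p = \<phi> \<cdot> q"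
      using D.mpbD[OF M] by simp_all
    obtain z where z[simp]: "z \<in> Arr C" "Dom C z = Cod C q" "Cod C z = Dom C q" and z2: "q \<cdot> z = Idt C (Cod C q)" "p \<cdot> z = \<phi>"
      by (rule pullback_of_idt[OF E M])
    have "z \<cdot> q = Idt C (Dom C q)"
      by (rule D.mpb_unique[OF M]) (use precomp[OF z2(1), of q] precomp[OF z2(2), of q] in \<open>simp_all add: pq[symmetric]\<close>)
    then have kzq: "k \<cdot> (z \<cdot> q) = k" by simp
    show "\<exists>h. h \<in> Arr C \<and> Dom C h = Dom C \<phi> \<and> Cod C h = Dom C y \<and> y \<cdot> h = \<phi> \<and> pr2 C (Idt C E) y \<cdot> pair C (Idt C E) y p (h \<cdot> q) = k"
      using kzq z2 precomp[OF k(4), of z] by (intro exI[of _ "k \<cdot> z"]) (simp add: pe)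
  next
    fix \<phi> p q h h'
    assume M: "D.mpb (Idt C E) \<phi> p q" and h[simp]: "h \<in> Arr C" "h' \<in> Arr C" "Dom C h = Dom C \<phi>" "Dom C h' = Dom C \<phi>" "Cod C h = Dom C y" "Cod C h' = Dom C y"
      and yh: "y \<cdot> h = \<phi>" "y \<cdot> h' = \<phi>" and eq: "pr2 C (Idt C E) y \<cdot> pair C (Idt C E) y p (h \<cdot> q) = pr2 C (Idt C E) y \<cdot> pair C (Idt C E) y p (h' \<cdot> q)"
    have [simp]: "\<phi> \<in> Arr C" "p \<in> Arr C" "q \<in> Arr C" "Cod C \<phi> = E" "Cod C p = E" "Dom C \<phi> = Cod C q" "Dom C p = Dom C q" and pq: "p = \<phi> \<cdot> q"
      using D.mpbD[OF M] by simp_all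
    obtain z where z[simp]: "z \<in> Arr C" "Dom C z = Cod C q" "Cod C z = Dom C q" and z2: "q \<cdot> z = Idt C (Cod C q)" "p \<cdot> z = \<phi>"
      by (rule pullback_of_idt[OF E M])
    have 1: "pr2 C (Idt C E) y \<cdot> pair C (Idt C E) y p (h \<cdot> q) = h \<cdot> q"
      by (rule pe) (use precomp[OF yh(1), of q] pq in simp_all)
    have 2: "pr2 C (Idt C E) y \<cdot> pair C (Idt C E) y p (h' \<cdot> q) = h' \<cdot> q"
      by (rule pe) (use precomp[OF yh(2), of q] pq in simp_all)
    have "(h \<cdot> q) \<cdot> z = (h' \<cdot> q) \<cdot> z" using eq unfolding 1 2 by (rule arg_cong)
    then show "h = h'" using z2 by simp
  qed simp_all
qed

text \<open>The \<open>W\<close>-types at hand are those of the functors \<open>\<Sigma>\<^sub>t \<Pi>\<^sub>f s\<^sup>*\<close>, without a constant summand. The summand \<open>1\<close> arises by composing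
  \<open>P\<close> with a coproduct injection: the new point has an empty fibre, so the dependent product over it is terminal.\<close>

lemma inl_pi:
  fixes P y r e
  assumes P[simp]: "P \<in> Arr C" and y[simp]: "y \<in> Arr C" "Cod C y = Dom C P" and pi: "is_pi P y r e"
  defines "T \<equiv> terminal_obj C"
  defines "i \<equiv> inl C (Cod C P) T" and "j \<equiv> inr C (Cod C P) T"
  defines "f \<equiv> i \<cdot> P"
  obtains n z where "n \<in> Arr C" "Dom C n = Dom C r" "Cod C n = Dom C (Pi f y)" "Pi f y \<cdot> n = i \<cdot> r"
    "Pi_ev f y \<cdot> pair C f (Pi f y) (pr1 C P r) (n \<cdot> pr2 C P r) = e"
    "z \<in> Arr C" "Dom C z = T" "Cod C z = Dom C (Pi f y)" "Pi f y \<cdot> z = j" "is_coproduct C n z"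
    "\<And>u v s. u \<in> Arr C \<Longrightarrow> v \<in> Arr C \<Longrightarrow> Dom C u = Dom C v \<Longrightarrow> Cod C u = Dom C (Pi f y) \<Longrightarrow> Cod C v = Dom C (Pi f y) \<Longrightarrow>
      s \<in> Arr C \<Longrightarrow> Dom C s = Dom C v \<Longrightarrow> Cod C s = T \<Longrightarrow> Pi f y \<cdot> u = j \<cdot> s \<Longrightarrow> Pi f y \<cdot> v = j \<cdot> s \<Longrightarrow> u = v"
    "\<And>p q \<phi>. D.mpb P \<phi> p q \<Longrightarrow> D.mpb f (i \<cdot> \<phi>) p q"
proof (rule zero)
  fix Z
  assume Z[simp]: "Z \<in> Obj C" and Zex: "\<And>X. X \<in> Obj C \<Longrightarrow> \<exists>f. f \<in> Arr C \<and> Dom C f = Z \<and> Cod C f = X"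
    and Zu: "\<And>f g. f \<in> Arr C \<Longrightarrow> g \<in> Arr C \<Longrightarrow> Dom C f = Z \<Longrightarrow> Dom C g = Z \<Longrightarrow> Cod C f = Cod C g \<Longrightarrow> f = g"
  have To[simp]: "T \<in> Obj C" by (simp add: T_def)
  have ij[simp]: "i \<in> Arr C" "j \<in> Arr C" "Dom C i = Cod C P" "Dom C j = T" "Cod C i = coprod C (Cod C P) T" "Cod C j = coprod C (Cod C P) T"
    by (simp_all add: i_def j_def)
  have f[simp]: "f \<in> Arr C" "Dom C f = Dom C P" "Cod C f = coprod C (Cod C P) T" by (simp_all add: f_def)
  obtain v0 w0 where ii: "D.mpb i i (Idt C (Cod C P)) (Idt C (Cod C P))" and ji: "D.mpb j i v0 w0" and v0[simp]: "Dom C v0 = Z"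
    unfolding i_def j_def by (rule injection_pullbacks[OF _ To Z Zex Zu, of "Cod C P"]) simp_all
  have i_mono: "a = b" if ab: "a \<in> Arr C" "b \<in> Arr C" "Dom C a = Dom C b" "Cod C a = Cod C P" "Cod C b = Cod C P" "i \<cdot> a = i \<cdot> b" for a b
  proof -
    obtain c where "c \<in> Arr C" "Dom C c = Dom C b" "Cod C c = Cod C P" "Idt C (Cod C P) \<cdot> c = b" "Idt C (Cod C P) \<cdot> c = a"
      by (rule D.mpb_lift[OF ii, of b a]) (use ab in simp_all)
    then show ?thesis by simp
  qed
  note [simp] = is_piD(1-5)[OF pi] and ye = is_piD(6)[OF pi]
  have fy: "f \<in> Arr C" "y \<in> Arr C" "Cod C y = Dom C f" by simp_all
  note PI[simp] = Pi_arr(1-5)[OF fy] and yev = Pi_arr(6)[OF fy]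
  define R ev where "R = Pi f y" and "ev = Pi_ev f y"
  note PI'[simp] = PI[folded R_def ev_def]
  have fM: "D.mpb f (i \<cdot> \<phi>) p q" if M: "D.mpb P \<phi> p q" for p q \<phi>
  proof -
    have [simp]: "\<phi> \<in> Arr C" "p \<in> Arr C" "q \<in> Arr C" "Cod C \<phi> = Cod C P" "Cod C p = Dom C P" "Dom C \<phi> = Cod C q" "Dom C p = Dom C q" and pq: "P \<cdot> p = \<phi> \<cdot> q"
      using D.mpbD[OF M] by simp_all
    show ?thesis
    proof (rule D.mpbI)
      fix a s
      assume a[simp]: "a \<in> Arr C" "s \<in> Arr C" "Cod C a = Cod C q" "Dom C s = Dom C a" and "Cod C s = Dom C f" "f \<cdot> s = (i \<cdot> \<phi>) \<cdot> a"
      then have s[simp]: "Cod C s = Dom C P" and e: "i \<cdot> (P \<cdot> s) = i \<cdot> (\<phi> \<cdot> a)" by (simp_all add: f_def)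
      have "P \<cdot> s = \<phi> \<cdot> a" by (rule i_mono) (use e in simp_all)
      then show "\<exists>z. z \<in> Arr C \<and> Dom C z = Dom C a \<and> Cod C z = Dom C q \<and> q \<cdot> z = a \<and> p \<cdot> z = s"
        by - (rule D.mpb_lift[OF M, of a s], auto)
    next
      fix z z'
      assume "z \<in> Arr C" "z' \<in> Arr C" "Dom C z = Dom C z'" "Cod C z = Dom C q" "Cod C z' = Dom C q" "q \<cdot> z = q \<cdot> z'" "p \<cdot> z = p \<cdot> z'"
      then show "z = z'" by - (rule D.mpb_unique[OF M], simp_all)
    qed (use pq in \<open>simp_all add: f_def\<close>)
  qed
  \<comment> \<open>A direction over the new shape would put one point under both injections; by
    their disjointness the pullback maps to \<open>Z\<close>.\<close>
  have to_zero: "\<exists>c. c \<in> Arr C \<and> Dom C c = Dom C q \<and> Cod C c = Z" if M: "D.mpb f (j \<cdot> s) p q" and s: "s \<in> Arr C" "Cod C s = T" for s p q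
  proof -
    note [simp] = s
    have [simp]: "p \<in> Arr C" "q \<in> Arr C" "Cod C p = Dom C P" "Dom C s = Cod C q" "Dom C p = Dom C q" and pq: "i \<cdot> (P \<cdot> p) = j \<cdot> (s \<cdot> q)"
      using D.mpbD(3,4,6,7,8,9)[OF M] by (simp_all add: f_def)
    have [simp]: "w0 \<in> Arr C" "Dom C w0 = Z" "Cod C w0 = Cod C P" using D.mpbD[OF ji] by simp_all
    show ?thesis by (rule D.mpb_lift[OF ji, of "P \<cdot> p" "s \<cdot> q"]) (use pq in auto)
  qed
  \<comment> \<open>With an empty fibre all evaluations agree by strictness, so the dependent
    product has at most one point over the new shape.\<close>
  have inr_unique: "u = v"
    if [simp]: "u \<in> Arr C" "v \<in> Arr C" "Dom C u = Dom C v" "Cod C u = Dom C R" "Cod C v = Dom C R" "s \<in> Arr C" "Dom C s = Dom C v" "Cod C s = T"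
      and e: "R \<cdot> u = j \<cdot> s" "R \<cdot> v = j \<cdot> s" for u v s
  proof -
    have M: "D.mpb f (j \<cdot> s) (pr1 C f (j \<cdot> s)) (pr2 C f (j \<cdot> s))" by (rule chosen_mpb) simp_all
    obtain c where c: "c \<in> Arr C" "Dom C c = pb C f (j \<cdot> s)" "Cod C c = Z" using to_zero[OF M] by auto
    have e': "f \<cdot> pr1 C f (j \<cdot> s) = R \<cdot> (u \<cdot> pr2 C f (j \<cdot> s))" "f \<cdot> pr1 C f (j \<cdot> s) = R \<cdot> (v \<cdot> pr2 C f (j \<cdot> s))"
      using precomp[OF e(1), of "pr2 C f (j \<cdot> s)"] precomp[OF e(2), of "pr2 C f (j \<cdot> s)"] pr_eq[of f "j \<cdot> s"] by simp_all
    have A: "pair C f R (pr1 C f (j \<cdot> s)) (u \<cdot> pr2 C f (j \<cdot> s)) \<in> Arr C" "Dom C (pair C f R (pr1 C f (j \<cdot> s)) (u \<cdot> pr2 C f (j \<cdot> s))) = pb C f (j \<cdot> s)"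
      "Cod C (pair C f R (pr1 C f (j \<cdot> s)) (u \<cdot> pr2 C f (j \<cdot> s))) = pb C f R" by (simp_all add: e'(1))
    have B: "pair C f R (pr1 C f (j \<cdot> s)) (v \<cdot> pr2 C f (j \<cdot> s)) \<in> Arr C" "Dom C (pair C f R (pr1 C f (j \<cdot> s)) (v \<cdot> pr2 C f (j \<cdot> s))) = pb C f (j \<cdot> s)"
      "Cod C (pair C f R (pr1 C f (j \<cdot> s)) (v \<cdot> pr2 C f (j \<cdot> s))) = pb C f R" by (simp_all add: e'(2))
    have k: "ev \<cdot> pair C f R (pr1 C f (j \<cdot> s)) (u \<cdot> pr2 C f (j \<cdot> s)) = ev \<cdot> pair C f R (pr1 C f (j \<cdot> s)) (v \<cdot> pr2 C f (j \<cdot> s))"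
      by (rule strict_zero[OF Z Zu c(1,3)]) (use c A B in simp_all)
    show ?thesis
      by (rule Pi_unique[OF fy M, folded R_def ev_def]) (use e k in simp_all)
  qed
  have rM: "D.mpb P r (pr1 C P r) (pr2 C P r)" by (rule chosen_mpb) simp_all
  obtain n where n[simp]: "n \<in> Arr C" "Dom C n = Dom C r" "Cod C n = Dom C R" and Rn: "R \<cdot> n = i \<cdot> r"
    and evn: "ev \<cdot> pair C f R (pr1 C P r) (n \<cdot> pr2 C P r) = e"
    by (rule Pi_ex[OF fy fM[OF rM], of e, folded R_def ev_def]) (simp_all add: ye)
  have Mj: "D.mpb f (j \<cdot> Idt C T) (pr1 C f j) (pr2 C f j)" using chosen_mpb[of f j] by simp
  obtain c where c[simp]: "c \<in> Arr C" "Dom C c = pb C f j" "Cod C c = Z" using to_zero[OF Mj] by auto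
  have yo: "Dom C y \<in> Obj C" by simp
  obtain d where d[simp]: "d \<in> Arr C" "Dom C d = Z" "Cod C d = Dom C y" using Zex[OF yo] by blast
  \<comment> \<open>The point \<open>z\<close> is the transpose of an arrow that factors through
    \<open>Z\<close>; strictness guarantees that this arrow lies over \<open>Dom C f\<close> as
    required.\<close>
  have ydc: "y \<cdot> (d \<cdot> c) = pr1 C f j" by (rule strict_zero[OF Z Zu c(1,3)]) simp_all
  obtain z where z[simp]: "z \<in> Arr C" "Dom C z = T" "Cod C z = Dom C R" and Rz: "R \<cdot> z = j"
    by (rule Pi_ex[OF fy, of j "pr1 C f j" "pr2 C f j" "d \<cdot> c", folded R_def]) (use Mj ydc in simp_all)
  \<comment> \<open>Over the old shapes the dependent product along \<open>f\<close> restricts to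
    the one along \<open>P\<close>: by \<open>fM\<close> both are tested on the same
    pullbacks.\<close>
  have 1: "D.mpb i R r n"
  proof (rule D.mpbI)
    fix v \<phi>
    assume v[simp]: "v \<in> Arr C" "\<phi> \<in> Arr C" and "Cod C v = Cod C n" "Dom C \<phi> = Dom C v" "Cod C \<phi> = Dom C i" and iv: "i \<cdot> \<phi> = R \<cdot> v"
    then have v2[simp]: "Cod C v = Dom C R" "Dom C \<phi> = Dom C v" "Cod C \<phi> = Cod C P" by simp_all
    define p q where "p = pr1 C P \<phi>" and "q = pr2 C P \<phi>"
    have p[simp]: "p \<in> Arr C" "q \<in> Arr C" "Dom C p = pb C P \<phi>" "Dom C q = pb C P \<phi>" "Cod C p = Dom C P" "Cod C q = Dom C v" by (simp_all add: p_def q_def)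
    have M: "D.mpb P \<phi> p q" unfolding p_def q_def by (rule chosen_mpb) simp_all
    have fp: "f \<cdot> p = R \<cdot> (v \<cdot> q)" using D.mpbD(9)[OF fM[OF M]] precomp[OF iv, of q] by simp
    define k where "k = ev \<cdot> pair C f R p (v \<cdot> q)"
    have k[simp]: "k \<in> Arr C" "Dom C k = pb C P \<phi>" "Cod C k = Dom C y" using fp by (simp_all add: k_def)
    have yk: "y \<cdot> k = p" using precomp[OF yev[folded R_def ev_def], of "pair C f R p (v \<cdot> q)"] fp by (simp add: k_def)
    obtain h where h[simp]: "h \<in> Arr C" "Dom C h = Dom C v" "Cod C h = Dom C r" and rh: "r \<cdot> h = \<phi>" and ek: "e \<cdot> pair C P r p (h \<cdot> q) = k"
      by (rule is_pi_ex[OF pi M, of k]) (simp_all add: yk)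
    have Pp: "P \<cdot> p = r \<cdot> (h \<cdot> q)" using D.mpbD(9)[OF M] precomp[OF rh, of q] by simp
    define w where "w = pair C P r p (h \<cdot> q)"
    have w[simp]: "w \<in> Arr C" "Dom C w = pb C P \<phi>" "Cod C w = pb C P r" and w2: "pr1 C P r \<cdot> w = p" "pr2 C P r \<cdot> w = h \<cdot> q"
      using Pp by (simp_all add: w_def)
    have fr: "f \<cdot> pr1 C P r = R \<cdot> (n \<cdot> pr2 C P r)" using D.mpbD(9)[OF fM[OF rM]] precomp[OF Rn, of "pr2 C P r"] by simp
    have Rnh: "R \<cdot> (n \<cdot> h) = i \<cdot> \<phi>" using precomp[OF Rn, of h] rh by simp
    have "k = (ev \<cdot> pair C f R (pr1 C P r) (n \<cdot> pr2 C P r)) \<cdot> w" unfolding evn w_def ek by (rule refl)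
    also have "\<dots> = ev \<cdot> (pair C f R (pr1 C P r) (n \<cdot> pr2 C P r) \<cdot> w)" by (rule assoc) (use fr in simp_all)
    also have "pair C f R (pr1 C P r) (n \<cdot> pr2 C P r) \<cdot> w = pair C f R p (n \<cdot> (h \<cdot> q))" using fr w2 by simp
    finally have k2: "ev \<cdot> pair C f R p ((n \<cdot> h) \<cdot> q) = ev \<cdot> pair C f R p (v \<cdot> q)" by (simp add: k_def)
    have "n \<cdot> h = v"
      by (rule Pi_unique[OF fy fM[OF M], folded R_def ev_def]) (use Rnh iv k2 in simp_all)
    then show "\<exists>z. z \<in> Arr C \<and> Dom C z = Dom C v \<and> Cod C z = Dom C n \<and> n \<cdot> z = v \<and> r \<cdot> z = \<phi>"
      using rh by (intro exI[of _ h]) simp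
  next
    fix h h'
    assume h[simp]: "h \<in> Arr C" "h' \<in> Arr C" "Dom C h = Dom C h'" and "Cod C h = Dom C n" "Cod C h' = Dom C n" and nh: "n \<cdot> h = n \<cdot> h'" and rh: "r \<cdot> h = r \<cdot> h'"
    then have h2[simp]: "Cod C h = Dom C r" "Cod C h' = Dom C r" by simp_all
    define \<phi> where "\<phi> = r \<cdot> h'"
    have \<phi>[simp]: "\<phi> \<in> Arr C" "Dom C \<phi> = Dom C h'" "Cod C \<phi> = Cod C P" by (simp_all add: \<phi>_def)
    define p q where "p = pr1 C P \<phi>" and "q = pr2 C P \<phi>"
    have p[simp]: "p \<in> Arr C" "q \<in> Arr C" "Dom C p = pb C P \<phi>" "Dom C q = pb C P \<phi>" "Cod C p = Dom C P" "Cod C q = Dom C h'" by (simp_all add: p_def q_def)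
    have M: "D.mpb P \<phi> p q" unfolding p_def q_def by (rule chosen_mpb) simp_all
    have fr: "f \<cdot> pr1 C P r = R \<cdot> (n \<cdot> pr2 C P r)" using D.mpbD(9)[OF fM[OF rM]] precomp[OF Rn, of "pr2 C P r"] by simp
    have ew: "e \<cdot> pair C P r p (g \<cdot> q) = ev \<cdot> pair C f R p ((n \<cdot> g) \<cdot> q)"
      if g[simp]: "g \<in> Arr C" "Dom C g = Dom C h'" "Cod C g = Dom C r" and rg: "r \<cdot> g = \<phi>" for g
    proof -
      have Pp: "P \<cdot> p = r \<cdot> (g \<cdot> q)" using D.mpbD(9)[OF M] precomp[OF rg, of q] by simp
      define w where "w = pair C P r p (g \<cdot> q)"
      have w[simp]: "w \<in> Arr C" "Dom C w = pb C P \<phi>" "Cod C w = pb C P r" and w2: "pr1 C P r \<cdot> w = p" "pr2 C P r \<cdot> w = g \<cdot> q"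
        using Pp by (simp_all add: w_def)
      have "e \<cdot> w = ev \<cdot> (pair C f R (pr1 C P r) (n \<cdot> pr2 C P r) \<cdot> w)" unfolding evn[symmetric] by (rule assoc) (use fr in simp_all)
      also have "pair C f R (pr1 C P r) (n \<cdot> pr2 C P r) \<cdot> w = pair C f R p (n \<cdot> (g \<cdot> q))" using fr w2 by simp
      finally show ?thesis by (simp add: w_def)
    qed
    have rhf: "r \<cdot> h = \<phi>" "r \<cdot> h' = \<phi>" using rh by (simp_all add: \<phi>_def)
    have "e \<cdot> pair C P r p (h \<cdot> q) = e \<cdot> pair C P r p (h' \<cdot> q)"
      unfolding ew[OF h(1,3) h2(1) rhf(1)] ew[OF h(2) refl h2(2) rhf(2)] nh by (rule refl)
    then show "h = h'"
      by - (rule is_pi_unique[OF pi M], use rhf in simp_all)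
  qed (simp_all add: Rn)
  have 2: "D.mpb j R (Idt C T) z"
  proof (rule D.mpbI)
    fix v s
    assume v[simp]: "v \<in> Arr C" "s \<in> Arr C" and "Cod C v = Cod C z" "Dom C s = Dom C v" "Cod C s = Dom C j" and e: "j \<cdot> s = R \<cdot> v"
    then have v2[simp]: "Cod C v = Dom C R" "Dom C s = Dom C v" "Cod C s = T" by simp_all
    have "z \<cdot> s = v" by (rule inr_unique[of _ _ s]) (use e precomp[OF Rz, of s] in simp_all)
    then show "\<exists>x. x \<in> Arr C \<and> Dom C x = Dom C v \<and> Cod C x = Dom C z \<and> z \<cdot> x = v \<and> Idt C T \<cdot> x = s"
      by (intro exI[of _ s]) simp
  qed (simp_all add: Rz)
  have "is_coproduct C n z"
    by (rule pullback_of_coproduct[OF _ 1 2]) (simp add: i_def j_def injections)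
  then show thesis
    by (rule that[OF n[unfolded R_def] Rn[unfolded R_def] evn[unfolded R_def ev_def] z[unfolded R_def] Rz[unfolded R_def]
      _ inr_unique[unfolded R_def] fM])
qed

text \<open>Both sides lie over \<open>i \<cdot> r\<close> and have the evaluation
  \<open>\<kappa> \<cdot> e\<close>, so uniqueness for the dependent product along \<open>f\<close>
  identifies them.\<close>

lemma inl_pi_natural:
  fixes P y r e
  assumes P[simp]: "P \<in> Arr C" and y[simp]: "y \<in> Arr C" "Cod C y = Dom C P" "y' \<in> Arr C" "Cod C y' = Dom C P"
    and pi: "is_pi P y r e" and pi': "is_pi P y' r' e'"
    and i[simp]: "i \<in> Arr C" "Dom C i = Cod C P"
    and \<kappa>[simp]: "\<kappa> \<in> Arr C" "Dom C \<kappa> = Dom C y" "Cod C \<kappa> = Dom C y'" and y\<kappa>: "y' \<cdot> \<kappa> = y"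
    and g[simp]: "g \<in> Arr C" "Dom C g = Dom C r" "Cod C g = Dom C r'" and rg: "r' \<cdot> g = r"
      and eg: "e' \<cdot> pair C P r' (pr1 C P r) (g \<cdot> pr2 C P r) = \<kappa> \<cdot> e"
  defines "f \<equiv> i \<cdot> P"
  assumes fM: "\<And>p q \<phi>. D.mpb P \<phi> p q \<Longrightarrow> D.mpb f (i \<cdot> \<phi>) p q"
    and n[simp]: "n \<in> Arr C" "Dom C n = Dom C r" "Cod C n = Dom C (Pi f y)" and Rn: "Pi f y \<cdot> n = i \<cdot> r"
      and evn: "Pi_ev f y \<cdot> pair C f (Pi f y) (pr1 C P r) (n \<cdot> pr2 C P r) = e"
    and n'[simp]: "n' \<in> Arr C" "Dom C n' = Dom C r'" "Cod C n' = Dom C (Pi f y')" and Rn': "Pi f y' \<cdot> n' = i \<cdot> r'"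
      and evn': "Pi_ev f y' \<cdot> pair C f (Pi f y') (pr1 C P r') (n' \<cdot> pr2 C P r') = e'"
  shows "underlying (FArr (dep_prod C f) (y, \<kappa>, y')) \<cdot> n = n' \<cdot> g"
proof -
  have f[simp]: "f \<in> Arr C" "Dom C f = Dom C P" "Cod C f = Cod C i" by (simp_all add: f_def)
  have fy: "f \<in> Arr C" "y \<in> Arr C" "Cod C y = Dom C f" and fy': "f \<in> Arr C" "y' \<in> Arr C" "Cod C y' = Dom C f" by simp_all
  note PI[simp] = Pi_arr(1-5)[OF fy] Pi_arr(1-5)[OF fy']
  define F where "F = underlying (FArr (dep_prod C f) (y, \<kappa>, y'))"
  note F0 = Pi_map(1-5)[OF fy fy'(2,3) \<kappa> y\<kappa>, folded F_def]
  note F[simp] = F0(1-3) and RF = F0(4) and evF = F0(5)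
  note [simp] = is_piD(1-5)[OF pi] is_piD(1-5)[OF pi']
  define p q where "p = pr1 C P r" and "q = pr2 C P r"
  have p[simp]: "p \<in> Arr C" "q \<in> Arr C" "Dom C p = pb C P r" "Dom C q = pb C P r" "Cod C p = Dom C P" "Cod C q = Dom C r" by (simp_all add: p_def q_def)
  have M: "D.mpb P r p q" unfolding p_def q_def by (rule chosen_mpb) simp_all
  have Pp: "P \<cdot> p = r \<cdot> q" using D.mpbD(9)[OF M] .
  have fp: "f \<cdot> p = i \<cdot> (r \<cdot> q)" using D.mpbD(9)[OF fM[OF M]] by simp
  have fn: "f \<cdot> p = Pi f y \<cdot> (n \<cdot> q)" using fp precomp[OF Rn, of q] by simp
  have "f \<cdot> pr1 C P r' = i \<cdot> (r' \<cdot> pr2 C P r')" using pr_eq[of P r'] by (simp add: f_def)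
  then have fr': "f \<cdot> pr1 C P r' = Pi f y' \<cdot> (n' \<cdot> pr2 C P r')"
    using precomp[OF Rn', of "pr2 C P r'"] by simp
  have fF: "f \<cdot> pr1 C f (Pi f y) = Pi f y' \<cdot> (F \<cdot> pr2 C f (Pi f y))"
    using precomp[OF RF, of "pr2 C f (Pi f y)"] pr_eq[of f "Pi f y"] by simp
  define B where "B = pair C f (Pi f y) p (n \<cdot> q)"
  have B[simp]: "B \<in> Arr C" "Dom C B = pb C P r" "Cod C B = pb C f (Pi f y)" and B2: "pr1 C f (Pi f y) \<cdot> B = p" "pr2 C f (Pi f y) \<cdot> B = n \<cdot> q"
    using fn by (simp_all add: B_def)
  have eB: "Pi_ev f y \<cdot> B = e" using evn by (simp add: B_def p_def q_def)
  define A where "A = pair C f (Pi f y') (pr1 C f (Pi f y)) (F \<cdot> pr2 C f (Pi f y))"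
  have A[simp]: "A \<in> Arr C" "Dom C A = pb C f (Pi f y)" "Cod C A = pb C f (Pi f y')" using fF by (simp_all add: A_def)
  have AB: "A \<cdot> B = pair C f (Pi f y') p ((F \<cdot> n) \<cdot> q)" using fF B2 by (simp add: A_def)
  have "Pi_ev f y' \<cdot> (A \<cdot> B) = \<kappa> \<cdot> (Pi_ev f y \<cdot> B)"
    using precomp[OF evF[folded A_def], of B] by simp
  then have 1: "Pi_ev f y' \<cdot> pair C f (Pi f y') p ((F \<cdot> n) \<cdot> q) = \<kappa> \<cdot> e" unfolding AB eB .
  define w where "w = pair C P r' p (g \<cdot> q)"
  have "P \<cdot> p = r' \<cdot> (g \<cdot> q)" using Pp precomp[OF rg, of q] by simp
  then have w[simp]: "w \<in> Arr C" "Dom C w = pb C P r" "Cod C w = pb C P r'" and w2: "pr1 C P r' \<cdot> w = p" "pr2 C P r' \<cdot> w = g \<cdot> q"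
    by (simp_all add: w_def)
  define N where "N = pair C f (Pi f y') (pr1 C P r') (n' \<cdot> pr2 C P r')"
  have N[simp]: "N \<in> Arr C" "Dom C N = pb C P r'" "Cod C N = pb C f (Pi f y')" using fr' by (simp_all add: N_def)
  have Nw: "N \<cdot> w = pair C f (Pi f y') p ((n' \<cdot> g) \<cdot> q)" using fr' w2 by (simp add: N_def)
  have "Pi_ev f y' \<cdot> (N \<cdot> w) = e' \<cdot> w" by (rule precomp[OF evn'[folded N_def]]) simp_all
  also have "\<dots> = \<kappa> \<cdot> e" using eg by (simp add: w_def p_def q_def)
  finally have 2: "Pi_ev f y' \<cdot> pair C f (Pi f y') p ((n' \<cdot> g) \<cdot> q) = \<kappa> \<cdot> e" unfolding Nw .
  have "F \<cdot> n = n' \<cdot> g"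
    by (rule Pi_unique[OF fy' fM[OF M]])
      (use precomp[OF RF, of n] Rn precomp[OF Rn', of g] rg in \<open>simp_all add: 1 2 del: assoc, simp_all\<close>)
  then show ?thesis by (simp only: F_def)
qed

text \<open>By \<open>inl_pi\<close> the dependent product along \<open>f\<close> is the coproduct
  of \<open>r y\<close> and one point, so an algebra amounts to a pair \<open>b1\<close>,
  \<open>b0\<close>. With \<open>r\<close>, \<open>e\<close> and \<open>g\<close> as parameters,
  trees can use \<open>seq_shape\<close> and \<open>seq_shape_arr\<close> themselves, and paths a
  plain pullback.\<close>

lemma poly_initial:
  fixes P s t0 t1 V
  defines "T \<equiv> terminal_obj C"
  defines "i \<equiv> inl C (Cod C P) T" and "j \<equiv> inr C (Cod C P) T"
  assumes P[simp]: "P \<in> Arr C" and s[simp]: "s \<in> Arr C" "Dom C s = Dom C P" "Cod C s = V"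
    and t[simp]: "t0 \<in> Arr C" "t1 \<in> Arr C" "Dom C t0 = Cod C P" "Dom C t1 = T" "Cod C t0 = V" "Cod C t1 = V"
    and ini: "initial_algebra (slice C V) (poly_functor C s (i \<cdot> P) (copair C t0 t1)) x a"
    and pi: "\<And>y. y \<in> Arr C \<Longrightarrow> Cod C y = V \<Longrightarrow> is_pi P (pr1 C s y) (r y) (e y)"
    and g: "\<And>y k. y \<in> Arr C \<Longrightarrow> Cod C y = V \<Longrightarrow> k \<in> Arr C \<Longrightarrow> Dom C k = Dom C x \<Longrightarrow> Cod C k = Dom C y \<Longrightarrow> y \<cdot> k = x \<Longrightarrow>
      g k y \<in> Arr C \<and> Dom C (g k y) = Dom C (r x) \<and> Cod C (g k y) = Dom C (r y) \<and> r y \<cdot> g k y = r x \<and>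
      e y \<cdot> pair C P (r y) (pr1 C P (r x)) (g k y \<cdot> pr2 C P (r x)) = pair C s y (pr1 C s x) (k \<cdot> pr2 C s x) \<cdot> e x"
  shows "x \<in> Arr C \<and> Cod C x = V \<and> (\<exists>a1 a0. a1 \<in> Arr C \<and> Dom C a1 = Dom C (r x) \<and> Cod C a1 = Dom C x \<and> a0 \<in> Arr C \<and> Dom C a0 = T \<and> Cod C a0 = Dom C x \<and>
    x \<cdot> a1 = t0 \<cdot> r x \<and> x \<cdot> a0 = t1 \<and>
    (\<forall>y b1 b0. y \<in> Arr C \<longrightarrow> Cod C y = V \<longrightarrow> b1 \<in> Arr C \<longrightarrow> Dom C b1 = Dom C (r y) \<longrightarrow> Cod C b1 = Dom C y \<longrightarrow>
      b0 \<in> Arr C \<longrightarrow> Dom C b0 = T \<longrightarrow> Cod C b0 = Dom C y \<longrightarrow> y \<cdot> b1 = t0 \<cdot> r y \<longrightarrow> y \<cdot> b0 = t1 \<longrightarrow>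
      (\<exists>!k. k \<in> Arr C \<and> Dom C k = Dom C x \<and> Cod C k = Dom C y \<and> y \<cdot> k = x \<and> k \<cdot> a1 = b1 \<cdot> g k y \<and> k \<cdot> a0 = b0)))"
proof -
  define f t where "f = i \<cdot> P" and "t = copair C t0 t1"
  have To[simp]: "T \<in> Obj C" by (simp add: T_def)
  have ij[simp]: "i \<in> Arr C" "j \<in> Arr C" "Dom C i = Cod C P" "Dom C j = T" "Cod C i = coprod C (Cod C P) T" "Cod C j = coprod C (Cod C P) T"
    by (simp_all add: i_def j_def)
  have f[simp]: "f \<in> Arr C" "Dom C f = Dom C P" "Cod C f = coprod C (Cod C P) T" by (simp_all add: f_def)
  have t2[simp]: "t \<in> Arr C" "Dom C t = coprod C (Cod C P) T" "Cod C t = V" and ti: "t \<cdot> i = t0" "t \<cdot> j = t1" by (simp_all add: t_def i_def j_def)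
  let ?F = "poly_functor C s f t" and ?R = "\<lambda>y. Pi f (pr1 C s y)"
  have FO: "FObj ?F y = t \<cdot> ?R y" for y by (simp add: poly_functor_def fcomp_def dep_sum_def base_change_def)
  have x[simp]: "x \<in> Arr C" "Cod C x = V" using ini by (simp_all add: initial_algebra_def)
  have fy: "f \<in> Arr C" "pr1 C s y \<in> Arr C" "Cod C (pr1 C s y) = Dom C f" if "y \<in> Arr C" "Cod C y = V" for y using that by simp_all
  have PI: "?R y \<in> Arr C" "Cod C (?R y) = coprod C (Cod C P) T" if "y \<in> Arr C" "Cod C y = V" for y
    using Pi_arr(1,2)[OF fy[OF that]] by simp_all
  have "a \<in> hom (slice C V) (t \<cdot> ?R x) x" using ini unfolding initial_algebra_def f_def[symmetric] t_def[symmetric] FO by blast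
  then obtain a' where a: "a = (t \<cdot> ?R x, a', x)" and a'[simp]: "a' \<in> Arr C" "Dom C a' = Dom C (?R x)" "Cod C a' = Dom C x" and xa: "x \<cdot> a' = t \<cdot> ?R x"
    using PI(1,2)[of x] by (auto simp: hom_slice)
  have U: "\<exists>!h. h \<in> hom (slice C V) x y \<and> h \<cdot>\<^bsub>slice C V\<^esub> a = b \<cdot>\<^bsub>slice C V\<^esub> FArr ?F h"
    if "y \<in> Arr C" "Cod C y = V" "b \<in> hom (slice C V) (t \<cdot> ?R y) y" for y b
  proof -
    have "y \<in> Obj (slice C V)" "b \<in> hom (slice C V) (FObj ?F y) y" using that by (simp_all add: FO)
    then show ?thesis using ini unfolding initial_algebra_def f_def[symmetric] t_def[symmetric] by blast
  qed
  have ex: "\<exists>n z. n \<in> Arr C \<and> Dom C n = Dom C (r y) \<and> Cod C n = Dom C (?R y) \<and> ?R y \<cdot> n = i \<cdot> r y \<and>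
    Pi_ev f (pr1 C s y) \<cdot> pair C f (?R y) (pr1 C P (r y)) (n \<cdot> pr2 C P (r y)) = e y \<and>
    z \<in> Arr C \<and> Dom C z = T \<and> Cod C z = Dom C (?R y) \<and> ?R y \<cdot> z = j \<and> is_coproduct C n z \<and>
    (\<forall>u v. u \<in> Arr C \<longrightarrow> v \<in> Arr C \<longrightarrow> Dom C u = T \<longrightarrow> Dom C v = T \<longrightarrow> Cod C u = Dom C (?R y) \<longrightarrow> Cod C v = Dom C (?R y) \<longrightarrow>
      ?R y \<cdot> u = j \<longrightarrow> ?R y \<cdot> v = j \<longrightarrow> u = v) \<and> (\<forall>p q \<phi>. D.mpb P \<phi> p q \<longrightarrow> D.mpb f (i \<cdot> \<phi>) p q)"
    if y: "y \<in> Arr C" "Cod C y = V" for y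
  proof (rule inl_pi[OF P _ _ pi[OF y], folded T_def, folded i_def j_def, folded f_def])
    show "pr1 C s y \<in> Arr C" "Cod C (pr1 C s y) = Dom C P" using y by simp_all
    fix n z
    assume A: "n \<in> Arr C" "Dom C n = Dom C (r y)" "Cod C n = Dom C (?R y)" "?R y \<cdot> n = i \<cdot> r y"
     "Pi_ev f (pr1 C s y) \<cdot> pair C f (?R y) (pr1 C P (r y)) (n \<cdot> pr2 C P (r y)) = e y"
     "z \<in> Arr C" "Dom C z = T" "Cod C z = Dom C (?R y)" "?R y \<cdot> z = j" "is_coproduct C n z" and
      un: "\<And>u v s'. u \<in> Arr C \<Longrightarrow> v \<in> Arr C \<Longrightarrow> Dom C u = Dom C v \<Longrightarrow> Cod C u = Dom C (?R y) \<Longrightarrow> Cod C v = Dom C (?R y) \<Longrightarrow>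
      s' \<in> Arr C \<Longrightarrow> Dom C s' = Dom C v \<Longrightarrow> Cod C s' = T \<Longrightarrow> ?R y \<cdot> u = j \<cdot> s' \<Longrightarrow> ?R y \<cdot> v = j \<cdot> s' \<Longrightarrow> u = v"
      and M: "\<And>p q \<phi>. D.mpb P \<phi> p q \<Longrightarrow> D.mpb f (i \<cdot> \<phi>) p q"
    have un': "u = v" if "u \<in> Arr C" "v \<in> Arr C" "Dom C u = T" "Dom C v = T" "Cod C u = Dom C (?R y)" "Cod C v = Dom C (?R y)" "?R y \<cdot> u = j" "?R y \<cdot> v = j" for u v
      by (rule un[of u v "Idt C T"]) (use that in simp_all)
    show ?thesis
      by (rule exI[of _ n], rule exI[of _ z]) (intro conjI allI impI A, fact un', fact M)
  qed
  obtain n z where nz: "\<And>y. y \<in> Arr C \<Longrightarrow> Cod C y = V \<Longrightarrow> n y \<in> Arr C \<and> Dom C (n y) = Dom C (r y) \<and> Cod C (n y) = Dom C (?R y) \<and> ?R y \<cdot> n y = i \<cdot> r y \<and>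
    Pi_ev f (pr1 C s y) \<cdot> pair C f (?R y) (pr1 C P (r y)) (n y \<cdot> pr2 C P (r y)) = e y \<and>
    z y \<in> Arr C \<and> Dom C (z y) = T \<and> Cod C (z y) = Dom C (?R y) \<and> ?R y \<cdot> z y = j \<and> is_coproduct C (n y) (z y) \<and>
    (\<forall>u v. u \<in> Arr C \<longrightarrow> v \<in> Arr C \<longrightarrow> Dom C u = T \<longrightarrow> Dom C v = T \<longrightarrow> Cod C u = Dom C (?R y) \<longrightarrow> Cod C v = Dom C (?R y) \<longrightarrow>
      ?R y \<cdot> u = j \<longrightarrow> ?R y \<cdot> v = j \<longrightarrow> u = v) \<and> (\<forall>p q \<phi>. D.mpb P \<phi> p q \<longrightarrow> D.mpb f (i \<cdot> \<phi>) p q)"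
    using ex by metis
  have N: "n y \<in> Arr C" "Dom C (n y) = Dom C (r y)" "Cod C (n y) = Dom C (?R y)" "?R y \<cdot> n y = i \<cdot> r y"
    "Pi_ev f (pr1 C s y) \<cdot> pair C f (?R y) (pr1 C P (r y)) (n y \<cdot> pr2 C P (r y)) = e y"
    "z y \<in> Arr C" "Dom C (z y) = T" "Cod C (z y) = Dom C (?R y)" "?R y \<cdot> z y = j" "is_coproduct C (n y) (z y)"
    if "y \<in> Arr C" "Cod C y = V" for y using nz[OF that] by blast+
  have zu: "u = v" if "y \<in> Arr C" "Cod C y = V" "u \<in> Arr C" "v \<in> Arr C" "Dom C u = T" "Dom C v = T" "Cod C u = Dom C (?R y)" "Cod C v = Dom C (?R y)"
      "?R y \<cdot> u = j" "?R y \<cdot> v = j" for y u v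
    using nz[OF that(1,2)] that(3-) by (elim conjE allE[where x = u] allE[where x = v]) simp
  have fM: "D.mpb f (i \<cdot> \<phi>) p q" if "D.mpb P \<phi> p q" for \<phi> p q using nz[OF x] that by blast
  note [simp] = N(1-3,6-8) PI
  have rV[simp]: "r y \<in> Arr C" "Cod C (r y) = Cod C P" if "y \<in> Arr C" "Cod C y = V" for y using is_piD(1,2)[OF pi[OF that]] .
  define a1 a0 where "a1 = a' \<cdot> n x" and "a0 = a' \<cdot> z x"
  have a10[simp]: "a1 \<in> Arr C" "Dom C a1 = Dom C (r x)" "Cod C a1 = Dom C x" "a0 \<in> Arr C" "Dom C a0 = T" "Cod C a0 = Dom C x"
    by (simp_all add: a1_def a0_def)
  have xa1: "x \<cdot> a1 = t0 \<cdot> r x" using precomp[OF xa, of "n x"] N(4)[OF x] precomp[OF ti(1), of "r x"] by (simp add: a1_def)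
  have xa0: "x \<cdot> a0 = t1" using precomp[OF xa, of "z x"] N(9)[OF x] ti(2) by (simp add: a0_def)
  have main: "\<exists>!k. k \<in> Arr C \<and> Dom C k = Dom C x \<and> Cod C k = Dom C y \<and> y \<cdot> k = x \<and> k \<cdot> a1 = b1 \<cdot> g k y \<and> k \<cdot> a0 = b0"
    if y[simp]: "y \<in> Arr C" "Cod C y = V" and b[simp]: "b1 \<in> Arr C" "Dom C b1 = Dom C (r y)" "Cod C b1 = Dom C y"
      "b0 \<in> Arr C" "Dom C b0 = T" "Cod C b0 = Dom C y" and yb: "y \<cdot> b1 = t0 \<cdot> r y" "y \<cdot> b0 = t1" for y b1 b0
  proof -
    have c: "is_coproduct C (n y) (z y)" by (rule N) simp_all
    obtain b where bb[simp]: "b \<in> Arr C" "Dom C b = Dom C (?R y)" "Cod C b = Dom C y" and bn: "b \<cdot> n y = b1" "b \<cdot> z y = b0"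
      by (rule coproduct_ex[OF c, of b1 b0 "Dom C y"]) simp_all
    have yb': "y \<cdot> b = t \<cdot> ?R y"
      by (rule coproduct_unique[OF c])
        (use bn yb N(4)[OF y] N(9)[OF y] precomp[OF ti(1), of "r y"] ti(2) in simp_all)
    have bh: "(t \<cdot> ?R y, b, y) \<in> hom (slice C V) (t \<cdot> ?R y) y" using yb' by (simp add: hom_slice)
    have cx: "is_coproduct C (n x) (z x)" by (rule N) simp_all
    \<comment> \<open>The algebra equation splits along the coproduct \<open>n x\<close>,
      \<open>z x\<close>. \<open>Fn\<close> and \<open>Fz\<close> say that the polynomial functor
      acts by \<open>g\<close> on the first part and preserves the added point.\<close>
    have eqv: "((x, k, y) \<cdot>\<^bsub>slice C V\<^esub> a = (t \<cdot> ?R y, b, y) \<cdot>\<^bsub>slice C V\<^esub> FArr ?F (x, k, y)) \<longleftrightarrow> k \<cdot> a1 = b1 \<cdot> g k y \<and> k \<cdot> a0 = b0"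
      if k[simp]: "k \<in> Arr C" "Dom C k = Dom C x" "Cod C k = Dom C y" and yk: "y \<cdot> k = x" for k
    proof -
      let ?\<kappa> = "pair C s y (pr1 C s x) (k \<cdot> pr2 C s x)"
      have e0: "s \<cdot> pr1 C s x = y \<cdot> (k \<cdot> pr2 C s x)" using precomp[OF yk, of "pr2 C s x"] pr_eq[of s x] by simp
      have \<kappa>: "?\<kappa> \<in> Arr C" "Dom C ?\<kappa> = Dom C (pr1 C s x)" "Cod C ?\<kappa> = Dom C (pr1 C s y)" "pr1 C s y \<cdot> ?\<kappa> = pr1 C s x"
        using e0 by simp_all
      define F where "F = underlying (FArr (dep_prod C f) (pr1 C s x, ?\<kappa>, pr1 C s y))"
      note F0 = Pi_map[OF fy[OF x] fy(2,3)[OF y] \<kappa>, folded F_def]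
      note [simp] = F0(1-3)
      have FA: "FArr ?F (x, k, y) = (t \<cdot> ?R x, F, t \<cdot> ?R y)"
        using F0(6) by (simp add: poly_functor_def fcomp_def dep_sum_def base_change_def)
      note gk = g[OF y k yk]
      have Fn: "F \<cdot> n x = n y \<cdot> g k y"
        unfolding F_def f_def
        by (rule inl_pi_natural[OF P _ _ _ _ pi[OF x] pi[OF y] ij(1,3) \<kappa> _ _ _ _ _ _ N(1-3)[OF x, unfolded f_def] N(4)[OF x, unfolded f_def]
          N(5)[OF x, unfolded f_def] N(1-3)[OF y, unfolded f_def] N(4)[OF y, unfolded f_def] N(5)[OF y, unfolded f_def]])
          (use gk in \<open>simp_all add: fM[unfolded f_def]\<close>)
      have Fz: "F \<cdot> z x = z y"
        by (rule zu[OF y]) (use precomp[OF F0(4), of "z x"] N(9)[OF x] N(9)[OF y] in simp_all)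
      have "(k \<cdot> a' = b \<cdot> F) \<longleftrightarrow> k \<cdot> a1 = b1 \<cdot> g k y \<and> k \<cdot> a0 = b0"
      proof
        assume e: "k \<cdot> a' = b \<cdot> F"
        have "k \<cdot> a1 = b \<cdot> (F \<cdot> n x)" using precomp[OF e, of "n x"] by (simp add: a1_def)
        also have "\<dots> = b1 \<cdot> g k y" unfolding Fn by (rule precomp[OF bn(1)]) (use gk in simp_all)
        finally have 1: "k \<cdot> a1 = b1 \<cdot> g k y" .
        have "k \<cdot> a0 = b \<cdot> (F \<cdot> z x)" using precomp[OF e, of "z x"] by (simp add: a0_def)
        then show "k \<cdot> a1 = b1 \<cdot> g k y \<and> k \<cdot> a0 = b0" using 1 unfolding Fz bn(2) by simp
      next
        assume e: "k \<cdot> a1 = b1 \<cdot> g k y \<and> k \<cdot> a0 = b0"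
        have "b \<cdot> (n y \<cdot> g k y) = b1 \<cdot> g k y" by (rule precomp[OF bn(1)]) (use gk in simp_all)
        then show "k \<cdot> a' = b \<cdot> F"
          using e by - (rule coproduct_unique[OF cx], simp_all add: Fn Fz bn a1_def a0_def)
      qed
      then show ?thesis unfolding FA a by simp
    qed
    show ?thesis
    proof (rule ex_ex1I)
      obtain h where h: "h \<in> hom (slice C V) x y" "h \<cdot>\<^bsub>slice C V\<^esub> a = (t \<cdot> ?R y, b, y) \<cdot>\<^bsub>slice C V\<^esub> FArr ?F h"
        using ex1_implies_ex[OF U[OF y bh]] by (elim exE conjE)
      then obtain k where hk: "h = (x, k, y)" and k: "k \<in> Arr C" "Dom C k = Dom C x" "Cod C k = Dom C y" "y \<cdot> k = x"
        by (auto simp: hom_slice)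
      then show "\<exists>k. k \<in> Arr C \<and> Dom C k = Dom C x \<and> Cod C k = Dom C y \<and> y \<cdot> k = x \<and> k \<cdot> a1 = b1 \<cdot> g k y \<and> k \<cdot> a0 = b0"
        using h(2) eqv[OF k] by (intro exI[of _ k]) simp
    next
      fix k k'
      assume K: "k \<in> Arr C \<and> Dom C k = Dom C x \<and> Cod C k = Dom C y \<and> y \<cdot> k = x \<and> k \<cdot> a1 = b1 \<cdot> g k y \<and> k \<cdot> a0 = b0"
        and K': "k' \<in> Arr C \<and> Dom C k' = Dom C x \<and> Cod C k' = Dom C y \<and> y \<cdot> k' = x \<and> k' \<cdot> a1 = b1 \<cdot> g k' y \<and> k' \<cdot> a0 = b0"
      have 1: "(x, k, y) \<in> hom (slice C V) x y \<and> (x, k, y) \<cdot>\<^bsub>slice C V\<^esub> a = (t \<cdot> ?R y, b, y) \<cdot>\<^bsub>slice C V\<^esub> FArr ?F (x, k, y)"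
        using K eqv[of k] by (simp add: hom_slice)
      have 2: "(x, k', y) \<in> hom (slice C V) x y \<and> (x, k', y) \<cdot>\<^bsub>slice C V\<^esub> a = (t \<cdot> ?R y, b, y) \<cdot>\<^bsub>slice C V\<^esub> FArr ?F (x, k', y)"
        using K' eqv[of k'] by (simp add: hom_slice)
      have "(x, k, y) = (x, k', y)"
        by (rule trans[OF the1_equality[OF U[OF y bh] 1, symmetric] the1_equality[OF U[OF y bh] 2]])
      then show "k = k'" by simp
    qed
  qed
  show ?thesis
    by (intro conjI x exI[of _ a1] exI[of _ a0] a10 xa1 xa0 allI impI) (rule main)
qed

text \<open>Lambek's argument, with the structure map given by its two components \<open>a1\<close> and \<open>a0\<close>.\<close>

lemma initial_pair_coproduct:
  assumes x[simp]: "x \<in> Arr C" and t0[simp]: "t0 \<in> Arr C" "Cod C t0 = Cod C x"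
    and a[simp]: "a1 \<in> Arr C" "a0 \<in> Arr C" "Cod C a1 = Dom C x" "Cod C a0 = Dom C x" "Dom C a1 = Dom C (r x)" and xa1: "x \<cdot> a1 = t0 \<cdot> r x"
    and init: "\<And>y b1 b0. y \<in> Arr C \<Longrightarrow> Cod C y = Cod C x \<Longrightarrow> b1 \<in> Arr C \<Longrightarrow> Dom C b1 = Dom C (r y) \<Longrightarrow> Cod C b1 = Dom C y \<Longrightarrow>
      b0 \<in> Arr C \<Longrightarrow> Dom C b0 = Dom C a0 \<Longrightarrow> Cod C b0 = Dom C y \<Longrightarrow> y \<cdot> b1 = t0 \<cdot> r y \<Longrightarrow> y \<cdot> b0 = x \<cdot> a0 \<Longrightarrow>
      \<exists>!k. k \<in> Arr C \<and> Dom C k = Dom C x \<and> Cod C k = Dom C y \<and> y \<cdot> k = x \<and> k \<cdot> a1 = b1 \<cdot> g x k y \<and> k \<cdot> a0 = b0"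
    and r: "\<And>y. y \<in> Arr C \<Longrightarrow> Cod C y = Cod C x \<Longrightarrow> r y \<in> Arr C \<and> Cod C (r y) = Dom C t0"
    and g: "\<And>y z k. y \<in> Arr C \<Longrightarrow> z \<in> Arr C \<Longrightarrow> Cod C y = Cod C x \<Longrightarrow> Cod C z = Cod C x \<Longrightarrow> k \<in> Arr C \<Longrightarrow> Dom C k = Dom C y \<Longrightarrow>
      Cod C k = Dom C z \<Longrightarrow> z \<cdot> k = y \<Longrightarrow> g y k z \<in> Arr C \<and> Dom C (g y k z) = Dom C (r y) \<and> Cod C (g y k z) = Dom C (r z) \<and> r z \<cdot> g y k z = r y"
    and g_cmp: "\<And>y k c. y \<in> Arr C \<Longrightarrow> Cod C y = Cod C x \<Longrightarrow> k \<in> Arr C \<Longrightarrow> c \<in> Arr C \<Longrightarrow> Dom C k = Dom C x \<Longrightarrow> Cod C k = Dom C y \<Longrightarrow>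
      Dom C c = Dom C y \<Longrightarrow> Cod C c = Dom C x \<Longrightarrow> y \<cdot> k = x \<Longrightarrow> x \<cdot> c = y \<Longrightarrow> g y c x \<cdot> g x k y = g x (c \<cdot> k) x"
    and g_idt: "g x (Idt C (Dom C x)) x = Idt C (Dom C (r x))"
  shows "is_coproduct C a1 a0"
proof -
  have rx[simp]: "r x \<in> Arr C" "Cod C (r x) = Dom C t0" using r[OF x] by simp_all
  define i j where "i = inl C (Dom C (r x)) (Dom C a0)" and "j = inr C (Dom C (r x)) (Dom C a0)"
  have ij: "is_coproduct C i j" by (simp add: i_def j_def injections)
  have [simp]: "i \<in> Arr C" "j \<in> Arr C" "Dom C i = Dom C (r x)" "Dom C j = Dom C a0" "Cod C j = Cod C i"
    by (simp_all add: i_def j_def)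
  obtain y where y[simp]: "y \<in> Arr C" "Dom C y = Cod C i" "Cod C y = Cod C x" and yi: "y \<cdot> i = t0 \<cdot> r x" and yj: "y \<cdot> j = x \<cdot> a0"
    by (rule coproduct_ex[OF ij, of "t0 \<cdot> r x" "x \<cdot> a0" "Cod C x"]) simp_all
  obtain c where c[simp]: "c \<in> Arr C" "Dom C c = Cod C i" "Cod C c = Dom C x" and ci: "c \<cdot> i = a1" and cj: "c \<cdot> j = a0"
    by (rule coproduct_ex[OF ij, of a1 a0 "Dom C x"]) simp_all
  have xc: "x \<cdot> c = y"
    by (rule coproduct_unique[OF ij]) (simp_all add: ci cj yi yj xa1)
  have ry[simp]: "r y \<in> Arr C" "Cod C (r y) = Dom C t0" using r[of y] by simp_all
  have gc[simp]: "g y c x \<in> Arr C" "Dom C (g y c x) = Dom C (r y)" "Cod C (g y c x) = Dom C (r x)" and rgc: "r x \<cdot> g y c x = r y"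
    using g[of y x c] xc by simp_all
  \<comment> \<open>Lambek's algebra: its carrier is the functor applied to \<open>x\<close>, here
    the coproduct \<open>y\<close>, and its structure is the functor applied to the structure map
    \<open>c\<close>. Then \<open>c \<cdot> k\<close> is an endomorphism of the initial algebra and
    hence the identity.\<close>
  have "\<exists>!k. k \<in> Arr C \<and> Dom C k = Dom C x \<and> Cod C k = Dom C y \<and> y \<cdot> k = x \<and> k \<cdot> a1 = (i \<cdot> g y c x) \<cdot> g x k y \<and> k \<cdot> a0 = j"
  proof (rule init)
    show "y \<cdot> (i \<cdot> g y c x) = t0 \<cdot> r y" using precomp[OF yi, of "g y c x"] rgc by simp
  qed (simp_all add: yj)
  then obtain k where k[simp]: "k \<in> Arr C" "Dom C k = Dom C x" "Cod C k = Cod C i" and yk: "y \<cdot> k = x" and ka: "k \<cdot> a1 = (i \<cdot> g y c x) \<cdot> g x k y" "k \<cdot> a0 = j"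
    unfolding y(2) by (elim ex1E conjE)
  have gk[simp]: "g x k y \<in> Arr C" "Dom C (g x k y) = Dom C (r x)" "Cod C (g x k y) = Dom C (r y)"
    using g[of x y k] yk by simp_all
  have gck: "g y c x \<cdot> g x k y = g x (c \<cdot> k) x" by (rule g_cmp) (simp_all add: xc yk)
  have gG[simp]: "g x (c \<cdot> k) x \<in> Arr C" "Dom C (g x (c \<cdot> k) x) = Dom C (r x)" "Cod C (g x (c \<cdot> k) x) = Dom C (r x)"
    unfolding gck[symmetric] by simp_all
  have ka1: "k \<cdot> a1 = i \<cdot> g x (c \<cdot> k) x" using ka(1) gck by simp
  have U: "\<exists>!k. k \<in> Arr C \<and> Dom C k = Dom C x \<and> Cod C k = Dom C x \<and> x \<cdot> k = x \<and> k \<cdot> a1 = a1 \<cdot> g x k x \<and> k \<cdot> a0 = a0"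
    by (rule init) (simp_all add: xa1)
  have 1: "c \<cdot> k \<in> Arr C \<and> Dom C (c \<cdot> k) = Dom C x \<and> Cod C (c \<cdot> k) = Dom C x \<and> x \<cdot> (c \<cdot> k) = x \<and> (c \<cdot> k) \<cdot> a1 = a1 \<cdot> g x (c \<cdot> k) x \<and> (c \<cdot> k) \<cdot> a0 = a0"
    using precomp[OF xc, of k] yk precomp[OF ci, of "g x (c \<cdot> k) x"] ka1 ka(2) cj by simp
  have 2: "Idt C (Dom C x) \<in> Arr C \<and> Dom C (Idt C (Dom C x)) = Dom C x \<and> Cod C (Idt C (Dom C x)) = Dom C x \<and> x \<cdot> Idt C (Dom C x) = x \<and>
    Idt C (Dom C x) \<cdot> a1 = a1 \<cdot> g x (Idt C (Dom C x)) x \<and> Idt C (Dom C x) \<cdot> a0 = a0"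
    by (simp add: g_idt)
  obtain w where w: "\<And>k. k \<in> Arr C \<and> Dom C k = Dom C x \<and> Cod C k = Dom C x \<and> x \<cdot> k = x \<and> k \<cdot> a1 = a1 \<cdot> g x k x \<and> k \<cdot> a0 = a0 \<Longrightarrow> k = w"
    using U by (rule ex1E) iprover
  have ck: "c \<cdot> k = Idt C (Dom C x)"
    unfolding w[OF 1] w[OF 2] by (rule refl)
  have ki: "k \<cdot> a1 = i"
    unfolding ka1 ck g_idt by simp
  show ?thesis
  proof (rule coproductI)
    fix u v S assume u: "u \<in> Arr C" "v \<in> Arr C" "Dom C u = Dom C a1" "Dom C v = Dom C a0" "Cod C u = S" "Cod C v = S"
    obtain h where h: "h \<in> Arr C" "Dom C h = Cod C i" "Cod C h = S" "h \<cdot> i = u" "h \<cdot> j = v"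
      by (rule coproduct_ex[OF ij, of u v S]) (use u in simp_all)
    then show "\<exists>h. h \<in> Arr C \<and> Dom C h = Cod C a1 \<and> Cod C h = S \<and> h \<cdot> a1 = u \<and> h \<cdot> a0 = v"
      by (intro exI[of _ "h \<cdot> k"]) (simp add: ki ka(2))
  next
    fix h h'
    assume h: "h \<in> Arr C" "h' \<in> Arr C" "Dom C h = Cod C a1" "Dom C h' = Cod C a1" "Cod C h = Cod C h'" "h \<cdot> a1 = h' \<cdot> a1" "h \<cdot> a0 = h' \<cdot> a0"
    have "h \<cdot> c = h' \<cdot> c" by (rule coproduct_unique[OF ij]) (use h in \<open>simp_all add: ci cj\<close>)
    then have "(h \<cdot> c) \<cdot> k = (h' \<cdot> c) \<cdot> k" by (rule arg_cong)
    then show "h = h'" using h ck by simp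
  qed simp_all
qed

text \<open>Writing \<open>P : A \<rightarrow> I\<close>, trees are the W-type of the diagram with
  arrows \<open>A \<rightarrow> 1\<close>, \<open>A \<rightarrow> I + 1\<close> and
  \<open>I + 1 \<rightarrow> 1\<close>, the middle one being \<open>P\<close> followed by the left
  injection. Nodes branch as \<open>P\<close> does, and the added shape is the leaf.\<close>

lemma shape_initial:
  assumes "has_dependent_W_types C" and P[simp]: "P \<in> Arr C"
  obtains W m e where "W \<in> Obj C" "m \<in> Arr C" "Dom C m = Dom C (seq_shape C P W)" "Cod C m = W"
    "e \<in> Arr C" "Dom C e = terminal_obj C" "Cod C e = W" "is_coproduct C m e"
    "\<And>Y b0 b1. b0 \<in> hom C (terminal_obj C) Y \<Longrightarrow> b1 \<in> hom C (Dom C (seq_shape C P Y)) Y \<Longrightarrow>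
      \<exists>!k. k \<in> hom C W Y \<and> k \<cdot> e = b0 \<and> k \<cdot> m = b1 \<cdot> seq_shape_arr C P k"
proof -
  interpret tp: two_powers K C "Cod C" shape P "seq_shape C P" "\<lambda>J. pr1 C P (seq_shape C P J)" "\<lambda>J. pr2 C P (seq_shape C P J)"
    "seq_ev C P" "seq_shape_arr C P" "seq_base P" "seq_counit P" "seq_arr C P"
    by (rule two_powers[OF P])
  define T s where "T = terminal_obj C" and "s = bang C (Dom C P)"
  have To[simp]: "T \<in> Obj C" by (simp add: T_def)
  have s[simp]: "s \<in> Arr C" "Dom C s = Dom C P" "Cod C s = T" by (simp_all add: s_def T_def)
  note sf = seq_shape_arr_facts[OF P]
  \<comment> \<open>An arrow to the terminal object is determined by its domain. The slice over
    \<open>T\<close> is thus \<open>C\<close> itself, and \<open>seq_shape\<close> is literally the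
    dependent product in the polynomial.\<close>
  have b: "bang C (Dom C y) = y" if "y \<in> Arr C" "Cod C y = T" for y
    by (rule terminal_unique) (use that in \<open>simp_all add: T_def\<close>)
  let ?r = "\<lambda>y. seq_shape C P (Dom C y)" and ?e = "\<lambda>y. Pi_ev P (pr1 C s y)"
  have R: "?r y = Pi P (pr1 C s y)" if y: "y \<in> Arr C" "Cod C y = T" for y
    using sf(6)[of "Dom C y"] b[OF y] y by (simp add: s_def)
  have pi: "is_pi P (pr1 C s y) (?r y) (?e y)" if y: "y \<in> Arr C" "Cod C y = T" for y
    unfolding R[OF y] by (rule Pi_is_pi) (use y in simp_all)
  have g: "seq_shape_arr C P k \<in> Arr C \<and> Dom C (seq_shape_arr C P k) = Dom C (?r y) \<and> Cod C (seq_shape_arr C P k) = Dom C (?r z) \<and>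
      ?r z \<cdot> seq_shape_arr C P k = ?r y \<and>
      ?e z \<cdot> pair C P (?r z) (pr1 C P (?r y)) (seq_shape_arr C P k \<cdot> pr2 C P (?r y)) = pair C s z (pr1 C s y) (k \<cdot> pr2 C s y) \<cdot> ?e y"
    if y[simp]: "y \<in> Arr C" "z \<in> Arr C" "Cod C y = T" "Cod C z = T" and k[simp]: "k \<in> Arr C" "Dom C k = Dom C y" "Cod C k = Dom C z" for y z k
  proof -
    have "s \<cdot> pr1 C s y = z \<cdot> (k \<cdot> pr2 C s y)"
      by (rule terminal_unique) (simp_all add: T_def[symmetric])
    then have \<kappa>: "pair C s z (pr1 C s y) (k \<cdot> pr2 C s y) \<in> Arr C" "Dom C (pair C s z (pr1 C s y) (k \<cdot> pr2 C s y)) = Dom C (pr1 C s y)"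
       "Cod C (pair C s z (pr1 C s y) (k \<cdot> pr2 C s y)) = Dom C (pr1 C s z)" "pr1 C s z \<cdot> pair C s z (pr1 C s y) (k \<cdot> pr2 C s y) = pr1 C s y"
      by simp_all
    have "seq_shape_arr C P k = underlying (FArr (dep_prod C P) (pr1 C s y, pair C s z (pr1 C s y) (k \<cdot> pr2 C s y), pr1 C s z))"
      using b[OF y(1,3)] b[OF y(2,4)] by (simp add: seq_shape_arr_def base_change_def s_def[symmetric])
    then show ?thesis
      unfolding R[OF y(1,3)] R[OF y(2,4)] by (simp only:) (intro conjI Pi_map(1-5)[OF P _ _ _ _ \<kappa>]; simp)
  qed
  define t0 where "t0 = bang C (Cod C P)"
  have t0[simp]: "t0 \<in> Arr C" "Dom C t0 = Cod C P" "Cod C t0 = T" by (simp_all add: t0_def T_def)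
  obtain x a where ini: "initial_algebra (slice C T) (poly_functor C s (inl C (Cod C P) (terminal_obj C) \<cdot> P) (copair C t0 (Idt C T))) x a"
  proof -
    have "s \<in> hom C (Dom C P) T" "inl C (Cod C P) (terminal_obj C) \<cdot> P \<in> hom C (Dom C P) (coprod C (Cod C P) T)"
      "copair C t0 (Idt C T) \<in> hom C (coprod C (Cod C P) T) T" "coprod C (Cod C P) T \<in> Obj C"
      using cod_in[of "inl C (Cod C P) T"] by (simp_all add: hom_iff T_def[symmetric])
    then show thesis using that assms(1) To dom_in[OF P] unfolding has_dependent_W_types_def by blast
  qed
  have xx: "x \<in> Arr C" "Cod C x = T" using ini by (simp_all add: initial_algebra_def)
  have "x \<in> Arr C \<and> Cod C x = T \<and> (\<exists>a1 a0. a1 \<in> Arr C \<and> Dom C a1 = Dom C (?r x) \<and> Cod C a1 = Dom C x \<and> a0 \<in> Arr C \<and> Dom C a0 = terminal_obj C \<and> Cod C a0 = Dom C x \<and>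
    x \<cdot> a1 = t0 \<cdot> ?r x \<and> x \<cdot> a0 = Idt C T \<and>
    (\<forall>y b1 b0. y \<in> Arr C \<longrightarrow> Cod C y = T \<longrightarrow> b1 \<in> Arr C \<longrightarrow> Dom C b1 = Dom C (?r y) \<longrightarrow> Cod C b1 = Dom C y \<longrightarrow>
      b0 \<in> Arr C \<longrightarrow> Dom C b0 = terminal_obj C \<longrightarrow> Cod C b0 = Dom C y \<longrightarrow> y \<cdot> b1 = t0 \<cdot> ?r y \<longrightarrow> y \<cdot> b0 = Idt C T \<longrightarrow>
      (\<exists>!k. k \<in> Arr C \<and> Dom C k = Dom C x \<and> Cod C k = Dom C y \<and> y \<cdot> k = x \<and> k \<cdot> a1 = b1 \<cdot> seq_shape_arr C P k \<and> k \<cdot> a0 = b0)))"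
    by (rule poly_initial[OF P s t0(1) _ t0(2) _ t0(3) _ ini pi g]) (use xx in \<open>simp_all add: T_def\<close>)
  then obtain a1 a0 where x[simp]: "x \<in> Arr C" "Cod C x = T" and a[simp]: "a1 \<in> Arr C" "Dom C a1 = Dom C (?r x)" "Cod C a1 = Dom C x"
     "a0 \<in> Arr C" "Dom C a0 = T" "Cod C a0 = Dom C x" and
    init0: "\<forall>y b1 b0. y \<in> Arr C \<longrightarrow> Cod C y = T \<longrightarrow> b1 \<in> Arr C \<longrightarrow> Dom C b1 = Dom C (?r y) \<longrightarrow> Cod C b1 = Dom C y \<longrightarrow>
      b0 \<in> Arr C \<longrightarrow> Dom C b0 = T \<longrightarrow> Cod C b0 = Dom C y \<longrightarrow> y \<cdot> b1 = t0 \<cdot> ?r y \<longrightarrow> y \<cdot> b0 = Idt C T \<longrightarrow>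
      (\<exists>!k. k \<in> Arr C \<and> Dom C k = Dom C x \<and> Cod C k = Dom C y \<and> y \<cdot> k = x \<and> k \<cdot> a1 = b1 \<cdot> seq_shape_arr C P k \<and> k \<cdot> a0 = b0)"
    unfolding T_def[symmetric] by (elim conjE exE)
  have tu: "f = h" if "f \<in> Arr C" "h \<in> Arr C" "Dom C f = Dom C h" "Cod C f = T" "Cod C h = T" for f h
    by (rule terminal_unique) (use that in \<open>simp_all add: T_def\<close>)
  have init: "\<exists>!k. k \<in> Arr C \<and> Dom C k = Dom C x \<and> Cod C k = Dom C y \<and> y \<cdot> k = x \<and> k \<cdot> a1 = b1 \<cdot> seq_shape_arr C P k \<and> k \<cdot> a0 = b0"
    if y: "y \<in> Arr C" "Cod C y = T" "b1 \<in> Arr C" "Dom C b1 = Dom C (?r y)" "Cod C b1 = Dom C y" "b0 \<in> Arr C" "Dom C b0 = T" "Cod C b0 = Dom C y" for y b1 b0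
  proof (rule init0[rule_format])
    show "y \<cdot> b1 = t0 \<cdot> ?r y" "y \<cdot> b0 = Idt C T" by (rule tu; use y sf(1,2)[of "Dom C y"] in simp)+
  qed (fact y)+
  have c: "is_coproduct C a1 a0"
  proof (rule initial_pair_coproduct[of x t0 a1 a0 ?r "\<lambda>y k z. seq_shape_arr C P k"])
    show "x \<cdot> a1 = t0 \<cdot> ?r x" by (rule tu) (use sf(1,2)[of "Dom C x"] in simp_all)
    show "\<exists>!k. k \<in> Arr C \<and> Dom C k = Dom C x \<and> Cod C k = Dom C y \<and> y \<cdot> k = x \<and> k \<cdot> a1 = b1 \<cdot> seq_shape_arr C P k \<and> k \<cdot> a0 = b0"
      if "y \<in> Arr C" "Cod C y = Cod C x" "b1 \<in> Arr C" "Dom C b1 = Dom C (?r y)" "Cod C b1 = Dom C y" "b0 \<in> Arr C" "Dom C b0 = Dom C a0" "Cod C b0 = Dom C y" for y b1 b0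
      by (rule init) (use that in simp_all)
    show "seq_shape_arr C P c \<cdot> seq_shape_arr C P k = seq_shape_arr C P (c \<cdot> k)" if "k \<in> Arr C" "c \<in> Arr C" "Cod C k = Dom C y" "Dom C c = Dom C y" for y k c
      using tp.D.L_cmp[of k c] that by simp
    show "seq_shape_arr C P (Idt C (Dom C x)) = Idt C (Dom C (?r x))"
      using tp.D.L_idt[of "Dom C x"] sf(1,2)[of "Dom C x"] by simp
  qed (use g sf(1,2) in simp_all)
  have U: "\<exists>!k. k \<in> hom C (Dom C x) Y \<and> k \<cdot> a0 = b0 \<and> k \<cdot> a1 = b1 \<cdot> seq_shape_arr C P k"
    if "b0 \<in> hom C (terminal_obj C) Y" "b1 \<in> hom C (Dom C (seq_shape C P Y)) Y" for Y b0 b1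
  proof -
    have b[simp]: "b0 \<in> Arr C" "Dom C b0 = T" "Cod C b0 = Y" "b1 \<in> Arr C" "Dom C b1 = Dom C (seq_shape C P Y)" "Cod C b1 = Y"
      using that by (simp_all add: hom_iff T_def)
    have Y[simp]: "Y \<in> Obj C" using cod_in[of b0] by simp
    have y: "Dom C (bang C Y) = Y" "Cod C (bang C Y) = T" "bang C Y \<in> Arr C" by (simp_all add: T_def)
    have "\<exists>!k. k \<in> Arr C \<and> Dom C k = Dom C x \<and> Cod C k = Dom C (bang C Y) \<and> bang C Y \<cdot> k = x \<and> k \<cdot> a1 = b1 \<cdot> seq_shape_arr C P k \<and> k \<cdot> a0 = b0"
      by (rule init) (simp_all add: y)
    moreover have "(k \<in> Arr C \<and> Dom C k = Dom C x \<and> Cod C k = Dom C (bang C Y) \<and> bang C Y \<cdot> k = x \<and> k \<cdot> a1 = b1 \<cdot> seq_shape_arr C P k \<and> k \<cdot> a0 = b0)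
      \<longleftrightarrow> k \<in> hom C (Dom C x) Y \<and> k \<cdot> a0 = b0 \<and> k \<cdot> a1 = b1 \<cdot> seq_shape_arr C P k" for k
    proof -
      have "bang C Y \<cdot> k = x" if "k \<in> Arr C" "Dom C k = Dom C x" "Cod C k = Y"
        by (rule tu) (use that y in simp_all)
      then show ?thesis unfolding hom_iff y(1) by iprover
    qed
    ultimately show ?thesis by simp
  qed
  show thesis
    by (rule that[of "Dom C x" a1 a0, OF _ _ _ _ _ _ _ c U]) (simp_all add: T_def[symmetric])
qed

text \<open>A W-type over \<open>V\<close> with at most one recursive argument. With
  \<open>V\<close> the object of trees, its constructors are the empty path, over the leaf
  \<open>t1\<close>, and the extension by \<open>a\<close> of a path in \<open>f a\<close>, for
  \<open>(a, (i, f))\<close> in \<open>Dom C ev\<close>; the extended path lies over the tree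
  \<open>t0\<close>. The recursive part pulls back along \<open>ev\<close>, and Lambek's lemma gives
  the decomposition of paths.\<close>

lemma dirs_initial:
  assumes W: "has_dependent_W_types C" and V[simp]: "V \<in> Obj C" and e[simp]: "ev \<in> Arr C" "Cod C ev = V"
    and t[simp]: "t0 \<in> Arr C" "t1 \<in> Arr C" "Dom C t0 = Dom C ev" "Dom C t1 = terminal_obj C" "Cod C t0 = V" "Cod C t1 = V"
  obtains x a1 a0 where "x \<in> Arr C" "Cod C x = V" "a1 \<in> Arr C" "Dom C a1 = pb C ev x" "Cod C a1 = Dom C x"
    "a0 \<in> Arr C" "Dom C a0 = terminal_obj C" "Cod C a0 = Dom C x" "x \<cdot> a1 = t0 \<cdot> pr1 C ev x" "x \<cdot> a0 = t1" "is_coproduct C a1 a0"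
proof -
  define E where "E = Dom C ev"
  have E[simp]: "E \<in> Obj C" "Dom C ev = E" "Dom C t0 = E" by (simp_all add: E_def)
  let ?f = "inl C (Cod C (Idt C E)) (terminal_obj C) \<cdot> Idt C E"
  obtain x a where ini: "initial_algebra (slice C V) (poly_functor C ev ?f (copair C t0 t1)) x a"
  proof -
    have "ev \<in> hom C E V" "?f \<in> hom C E (coprod C E (terminal_obj C))"
      "copair C t0 t1 \<in> hom C (coprod C E (terminal_obj C)) V" "coprod C E (terminal_obj C) \<in> Obj C"
      using cod_in[of "inl C E (terminal_obj C)"] by (simp_all add: hom_iff)
    then show thesis using that W V E(1) unfolding has_dependent_W_types_def by blast
  qed
  have xx: "x \<in> Arr C" "Cod C x = V" using ini by (simp_all add: initial_algebra_def)
  let ?r = "\<lambda>y. pr1 C ev y" and ?e = "\<lambda>y. pr2 C (Idt C E) (pr1 C ev y)"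
  let ?g = "\<lambda>y k z. pair C ev z (pr1 C ev y) (k \<cdot> pr2 C ev y)"
  have pi: "is_pi (Idt C E) (pr1 C ev y) (?r y) (?e y)" if "y \<in> Arr C" "Cod C y = V" for y
    by (rule idt_is_pi) (use that in simp_all)
  have g: "?g y k z \<in> Arr C \<and> Dom C (?g y k z) = Dom C (?r y) \<and> Cod C (?g y k z) = Dom C (?r z) \<and> ?r z \<cdot> ?g y k z = ?r y \<and>
      pr2 C ev z \<cdot> ?g y k z = k \<cdot> pr2 C ev y \<and>
      ?e z \<cdot> pair C (Idt C E) (?r z) (pr1 C (Idt C E) (?r y)) (?g y k z \<cdot> pr2 C (Idt C E) (?r y)) = ?g y k z \<cdot> ?e y"
    if y[simp]: "y \<in> Arr C" "z \<in> Arr C" "Cod C y = V" "Cod C z = V" and k[simp]: "k \<in> Arr C" "Dom C k = Dom C y" "Cod C k = Dom C z" and zk: "z \<cdot> k = y" for y z k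
  proof -
    define h where "h = ?g y k z"
    have "ev \<cdot> pr1 C ev y = z \<cdot> (k \<cdot> pr2 C ev y)" using precomp[OF zk, of "pr2 C ev y"] pr_eq[of ev y] by simp
    then have h[simp]: "h \<in> Arr C" "Dom C h = Dom C (?r y)" "Cod C h = Dom C (?r z)" and rh: "?r z \<cdot> h = ?r y" "pr2 C ev z \<cdot> h = k \<cdot> pr2 C ev y"
      by (simp_all add: h_def)
    have "Idt C E \<cdot> pr1 C (Idt C E) (?r y) = ?r z \<cdot> (h \<cdot> pr2 C (Idt C E) (?r y))"
      using precomp[OF rh(1), of "pr2 C (Idt C E) (?r y)"] pr_eq[of "Idt C E" "?r y"] by simp
    then have "?e z \<cdot> pair C (Idt C E) (?r z) (pr1 C (Idt C E) (?r y)) (h \<cdot> pr2 C (Idt C E) (?r y)) = h \<cdot> ?e y"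
      by simp
    then show ?thesis using h rh unfolding h_def[symmetric] by iprover
  qed
  have "x \<in> Arr C \<and> Cod C x = V \<and> (\<exists>a1 a0. a1 \<in> Arr C \<and> Dom C a1 = Dom C (?r x) \<and> Cod C a1 = Dom C x \<and> a0 \<in> Arr C \<and> Dom C a0 = terminal_obj C \<and> Cod C a0 = Dom C x \<and>
    x \<cdot> a1 = t0 \<cdot> ?r x \<and> x \<cdot> a0 = t1 \<and>
    (\<forall>y b1 b0. y \<in> Arr C \<longrightarrow> Cod C y = V \<longrightarrow> b1 \<in> Arr C \<longrightarrow> Dom C b1 = Dom C (?r y) \<longrightarrow> Cod C b1 = Dom C y \<longrightarrow>
      b0 \<in> Arr C \<longrightarrow> Dom C b0 = terminal_obj C \<longrightarrow> Cod C b0 = Dom C y \<longrightarrow> y \<cdot> b1 = t0 \<cdot> ?r y \<longrightarrow> y \<cdot> b0 = t1 \<longrightarrow>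
      (\<exists>!k. k \<in> Arr C \<and> Dom C k = Dom C x \<and> Cod C k = Dom C y \<and> y \<cdot> k = x \<and> k \<cdot> a1 = b1 \<cdot> ?g x k y \<and> k \<cdot> a0 = b0)))"
  proof (rule poly_initial[of "Idt C E" ev V t0 t1 x a ?r ?e "\<lambda>k y. ?g x k y", OF _ _ _ _ _ _ _ _ _ _ ini pi])
    fix y k
    assume A: "y \<in> Arr C" "Cod C y = V" "k \<in> Arr C" "Dom C k = Dom C x" "Cod C k = Dom C y" "y \<cdot> k = x"
    show "?g x k y \<in> Arr C \<and> Dom C (?g x k y) = Dom C (?r x) \<and> Cod C (?g x k y) = Dom C (?r y) \<and> ?r y \<cdot> ?g x k y = ?r x \<and>
      ?e y \<cdot> pair C (Idt C E) (?r y) (pr1 C (Idt C E) (?r x)) (?g x k y \<cdot> pr2 C (Idt C E) (?r x)) = ?g x k y \<cdot> ?e x"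
      using g[OF xx(1) A(1) xx(2) A(2-6)] by iprover
  qed (use xx in simp_all)
  then obtain a1 a0 where x[simp]: "x \<in> Arr C" "Cod C x = V" and a[simp]: "a1 \<in> Arr C" "Dom C a1 = Dom C (?r x)" "Cod C a1 = Dom C x"
     "a0 \<in> Arr C" "Dom C a0 = terminal_obj C" "Cod C a0 = Dom C x" and xa: "x \<cdot> a1 = t0 \<cdot> ?r x" "x \<cdot> a0 = t1" and
    init: "\<forall>y b1 b0. y \<in> Arr C \<longrightarrow> Cod C y = V \<longrightarrow> b1 \<in> Arr C \<longrightarrow> Dom C b1 = Dom C (?r y) \<longrightarrow> Cod C b1 = Dom C y \<longrightarrow>
      b0 \<in> Arr C \<longrightarrow> Dom C b0 = terminal_obj C \<longrightarrow> Cod C b0 = Dom C y \<longrightarrow> y \<cdot> b1 = t0 \<cdot> ?r y \<longrightarrow> y \<cdot> b0 = t1 \<longrightarrow>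
      (\<exists>!k. k \<in> Arr C \<and> Dom C k = Dom C x \<and> Cod C k = Dom C y \<and> y \<cdot> k = x \<and> k \<cdot> a1 = b1 \<cdot> ?g x k y \<and> k \<cdot> a0 = b0)"
    by (elim conjE exE)
  have c: "is_coproduct C a1 a0"
  proof (rule initial_pair_coproduct[of x t0 a1 a0 ?r ?g])
    fix y b1 b0
    assume A: "y \<in> Arr C" "Cod C y = Cod C x" "b1 \<in> Arr C" "Dom C b1 = Dom C (?r y)" "Cod C b1 = Dom C y" "b0 \<in> Arr C" "Dom C b0 = Dom C a0" "Cod C b0 = Dom C y"
      "y \<cdot> b1 = t0 \<cdot> ?r y" "y \<cdot> b0 = x \<cdot> a0"
    show "\<exists>!k. k \<in> Arr C \<and> Dom C k = Dom C x \<and> Cod C k = Dom C y \<and> y \<cdot> k = x \<and> k \<cdot> a1 = b1 \<cdot> ?g x k y \<and> k \<cdot> a0 = b0"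
      by (rule init[rule_format, OF A(1) A(2)[unfolded x] A(3-6) A(7)[unfolded a] A(8-9) A(10)[unfolded xa]])
  next
    fix y z k
    assume A: "y \<in> Arr C" "z \<in> Arr C" "Cod C y = Cod C x" "Cod C z = Cod C x" "k \<in> Arr C" "Dom C k = Dom C y" "Cod C k = Dom C z" "z \<cdot> k = y"
    show "?g y k z \<in> Arr C \<and> Dom C (?g y k z) = Dom C (?r y) \<and> Cod C (?g y k z) = Dom C (?r z) \<and> ?r z \<cdot> ?g y k z = ?r y"
      using g[OF A(1,2) A(3,4)[unfolded x] A(5-8)] by iprover
  next
    fix y k d
    assume A[simp]: "y \<in> Arr C" "Cod C y = Cod C x" "k \<in> Arr C" "d \<in> Arr C" "Dom C k = Dom C x" "Cod C k = Dom C y" "Dom C d = Dom C y" "Cod C d = Dom C x" and yk: "y \<cdot> k = x" and xd: "x \<cdot> d = y"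
    have xdk: "x \<cdot> (d \<cdot> k) = x" using precomp[OF xd, of k] yk by simp
    have dk: "d \<cdot> k \<in> Arr C" "Dom C (d \<cdot> k) = Dom C x" "Cod C (d \<cdot> k) = Dom C x" by simp_all
    have Dk: "?g x k y \<in> Arr C \<and> Dom C (?g x k y) = Dom C (?r x) \<and> Cod C (?g x k y) = Dom C (?r y) \<and> ?r y \<cdot> ?g x k y = ?r x \<and> pr2 C ev y \<cdot> ?g x k y = k \<cdot> pr2 C ev x"
      using g[OF x(1) A(1) x(2) A(2)[unfolded x] A(3,5,6) yk] by iprover
    have Dd: "?g y d x \<in> Arr C \<and> Dom C (?g y d x) = Dom C (?r y) \<and> Cod C (?g y d x) = Dom C (?r x) \<and> ?r x \<cdot> ?g y d x = ?r y \<and> pr2 C ev x \<cdot> ?g y d x = d \<cdot> pr2 C ev y"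
      using g[OF A(1) x(1) A(2)[unfolded x] x(2) A(4,7,8) xd] by iprover
    have Ddk: "?g x (d \<cdot> k) x \<in> Arr C \<and> Dom C (?g x (d \<cdot> k) x) = Dom C (?r x) \<and> Cod C (?g x (d \<cdot> k) x) = Dom C (?r x) \<and> ?r x \<cdot> ?g x (d \<cdot> k) x = ?r x \<and> pr2 C ev x \<cdot> ?g x (d \<cdot> k) x = (d \<cdot> k) \<cdot> pr2 C ev x"
      using g[OF x(1) x(1) x(2) x(2) dk(1) dk(2) dk(3) xdk] by iprover
    define K1 K2 K3 where "K1 = ?g x k y" and "K2 = ?g y d x" and "K3 = ?g x (d \<cdot> k) x"
    have prd: "Dom C (?r x) = pb C ev x" "Dom C (?r y) = pb C ev y" by simp_all
    have K[simp]: "K1 \<in> Arr C" "Dom C K1 = pb C ev x" "Cod C K1 = pb C ev y" "K2 \<in> Arr C" "Dom C K2 = pb C ev y" "Cod C K2 = pb C ev x"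
      "K3 \<in> Arr C" "Dom C K3 = pb C ev x" "Cod C K3 = pb C ev x"
      unfolding prd[symmetric] using Dk[folded K1_def] Dd[folded K2_def] Ddk[folded K3_def] by iprover+
    have 1: "?r y \<cdot> K1 = ?r x" "pr2 C ev y \<cdot> K1 = k \<cdot> pr2 C ev x" using Dk unfolding K1_def[symmetric] by iprover+
    have 2: "?r x \<cdot> K2 = ?r y" "pr2 C ev x \<cdot> K2 = d \<cdot> pr2 C ev y" using Dd unfolding K2_def[symmetric] by iprover+
    have 3: "?r x \<cdot> K3 = ?r x" "pr2 C ev x \<cdot> K3 = (d \<cdot> k) \<cdot> pr2 C ev x" using Ddk unfolding K3_def[symmetric] by iprover+
    have "K2 \<cdot> K1 = K3"
      by (rule pb_eqI[of ev x]) (use precomp[OF 2(1), of K1] precomp[OF 2(2), of K1] 1 3 in simp_all)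
    then show "?g y d x \<cdot> ?g x k y = ?g x (d \<cdot> k) x" unfolding K1_def K2_def K3_def .
  next
    show "?g x (Idt C (Dom C x)) x = Idt C (Dom C (?r x))"
      by simp
  qed (use xa in simp_all)
  show thesis
    by (rule that[OF x a(1) _ a(3-6) xa c]) simp
qed

section \<open>Initial algebras of containers\<close>

text \<open>Joins \<open>recursion\<close> with the existence of classifying objects; the structure
  map is the copairing of \<open>q\<close> and \<open>p\<close>. It is applied both to the container
  of paths and to \<open>Q \<star> P\<^sup>\<diamond>\<close>.\<close>

lemma initial_algebra_recursion:
  assumes P[simp]: "P \<in> Arr C" and Q[simp]: "Q \<in> Arr C"
    and q: "KC.mpb e u b q" "Dom K q = Q" "Cod K q = G"
    and p: "KC.mpb m u (seq_shape_arr C P u) p" "Dom K p = G \<star> P" "Cod K p = G"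
    and init: "\<And>Y b0 b1. b0 \<in> hom C (Dom C e) Y \<Longrightarrow> b1 \<in> hom C (Dom C (seq_shape C P Y)) Y \<Longrightarrow>
      \<exists>!k. k \<in> hom C (Cod C u) Y \<and> k \<cdot> e = b0 \<and> k \<cdot> m = b1 \<cdot> seq_shape_arr C P k"
  shows "\<exists>\<alpha>. initial_algebra K (step C Q P) G \<alpha>"
proof -
  interpret tp: two_powers K C "Cod C" shape P "seq_shape C P" "\<lambda>J. pr1 C P (seq_shape C P J)" "\<lambda>J. pr2 C P (seq_shape C P J)"
    "seq_ev C P" "seq_shape_arr C P" "seq_base P" "seq_counit P" "seq_arr C P"
    by (rule two_powers[OF P])
  note [simp] = q(2,3) p(2,3)
  have qp[simp]: "q \<in> Arr K" "p \<in> Arr K" and u: "u \<in> Arr C" "Dom C u = Cod C G" using KC.mpbD(2,4,6)[OF q(1)] KC.mpbD(4)[OF p(1)] by simp_all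
  have G[simp]: "G \<in> Arr C" using arr_K(2)[OF qp(1)] by simp
  note I[simp] = in12(2,3,6,7)[OF Q, of "G \<star> P"] in12_arr[OF Q, of "G \<star> P"]
  have c: "is_coproduct K (in1 Q (G \<star> P)) (in2 Q (G \<star> P))" by (rule sum_coproduct) simp_all
  obtain \<alpha> where \<alpha>: "\<alpha> \<in> Arr K" "Dom K \<alpha> = coprod_arr C Q (G \<star> P)" "Cod K \<alpha> = G" and
    \<alpha>12: "\<alpha> \<cdot>\<^bsub>K\<^esub> in1 Q (G \<star> P) = q" "\<alpha> \<cdot>\<^bsub>K\<^esub> in2 Q (G \<star> P) = p"
    by (rule KC.E.coproduct_ex[OF c, of q p G]) simp_all
  have "initial_algebra K (step C Q P) G \<alpha>"
    unfolding initial_algebra_iff[OF P Q G \<alpha>] \<alpha>12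
  proof (intro allI impI)
    fix X q' p'
    assume X[simp]: "X \<in> Arr C" and q': "q' \<in> hom K Q X" and p': "p' \<in> hom K (X \<star> P) X"
    have nE: "Cod K (seq_base P Y) = Y \<star> P" if "Y \<in> Arr C" for Y by (rule seq_base(3)[OF P that])
    have n: "Cod C (pr2 C P (seq_shape C P Y)) = Dom C (seq_shape C P Y)" if "Y \<in> Obj C" for Y
      using seq_facts(1,2)[OF P that] by simp
    show "\<exists>!\<theta>. \<theta> \<in> hom K G X \<and> \<theta> \<cdot>\<^bsub>K\<^esub> q = q' \<and> \<theta> \<cdot>\<^bsub>K\<^esub> p = p' \<cdot>\<^bsub>K\<^esub> seq_arr C P \<theta>"
    proof (rule classifier_exists[OF G X u])
      fix h t c \<chi> assume cl: "KC.classifies u G X h t c \<chi>"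
      show ?thesis
      proof (rule tp.recursion[OF q(1,2,3) refl p(1) _ p(3) refl _ cl q'])
        fix Y b0 b1
        assume b: "b0 \<in> hom C (Dom C e) Y" "b1 \<in> hom C (Cod C (pr2 C P (seq_shape C P Y))) Y"
        have "Y \<in> Obj C" using b(1) cod_in[of b0] by (auto simp: hom_iff)
        from b(2)[unfolded n[OF this]] show "\<exists>!k. k \<in> hom C (Cod C u) Y \<and> k \<cdot> e = b0 \<and> k \<cdot> m = b1 \<cdot> seq_shape_arr C P k"
          by (rule init[OF b(1)])
      qed (use nE p' in simp_all)
    qed
  qed
  then show ?thesis by (rule exI)
qed

text \<open>\<open>P\<^sup>\<diamond>\<close> is a selected carrier and is tied to the container of
  paths through this isomorphism. Each composite is an algebra endomorphism, so it equals the
  identity.\<close>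

lemma initial_algebra_iso:
  assumes P[simp]: "P \<in> Arr C" and Q[simp]: "Q \<in> Arr C"
    and G: "initial_algebra K (step C Q P) G \<alpha>" and H: "initial_algebra K (step C Q P) H \<beta>"
  obtains j k where "j \<in> hom K G H" "k \<in> hom K H G" "k \<cdot>\<^bsub>K\<^esub> j = Idt K G" "j \<cdot>\<^bsub>K\<^esub> k = Idt K H"
proof -
  interpret tp: two_powers K C "Cod C" shape P "seq_shape C P" "\<lambda>J. pr1 C P (seq_shape C P J)" "\<lambda>J. pr2 C P (seq_shape C P J)"
    "seq_ev C P" "seq_shape_arr C P" "seq_base P" "seq_counit P" "seq_arr C P"
    by (rule two_powers[OF P])
  let ?q = "\<lambda>G \<alpha>. \<alpha> \<cdot>\<^bsub>K\<^esub> in1 Q (G \<star> P)" and ?p = "\<lambda>G \<alpha>. \<alpha> \<cdot>\<^bsub>K\<^esub> in2 Q (G \<star> P)"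
  have S[simp]: "seq_arr C P k \<in> Arr K" "Dom K (seq_arr C P k) = Dom K k \<star> P" "Cod K (seq_arr C P k) = Cod K k \<star> P" if "k \<in> Arr K" for k
    using tp.L_facts(1-3)[OF that] that by (simp_all add: seq_base)
  have facts: "G \<in> Arr C" "?q G \<alpha> \<in> hom K Q G" "?p G \<alpha> \<in> hom K (G \<star> P) G" and
    U: "\<And>X q' p'. X \<in> Arr C \<Longrightarrow> q' \<in> hom K Q X \<Longrightarrow> p' \<in> hom K (X \<star> P) X \<Longrightarrow>
      \<exists>!\<theta>. \<theta> \<in> hom K G X \<and> \<theta> \<cdot>\<^bsub>K\<^esub> ?q G \<alpha> = q' \<and> \<theta> \<cdot>\<^bsub>K\<^esub> ?p G \<alpha> = p' \<cdot>\<^bsub>K\<^esub> seq_arr C P \<theta>"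
    if ia: "initial_algebra K (step C Q P) G \<alpha>" for G \<alpha>
  proof -
    show G[simp]: "G \<in> Arr C" using ia by (simp add: initial_algebra_def)
    have a[simp]: "\<alpha> \<in> Arr K" "Dom K \<alpha> = coprod_arr C Q (G \<star> P)" "Cod K \<alpha> = G"
      using ia by (simp_all add: initial_algebra_def step_def KC.E.hom_iff)
    note I[simp] = in12(2,3,6,7)[OF Q, of "G \<star> P"] in12_arr[OF Q, of "G \<star> P"]
    show "?q G \<alpha> \<in> hom K Q G" "?p G \<alpha> \<in> hom K (G \<star> P) G" by (simp_all add: KC.E.hom_iff)
    show "\<exists>!\<theta>. \<theta> \<in> hom K G X \<and> \<theta> \<cdot>\<^bsub>K\<^esub> ?q G \<alpha> = q' \<and> \<theta> \<cdot>\<^bsub>K\<^esub> ?p G \<alpha> = p' \<cdot>\<^bsub>K\<^esub> seq_arr C P \<theta>"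
      if "X \<in> Arr C" "q' \<in> hom K Q X" "p' \<in> hom K (X \<star> P) X" for X q' p'
      using ia that unfolding initial_algebra_iff[OF P Q G a] by blast
  qed
  have inv: "k \<cdot>\<^bsub>K\<^esub> j = Idt K G"
    if iaG: "initial_algebra K (step C Q P) G \<alpha>" and iaH: "initial_algebra K (step C Q P) H \<beta>"
      and j: "j \<in> hom K G H" "j \<cdot>\<^bsub>K\<^esub> ?q G \<alpha> = ?q H \<beta>" "j \<cdot>\<^bsub>K\<^esub> ?p G \<alpha> = ?p H \<beta> \<cdot>\<^bsub>K\<^esub> seq_arr C P j"
      and k: "k \<in> hom K H G" "k \<cdot>\<^bsub>K\<^esub> ?q H \<beta> = ?q G \<alpha>" "k \<cdot>\<^bsub>K\<^esub> ?p H \<beta> = ?p G \<alpha> \<cdot>\<^bsub>K\<^esub> seq_arr C P k"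
    for G \<alpha> H \<beta> j k
  proof -
    define qG pG qH pH where d: "qG = ?q G \<alpha>" "pG = ?p G \<alpha>" "qH = ?q H \<beta>" "pH = ?p H \<beta>"
    have [simp]: "G \<in> Arr C" "H \<in> Arr C" using facts(1) iaG iaH by blast+
    have [simp]: "qG \<in> Arr K" "Dom K qG = Q" "Cod K qG = G" "pG \<in> Arr K" "Dom K pG = G \<star> P" "Cod K pG = G"
      "qH \<in> Arr K" "Dom K qH = Q" "Cod K qH = H" "pH \<in> Arr K" "Dom K pH = H \<star> P" "Cod K pH = H"
      using facts(2,3)[OF iaG, folded d] facts(2,3)[OF iaH, folded d] by (simp_all add: KC.E.hom_iff)
    have [simp]: "j \<in> Arr K" "Dom K j = G" "Cod K j = H" "k \<in> Arr K" "Dom K k = H" "Cod K k = G"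
      using j(1) k(1) by (simp_all add: KC.E.hom_iff)
    note j' = j(2,3)[folded d] and k' = k(2,3)[folded d]
    have Lkj: "seq_arr C P (k \<cdot>\<^bsub>K\<^esub> j) = seq_arr C P k \<cdot>\<^bsub>K\<^esub> seq_arr C P j" by (rule tp.L_cmp) simp_all
    have Li: "seq_arr C P (Idt K G) = Idt K (G \<star> P)" using tp.L_idt[of G] seq_base(3)[OF P, of G] by simp
    have U1: "\<exists>!\<theta>. \<theta> \<in> hom K G G \<and> \<theta> \<cdot>\<^bsub>K\<^esub> qG = qG \<and> \<theta> \<cdot>\<^bsub>K\<^esub> pG = pG \<cdot>\<^bsub>K\<^esub> seq_arr C P \<theta>"
      by (rule U[OF iaG, folded d]) (simp_all add: KC.E.hom_iff)
    have 1: "k \<cdot>\<^bsub>K\<^esub> j \<in> hom K G G \<and> (k \<cdot>\<^bsub>K\<^esub> j) \<cdot>\<^bsub>K\<^esub> qG = qG \<and> (k \<cdot>\<^bsub>K\<^esub> j) \<cdot>\<^bsub>K\<^esub> pG = pG \<cdot>\<^bsub>K\<^esub> seq_arr C P (k \<cdot>\<^bsub>K\<^esub> j)"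
      unfolding Lkj using j' k' KC.E.precomp[OF k'(2), of "seq_arr C P j"] by (simp add: KC.E.hom_iff)
    have 2: "Idt K G \<in> hom K G G \<and> Idt K G \<cdot>\<^bsub>K\<^esub> qG = qG \<and> Idt K G \<cdot>\<^bsub>K\<^esub> pG = pG \<cdot>\<^bsub>K\<^esub> seq_arr C P (Idt K G)"
      unfolding Li by (simp add: KC.E.hom_iff)
    obtain w where w: "\<And>\<theta>. \<theta> \<in> hom K G G \<and> \<theta> \<cdot>\<^bsub>K\<^esub> qG = qG \<and> \<theta> \<cdot>\<^bsub>K\<^esub> pG = pG \<cdot>\<^bsub>K\<^esub> seq_arr C P \<theta> \<Longrightarrow> \<theta> = w"
      using U1 by (rule ex1E) iprover
    show ?thesis unfolding w[OF 1] by (rule w[OF 2, symmetric])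
  qed
  obtain j where j: "j \<in> hom K G H" "j \<cdot>\<^bsub>K\<^esub> ?q G \<alpha> = ?q H \<beta>" "j \<cdot>\<^bsub>K\<^esub> ?p G \<alpha> = ?p H \<beta> \<cdot>\<^bsub>K\<^esub> seq_arr C P j"
    using U[OF G facts[OF H]] by (elim ex1E conjE)
  obtain k where k: "k \<in> hom K H G" "k \<cdot>\<^bsub>K\<^esub> ?q H \<beta> = ?q G \<alpha>" "k \<cdot>\<^bsub>K\<^esub> ?p H \<beta> = ?p G \<alpha> \<cdot>\<^bsub>K\<^esub> seq_arr C P k"
    using U[OF H facts[OF G]] by (elim ex1E conjE)
  show thesis
    by (rule that[OF j(1) k(1) inv[OF G H j k] inv[OF H G k j]])
qed

text \<open>The isomorphism gives pullback squares \<open>M\<close> and \<open>M'\<close> between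
  \<open>D\<close> and \<open>D'\<close>. Pasting with them turns pullbacks of one container into
  pullbacks of the other, and the transposes remain the same.\<close>

lemma power_iso:
  assumes pow: "KC.is_power D' Q r a n \<epsilon>" and j: "j \<in> hom K D D'" and k: "k \<in> hom K D' D"
    and kj: "k \<cdot>\<^bsub>K\<^esub> j = Idt K D" and jk: "j \<cdot>\<^bsub>K\<^esub> k = Idt K D'"
  obtains r' a' where "KC.is_power D Q r' a' n \<epsilon>"
proof -
  have [simp]: "j \<in> Arr K" "Dom K j = D" "Cod K j = D'" "k \<in> Arr K" "Dom K k = D'" "Cod K k = D"
    using j k by (simp_all add: KC.E.hom_iff)
  have DD[simp]: "D \<in> Arr C" "D' \<in> Arr C" using arr_K(1)[of j] arr_K(2)[of j] by simp_all
  define j0 k0 where "j0 = shape j" and "k0 = shape k"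
  have n[simp]: "shape j = j0" "shape k = k0" by (simp_all add: j0_def k0_def)
  have [simp]: "j0 \<in> Arr C" "Dom C j0 = Cod C D" "Cod C j0 = Cod C D'" "k0 \<in> Arr C" "Dom C k0 = Cod C D'" "Cod C k0 = Cod C D"
    using arr_K(3-5)[of j] arr_K(3-5)[of k] by simp_all
  have kj0: "k0 \<cdot> j0 = Idt C (Cod C D)" using cmp_K(4)[of j k] idt_K(4)[of D] kj by simp
  have jk0: "j0 \<cdot> k0 = Idt C (Cod C D')" using cmp_K(4)[of k j] idt_K(4)[of D'] jk by simp
  have kj0': "k0 \<cdot> (j0 \<cdot> f) = f" if "f \<in> Arr C" "Cod C f = Cod C D" for f using precomp[OF kj0, of f] that by simp
  have jk0': "j0 \<cdot> (k0 \<cdot> f) = f" if "f \<in> Arr C" "Cod C f = Cod C D'" for f using precomp[OF jk0, of f] that by simp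
  \<comment> \<open>\<open>j1\<close> and \<open>k1\<close> are the direction parts of
    \<open>j\<close> and \<open>k\<close>, with the change of shapes built in, as mutually inverse
    arrows between the direction objects of \<open>D'\<close> and \<open>D\<close>.\<close>
  define j1 where "j1 = act j (k0 \<cdot> D') (Idt C (Dom C D'))"
  define k1 where "k1 = act k (j0 \<cdot> D) (Idt C (Dom C D))"
  have j1[simp]: "j1 \<in> Arr C" "Dom C j1 = Dom C D'" "Cod C j1 = Dom C D" and Dj1: "D \<cdot> j1 = k0 \<cdot> D'"
    and j1n: "x \<in> Arr C \<Longrightarrow> Cod C x = Dom C D' \<Longrightarrow> j1 \<cdot> x = act j (k0 \<cdot> (D' \<cdot> x)) x" for x
    by (simp_all add: j1_def jk0')
  have k1[simp]: "k1 \<in> Arr C" "Dom C k1 = Dom C D" "Cod C k1 = Dom C D'" and Dk1: "D' \<cdot> k1 = j0 \<cdot> D"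
    and k1n: "x \<in> Arr C \<Longrightarrow> Cod C x = Dom C D \<Longrightarrow> k1 \<cdot> x = act k (j0 \<cdot> (D \<cdot> x)) x" for x
    by (simp_all add: k1_def kj0')
  have j1k1: "j1 \<cdot> k1 = Idt C (Dom C D)"
  proof -
    have "j1 \<cdot> k1 = act j D k1" using j1n[of k1] by (simp add: Dk1 kj0')
    also have "\<dots> = act j D (act k (j0 \<cdot> D) (Idt C (Dom C D)))" by (simp only: k1_def)
    also have "\<dots> = act (k \<cdot>\<^bsub>K\<^esub> j) D (Idt C (Dom C D))" by (rule trans[OF _ act_cmp[symmetric]]) (simp_all add: kj0')
    also have "\<dots> = Idt C (Dom C D)" unfolding kj by (rule idt_K(5)) simp_all
    finally show ?thesis .
  qed
  have k1j1: "k1 \<cdot> j1 = Idt C (Dom C D')"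
  proof -
    have "k1 \<cdot> j1 = act k D' j1" using k1n[of j1] by (simp add: Dj1 jk0')
    also have "\<dots> = act k D' (act j (k0 \<cdot> D') (Idt C (Dom C D')))" by (simp only: j1_def)
    also have "\<dots> = act (j \<cdot>\<^bsub>K\<^esub> k) D' (Idt C (Dom C D'))" by (rule trans[OF _ act_cmp[symmetric]]) (simp_all add: jk0')
    also have "\<dots> = Idt C (Dom C D')" unfolding jk by (rule idt_K(5)) simp_all
    finally show ?thesis .
  qed
  have iso: "D.mpb A f g B"
    if [simp]: "A \<in> Arr C" "B \<in> Arr C" "f \<in> Arr C" "g \<in> Arr C" "f' \<in> Arr C" "g' \<in> Arr C" "Dom C f = Cod C B" "Cod C f = Cod C A" "Dom C g = Dom C B" "Cod C g = Dom C A"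
      "Dom C f' = Cod C A" "Cod C f' = Cod C B" "Dom C g' = Dom C A" "Cod C g' = Dom C B"
      and e: "A \<cdot> g = f \<cdot> B" "B \<cdot> g' = f' \<cdot> A" "f' \<cdot> f = Idt C (Cod C B)" "g \<cdot> g' = Idt C (Dom C A)" "g' \<cdot> g = Idt C (Dom C B)"
    for A B f g f' g'
  proof (rule D.mpbI)
    fix y s
    assume y: "y \<in> Arr C" "s \<in> Arr C" "Cod C y = Cod C B" "Dom C s = Dom C y" "Cod C s = Dom C A" "A \<cdot> s = f \<cdot> y"
    then show "\<exists>z. z \<in> Arr C \<and> Dom C z = Dom C y \<and> Cod C z = Dom C B \<and> B \<cdot> z = y \<and> g \<cdot> z = s"
      using precomp[OF e(2), of s] precomp[OF e(3), of y] precomp[OF e(4), of s] by (intro exI[of _ "g' \<cdot> s"]) simp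
  next
    fix z z'
    assume z: "z \<in> Arr C" "z' \<in> Arr C" "Dom C z = Dom C z'" "Cod C z = Dom C B" "Cod C z' = Dom C B" "g \<cdot> z = g \<cdot> z'"
    then have "g' \<cdot> (g \<cdot> z) = g' \<cdot> (g \<cdot> z')" by simp
    then show "z = z'" using z(1-5) precomp[OF e(5), of z] precomp[OF e(5), of z'] by simp
  qed (simp_all add: e)
  have M: "D.mpb D k0 j1 D'" by (rule iso[of _ _ _ _ j0 k1]) (simp_all add: Dj1 Dk1 jk0 j1k1 k1j1)
  have M': "D.mpb D' j0 k1 D" by (rule iso[of _ _ _ _ k0 j1]) (simp_all add: Dj1 Dk1 kj0 j1k1 k1j1)
  note power_facts = KC.powerD[OF pow]
  note m[simp] = KC.mpbD(2-4)[OF power_facts(1)] power_facts(2-4)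
  have [simp]: "Cod C r = Cod C D'" "Dom C r = Cod C (Cod K n)" "Cod C a = Dom C D'" "Dom C a = Cod C (Dom K n)"
    using KC.mpbD(5-8)[OF power_facts(1)] by simp_all
  have jr: "k0 \<cdot> (r \<cdot> s) = \<phi> \<longleftrightarrow> r \<cdot> s = j0 \<cdot> \<phi>" if "s \<in> Arr C" "Cod C s = Dom C r" "\<phi> \<in> Arr C" "Cod C \<phi> = Cod C D" for s \<phi>
    using that kj0'[of \<phi>] jk0'[of "r \<cdot> s"] by auto
  have ja: "j1 \<cdot> (a \<cdot> s) = \<phi> \<longleftrightarrow> a \<cdot> s = k1 \<cdot> \<phi>" if "s \<in> Arr C" "Cod C s = Dom C a" "\<phi> \<in> Arr C" "Cod C \<phi> = Dom C D" for s \<phi>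
    using that precomp[OF j1k1, of \<phi>] precomp[OF k1j1, of "a \<cdot> s"] by auto
  have "KC.is_power D Q (k0 \<cdot> r) (j1 \<cdot> a) n \<epsilon>"
    unfolding KC.is_power_def
  proof (intro conjI allI impI KC.mpb_paste[OF M power_facts(1)] power_facts(2-4))
    fix \<phi> \<alpha> c g
    assume c: "KC.mpb D \<phi> \<alpha> c" and g: "g \<in> Arr K" "Dom K g = Dom K c" "Cod K g = Q"
    note [simp] = KC.mpbD(2-4)[OF c]
    have [simp]: "Cod C \<phi> = Cod C D" "Cod C \<alpha> = Dom C D" using KC.mpbD(5,7)[OF c] by simp_all
    have "KC.transposes (k0 \<cdot> r) (j1 \<cdot> a) n \<epsilon> \<phi> \<alpha> c m g \<longleftrightarrow> KC.transposes r a n \<epsilon> (j0 \<cdot> \<phi>) (k1 \<cdot> \<alpha>) c m g" for m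
      unfolding KC.transposes_def
    proof (intro conj_cong refl ex_cong1)
      assume "m \<in> Arr K" "Dom K m = Cod K c" "Cod K m = Cod K n"
      then show "(k0 \<cdot> r \<cdot> shape m = \<phi>) = (r \<cdot> shape m = j0 \<cdot> \<phi>)"
        using jr[of "shape m" \<phi>] arr_K(3-5)[of m] by simp
    next
      fix m' assume "m' \<in> Arr K" "Dom K m' = Dom K c" "Cod K m' = Dom K n"
      then show "(j1 \<cdot> a \<cdot> shape m' = \<alpha>) = (a \<cdot> shape m' = k1 \<cdot> \<alpha>)"
        using ja[of "shape m'" \<alpha>] arr_K(3-5)[of m'] by simp
    qed
    then show "\<exists>!m. KC.transposes (k0 \<cdot> r) (j1 \<cdot> a) n \<epsilon> \<phi> \<alpha> c m g"
      using KC.power_ex1[OF pow KC.mpb_paste[OF M' c] g] by simp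
  qed
  then show thesis by (rule that)
qed

lemma seq_diamond_initial:
  assumes W: "has_dependent_W_types C" and P[simp]: "P \<in> Arr C" and Q[simp]: "Q \<in> Arr C"
  shows "\<exists>\<alpha>. initial_algebra K (step C Q P) (Q \<star> P\<^sup>\<diamond>) \<alpha>"
proof (rule shape_initial[OF W P])
  fix W m e
  assume [simp]: "W \<in> Obj C" "m \<in> Arr C" "Dom C m = Dom C (seq_shape C P W)" "Cod C m = W" "e \<in> Arr C" "Dom C e = terminal_obj C" "Cod C e = W"
    and me: "is_coproduct C m e"
    and init: "\<And>Y b0 b1. b0 \<in> hom C (terminal_obj C) Y \<Longrightarrow> b1 \<in> hom C (Dom C (seq_shape C P Y)) Y \<Longrightarrow>
      \<exists>!k. k \<in> hom C W Y \<and> k \<cdot> e = b0 \<and> k \<cdot> m = b1 \<cdot> seq_shape_arr C P k"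
  interpret tp: two_powers K C "Cod C" shape P "seq_shape C P" "\<lambda>J. pr1 C P (seq_shape C P J)" "\<lambda>J. pr2 C P (seq_shape C P J)"
    "seq_ev C P" "seq_shape_arr C P" "seq_base P" "seq_counit P" "seq_arr C P"
    by (rule two_powers[OF P])
  define n ev where "n = pr2 C P (seq_shape C P W)" and "ev = seq_ev C P W"
  note sf[simp] = seq_facts[OF P \<open>W \<in> Obj C\<close>, folded ev_def]
  have n[simp]: "n \<in> Arr C" "Dom C n = pb C P (seq_shape C P W)" "Cod C n = Dom C (seq_shape C P W)" by (simp_all add: n_def)
  \<comment> \<open>The container of paths: \<open>a0\<close> is the empty path over the leaf, and
    \<open>a1\<close> extends a path in a subtree by the direction that leads to that
    subtree.\<close>
  obtain D1 a1 a0 where D[simp]: "D1 \<in> Arr C" "Cod C D1 = W" and a[simp]: "a1 \<in> Arr C" "Dom C a1 = pb C ev D1" "Cod C a1 = Dom C D1"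
    "a0 \<in> Arr C" "Dom C a0 = terminal_obj C" "Cod C a0 = Dom C D1" and Da: "D1 \<cdot> a1 = (m \<cdot> n) \<cdot> pr1 C ev D1" "D1 \<cdot> a0 = e" and aa: "is_coproduct C a1 a0"
    by (rule dirs_initial[OF W, of W ev "m \<cdot> n" e]) simp_all
  \<comment> \<open>Trees and paths are both coproducts of a node part and a leaf part, and
    \<open>D1\<close> respects the decompositions. By extensivity the constructor squares are
    pullbacks, which determines the fibres of \<open>D1\<close> over nodes and over the
    leaf.\<close>
  have node: "D.mpb m D1 (n \<cdot> pr1 C ev D1) a1"
    by (rule coproduct_square_pullback(1)[OF me aa, of _ _ "Idt C (terminal_obj C)"]) (simp_all add: Da)
  have unit: "D.mpb e D1 (Idt C (terminal_obj C)) a0"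
    by (rule coproduct_square_pullback(2)[OF me aa, of _ "n \<cdot> pr1 C ev D1"]) (simp_all add: Da)
  have idt: "D.mpb f (Idt C (Cod C f)) (Idt C (Dom C f)) f" if "f \<in> Arr C" for f
    by (rule D.mpbI) (use that in auto)
  have one[simp]: "one_cont C \<in> Arr C" by (simp add: one_cont_def)
  \<comment> \<open>The first use of the recursion, with the identity of \<open>W\<close> as
    \<open>u\<close>: the restriction of \<open>D1\<close> along \<open>e\<close> is the unit
    container, and the restriction along \<open>m\<close> is \<open>D1 \<star> P\<close> by the very
    definition of the sequential product.\<close>
  have "\<exists>d. initial_algebra K (step C (one_cont C) P) D1 d"
  proof (rule cartesian_ex[OF unit])
    fix q assume q: "cartesian q a0" "Dom K q = Idt C (terminal_obj C)" "Cod K q = D1" "shape q = e"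
    show ?thesis
    proof (rule cartesian_ex[OF node])
      fix p assume p: "cartesian p a1" "Dom K p = n \<cdot> pr1 C ev D1" "Cod K p = D1" "shape p = m"
      have q1: "KC.mpb e (Idt C W) (Idt C (terminal_obj C)) q"
        by (rule cartesian_mpb[OF q(1)]) (use idt[of e] in \<open>simp add: q(4)\<close>)
      have L: "seq_shape_arr C P (Idt C W) = Idt C (Dom C (seq_shape C P W))"
        using tp.D.L_idt[of W] by simp
      have p1: "KC.mpb m (Idt C W) (seq_shape_arr C P (Idt C W)) p"
        unfolding L by (rule cartesian_mpb[OF p(1)]) (use idt[of m] in \<open>simp add: p(4)\<close>)
      show ?thesis
      proof (rule initial_algebra_recursion[OF P one q1 _ q(3) p1 _ p(3)])
        show "Dom K q = one_cont C" by (simp add: q(2) one_cont_def)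
        show "Dom K p = D1 \<star> P" by (simp add: p(2) seq_def n_def ev_def)
      qed (use init in simp_all)
    qed
  qed
  then obtain d where d: "initial_algebra K (step C (one_cont C) P) D1 d" by (rule exE)
  have "\<exists>d. initial_algebra K (step C (one_cont C) P) (P\<^sup>\<diamond>) d"
    unfolding diamond_def by (rule someI_ex) (use d in blast)
  then obtain d' where d': "initial_algebra K (step C (one_cont C) P) (P\<^sup>\<diamond>) d'" by (rule exE)
  define D' where "D' = P\<^sup>\<diamond>"
  note d' = d'[folded D'_def]
  have D'[simp]: "D' \<in> Arr C" using d' by (simp add: initial_algebra_def)
  obtain j k where jk: "j \<in> hom K D1 D'" "k \<in> hom K D' D1" "k \<cdot>\<^bsub>K\<^esub> j = Idt K D1" "j \<cdot>\<^bsub>K\<^esub> k = Idt K D'"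
    by (rule initial_algebra_iso[OF P one d d'])
  \<comment> \<open>\<open>Q \<star> P\<^sup>\<diamond>\<close> is a power of \<open>Q\<close> by
    \<open>P\<^sup>\<diamond>\<close>, hence by \<open>D1\<close>. The new display \<open>r\<close>
    maps its shapes to trees, so the fibres of \<open>D1\<close> found above can be used for the
    second recursion.\<close>
  obtain r a where pow: "KC.is_power D1 Q r a (seq_base D' Q) (seq_counit D' Q)"
    by (rule power_iso[OF seq_power[OF D' Q] jk])
  have G: "Cod K (seq_base D' Q) = Q \<star> D'" by (rule seq_base(3)[OF D' Q])
  have QK: "Q \<in> Obj K" by simp
  obtain b q where q: "KC.mpb e r b q" "Dom K q = Q" "Cod K q = Q \<star> D'"
    by (rule tp.power_restricts_leaf[OF pow G D_mpb_sym[OF unit] terminal QK])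
  have ch: "D.mpb D1 ev (pr2 C ev D1) (pr1 C ev D1)" by (rule D_mpb_sym[OF chosen_mpb]) simp_all
  obtain p where p: "KC.mpb m r (seq_shape_arr C P r) p" "Dom K p = Cod K (seq_base P (Q \<star> D'))" "Cod K p = Q \<star> D'"
    by (rule tp.power_restricts_node[OF pow G D(2) ch[unfolded ev_def] D_mpb_sym[OF node, unfolded n_def ev_def]])
  have r: "Cod C r = W" using KC.mpbD(5)[OF q(1)] by simp
  have p2: "Dom K p = (Q \<star> D') \<star> P" using p(2) seq_base(3)[OF P, of "Q \<star> D'"] by simp
  show ?thesis
    unfolding D'_def[symmetric]
    by (rule initial_algebra_recursion[OF P Q q p(1) p2 p(3)]) (use init r in simp_all)
qed

end

theorem theorem4p6:
  fixes C :: "('o, 'm) cat" and P Q :: 'm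
  assumes "category C"
    and "extensive C"
    and "locally_cartesian_closed C"
    and "has_dependent_W_types C"
    and "has_dependent_M_types C"
    and "P \<in> Obj (Cont C)"
    and "Q \<in> Obj (Cont C)"
  shows "\<exists>\<alpha>. initial_algebra (Cont C) (step C Q P) (Q \<star>\<^bsub>C\<^esub> (P\<^sup>\<diamond>\<^bsub>C\<^esub>)) \<alpha>"
proof -
  interpret extensive_lcc C
    by (intro extensive_lcc.intro lcc_category.intro lcc_category_axioms.intro extensive_lcc_axioms.intro assms)
  show ?thesis
    by (rule seq_diamond_initial[OF assms(4)]) (use assms(6,7) in simp_all)
qed

end
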